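(* Let $\alpha\in(-\infty,32\pi^2)$. If $32\pi^{2}-\alpha<\frac{(32\pi^{2})^2B_{2}}{2}$, then every extremal function of $S(\alpha)$ (i.e. every $u\in H$ with $\int_{\mathbb{R}^4}(\exp(32\pi^2|u|^2)-1-\alpha|u|^2)\,dx=S(\alpha)$) is radially symmetric and real valued up to translation and constant phase; that is, there exist $\theta\in\mathbb{R}$, $x_0\in\mathbb{R}^4$ and a real-valued radially symmetric function $w$ on $\mathbb{R}^4$ such that $u(x)=e^{i\theta}w(x-x_0)$ for (almost) every $x\in\mathbb{R}^4$.
   Context: Functions are complex valued. $H:=\{u\in H^2(\mathbb{R}^4): \|u\|_{H^2(\mathbb{R}^4)}=1\}$, where $\|u\|_{H^2(\mathbb{R}^4)}=\left(\int_{\mathbb{R}^4}(|u|^2+|\Delta u|^2)\,dx\right)^{1/2}$. For $\alpha\in(-\infty,32\pi^2)$, $$S(\alpha)=\sup_{u\in H}\int_{\mathbb{R}^4}\left(\exp(32\pi^2|u|^2)-1-\alpha|u|^2\right)dx .$$ $$B_2=\sup_{v\in H^2(\mathbb{R}^4)\setminus\{0\}}\frac{\|v\|_4^4}{\|\Delta v\|_2^2\,\|v\|_2^2},$$ with $\|\cdot\|_p$ the $L^p(\mathbb{R}^4)$ norm. *)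

theory Defs
  imports "HOL-Analysis.Analysis"
begin

definition partial :: "4 \<Rightarrow> (real^4 \<Rightarrow> real) \<Rightarrow> real^4 \<Rightarrow> real" where
  "partial i f = (\<lambda>x. frechet_derivative f (at x) (axis i 1))"

(* foldr partial [i1, ..., ik] f is the iterated partial derivative along the directions i1, ..., ik.
   A function is smooth iff all of its iterated partials exist and are differentiable. *)
definition test_function :: "(real^4 \<Rightarrow> real) \<Rightarrow> bool" where
  "test_function \<phi> \<longleftrightarrow>
     (\<forall>is. foldr partial is \<phi> differentiable_on UNIV) \<and> compact (closure {x. \<phi> x \<noteq> 0})"

(* Elements of function spaces are represented by actual functions, not by classes modulo
   almost everywhere equality. *)
definition L2 :: "(real^4 \<Rightarrow> complex) set" where
  "L2 = {u. u \<in> borel_measurable lebesgue \<and> integrable lebesgue (\<lambda>x. (cmod (u x))^2)}"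

definition has_weak_deriv ::
    "4 list \<Rightarrow> (real^4 \<Rightarrow> complex) \<Rightarrow> (real^4 \<Rightarrow> complex) \<Rightarrow> bool" where
  "has_weak_deriv is u g \<longleftrightarrow>
     (\<forall>\<phi>. test_function \<phi> \<longrightarrow>
        (LINT x|lebesgue. foldr partial is \<phi> x *\<^sub>R u x) =
        (-1) ^ length is * (LINT x|lebesgue. \<phi> x *\<^sub>R g x))"

definition H2 :: "(real^4 \<Rightarrow> complex) set" where
  "H2 = {u \<in> L2. \<forall>is. length is \<le> 2 \<longrightarrow> (\<exists>g\<in>L2. has_weak_deriv is u g)}"

(* The weak derivative is unique up to a null set, so all integrals built from it are independent
   of the choice. *)
definition weak_deriv :: "4 list \<Rightarrow> (real^4 \<Rightarrow> complex) \<Rightarrow> real^4 \<Rightarrow> complex" where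
  "weak_deriv is u = (SOME g. g \<in> L2 \<and> has_weak_deriv is u g)"

definition laplacian :: "(real^4 \<Rightarrow> complex) \<Rightarrow> real^4 \<Rightarrow> complex" where
  "laplacian u = (\<lambda>x. \<Sum>i\<in>UNIV. weak_deriv [i, i] u x)"

definition H2_norm :: "(real^4 \<Rightarrow> complex) \<Rightarrow> real" where
  "H2_norm u = sqrt (LINT x|lebesgue. (cmod (u x))^2 + (cmod (laplacian u x))^2)"

definition H2_sphere :: "(real^4 \<Rightarrow> complex) set" where
  "H2_sphere = {u \<in> H2. H2_norm u = 1}"

(* Lebesgue integral with values in the extended reals: an integrand with infinite positive part
   and finite negative part has integral \<infinity>, whereas the Bochner integral would
   assign it the value 0. *)
definition ext_integral :: "(real^4 \<Rightarrow> real) \<Rightarrow> ereal" where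
  "ext_integral f = enn2ereal (\<integral>\<^sup>+x. ennreal (f x) \<partial>lebesgue)
                  - enn2ereal (\<integral>\<^sup>+x. ennreal (- f x) \<partial>lebesgue)"

definition J :: "real \<Rightarrow> (real^4 \<Rightarrow> complex) \<Rightarrow> ereal" where
  "J \<alpha> u = ext_integral (\<lambda>x. exp (32 * pi^2 * (cmod (u x))^2) - 1 - \<alpha> * (cmod (u x))^2)"

definition S :: "real \<Rightarrow> ereal" where
  "S \<alpha> = (SUP u\<in>H2_sphere. J \<alpha> u)"

definition Lp_norm :: "nat \<Rightarrow> (real^4 \<Rightarrow> complex) \<Rightarrow> ennreal" where
  "Lp_norm p u =
     (let I = (\<integral>\<^sup>+x. ennreal (cmod (u x) ^ p) \<partial>lebesgue)
      in if I = \<infinity> then \<infinity> else ennreal (root p (enn2real I)))"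

definition B\<^sub>2 :: ennreal where
  "B\<^sub>2 = (SUP v\<in>{v \<in> H2. \<not> (AE x in lebesgue. v x = 0)}.
            (Lp_norm 4 v)^4 / ((Lp_norm 2 (laplacian v))^2 * (Lp_norm 2 v)^2))"

definition extremal :: "real \<Rightarrow> (real^4 \<Rightarrow> complex) \<Rightarrow> bool" where
  "extremal \<alpha> u \<longleftrightarrow> u \<in> H2_sphere \<and> J \<alpha> u = S \<alpha>"

definition radially_symmetric :: "(real^4 \<Rightarrow> real) \<Rightarrow> bool" where
  "radially_symmetric w \<longleftrightarrow> (\<forall>x y. norm x = norm y \<longrightarrow> w x = w y)"

end

theory Submission
  imports Defs "HOL-Probability.Probability"
begin

text \<open>
Write \<open>u = fourier h\<close>, where \<open>fourier h x\<close> is the integral of \<open>exp (2 \<pi> \<i> x \<bullet> \<xi>) h \<xi>\<close>, so that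
\<open>h\<close> is the frequency density of \<open>u\<close>. The squared Sobolev norm of \<open>u\<close> is the integral of
\<open>weight \<xi> |h \<xi>|\<^sup>2\<close> with the radial, strictly increasing weight \<open>1 + 16 \<pi>\<^sup>4 |\<xi>|\<^sup>4\<close>
(\<open>H2_norm_fourier\<close>, \<open>fourier_pair_in_H2\<close>), and expanding the exponential turns the functional into a series
of the integrals of \<open>|u|\<close> to the powers \<open>2, 4, 6, \<dots>\<close> with strictly positive coefficients
(\<open>energy_series\<close>). By Plancherel's theorem the integral of \<open>|u|\<close> to the power \<open>2 k\<close> is the squared
\<open>L\<^sup>2\<close> norm of the \<open>k\<close>-fold convolution power of \<open>h\<close>. Symmetrising \<open>h\<close> rather than \<open>u\<close>
therefore avoids rearranging the Laplacian, and rests on three facts.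

Replacing \<open>h\<close> by \<open>|h|\<close> leaves the norm fixed and does not decrease the modulus of any convolution power
at any point. If \<open>u\<close> is a maximiser, so is \<open>v = fourier |h|\<close>, and all the \<open>L\<close>-norms of even order of
\<open>u\<close> and \<open>v\<close> agree (\<open>maximiser_modulus\<close>).

Steiner symmetrisation of \<open>|h|\<close> in any direction does not decrease the \<open>L\<^sup>2\<close> norm of its convolution
powers (\<open>conv_power_steiner\<close>, from the Riesz rearrangement inequality on lines), and does not increase the weighted norm;
the latter is preserved only if \<open>|h|\<close> is its own symmetrisation (\<open>steiner_weight_eq\<close>). A drop of the weighted
norm could be scaled away with a strict gain of energy (\<open>maximiser_strict_scaling\<close>). Hence \<open>|h|\<close> is invariant under
all reflections in hyperplanes through the origin (\<open>maximiser_reflection\<close>), and \<open>v\<close> is radial and real valued.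

The equality of all even \<open>L\<close>-norms forces \<open>u\<close> and \<open>v\<close> to have the same supremum, which for \<open>v\<close> is
\<open>v 0\<close>, the integral of \<open>|h|\<close>. A continuous function vanishing at infinity attains its supremum, so
\<open>|u x\<^sub>0|\<close> equals the integral of \<open>|h|\<close> for some \<open>x\<^sub>0\<close> (\<open>modulus_maximum\<close>). This is equality in
the triangle inequality for the integral defining \<open>u x\<^sub>0\<close>; it determines the argument of \<open>h\<close>
(\<open>phase_of_maximum\<close>), and \<open>h \<xi> = exp (\<i> \<theta>) exp (- 2 \<pi> \<i> x\<^sub>0 \<bullet> \<xi>) |h \<xi>|\<close> says precisely that
\<open>u x = exp (\<i> \<theta>) v (x - x\<^sub>0)\<close>.

Convolution powers and the values of \<open>fourier h\<close> need \<open>h\<close> to be integrable, which the weighted norm just fails to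
provide in dimension four, as the reciprocal of the weight is barely not integrable. Integrability is supplied by
the maximising property: comparing \<open>u\<close> with small perturbations of it bounds the integral of \<open>|h|\<close> over balls
uniformly (\<open>maximiser_integrable\<close>), given that \<open>|u|\<^sup>2 exp (\<gamma> |u|\<^sup>2)\<close> is integrable for every
\<open>\<gamma>\<close> (\<open>exp_integrability\<close>).
\<close>

section \<open>Majorisation on the line\<close>

lemma nn_integral_lborel_affine:
  fixes f :: "'a::euclidean_space \<Rightarrow> ennreal" and c :: real
  assumes [measurable]: "f \<in> borel_measurable borel" and c: "c \<noteq> 0"
  shows "(\<integral>\<^sup>+x. f (a + c *\<^sub>R x) \<partial>lborel) * ennreal (\<bar>c\<bar> ^ DIM('a)) = (\<integral>\<^sup>+x. f x \<partial>lborel)"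
  by (subst (2) lborel_affine[OF c, of a])
     (simp add: nn_integral_density nn_integral_distr nn_integral_cmult mult.commute)

lemma nn_integral_lborel_translate:
  fixes f :: "'a::euclidean_space \<Rightarrow> ennreal"
  assumes [measurable]: "f \<in> borel_measurable borel"
  shows "(\<integral>\<^sup>+x. f (x + a) \<partial>lborel) = (\<integral>\<^sup>+x. f x \<partial>lborel)"
  using nn_integral_lborel_affine[of f 1 a] by (simp add: add.commute)

lemma nn_integral_lborel_flip:
  fixes f :: "'a::euclidean_space \<Rightarrow> ennreal"
  assumes [measurable]: "f \<in> borel_measurable borel"
  shows "(\<integral>\<^sup>+x. f (a - x) \<partial>lborel) = (\<integral>\<^sup>+x. f x \<partial>lborel)"
  using nn_integral_lborel_affine[of f "-1" a] by simp

text \<open>The layer cake formula for a single number above the level \<open>t\<close>. With \<open>t = 0\<close> it writes a function as the superposition of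
the indicators of its superlevel sets; a positive \<open>t\<close> removes the part below \<open>t\<close>.\<close>
lemma nn_integral_levels:
  fixes y :: ennreal and t :: real
  assumes "0 \<le> t"
  shows "(\<integral>\<^sup>+\<tau>. indicator {t..} \<tau> * indicator {\<tau>. ennreal \<tau> < y} \<tau> \<partial>lborel) = y - ennreal t"
proof -
  have [measurable]: "{\<tau>. ennreal \<tau> < y} \<in> sets borel" by measurable
  have *: "(\<integral>\<^sup>+\<tau>. indicator {t..} \<tau> * indicator {\<tau>. ennreal \<tau> < y} \<tau> \<partial>lborel)
      = emeasure lborel ({t..} \<inter> {\<tau>. ennreal \<tau> < y})"
    unfolding indicator_inter_arith[symmetric] by (intro nn_integral_indicator) simp
  show ?thesis
  proof (cases y)
    case (real r)
    have "{t..} \<inter> {\<tau>. ennreal \<tau> < y} = {t..<r}"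
      using assms real by (auto simp: ennreal_less_iff)
    with * real assms show ?thesis
      by (cases "t \<le> r") (auto simp: ennreal_minus ennreal_neg)
  next
    case top
    then have "{t..} \<inter> {\<tau>. ennreal \<tau> < y} = {t..}" by auto
    moreover have "emeasure lborel {t..} = \<infinity>"
    proof -
      have "of_nat n \<le> emeasure lborel {t..}" for n
      proof -
        have "emeasure lborel {t..t + real n} \<le> emeasure lborel {t..}"
          by (intro emeasure_mono) auto
        then show ?thesis by (simp add: ennreal_of_nat_eq_real_of_nat)
      qed
      then show ?thesis
        using ennreal_Ex_less_of_nat[of "emeasure lborel {t..}"]
        by (auto simp: less_top[symmetric] dest: leD)
    qed
    ultimately show ?thesis using * top by simp
  qed
qed

definition tail :: "(real \<Rightarrow> ennreal) \<Rightarrow> real \<Rightarrow> ennreal" where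
  "tail g \<tau> = emeasure lborel {x. ennreal \<tau> < g x}"

lemma measurable_tail [measurable]:
  assumes [measurable]: "g \<in> borel_measurable borel"
  shows "tail g \<in> borel_measurable borel"
  unfolding tail_def by measurable

lemma tail_antimono: "g \<in> borel_measurable borel \<Longrightarrow> \<sigma> \<le> \<tau> \<Longrightarrow> tail g \<tau> \<le> tail g \<sigma>"
  unfolding tail_def
  by (rule emeasure_mono) (auto intro: le_less_trans[OF ennreal_leI])

lemma nn_integral_excess:
  assumes [measurable]: "g \<in> borel_measurable borel" and t: "0 \<le> t"
  shows "(\<integral>\<^sup>+x. g x - ennreal t \<partial>lborel) = (\<integral>\<^sup>+\<tau>. indicator {t..} \<tau> * tail g \<tau> \<partial>lborel)"
proof -
  have "(\<integral>\<^sup>+x. g x - ennreal t \<partial>lborel) =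
     (\<integral>\<^sup>+x. (\<integral>\<^sup>+\<tau>. indicator {t..} \<tau> * indicator {\<tau>. ennreal \<tau> < g x} \<tau> \<partial>lborel) \<partial>lborel)"
    using t by (simp add: nn_integral_levels)
  also have "\<dots> = (\<integral>\<^sup>+\<tau>. (\<integral>\<^sup>+x. indicator {t..} \<tau> * indicator {x. ennreal \<tau> < g x} x \<partial>lborel) \<partial>lborel)"
    by (subst lborel_pair.Fubini') (auto simp: indicator_def)
  also have "\<dots> = (\<integral>\<^sup>+\<tau>. indicator {t..} \<tau> * tail g \<tau> \<partial>lborel)"
    by (simp add: nn_integral_cmult tail_def)
  finally show ?thesis .
qed

text \<open>Weak majorisation (the Hardy--Littlewood--Polya order), stated through the excess over each level. Unlike a comparison of
decreasing rearrangements it can be verified by testing against sets (\<open>majorisedI_sets\<close>), and it survives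
integration over a parameter.\<close>
definition majorised :: "(real \<Rightarrow> ennreal) \<Rightarrow> (real \<Rightarrow> ennreal) \<Rightarrow> bool" where
  "majorised g G \<longleftrightarrow> (\<forall>t\<ge>0. (\<integral>\<^sup>+x. g x - ennreal t \<partial>lborel) \<le> (\<integral>\<^sup>+x. G x - ennreal t \<partial>lborel))"

definition symdec :: "(real \<Rightarrow> 'b::order) \<Rightarrow> bool" where
  "symdec G \<longleftrightarrow> (\<forall>x y. \<bar>x\<bar> \<le> \<bar>y\<bar> \<longrightarrow> G y \<le> G x)"

lemma symdecD: "symdec G \<Longrightarrow> \<bar>x\<bar> \<le> \<bar>y\<bar> \<Longrightarrow> G y \<le> G x"
  by (auto simp: symdec_def)

text \<open>The tail of \<open>G\<close> is decreasing, so it exceeds \<open>\<mu>\<close> below some height \<open>t\<close> and lies below \<open>\<mu>\<close> beyond it. Bounding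
the truncated tail of \<open>g\<close> by \<open>\<mu>\<close> below \<open>t\<close> and by the tail above \<open>t\<close> costs nothing for \<open>G\<close>, and above
\<open>t\<close> majorisation applies.\<close>
lemma majorised_truncated_tail:
  assumes [measurable]: "g \<in> borel_measurable borel" "G \<in> borel_measurable borel"
    and maj: "majorised g G"
  shows "(\<integral>\<^sup>+\<tau>. indicator {0..} \<tau> * min (tail g \<tau>) \<mu> \<partial>lborel)
       \<le> (\<integral>\<^sup>+\<tau>. indicator {0..} \<tau> * min (tail G \<tau>) \<mu> \<partial>lborel)"
proof (cases "\<forall>\<tau>\<ge>0. tail G \<tau> > \<mu>")
  case True
  have "(\<integral>\<^sup>+\<tau>. indicator {0..} \<tau> * min (tail g \<tau>) \<mu> \<partial>lborel) \<le> (\<integral>\<^sup>+\<tau>. indicator {0::real..} \<tau> * \<mu> \<partial>lborel)"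
    by (intro nn_integral_mono) (auto split: split_indicator)
  also have "\<dots> \<le> (\<integral>\<^sup>+\<tau>. indicator {0..} \<tau> * min (tail G \<tau>) \<mu> \<partial>lborel)"
    using True by (intro nn_integral_mono) (auto split: split_indicator simp: less_imp_le)
  finally show ?thesis .
next
  case False
  define T where "T = {\<tau>. 0 \<le> \<tau> \<and> tail G \<tau> \<le> \<mu>}"
  have T: "T \<noteq> {}" "bdd_below T" using False by (auto simp: T_def not_less bdd_below_def)
  define t where "t = Inf T"
  have t0: "0 \<le> t" unfolding t_def by (rule cInf_greatest[OF T(1)]) (auto simp: T_def)
  have lo: "\<mu> < tail G \<tau>" if "0 \<le> \<tau>" "\<tau> < t" for \<tau>
  proof (rule ccontr)
    assume "\<not> ?thesis"
    then have "\<tau> \<in> T" using that by (auto simp: T_def not_less)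
    then have "t \<le> \<tau>" unfolding t_def by (rule cInf_lower[OF _ T(2)])
    then show False using that by simp
  qed
  have hi: "tail G \<tau> \<le> \<mu>" if "t < \<tau>" for \<tau>
  proof -
    from that have "\<exists>x\<in>T. x < \<tau>" unfolding t_def using cInf_less_iff[OF T] by auto
    then obtain x where "x \<in> T" "x < \<tau>" by auto
    then show ?thesis using tail_antimono[of G x \<tau>] by (auto simp: T_def)
  qed
  have "(\<integral>\<^sup>+\<tau>. indicator {0..} \<tau> * min (tail g \<tau>) \<mu> \<partial>lborel)
     \<le> (\<integral>\<^sup>+\<tau>. indicator {0..<t} \<tau> * \<mu> + indicator {t..} \<tau> * tail g \<tau> \<partial>lborel)"
    by (intro nn_integral_mono) (auto split: split_indicator)
  also have "\<dots> = (\<integral>\<^sup>+\<tau>. indicator {0..<t} \<tau> * \<mu> \<partial>lborel) + (\<integral>\<^sup>+x. g x - ennreal t \<partial>lborel)"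
    by (simp add: nn_integral_add nn_integral_excess t0)
  also have "\<dots> \<le> (\<integral>\<^sup>+\<tau>. indicator {0..<t} \<tau> * \<mu> \<partial>lborel) + (\<integral>\<^sup>+x. G x - ennreal t \<partial>lborel)"
    using maj t0 by (auto simp: majorised_def intro!: add_left_mono)
  also have "\<dots> = (\<integral>\<^sup>+\<tau>. indicator {0..<t} \<tau> * \<mu> + indicator {t..} \<tau> * tail G \<tau> \<partial>lborel)"
    by (simp add: nn_integral_add nn_integral_excess t0)
  also have "\<dots> = (\<integral>\<^sup>+\<tau>. indicator {0..} \<tau> * min (tail G \<tau>) \<mu> \<partial>lborel)"
  proof (rule nn_integral_cong_AE)
    have "AE \<tau> in lborel. \<tau> \<noteq> t" by (rule AE_lborel_singleton)
    then show "AE \<tau> in lborel. indicator {0..<t} \<tau> * \<mu> + indicator {t..} \<tau> * tail G \<tau>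
        = indicator {0..} \<tau> * min (tail G \<tau>) \<mu>"
    proof eventually_elim
      case (elim \<tau>)
      then show ?case using lo[of \<tau>] hi[of \<tau>] t0
        by (cases "\<tau> < t") (auto split: split_indicator simp: min_def)
    qed
  qed
  finally show ?thesis .
qed

lemma nn_integral_mult_levels:
  fixes g k :: "'a::euclidean_space \<Rightarrow> ennreal"
  assumes [measurable]: "g \<in> borel_measurable borel" "k \<in> borel_measurable borel"
  shows "(\<integral>\<^sup>+x. g x * k x \<partial>lborel) = (\<integral>\<^sup>+\<tau>. indicator {0..} \<tau> *
     (\<integral>\<^sup>+\<sigma>. indicator {0..} \<sigma> * emeasure lborel ({x. ennreal \<sigma> < g x} \<inter> {x. ennreal \<tau> < k x}) \<partial>lborel) \<partial>lborel)"
proof -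
  have lev: "y = (\<integral>\<^sup>+\<tau>. indicator {0..} \<tau> * indicator {\<tau>. ennreal \<tau> < y} \<tau> \<partial>lborel)" for y
    using nn_integral_levels[of 0 y] by simp
  have "(\<integral>\<^sup>+x. g x * k x \<partial>lborel) =
    (\<integral>\<^sup>+x. g x * (\<integral>\<^sup>+\<tau>. indicator {0..} \<tau> * indicator {\<tau>. ennreal \<tau> < k x} \<tau> \<partial>lborel) \<partial>lborel)"
    by (subst (2) lev) simp
  also have "\<dots> = (\<integral>\<^sup>+x. (\<integral>\<^sup>+\<tau>. indicator {0..} \<tau> * (g x * indicator {\<tau>. ennreal \<tau> < k x} \<tau>) \<partial>lborel) \<partial>lborel)"
    by (subst nn_integral_cmult[symmetric]) (auto simp: mult_ac)
  also have "\<dots> = (\<integral>\<^sup>+\<tau>. (\<integral>\<^sup>+x. indicator {0..} \<tau> * (g x * indicator {\<tau>. ennreal \<tau> < k x} \<tau>) \<partial>lborel) \<partial>lborel)"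
    by (subst lborel_pair.Fubini') (auto simp: indicator_def)
  also have "\<dots> = (\<integral>\<^sup>+\<tau>. indicator {0..} \<tau> * (\<integral>\<^sup>+x. g x * indicator {x. ennreal \<tau> < k x} x \<partial>lborel) \<partial>lborel)"
    by (subst nn_integral_cmult) (auto simp: indicator_def)
  also have "(\<lambda>\<tau>. \<integral>\<^sup>+x. g x * indicator {x. ennreal \<tau> < k x} x \<partial>lborel) =
     (\<lambda>\<tau>. \<integral>\<^sup>+\<sigma>. indicator {0..} \<sigma> * emeasure lborel ({x. ennreal \<sigma> < g x} \<inter> {x. ennreal \<tau> < k x}) \<partial>lborel)"
  proof
    fix \<tau>
    have "(\<integral>\<^sup>+x. g x * indicator {x. ennreal \<tau> < k x} x \<partial>lborel) =
      (\<integral>\<^sup>+x. (\<integral>\<^sup>+\<sigma>. indicator {0..} \<sigma> * indicator {\<sigma>. ennreal \<sigma> < g x} \<sigma> \<partial>lborel) * indicator {x. ennreal \<tau> < k x} x \<partial>lborel)"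
      by (subst lev[of "g _"]) simp
    also have "\<dots> = (\<integral>\<^sup>+x. (\<integral>\<^sup>+\<sigma>. indicator {0..} \<sigma> * (indicator {\<sigma>. ennreal \<sigma> < g x} \<sigma> * indicator {x. ennreal \<tau> < k x} x) \<partial>lborel) \<partial>lborel)"
      by (subst nn_integral_multc[symmetric]) (auto simp: mult_ac)
    also have "\<dots> = (\<integral>\<^sup>+\<sigma>. (\<integral>\<^sup>+x. indicator {0..} \<sigma> * (indicator {\<sigma>. ennreal \<sigma> < g x} \<sigma> * indicator {x. ennreal \<tau> < k x} x) \<partial>lborel) \<partial>lborel)"
      by (subst lborel_pair.Fubini') (auto simp: indicator_def)
    also have "\<dots> = (\<integral>\<^sup>+\<sigma>. indicator {0..} \<sigma> * emeasure lborel ({x. ennreal \<sigma> < g x} \<inter> {x. ennreal \<tau> < k x}) \<partial>lborel)"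
    proof (rule nn_integral_cong)
      fix \<sigma>
      have "(\<integral>\<^sup>+x. indicator {0..} \<sigma> * (indicator {\<sigma>. ennreal \<sigma> < g x} \<sigma> * indicator {x. ennreal \<tau> < k x} x) \<partial>lborel)
        = (\<integral>\<^sup>+x. indicator {0..} \<sigma> * indicator ({x. ennreal \<sigma> < g x} \<inter> {x. ennreal \<tau> < k x}) x \<partial>lborel)"
        by (intro nn_integral_cong) (auto split: split_indicator)
      then show "(\<integral>\<^sup>+x. indicator {0..} \<sigma> * (indicator {\<sigma>. ennreal \<sigma> < g x} \<sigma> * indicator {x. ennreal \<tau> < k x} x) \<partial>lborel)
        = indicator {0..} \<sigma> * emeasure lborel ({x. ennreal \<sigma> < g x} \<inter> {x. ennreal \<tau> < k x})"
        by (simp add: nn_integral_cmult)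
    qed
    finally show "(\<integral>\<^sup>+x. g x * indicator {x. ennreal \<tau> < k x} x \<partial>lborel) = \<dots>" .
  qed
  finally show ?thesis .
qed

lemma emeasure_levels_symdec:
  assumes [measurable]: "G \<in> borel_measurable borel" "K \<in> borel_measurable borel"
    and "symdec G" "symdec K"
  shows "emeasure lborel ({x. ennreal \<sigma> < G x} \<inter> {x. ennreal \<tau> < K x}) = min (tail G \<sigma>) (tail K \<tau>)"
proof -
  let ?A = "{x. ennreal \<sigma> < G x}" and ?B = "{x. ennreal \<tau> < K x}"
  have "?A \<subseteq> ?B \<or> ?B \<subseteq> ?A"
  proof (rule ccontr)
    assume "\<not> ?thesis"
    then obtain x y where "x \<in> ?A" "x \<notin> ?B" "y \<in> ?B" "y \<notin> ?A" by blast
    then show False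
      using symdecD[OF assms(3), of x y] symdecD[OF assms(3), of y x]
        symdecD[OF assms(4), of x y] symdecD[OF assms(4), of y x]
      by (cases "\<bar>x\<bar> \<le> \<bar>y\<bar>") (auto dest: less_le_trans)
  qed
  then show ?thesis
  proof
    assume "?A \<subseteq> ?B"
    then have "?A \<inter> ?B = ?A" "tail G \<sigma> \<le> tail K \<tau>"
      by (auto simp: tail_def intro!: emeasure_mono)
    then show ?thesis by (simp add: tail_def min_absorb1)
  next
    assume "?B \<subseteq> ?A"
    then have "?A \<inter> ?B = ?B" "tail K \<tau> \<le> tail G \<sigma>"
      by (auto simp: tail_def intro!: emeasure_mono)
    then show ?thesis by (simp add: tail_def min_absorb2)
  qed
qed

text \<open>The layer cake formula in both factors reduces the pairing to measures of intersections of superlevel sets. Such a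
measure is at most the minimum of the two measures, with equality for symmetric decreasing functions because their
superlevel sets are nested; \<open>majorised_truncated_tail\<close> exchanges one factor at a time.\<close>
lemma majorised_pairing:
  assumes [measurable]: "g \<in> borel_measurable borel" "k \<in> borel_measurable borel"
    "G \<in> borel_measurable borel" "K \<in> borel_measurable borel"
    and "majorised g G" "majorised k K" "symdec G" "symdec K"
  shows "(\<integral>\<^sup>+x. g x * k x \<partial>lborel) \<le> (\<integral>\<^sup>+x. G x * K x \<partial>lborel)"
proof -
  have "(\<integral>\<^sup>+x. g x * k x \<partial>lborel) \<le> (\<integral>\<^sup>+\<tau>. indicator {0..} \<tau> *
     (\<integral>\<^sup>+\<sigma>. indicator {0..} \<sigma> * min (tail g \<sigma>) (tail k \<tau>) \<partial>lborel) \<partial>lborel)"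
    unfolding nn_integral_mult_levels[OF assms(1,2)] tail_def
    by (intro nn_integral_mono mult_left_mono min.boundedI emeasure_mono) auto
  also have "\<dots> \<le> (\<integral>\<^sup>+\<tau>. indicator {0..} \<tau> *
     (\<integral>\<^sup>+\<sigma>. indicator {0..} \<sigma> * min (tail G \<sigma>) (tail k \<tau>) \<partial>lborel) \<partial>lborel)"
    by (intro nn_integral_mono mult_left_mono majorised_truncated_tail assms) auto
  also have "\<dots> = (\<integral>\<^sup>+\<tau>. (\<integral>\<^sup>+\<sigma>. indicator {0..} \<tau> * (indicator {0..} \<sigma> * min (tail G \<sigma>) (tail k \<tau>)) \<partial>lborel) \<partial>lborel)"
    by (subst nn_integral_cmult) auto
  also have "\<dots> = (\<integral>\<^sup>+\<sigma>. (\<integral>\<^sup>+\<tau>. indicator {0..} \<tau> * (indicator {0..} \<sigma> * min (tail G \<sigma>) (tail k \<tau>)) \<partial>lborel) \<partial>lborel)"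
    by (subst lborel_pair.Fubini') auto
  also have "\<dots> = (\<integral>\<^sup>+\<sigma>. indicator {0..} \<sigma> * (\<integral>\<^sup>+\<tau>. indicator {0..} \<tau> * min (tail k \<tau>) (tail G \<sigma>) \<partial>lborel) \<partial>lborel)"
    by (subst nn_integral_cmult[symmetric]) (auto simp: mult_ac min.commute)
  also have "\<dots> \<le> (\<integral>\<^sup>+\<sigma>. indicator {0..} \<sigma> * (\<integral>\<^sup>+\<tau>. indicator {0..} \<tau> * min (tail K \<tau>) (tail G \<sigma>) \<partial>lborel) \<partial>lborel)"
    by (intro nn_integral_mono mult_left_mono majorised_truncated_tail assms) auto
  also have "\<dots> = (\<integral>\<^sup>+x. K x * G x \<partial>lborel)"
    by (subst nn_integral_mult_levels) (auto simp: emeasure_levels_symdec assms)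
  finally show ?thesis by (simp add: mult.commute)
qed

abbreviation centred :: "real set \<Rightarrow> real set" where
  "centred C \<equiv> {- (measure lborel C / 2)..measure lborel C / 2}"

lemma emeasure_centred: "emeasure lborel C < \<infinity> \<Longrightarrow> emeasure lborel (centred C) = emeasure lborel C"
  by (simp add: emeasure_eq_ennreal_measure)

lemma symdec_indicator_centred: "symdec (indicator {-r..r} :: real \<Rightarrow> ennreal)"
  by (auto simp: symdec_def split: split_indicator)

lemma le_diff_add_ennreal: "a \<le> (a - b) + (b::ennreal)"
  by (cases "b \<le> a") (auto simp: diff_add_cancel_ennreal not_le intro: add_increasing less_imp_le)

text \<open>Testing with the superlevel set \<open>C = {g > t}\<close>, cut to a bounded interval to make its measure finite, the two
sides differ from the excesses by \<open>t\<close> times the equal measures of \<open>C\<close> and of the centred interval.\<close>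
lemma majorisedI_sets:
  assumes [measurable]: "g \<in> borel_measurable borel" "G \<in> borel_measurable borel"
    and *: "\<And>C. C \<in> sets borel \<Longrightarrow> emeasure lborel C < \<infinity> \<Longrightarrow>
      (\<integral>\<^sup>+x. indicator C x * g x \<partial>lborel) \<le> (\<integral>\<^sup>+x. indicator (centred C) x * G x \<partial>lborel)"
  shows "majorised g G"
  unfolding majorised_def
proof (intro allI impI)
  fix t :: real assume t: "0 \<le> t"
  define C where "C n = {x. ennreal t < g x} \<inter> {- real n..real n}" for n
  have [measurable]: "C n \<in> sets borel" for n
    unfolding C_def by measurable
  have fin: "emeasure lborel (C n) < \<infinity>" for n
  proof -
    have "emeasure lborel (C n) \<le> emeasure lborel {- real n..real n}"
      unfolding C_def by (intro emeasure_mono) auto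
    then show ?thesis by (auto intro: le_less_trans)
  qed
  have split: "a - ennreal t + ennreal t = a" if "ennreal t < a" for a
    using that by (simp add: diff_add_cancel_ennreal less_imp_le)
  have C_le: "(\<integral>\<^sup>+x. indicator (C n) x * (g x - ennreal t) \<partial>lborel) \<le> (\<integral>\<^sup>+x. G x - ennreal t \<partial>lborel)" for n
  proof -
    have "(\<integral>\<^sup>+x. indicator (C n) x * (g x - ennreal t) \<partial>lborel) + ennreal t * emeasure lborel (C n)
      = (\<integral>\<^sup>+x. indicator (C n) x * (g x - ennreal t) + ennreal t * indicator (C n) x \<partial>lborel)"
      by (subst nn_integral_add) (auto simp: nn_integral_cmult)
    also have "\<dots> = (\<integral>\<^sup>+x. indicator (C n) x * g x \<partial>lborel)"
      by (intro nn_integral_cong) (auto split: split_indicator simp: split C_def)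
    also have "\<dots> \<le> (\<integral>\<^sup>+x. indicator (centred (C n)) x * G x \<partial>lborel)"
      by (intro * fin) measurable
    also have "\<dots> \<le> (\<integral>\<^sup>+x. (G x - ennreal t) + ennreal t * indicator (centred (C n)) x \<partial>lborel)"
      by (intro nn_integral_mono)
         (auto split: split_indicator simp: le_diff_add_ennreal)
    also have "\<dots> = (\<integral>\<^sup>+x. G x - ennreal t \<partial>lborel) + ennreal t * emeasure lborel (centred (C n))"
      by (subst nn_integral_add) (auto simp: nn_integral_cmult)
    also have "\<dots> = (\<integral>\<^sup>+x. G x - ennreal t \<partial>lborel) + ennreal t * emeasure lborel (C n)"
      by (simp only: emeasure_centred[OF fin])
    finally show ?thesis
      using fin[of n] ennreal_mult_less_top[of "ennreal t" "emeasure lborel (C n)"] by auto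
  qed
  have "(\<integral>\<^sup>+x. g x - ennreal t \<partial>lborel) = (\<integral>\<^sup>+x. (SUP n. indicator (C n) x * (g x - ennreal t)) \<partial>lborel)"
  proof (intro nn_integral_cong)
    fix x
    obtain n0 where "\<bar>x\<bar> \<le> real n0" using real_arch_simple by blast
    show "g x - ennreal t = (SUP n. indicator (C n) x * (g x - ennreal t))"
    proof (cases "ennreal t < g x")
      case True
      then have "x \<in> C n0" using \<open>\<bar>x\<bar> \<le> real n0\<close> by (auto simp: C_def)
      then show ?thesis
        by (intro antisym SUP_upper2[of n0] SUP_least) (auto split: split_indicator)
    next
      case False
      then have "g x - ennreal t = 0" by (auto simp: diff_eq_0_iff_ennreal not_less intro: le_less_trans)
      then show ?thesis by simp
    qed
  qed
  also have "\<dots> = (SUP n. \<integral>\<^sup>+x. indicator (C n) x * (g x - ennreal t) \<partial>lborel)"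
    by (intro nn_integral_monotone_convergence_SUP)
       (auto simp: incseq_def le_fun_def C_def split: split_indicator)
  also have "\<dots> \<le> (\<integral>\<^sup>+x. G x - ennreal t \<partial>lborel)"
    by (rule SUP_least, rule C_le)
  finally show "(\<integral>\<^sup>+x. g x - ennreal t \<partial>lborel) \<le> (\<integral>\<^sup>+x. G x - ennreal t \<partial>lborel)" .
qed

section \<open>Riesz rearrangement on the line\<close>

lemma emeasure_shift_eq:
  fixes y :: real
  assumes [measurable]: "A \<in> sets borel" "C \<in> sets borel"
  shows "emeasure lborel {s. s \<in> A \<and> s + y \<in> C} = (\<integral>\<^sup>+s. indicator A s * indicator C (s + y) \<partial>lborel)"
proof -
  have "(\<integral>\<^sup>+s. indicator A s * indicator C (s + y) \<partial>lborel) = (\<integral>\<^sup>+s. indicator {s. s \<in> A \<and> s + y \<in> C} s \<partial>lborel)"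
    by (intro nn_integral_cong) (auto split: split_indicator)
  then show ?thesis by simp
qed

text \<open>The overlap of \<open>A\<close> with the translates of \<open>C\<close>, as a function of the translation, is the kernel by which convolutions
are tested against sets.\<close>
lemma nn_integral_emeasure_shift:
  fixes h :: "real \<Rightarrow> ennreal"
  assumes [measurable]: "A \<in> sets borel" "C \<in> sets borel" "h \<in> borel_measurable borel"
  shows "(\<integral>\<^sup>+y. h y * emeasure lborel {s. s \<in> A \<and> s + y \<in> C} \<partial>lborel)
    = (\<integral>\<^sup>+s. indicator A s * (\<integral>\<^sup>+y. h y * indicator C (s + y) \<partial>lborel) \<partial>lborel)"
proof -
  have "(\<integral>\<^sup>+y. h y * emeasure lborel {s. s \<in> A \<and> s + y \<in> C} \<partial>lborel) =
    (\<integral>\<^sup>+y. (\<integral>\<^sup>+s. h y * (indicator A s * indicator C (s + y)) \<partial>lborel) \<partial>lborel)"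
    by (subst emeasure_shift_eq, simp, simp, subst nn_integral_cmult) auto
  also have "\<dots> = (\<integral>\<^sup>+s. (\<integral>\<^sup>+y. h y * (indicator A s * indicator C (s + y)) \<partial>lborel) \<partial>lborel)"
    by (subst lborel_pair.Fubini') auto
  also have "\<dots> = (\<integral>\<^sup>+s. indicator A s * (\<integral>\<^sup>+y. h y * indicator C (s + y) \<partial>lborel) \<partial>lborel)"
    by (subst nn_integral_cmult[symmetric]) (auto simp: mult_ac)
  finally show ?thesis .
qed

lemma nn_integral_emeasure_shift_const:
  fixes A C :: "real set"
  assumes [measurable]: "A \<in> sets borel" "C \<in> sets borel"
  shows "(\<integral>\<^sup>+y. emeasure lborel {s. s \<in> A \<and> s + y \<in> C} \<partial>lborel) = emeasure lborel A * emeasure lborel C"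
proof -
  have "(\<integral>\<^sup>+y. emeasure lborel {s. s \<in> A \<and> s + y \<in> C} \<partial>lborel)
     = (\<integral>\<^sup>+s. indicator A s * (\<integral>\<^sup>+y. indicator C (s + y) \<partial>lborel) \<partial>lborel)"
    using nn_integral_emeasure_shift[OF assms, of "\<lambda>_. 1"] by simp
  also have "(\<lambda>s. \<integral>\<^sup>+y. indicator C (s + y) \<partial>lborel) = (\<lambda>s. emeasure lborel C)"
    using nn_integral_lborel_translate[of "indicator C"] by (simp add: add.commute)
  finally show ?thesis by (simp add: nn_integral_multc)
qed

text \<open>The measure of the part of \<open>A\<close> left of \<open>a\<close> is 1-Lipschitz in \<open>a\<close>, so it takes every intermediate value.\<close>
lemma ex_left_part:
  fixes A :: "real set"
  assumes [measurable]: "A \<in> sets borel" and fin: "emeasure lborel A < \<infinity>"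
    and t: "0 < t" "ennreal t < emeasure lborel A"
  shows "\<exists>a. emeasure lborel (A \<inter> {..a}) = ennreal t"
proof -
  define F where "F a = measure lborel (A \<inter> {..a::real})" for a
  have fm: "A \<inter> S \<in> fmeasurable lborel" if "S \<in> sets borel" for S
    using fin that by (auto simp: fmeasurable_def intro: le_less_trans[OF emeasure_mono])
  have lip: "F b - F a \<le> b - a" if "a \<le> b" for a b
  proof -
    have "(A \<inter> {..a}) \<union> (A \<inter> {..b}) = A \<inter> {..b}" "(A \<inter> {..b}) - (A \<inter> {..a}) = A \<inter> {a<..b}"
      using that by auto
    then have "F b = measure lborel (A \<inter> {..a}) + measure lborel (A \<inter> {a<..b})"
      unfolding F_def using measure_Un2[OF fm[of "{..a}"] fm[of "{..b}"]] by simp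
    also have "measure lborel (A \<inter> {a<..b}) \<le> measure lborel {a<..b}"
      using that by (intro measure_mono_fmeasurable) (auto simp: fmeasurable_def)
    finally show ?thesis using that by (simp add: F_def)
  qed
  have mono: "F a \<le> F b" if "a \<le> b" for a b
    unfolding F_def using that by (intro measure_mono_fmeasurable fm) auto
  have cont: "continuous_on UNIV F"
  proof (rule continuous_onI)
    fix x e :: real assume "0 < e"
    have "dist (F y) (F x) \<le> dist y x" for y
      using lip[of x y] lip[of y x] mono[of x y] mono[of y x] by (cases "x \<le> y") (auto simp: dist_real_def)
    then show "\<exists>d>0. \<forall>x'\<in>UNIV. dist x' x < d \<longrightarrow> dist (F x') (F x) \<le> e"
      using \<open>0 < e\<close> by (intro exI[of _ e]) (auto intro: order_trans less_imp_le)
  qed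
  have "(\<lambda>n. emeasure lborel (A \<inter> {..real n})) \<longlonglongrightarrow> emeasure lborel (\<Union>n. A \<inter> {..real n})"
    by (intro Lim_emeasure_incseq) (auto simp: incseq_def)
  moreover have "(\<Union>n. A \<inter> {..real n}) = A" using real_arch_simple by auto
  ultimately have "eventually (\<lambda>n. ennreal t < emeasure lborel (A \<inter> {..real n})) sequentially"
    using t by (auto intro: order_tendstoD)
  then obtain n where "ennreal t < emeasure lborel (A \<inter> {..real n})" by (auto simp: eventually_sequentially)
  then have up: "t \<le> F (real n)"
    using fm[of "{..real n}"] t by (auto simp: F_def emeasure_eq_measure2 ennreal_less_iff)
  have "(\<lambda>n. emeasure lborel (A \<inter> {..- real n})) \<longlonglongrightarrow> emeasure lborel (\<Inter>n. A \<inter> {..- real n})"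
    using fm by (intro Lim_emeasure_decseq) (auto simp: decseq_def fmeasurable_def less_top[symmetric])
  moreover have "(\<Inter>n. A \<inter> {..- real n}) = {}"
  proof -
    have "\<exists>n. \<not> x \<le> - real n" for x
    proof -
      obtain n where "- x < real n" using reals_Archimedean2 by blast
      then have "\<not> x \<le> - real n" by linarith
      then show ?thesis ..
    qed
    then show ?thesis by auto
  qed
  ultimately have lim0: "(\<lambda>n. emeasure lborel (A \<inter> {..- real n})) \<longlonglongrightarrow> 0" by simp
  have "0 < ennreal t" using t by simp
  then have "eventually (\<lambda>n. emeasure lborel (A \<inter> {..- real n}) < ennreal t) sequentially"
    using lim0 by (auto intro: order_tendstoD)
  then obtain m where "emeasure lborel (A \<inter> {..- real m}) < ennreal t" by (auto simp: eventually_sequentially)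
  then have lo: "F (- real m) \<le> t"
    using fm[of "{..- real m}"] t by (auto simp: F_def emeasure_eq_measure2 ennreal_less_iff)
  have "\<exists>x\<ge>- real m. x \<le> real n \<and> F x = t"
    using lo up by (intro IVT') (auto intro: continuous_on_subset[OF cont])
  then obtain x where "F x = t" by auto
  then show ?thesis using fm[of "{..x}"] by (auto simp: F_def emeasure_eq_measure2 intro!: exI[of _ x])
qed

text \<open>The heart of the rearrangement inequality: the overlap function of two sets is majorised by that of the centred
intervals of the same lengths. To bound the excess over \<open>t\<close>, cut from each set its leftmost part of measure \<open>t\<close>. Every
overlap then shrinks by at most \<open>t\<close>, since for a given translation the points lost with one of the two parts are among those lost with the other,
and the overlap of what remains has integral \<open>(d - t) (c - t)\<close>. For centred intervals shortening both by \<open>t\<close> reduces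
each overlap longer than \<open>t\<close> by exactly \<open>t\<close>, so the same number is a lower bound for the other side.\<close>
lemma majorised_shift:
  assumes [measurable]: "D \<in> sets borel" "C \<in> sets borel"
    and finD: "emeasure lborel D < \<infinity>" and finC: "emeasure lborel C < \<infinity>"
  shows "majorised (\<lambda>y. emeasure lborel {s. s \<in> D \<and> s + y \<in> C})
                   (\<lambda>y. emeasure lborel {s. s \<in> centred D \<and> s + y \<in> centred C})"
  unfolding majorised_def
proof (intro allI impI)
  fix t :: real assume t0: "0 \<le> t"
  define d where "d = measure lborel D"
  define c where "c = measure lborel C"
  have d: "emeasure lborel D = ennreal d" "d \<ge> 0" and c: "emeasure lborel C = ennreal c" "c \<ge> 0"
    using finD finC by (auto simp: d_def c_def emeasure_eq_ennreal_measure)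
  let ?k = "\<lambda>y. emeasure lborel {s. s \<in> D \<and> s + y \<in> C}"
  let ?K = "\<lambda>y. emeasure lborel {s. s \<in> centred D \<and> s + y \<in> centred C}"
  have kd: "?k y \<le> ennreal d" for y
    unfolding d(1)[symmetric] by (intro emeasure_mono) auto
  have kc: "?k y \<le> ennreal c" for y
  proof -
    have "?k y \<le> (\<integral>\<^sup>+s. indicator C (s + y) \<partial>lborel)"
      by (subst emeasure_shift_eq) (auto intro!: nn_integral_mono split: split_indicator)
    also have "\<dots> = ennreal c"
      by (subst nn_integral_lborel_translate) (auto simp: c)
    finally show ?thesis .
  qed
  consider "t \<ge> min d c" | "t = 0" | "0 < t" "t < d" "t < c" using t0 by fastforce
  then show "(\<integral>\<^sup>+x. ?k x - ennreal t \<partial>lborel) \<le> (\<integral>\<^sup>+x. ?K x - ennreal t \<partial>lborel)"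
  proof cases
    case 1
    have "?k y \<le> ennreal t" for y
      using kd[of y] kc[of y] 1 by (auto simp: min_le_iff_disj intro: order_trans ennreal_leI)
    then have "(\<integral>\<^sup>+x. ?k x - ennreal t \<partial>lborel) = (\<integral>\<^sup>+(x::real). 0 \<partial>lborel)"
      by (intro nn_integral_cong) (auto simp: diff_eq_0_iff_ennreal intro: le_less_trans[OF _ ennreal_less_top])
    then show ?thesis by simp
  next
    case 2
    have "(\<integral>\<^sup>+x. ?K x \<partial>lborel) = (\<integral>\<^sup>+x. ?k x \<partial>lborel)"
      using emeasure_centred[OF finD] emeasure_centred[OF finC]
      by (subst (1 2) nn_integral_emeasure_shift_const) (simp_all del: emeasure_lborel_Icc)
    then show ?thesis unfolding 2 by simp
  next
    case 3
    (* for y \<le> b - a, every point of the overlap that is lost with the left part of D is also lost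
       with the left part of C; for larger y it is the other way round *)
    obtain a where a: "emeasure lborel (D \<inter> {..a}) = ennreal t"
      using ex_left_part[OF assms(1) finD] 3 d by (auto simp: ennreal_less_iff)
    obtain b where b: "emeasure lborel (C \<inter> {..b}) = ennreal t"
      using ex_left_part[OF assms(2) finC] 3 c by (auto simp: ennreal_less_iff)
    define D' where "D' = D \<inter> {a<..}"
    define C' where "C' = C \<inter> {b<..}"
    have [measurable]: "D' \<in> sets borel" "C' \<in> sets borel" by (auto simp: D'_def C'_def)
    have "emeasure lborel D = emeasure lborel (D \<inter> {..a}) + emeasure lborel D'"
      unfolding D'_def by (subst plus_emeasure) (auto intro!: arg_cong[where f="emeasure lborel"])
    then have D': "emeasure lborel D' = ennreal (d - t)"
      using 3 a d(1) by (metis ennreal_add_diff_cancel_left ennreal_minus ennreal_neq_top t0)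
    have "emeasure lborel C = emeasure lborel (C \<inter> {..b}) + emeasure lborel C'"
      unfolding C'_def by (subst plus_emeasure) (auto intro!: arg_cong[where f="emeasure lborel"])
    then have C': "emeasure lborel C' = ennreal (c - t)"
      using 3 b c(1) by (metis ennreal_add_diff_cancel_left ennreal_minus ennreal_neq_top t0)
    have k_le: "?k y \<le> emeasure lborel {s. s \<in> D' \<and> s + y \<in> C'} + ennreal t" for y
    proof -
      let ?S = "{s. s \<in> D' \<and> s + y \<in> C'}"
      have S: "?S \<in> sets lborel" by simp
      show ?thesis
      proof (cases "y \<le> b - a")
        case True
        have "{s. s \<in> D \<and> s + y \<in> C} \<subseteq> ?S \<union> {s. s + y \<in> C \<inter> {..b}}"
          using True by (auto simp: D'_def C'_def)
        then have "?k y \<le> emeasure lborel ?S + emeasure lborel {s. s + y \<in> C \<inter> {..b}}"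
          by (intro order_trans[OF emeasure_mono emeasure_subadditive]) auto
        also have "emeasure lborel {s. s + y \<in> C \<inter> {..b}} = (\<integral>\<^sup>+s. indicator (C \<inter> {..b}) (s + y) \<partial>lborel)"
          using emeasure_shift_eq[of UNIV "C \<inter> {..b}" y] by simp
        also have "\<dots> = ennreal t"
          by (subst nn_integral_lborel_translate) (auto simp: b)
        finally show ?thesis .
      next
        case False
        have "{s. s \<in> D \<and> s + y \<in> C} \<subseteq> ?S \<union> (D \<inter> {..a})"
          using False by (auto simp: D'_def C'_def)
        then have "?k y \<le> emeasure lborel ?S + emeasure lborel (D \<inter> {..a})"
          by (intro order_trans[OF emeasure_mono emeasure_subadditive]) auto
        then show ?thesis by (simp add: a)
      qed
    qed
    have "(\<integral>\<^sup>+x. ?k x - ennreal t \<partial>lborel) \<le> (\<integral>\<^sup>+y. emeasure lborel {s. s \<in> D' \<and> s + y \<in> C'} \<partial>lborel)"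
      using k_le by (intro nn_integral_mono) (auto simp: ennreal_minus_le_iff add.commute)
    also have "\<dots> = ennreal (d - t) * ennreal (c - t)"
      by (simp add: nn_integral_emeasure_shift_const D' C')
    also have "\<dots> = emeasure lborel {- (d - t) / 2..(d - t) / 2} * emeasure lborel {- (c - t) / 2..(c - t) / 2}"
    proof -
      have "emeasure lborel {- (z - t) / 2..(z - t) / 2} = ennreal (z - t)" if "t < z" for z
      proof -
        have "(z - t) / 2 - (- (z - t) / 2) = z - t" by (simp add: field_simps)
        then show ?thesis using that by (subst emeasure_lborel_Icc) auto
      qed
      then show ?thesis using 3 by simp
    qed
    also have "\<dots> = (\<integral>\<^sup>+y. emeasure lborel {s. s \<in> {- (d - t) / 2..(d - t) / 2} \<and> s + y \<in> {- (c - t) / 2..(c - t) / 2}} \<partial>lborel)"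
      by (subst nn_integral_emeasure_shift_const) auto
    also have "\<dots> \<le> (\<integral>\<^sup>+x. ?K x - ennreal t \<partial>lborel)"
    proof (intro nn_integral_mono)
      fix y :: real
      define l where "l = max (- d / 2) (- c / 2 - y)"
      define u where "u = min (d / 2) (c / 2 - y)"
      (* shortening both centred intervals by t moves each end of the overlap {l..u} by t/2 *)
      have e1: "{s. s \<in> {- (d - t) / 2..(d - t) / 2} \<and> s + y \<in> {- (c - t) / 2..(c - t) / 2}} = {l + t/2..u - t/2}"
        by (auto simp: l_def u_def min_def max_def add_divide_distrib diff_divide_distrib split: if_splits)
      have e2: "{s. s \<in> centred D \<and> s + y \<in> centred C} = {l..u}"
        unfolding d_def[symmetric] c_def[symmetric] by (auto simp: l_def u_def min_def max_def split: if_splits)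
      show "emeasure lborel {s. s \<in> {- (d - t) / 2..(d - t) / 2} \<and> s + y \<in> {- (c - t) / 2..(c - t) / 2}} \<le> ?K y - ennreal t"
        unfolding e1 e2 using t0
        by (cases "l + t/2 \<le> u - t/2") (auto simp: ennreal_minus)
    qed
    finally show ?thesis .
  qed
qed

text \<open>Convolution of nonnegative functions with values in the extended reals, so that no integrability is required.\<close>
definition conv :: "('a::euclidean_space \<Rightarrow> ennreal) \<Rightarrow> ('a \<Rightarrow> ennreal) \<Rightarrow> 'a \<Rightarrow> ennreal" where
  "conv f g x = (\<integral>\<^sup>+y. f y * g (x - y) \<partial>lborel)"

lemma measurable_conv [measurable]:
  assumes [measurable]: "f \<in> borel_measurable borel" "g \<in> borel_measurable borel"
  shows "conv f g \<in> borel_measurable borel"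
  unfolding conv_def by measurable

lemma ennreal_rearrangement2:
  fixes a b a' b' :: ennreal
  assumes "a' \<le> a" "b' \<le> b"
  shows "a * b' + a' * b \<le> a * b + a' * b'"
proof -
  from assms obtain x y where "a = a' + x" "b = b' + y" by (auto simp: le_iff_add)
  then show ?thesis by (simp add: algebra_simps add_left_mono)
qed

text \<open>For \<open>0 \<le> s \<le> s'\<close> fold both integrals about the midpoint \<open>m\<close> of \<open>s\<close> and \<open>s'\<close>. The points \<open>y\<close> and \<open>2 m - y\<close> pair
up so that going from \<open>s'\<close> to \<open>s\<close> replaces a sum of products by one in which large factors meet large factors.\<close>
lemma symdec_conv:
  assumes [measurable]: "G \<in> borel_measurable borel" "K \<in> borel_measurable borel"
    and G: "symdec G" and K: "symdec K"
  shows "symdec (conv G K)"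
proof -
  have even: "G (-x) = G x" "K (-x) = K x" for x
    using symdecD[OF G, of x "-x"] symdecD[OF G, of "-x" x] symdecD[OF K, of x "-x"] symdecD[OF K, of "-x" x]
    by (auto intro: antisym)
  have conv_even: "conv G K (- s) = conv G K s" for s
  proof -
    have "conv G K (- s) = (\<integral>\<^sup>+y. G (0 - y) * K (- s - (0 - y)) \<partial>lborel)"
      unfolding conv_def by (subst nn_integral_lborel_flip) auto
    also have "\<dots> = (\<integral>\<^sup>+y. G y * K (s - y) \<partial>lborel)"
      using even(2)[of "s - _"] by (simp add: even(1))
    finally show ?thesis by (simp add: conv_def)
  qed
  (* the integral folded about an arbitrary point m *)
  have half: "conv G K s = (\<integral>\<^sup>+y. indicator {..<m} y * (G y * K (s - y) + G (2 * m - y) * K (s - 2 * m + y)) \<partial>lborel)" for s m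
  proof -
    have "AE y in lborel. y \<noteq> m" by (rule AE_lborel_singleton)
    then have "conv G K s = (\<integral>\<^sup>+y. indicator {..<m} y * (G y * K (s - y)) + indicator {m<..} y * (G y * K (s - y)) \<partial>lborel)"
      unfolding conv_def by (intro nn_integral_cong_AE) (auto split: split_indicator)
    also have "\<dots> = (\<integral>\<^sup>+y. indicator {..<m} y * (G y * K (s - y)) \<partial>lborel) + (\<integral>\<^sup>+y. indicator {m<..} y * (G y * K (s - y)) \<partial>lborel)"
      by (intro nn_integral_add) auto
    also have "(\<integral>\<^sup>+y. indicator {m<..} y * (G y * K (s - y)) \<partial>lborel) =
       (\<integral>\<^sup>+y. indicator {m<..} (2 * m - y) * (G (2 * m - y) * K (s - (2 * m - y))) \<partial>lborel)"
      by (subst nn_integral_lborel_flip) auto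
    also have "\<dots> = (\<integral>\<^sup>+y. indicator {..<m} y * (G (2 * m - y) * K (s - 2 * m + y)) \<partial>lborel)"
      by (intro nn_integral_cong) (auto split: split_indicator simp: algebra_simps)
    finally show ?thesis by (subst (asm) nn_integral_add[symmetric]) (auto simp: distrib_left)
  qed
  have mono: "conv G K s' \<le> conv G K s" if "0 \<le> s" "s \<le> s'" for s s'
  proof -
    define m where "m = (s + s') / 2"
    have "conv G K s' = (\<integral>\<^sup>+y. indicator {..<m} y * (G y * K (s' - y) + G (2 * m - y) * K (s - y)) \<partial>lborel)"
    proof -
      have "K (s' - 2 * m + y) = K (s - y)" for y
        using even(2)[of "s - y"] by (simp add: m_def field_simps)
      then show ?thesis by (subst half[of _ m]) simp
    qed
    also have "\<dots> \<le> (\<integral>\<^sup>+y. indicator {..<m} y * (G y * K (s - y) + G (2 * m - y) * K (s' - y)) \<partial>lborel)"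
    proof (intro nn_integral_mono)
      fix y
      have "y < m \<Longrightarrow> \<bar>y\<bar> \<le> \<bar>2 * m - y\<bar> \<and> \<bar>s - y\<bar> \<le> \<bar>s' - y\<bar>"
        using that by (auto simp: m_def abs_if field_simps)
      then show "indicator {..<m} y * (G y * K (s' - y) + G (2 * m - y) * K (s - y))
          \<le> indicator {..<m} y * (G y * K (s - y) + G (2 * m - y) * K (s' - y))"
        by (auto split: split_indicator intro!: ennreal_rearrangement2 symdecD[OF G] symdecD[OF K])
    qed
    also have "\<dots> = conv G K s"
    proof -
      have "K (s - 2 * m + y) = K (s' - y)" for y
        using even(2)[of "s' - y"] by (simp add: m_def field_simps)
      then show ?thesis by (subst half[of s m]) simp
    qed
    finally show ?thesis .
  qed
  have "conv G K \<bar>s\<bar> = conv G K s" for s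
    using conv_even[of s] by (cases "0 \<le> s") auto
  then show ?thesis
    unfolding symdec_def using mono[of "\<bar>_\<bar>" "\<bar>_\<bar>"] by (metis abs_ge_zero)
qed

text \<open>Integrating \<open>conv g k\<close> over \<open>C\<close> is pairing \<open>g\<close> with the average \<open>H k C\<close> of \<open>k\<close> over translates of \<open>C\<close>. Testing
\<open>H k C\<close> against a second set leads to the overlap functions of \<open>majorised_shift\<close>, so \<open>H k C\<close> is majorised by its
centred counterpart and \<open>majorised_pairing\<close> applies twice.\<close>
lemma majorised_conv:
  assumes [measurable]: "g \<in> borel_measurable borel" "k \<in> borel_measurable borel"
    "G \<in> borel_measurable borel" "K \<in> borel_measurable borel"
    and maj: "majorised g G" "majorised k K" and sd: "symdec G" "symdec K"
    and C [measurable]: "C \<in> sets borel" and fin: "emeasure lborel C < \<infinity>"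
  shows "(\<integral>\<^sup>+x. indicator C x * conv g k x \<partial>lborel) \<le> (\<integral>\<^sup>+x. indicator (centred C) x * conv G K x \<partial>lborel)"
proof -
  define H where "H k C s = (\<integral>\<^sup>+y. k y * indicator C (s + y) \<partial>lborel)" for k :: "real \<Rightarrow> ennreal" and C s
  have [measurable]: "H k C \<in> borel_measurable borel" if [measurable]: "k \<in> borel_measurable borel" "C \<in> sets borel" for k C
    unfolding H_def by measurable
  have HK: "H k {-r..r} s = conv k (indicator {-r..r}) (- s)" for k r s
    unfolding H_def conv_def by (intro nn_integral_cong) (auto split: split_indicator)
  have sym_neg: "symdec (\<lambda>s. F (- s))" if "symdec F" for F :: "real \<Rightarrow> ennreal"
    using that by (auto simp: symdec_def)
  have symH: "symdec (H K {-r..r})" if [measurable]: "K \<in> borel_measurable borel" and "symdec K" for K r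
    unfolding HK by (intro sym_neg symdec_conv symdec_indicator_centred that) auto
  have conv_eq: "(\<integral>\<^sup>+x. indicator C x * conv g k x \<partial>lborel) = (\<integral>\<^sup>+y. g y * H k C y \<partial>lborel)"
    if [measurable]: "C \<in> sets borel" "g \<in> borel_measurable borel" "k \<in> borel_measurable borel" for g k C
  proof -
    have "(\<integral>\<^sup>+x. indicator C x * conv g k x \<partial>lborel) = (\<integral>\<^sup>+x. (\<integral>\<^sup>+y. indicator C x * (g y * k (x - y)) \<partial>lborel) \<partial>lborel)"
      unfolding conv_def by (subst nn_integral_cmult) auto
    also have "\<dots> = (\<integral>\<^sup>+y. (\<integral>\<^sup>+x. indicator C x * (g y * k (x - y)) \<partial>lborel) \<partial>lborel)"
      by (subst lborel_pair.Fubini') auto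
    also have "\<dots> = (\<integral>\<^sup>+y. g y * (\<integral>\<^sup>+x. k (x - y) * indicator C x \<partial>lborel) \<partial>lborel)"
      by (subst nn_integral_cmult[symmetric]) (auto simp: mult_ac)
    also have "(\<lambda>y. \<integral>\<^sup>+x. k (x - y) * indicator C x \<partial>lborel) = H k C"
    proof
      fix y
      show "(\<integral>\<^sup>+x. k (x - y) * indicator C x \<partial>lborel) = H k C y"
        unfolding H_def using nn_integral_lborel_translate[of "\<lambda>x. k (x - y) * indicator C x" y]
        by (simp add: add.commute)
    qed
    finally show ?thesis .
  qed
  have majH: "majorised (H k C) (H K (centred C))"
  proof (rule majorisedI_sets)
    fix D :: "real set" assume D [measurable]: "D \<in> sets borel" and finD: "emeasure lborel D < \<infinity>"
    have "(\<integral>\<^sup>+x. indicator D x * H k C x \<partial>lborel) = (\<integral>\<^sup>+y. k y * emeasure lborel {s. s \<in> D \<and> s + y \<in> C} \<partial>lborel)"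
      unfolding H_def by (subst nn_integral_emeasure_shift) auto
    also have "\<dots> \<le> (\<integral>\<^sup>+y. K y * emeasure lborel {s. s \<in> centred D \<and> s + y \<in> centred C} \<partial>lborel)"
    proof (intro majorised_pairing maj sd majorised_shift fin finD)
      have *: "emeasure lborel {s. s \<in> {-p..p} \<and> s + y \<in> {-q..q}} = H (indicator {-p..p}) {-q..q} y" for p q y :: real
        unfolding H_def by (subst emeasure_shift_eq) (auto simp: add.commute)
      show "symdec (\<lambda>y. emeasure lborel {s. s \<in> centred D \<and> s + y \<in> centred C})"
        unfolding * by (intro symH symdec_indicator_centred) auto
    qed measurable
    also have "\<dots> = (\<integral>\<^sup>+x. indicator (centred D) x * H K (centred C) x \<partial>lborel)"
      unfolding H_def by (subst nn_integral_emeasure_shift) auto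
    finally show "(\<integral>\<^sup>+x. indicator D x * H k C x \<partial>lborel) \<le> (\<integral>\<^sup>+x. indicator (centred D) x * H K (centred C) x \<partial>lborel)" .
  qed auto
  have "(\<integral>\<^sup>+y. g y * H k C y \<partial>lborel) \<le> (\<integral>\<^sup>+y. G y * H K (centred C) y \<partial>lborel)"
    by (intro majorised_pairing maj sd majH symH) auto
  then show ?thesis by (simp add: conv_eq)
qed

section \<open>Steiner symmetrisation\<close>

text \<open>A unit vector \<open>e\<close>, with the lines parallel to it as fibres. The fibre through \<open>x\<close> is parametrised by the coordinate along
\<open>e\<close>; it depends on \<open>x\<close> only through the projection to the orthogonal complement. All points of the ambient space
serve as labels of fibres, which avoids introducing the hyperplane as a measure space.\<close>
locale direction =
  fixes e :: "'a::euclidean_space"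
  assumes norm_e: "norm e = 1"
begin

definition proj :: "'a \<Rightarrow> 'a" where "proj x = x - (x \<bullet> e) *\<^sub>R e"
definition fib :: "('a \<Rightarrow> 'b) \<Rightarrow> 'a \<Rightarrow> real \<Rightarrow> 'b" where "fib f x s = f (proj x + s *\<^sub>R e)"
definition slab :: "'a set" where "slab = {y. 0 \<le> y \<bullet> e \<and> y \<bullet> e < 1}"

lemma e_e [simp]: "e \<bullet> e = 1"
  using norm_e by (simp add: dot_square_norm)

lemma proj_dot [simp]: "proj x \<bullet> e = 0"
  by (simp add: proj_def inner_diff_left)

lemma proj_fibre [simp]: "proj (proj x + s *\<^sub>R e) = proj x"
  unfolding proj_def[of "proj x + _"] by (simp add: inner_add_left)

lemma fibre_dot [simp]: "(proj x + s *\<^sub>R e) \<bullet> e = s"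
  by (simp add: inner_add_left)

lemma proj_diff: "proj (x - y) = proj x - proj y"
  by (simp add: proj_def inner_diff_left algebra_simps)

lemma fib_self: "fib f x (x \<bullet> e) = f x"
  by (simp add: fib_def proj_def)

lemma norm_fibre: "(norm (proj x + s *\<^sub>R e))\<^sup>2 = (norm (proj x))\<^sup>2 + s\<^sup>2"
proof -
  have "e \<bullet> proj x = 0" by (subst inner_commute) simp
  then show ?thesis
    unfolding power2_norm_eq_inner by (simp add: inner_add_left inner_add_right power2_eq_square)
qed

lemma norm_fibre_le: "\<bar>s\<bar> \<le> \<bar>t\<bar> \<Longrightarrow> norm (proj x + s *\<^sub>R e) \<le> norm (proj x + t *\<^sub>R e)"
  by (rule power2_le_imp_le) (simp_all add: norm_fibre abs_le_square_iff)

lemma norm_fibre_less: "\<bar>s\<bar> < \<bar>t\<bar> \<Longrightarrow> norm (proj x + s *\<^sub>R e) < norm (proj x + t *\<^sub>R e)"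
  by (rule power2_less_imp_less) (use abs_le_square_iff[of t s] in \<open>auto simp: norm_fibre\<close>)

lemma measurable_proj [measurable]: "proj \<in> borel_measurable borel"
  unfolding proj_def by measurable

lemma slab_sets [measurable]: "slab \<in> sets borel"
  unfolding slab_def by measurable

lemma measurable_fib [measurable]:
  assumes [measurable]: "f \<in> borel_measurable borel"
  shows "fib f x \<in> borel_measurable borel"
  unfolding fib_def by measurable

lemma measurable_fib_pair [measurable]:
  assumes [measurable]: "f \<in> borel_measurable borel" "g \<in> M \<rightarrow>\<^sub>M borel" "h \<in> M \<rightarrow>\<^sub>M borel"
  shows "(\<lambda>z. fib f (g z) (h z)) \<in> borel_measurable M"
  unfolding fib_def by measurable

text \<open>Fubini's theorem along the lines parallel to \<open>e\<close>, free of coordinates: each line meets the slab in a segment of length one,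
so averaging over the slab counts every line once.\<close>
lemma nn_integral_fib:
  assumes [measurable]: "H \<in> borel_measurable borel"
  shows "(\<integral>\<^sup>+x. H x \<partial>lborel) = (\<integral>\<^sup>+y. indicator slab y * (\<integral>\<^sup>+s. fib H y s \<partial>lborel) \<partial>lborel)"
proof -
  have shift: "(\<integral>\<^sup>+s. fib H y s \<partial>lborel) = (\<integral>\<^sup>+s. H (y + s *\<^sub>R e) \<partial>lborel)" for y
  proof -
    have "(\<integral>\<^sup>+s. fib H y s \<partial>lborel) = (\<integral>\<^sup>+s. fib H y (s + y \<bullet> e) \<partial>lborel)"
      by (subst nn_integral_lborel_translate) auto
    then show ?thesis by (simp add: fib_def proj_def algebra_simps)
  qed
  have "(\<integral>\<^sup>+y. indicator slab y * (\<integral>\<^sup>+s. fib H y s \<partial>lborel) \<partial>lborel)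
     = (\<integral>\<^sup>+y. (\<integral>\<^sup>+s. indicator slab y * H (y + s *\<^sub>R e) \<partial>lborel) \<partial>lborel)"
    unfolding shift by (subst nn_integral_cmult) auto
  also have "\<dots> = (\<integral>\<^sup>+s. (\<integral>\<^sup>+y. indicator slab y * H (y + s *\<^sub>R e) \<partial>lborel) \<partial>lborel)"
    by (subst lborel_pair.Fubini') auto
  also have "\<dots> = (\<integral>\<^sup>+s. (\<integral>\<^sup>+y. indicator slab (y - s *\<^sub>R e) * H y \<partial>lborel) \<partial>lborel)"
  proof (rule nn_integral_cong)
    fix s :: real
    show "(\<integral>\<^sup>+y. indicator slab y * H (y + s *\<^sub>R e) \<partial>lborel) = (\<integral>\<^sup>+y. indicator slab (y - s *\<^sub>R e) * H y \<partial>lborel)"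
      using nn_integral_lborel_translate[of "\<lambda>y. indicator slab (y - s *\<^sub>R e) * H y" "s *\<^sub>R e"] by simp
  qed
  also have "\<dots> = (\<integral>\<^sup>+y. (\<integral>\<^sup>+s. indicator slab (y - s *\<^sub>R e) * H y \<partial>lborel) \<partial>lborel)"
    by (subst lborel_pair.Fubini') auto
  also have "\<dots> = (\<integral>\<^sup>+y. H y \<partial>lborel)"
  proof (intro nn_integral_cong)
    fix y :: 'a
    have "(\<integral>\<^sup>+s. indicator slab (y - s *\<^sub>R e) * H y \<partial>lborel) = (\<integral>\<^sup>+s. indicator {y \<bullet> e - 1<..y \<bullet> e} s * H y \<partial>lborel)"
      by (intro nn_integral_cong) (auto simp: slab_def inner_diff_left split: split_indicator)
    then show "(\<integral>\<^sup>+s. indicator slab (y - s *\<^sub>R e) * H y \<partial>lborel) = H y"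
      by (simp add: nn_integral_multc)
  qed
  finally show ?thesis by simp
qed

definition reflect :: "'a \<Rightarrow> 'a" where "reflect x = x - (2 * (x \<bullet> e)) *\<^sub>R e"

lemma measurable_reflect [measurable]: "reflect \<in> borel_measurable borel"
  unfolding reflect_def by measurable

lemma reflect_fibre: "reflect (proj x + s *\<^sub>R e) = proj x + (- s) *\<^sub>R e"
proof -
  have "(2 * s) *\<^sub>R e = s *\<^sub>R e + s *\<^sub>R e" by (simp add: scaleR_add_left[symmetric])
  then show ?thesis by (simp add: reflect_def)
qed

lemma reflect_inner: "reflect x \<bullet> reflect y = x \<bullet> y"
  by (simp add: reflect_def inner_diff_left inner_diff_right inner_commute algebra_simps)

lemma nn_integral_reflect:
  assumes [measurable]: "H \<in> borel_measurable borel"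
  shows "(\<integral>\<^sup>+x. H (reflect x) \<partial>lborel) = (\<integral>\<^sup>+x. H x \<partial>lborel)"
proof -
  have *: "(\<integral>\<^sup>+s. fib H y (- s) \<partial>lborel) = (\<integral>\<^sup>+s. fib H y s \<partial>lborel)" for y
    using nn_integral_lborel_flip[of "fib H y" 0] by simp
  have "fib (\<lambda>x. H (reflect x)) y s = fib H y (- s)" for y s
    by (simp only: fib_def reflect_fibre)
  then show ?thesis
    using nn_integral_fib[of "\<lambda>x. H (reflect x)"] nn_integral_fib[of H] by (simp add: *)
qed

lemma distr_reflect: "distr lborel borel reflect = lborel"
proof (rule measure_eqI)
  fix A assume "A \<in> sets (distr lborel borel reflect)"
  then have [measurable]: "A \<in> sets borel" by simp
  have "emeasure (distr lborel borel reflect) A = (\<integral>\<^sup>+x. indicator A x \<partial>distr lborel borel reflect)"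
    by simp
  also have "\<dots> = (\<integral>\<^sup>+x. indicator A (reflect x) \<partial>lborel)"
    by (subst nn_integral_distr) auto
  also have "\<dots> = emeasure lborel A"
    using nn_integral_reflect[of "indicator A"] by simp
  finally show "emeasure (distr lborel borel reflect) A = emeasure lborel A" .
qed simp

definition fib_majorised :: "('a \<Rightarrow> ennreal) \<Rightarrow> ('a \<Rightarrow> ennreal) \<Rightarrow> bool" where
  "fib_majorised f G \<longleftrightarrow> (\<forall>x. majorised (fib f x) (fib G x))"

definition fib_symdec :: "('a \<Rightarrow> ennreal) \<Rightarrow> bool" where
  "fib_symdec G \<longleftrightarrow> (\<forall>x. symdec (fib G x))"

text \<open>A fibre of a convolution is an average of one-dimensional convolutions of fibres; this is why statements about the
line pass to every fibre.\<close>
lemma fib_conv: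
  assumes [measurable]: "f \<in> borel_measurable borel" "g \<in> borel_measurable borel"
  shows "fib (conv f g) x t = (\<integral>\<^sup>+y. indicator slab y * conv (fib f y) (fib g (x - y)) t \<partial>lborel)"
proof -
  have "fib (conv f g) x t = (\<integral>\<^sup>+y. f y * g (proj x + t *\<^sub>R e - y) \<partial>lborel)"
    by (simp add: fib_def conv_def)
  also have "\<dots> = (\<integral>\<^sup>+y. indicator slab y * (\<integral>\<^sup>+s. fib (\<lambda>y. f y * g (proj x + t *\<^sub>R e - y)) y s \<partial>lborel) \<partial>lborel)"
    by (rule nn_integral_fib) measurable
  also have "\<dots> = (\<integral>\<^sup>+y. indicator slab y * conv (fib f y) (fib g (x - y)) t \<partial>lborel)"
    by (simp add: conv_def fib_def proj_diff algebra_simps)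
  finally show ?thesis .
qed

lemma fib_symdec_conv:
  assumes [measurable]: "f \<in> borel_measurable borel" "g \<in> borel_measurable borel"
    and "fib_symdec f" "fib_symdec g"
  shows "fib_symdec (conv f g)"
  unfolding fib_symdec_def symdec_def
proof (intro allI impI)
  fix x :: 'a and s t :: real assume st: "\<bar>s\<bar> \<le> \<bar>t\<bar>"
  have "symdec (conv (fib f y) (fib g (x - y)))" for y
    using assms by (intro symdec_conv) (auto simp: fib_symdec_def)
  then show "fib (conv f g) x t \<le> fib (conv f g) x s"
    unfolding fib_conv[OF assms(1,2)] by (intro nn_integral_mono mult_left_mono symdecD[OF _ st]) auto
qed

lemma fib_majorised_conv:
  assumes [measurable]: "f \<in> borel_measurable borel" "g \<in> borel_measurable borel"
    "F \<in> borel_measurable borel" "G \<in> borel_measurable borel"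
    and maj: "fib_majorised f F" "fib_majorised g G" and sd: "fib_symdec F" "fib_symdec G"
  shows "fib_majorised (conv f g) (conv F G)"
  unfolding fib_majorised_def
proof (intro allI majorisedI_sets)
  fix x :: 'a and C :: "real set"
  assume [measurable]: "C \<in> sets borel" and fin: "emeasure lborel C < \<infinity>"
  have eq: "(\<integral>\<^sup>+t. indicator D t * fib (conv f g) x t \<partial>lborel)
    = (\<integral>\<^sup>+y. indicator slab y * (\<integral>\<^sup>+t. indicator D t * conv (fib f y) (fib g (x - y)) t \<partial>lborel) \<partial>lborel)"
    if [measurable]: "D \<in> sets borel" "f \<in> borel_measurable borel" "g \<in> borel_measurable borel" for D f g
  proof -
    have [measurable]: "(\<lambda>(t, y). conv (fib f y) (fib g (x - y)) t) \<in> borel_measurable (borel \<Otimes>\<^sub>M borel)"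
      unfolding conv_def by measurable
    have "(\<integral>\<^sup>+t. indicator D t * fib (conv f g) x t \<partial>lborel)
      = (\<integral>\<^sup>+t. (\<integral>\<^sup>+y. indicator D t * (indicator slab y * conv (fib f y) (fib g (x - y)) t) \<partial>lborel) \<partial>lborel)"
      by (subst fib_conv, simp, simp, subst nn_integral_cmult) auto
    also have "\<dots> = (\<integral>\<^sup>+y. (\<integral>\<^sup>+t. indicator D t * (indicator slab y * conv (fib f y) (fib g (x - y)) t) \<partial>lborel) \<partial>lborel)"
      by (subst lborel_pair.Fubini') auto
    also have "\<dots> = (\<integral>\<^sup>+y. indicator slab y * (\<integral>\<^sup>+t. indicator D t * conv (fib f y) (fib g (x - y)) t \<partial>lborel) \<partial>lborel)"
      by (subst nn_integral_cmult[symmetric]) (auto simp: mult_ac)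
    finally show ?thesis .
  qed
  show "(\<integral>\<^sup>+t. indicator C t * fib (conv f g) x t \<partial>lborel) \<le> (\<integral>\<^sup>+t. indicator (centred C) t * fib (conv F G) x t \<partial>lborel)"
    unfolding eq[OF \<open>C \<in> sets borel\<close> assms(1,2)] eq[OF atLeastAtMost_borel assms(3,4)]
    using maj sd fin
    by (intro nn_integral_mono mult_left_mono majorised_conv) (auto simp: fib_majorised_def fib_symdec_def)
qed auto

text \<open>\<open>majorised_pairing\<close> on each fibre, with both factors equal.\<close>
lemma fib_majorised_square_le:
  assumes [measurable]: "f \<in> borel_measurable borel" "G \<in> borel_measurable borel"
    and "fib_majorised f G" "fib_symdec G"
  shows "(\<integral>\<^sup>+x. f x * f x \<partial>lborel) \<le> (\<integral>\<^sup>+x. G x * G x \<partial>lborel)"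
proof -
  have "fib (\<lambda>x. f x * f x) y = (\<lambda>s. fib f y s * fib f y s)" for f :: "'a \<Rightarrow> ennreal" and y
    by (simp add: fib_def fun_eq_iff)
  moreover have "(\<integral>\<^sup>+s. fib f y s * fib f y s \<partial>lborel) \<le> (\<integral>\<^sup>+s. fib G y s * fib G y s \<partial>lborel)" for y
    using assms(3,4) by (intro majorised_pairing) (auto simp: fib_majorised_def fib_symdec_def)
  ultimately show ?thesis
    by (subst (1 2) nn_integral_fib, simp, simp, intro nn_integral_mono) (auto intro: mult_left_mono)
qed

end

text \<open>The index is shifted: \<open>conv_power f n\<close> is the convolution of \<open>n + 1\<close> copies of \<open>f\<close>.\<close>
fun conv_power :: "('a::euclidean_space \<Rightarrow> ennreal) \<Rightarrow> nat \<Rightarrow> 'a \<Rightarrow> ennreal" where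
  "conv_power f 0 = f"
| "conv_power f (Suc n) = conv f (conv_power f n)"

lemma measurable_conv_power [measurable]:
  assumes [measurable]: "f \<in> borel_measurable borel"
  shows "conv_power f n \<in> borel_measurable borel"
  by (induction n) auto

lemma ennreal_eqI_levels:
  assumes "\<And>\<tau>. 0 \<le> \<tau> \<Longrightarrow> ennreal \<tau> < a \<longleftrightarrow> ennreal \<tau> < b"
  shows "a = b"
proof -
  have "a = (\<integral>\<^sup>+\<tau>. indicator {0..} \<tau> * indicator {\<tau>. ennreal \<tau> < a} \<tau> \<partial>lborel)"
    using nn_integral_levels[of 0 a] by simp
  also have "\<dots> = (\<integral>\<^sup>+\<tau>. indicator {0..} \<tau> * indicator {\<tau>. ennreal \<tau> < b} \<tau> \<partial>lborel)"
    using assms by (intro nn_integral_cong) (auto split: split_indicator)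
  also have "\<dots> = b" using nn_integral_levels[of 0 b] by simp
  finally show ?thesis .
qed

text \<open>Right continuity of the distribution function, in the form used to compare strict inequalities.\<close>
lemma tail_right_continuous:
  assumes [measurable]: "g \<in> borel_measurable borel" and "c < tail g \<tau>" and "0 \<le> \<tau>"
  shows "\<exists>\<sigma>>\<tau>. c < tail g \<sigma>"
proof -
  define A where "A n = {x. ennreal (\<tau> + 1 / Suc n) < g x}" for n
  have "(\<lambda>n. emeasure lborel (A n)) \<longlonglongrightarrow> emeasure lborel (\<Union>n. A n)"
  proof (intro Lim_emeasure_incseq)
    show "incseq A"
    proof (intro incseq_SucI subsetI)
      fix n x assume "x \<in> A n"
      moreover have "ennreal (\<tau> + 1 / Suc (Suc n)) \<le> ennreal (\<tau> + 1 / Suc n)"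
        by (intro ennreal_leI add_left_mono frac_le) auto
      ultimately show "x \<in> A (Suc n)" unfolding A_def mem_Collect_eq by (rule le_less_trans[rotated])
    qed
  qed (auto simp: A_def)
  moreover have "(\<Union>n. A n) = {x. ennreal \<tau> < g x}"
  proof (intro equalityI subsetI)
    fix x assume "x \<in> {x. ennreal \<tau> < g x}"
    then obtain r where r: "ennreal \<tau> < r" "r < g x" using dense by auto
    then obtain r' where r': "r = ennreal r'" "0 \<le> r'" by (cases r) (auto simp: less_top)
    then have "\<tau> < r'" using r \<open>0 \<le> \<tau>\<close> by (simp add: ennreal_less_iff)
    then obtain n where "1 / real (Suc n) < r' - \<tau>" using nat_approx_posE[of "r' - \<tau>"] by auto
    then have "ennreal (\<tau> + 1 / Suc n) \<le> r" unfolding r' by (intro ennreal_leI) simp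
    then show "x \<in> (\<Union>n. A n)" using r by (auto simp: A_def intro: le_less_trans)
  next
    fix x assume "x \<in> (\<Union>n. A n)"
    then obtain n where "ennreal (\<tau> + 1 / Suc n) < g x" by (auto simp: A_def)
    moreover have "ennreal \<tau> \<le> ennreal (\<tau> + 1 / Suc n)" by (intro ennreal_leI) simp
    ultimately show "x \<in> {x. ennreal \<tau> < g x}" by simp
  qed
  ultimately have "eventually (\<lambda>n. c < emeasure lborel (A n)) sequentially"
    using assms(2) by (auto simp: tail_def intro: order_tendstoD)
  then obtain n where "c < emeasure lborel (A n)" by (auto simp: eventually_sequentially)
  then show ?thesis by (intro exI[of _ "\<tau> + 1 / Suc n"]) (auto simp: A_def tail_def)
qed

lemma emeasure_open_centred: "emeasure lborel {s. ennreal (2 * \<bar>s\<bar>) < c} = c"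
proof (cases c)
  case (real r)
  have "{s. ennreal (2 * \<bar>s\<bar>) < c} = {- (r / 2)<..<r / 2}"
    unfolding real by (auto simp: ennreal_less_iff)
  then show ?thesis using real by simp
qed simp

context direction
begin

text \<open>On each fibre every superlevel set is replaced by the open centred interval of the same length: the point with
coordinate \<open>x \<bullet> e\<close> belongs to it when twice its absolute value is below the length.\<close>
definition steiner :: "('a \<Rightarrow> ennreal) \<Rightarrow> 'a \<Rightarrow> ennreal" where
  "steiner f x = (\<integral>\<^sup>+\<tau>. indicator {0..} \<tau> * indicator {\<tau>. ennreal (2 * \<bar>x \<bullet> e\<bar>) < tail (fib f x) \<tau>} \<tau> \<partial>lborel)"

lemma measurable_tail_fib [measurable]:
  assumes [measurable]: "f \<in> borel_measurable borel"
  shows "(\<lambda>(x, \<tau>). tail (fib f x) \<tau>) \<in> borel_measurable (borel \<Otimes>\<^sub>M borel)"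
proof -
  have *: "tail (fib f x) \<tau> = emeasure lborel {s \<in> space lborel. ennreal \<tau> < fib f x s}" for x \<tau>
    by (simp add: tail_def)
  show ?thesis unfolding * by measurable
qed

lemma measurable_steiner [measurable]:
  assumes [measurable]: "f \<in> borel_measurable borel"
  shows "steiner f \<in> borel_measurable borel"
  unfolding steiner_def indicator_def by measurable

text \<open>The superlevel sets of the symmetrised function are the centred intervals from which it was assembled. The heights whose interval contains
the point form an initial segment of the half line, and right continuity of the tail excludes its end point.\<close>
lemma steiner_level:
  assumes [measurable]: "f \<in> borel_measurable borel" and "0 \<le> \<tau>"
  shows "ennreal \<tau> < steiner f x \<longleftrightarrow> ennreal (2 * \<bar>x \<bullet> e\<bar>) < tail (fib f x) \<tau>"
proof
  let ?S = "{\<tau>. ennreal (2 * \<bar>x \<bullet> e\<bar>) < tail (fib f x) \<tau>}"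
  have [measurable]: "?S \<in> sets borel" by measurable
  have eq: "steiner f x = emeasure lborel ({0..} \<inter> ?S)"
    unfolding steiner_def indicator_inter_arith[symmetric] by (intro nn_integral_indicator) simp
  {
    assume "ennreal (2 * \<bar>x \<bullet> e\<bar>) < tail (fib f x) \<tau>"
    then obtain \<sigma> where \<sigma>: "\<tau> < \<sigma>" "ennreal (2 * \<bar>x \<bullet> e\<bar>) < tail (fib f x) \<sigma>"
      using tail_right_continuous[of "fib f x"] assms by auto
    have "{0..\<sigma>} \<subseteq> {0..} \<inter> ?S"
      using \<sigma>(2) tail_antimono[of "fib f x" _ \<sigma>] by (auto intro: less_le_trans)
    then have "emeasure lborel {0..\<sigma>} \<le> steiner f x"
      unfolding eq by (intro emeasure_mono) auto
    then have "ennreal \<sigma> \<le> steiner f x" using \<sigma> assms by simp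
    then show "ennreal \<tau> < steiner f x"
      using \<sigma>(1) assms by (auto intro: less_le_trans[rotated] simp: ennreal_less_iff)
  }
  {
    assume *: "ennreal \<tau> < steiner f x"
    show "ennreal (2 * \<bar>x \<bullet> e\<bar>) < tail (fib f x) \<tau>"
    proof (rule ccontr)
      assume n: "\<not> ?thesis"
      have "{0..} \<inter> ?S \<subseteq> {0..\<tau>}"
      proof
        fix \<sigma> assume \<sigma>: "\<sigma> \<in> {0..} \<inter> ?S"
        show "\<sigma> \<in> {0..\<tau>}"
        proof (rule ccontr)
          assume "\<sigma> \<notin> {0..\<tau>}"
          then have "tail (fib f x) \<sigma> \<le> tail (fib f x) \<tau>" using \<sigma> by (intro tail_antimono) auto
          then show False using n \<sigma> by (auto dest: less_le_trans)
        qed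
      qed
      then have "steiner f x \<le> emeasure lborel {0..\<tau>}"
        unfolding eq by (intro emeasure_mono) auto
      then show False using * assms by simp
    qed
  }
qed

lemma fib_steiner_level:
  assumes [measurable]: "f \<in> borel_measurable borel" and "0 \<le> \<tau>"
  shows "ennreal \<tau> < fib (steiner f) x s \<longleftrightarrow> ennreal (2 * \<bar>s\<bar>) < tail (fib f x) \<tau>"
proof -
  have "fib f (proj x + s *\<^sub>R e) = fib f x" by (rule ext) (simp add: fib_def)
  then show ?thesis by (simp add: fib_def[of "steiner f"] steiner_level assms)
qed

lemma fib_symdec_steiner:
  assumes [measurable]: "f \<in> borel_measurable borel"
  shows "fib_symdec (steiner f)"
  unfolding fib_symdec_def symdec_def
proof (intro allI impI)
  fix x :: 'a and s t :: real assume st: "\<bar>s\<bar> \<le> \<bar>t\<bar>"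
  show "fib (steiner f) x t \<le> fib (steiner f) x s"
  proof (rule ccontr)
    assume "\<not> ?thesis"
    then obtain r where r: "fib (steiner f) x s < r" "r < fib (steiner f) x t" using dense by (auto simp: not_le)
    then obtain \<tau> where "r = ennreal \<tau>" "0 \<le> \<tau>" by (cases r) auto
    then have "ennreal (2 * \<bar>t\<bar>) < tail (fib f x) \<tau>"
      using r fib_steiner_level[OF assms, of \<tau> x t] by simp
    moreover have "ennreal (2 * \<bar>s\<bar>) \<le> ennreal (2 * \<bar>t\<bar>)" using st by (intro ennreal_leI) simp
    ultimately have "ennreal \<tau> < fib (steiner f) x s"
      using fib_steiner_level[OF assms, of \<tau> x s] \<open>0 \<le> \<tau>\<close> by (simp only: le_less_trans)
    then show False using r \<open>r = ennreal \<tau>\<close> by simp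
  qed
qed

lemma tail_fib_steiner:
  assumes [measurable]: "f \<in> borel_measurable borel" and "0 \<le> \<tau>"
  shows "tail (fib (steiner f) x) \<tau> = tail (fib f x) \<tau>"
  unfolding tail_def[of "fib (steiner f) x"] fib_steiner_level[OF assms] by (rule emeasure_open_centred)

text \<open>Fibres of \<open>f\<close> and \<open>steiner f\<close> are equimeasurable, so all the excess integrals coincide.\<close>
lemma fib_majorised_steiner:
  assumes [measurable]: "f \<in> borel_measurable borel"
  shows "fib_majorised f (steiner f)"
  unfolding fib_majorised_def majorised_def
proof (intro allI impI)
  fix x and t :: real assume "0 \<le> t"
  then have "(\<integral>\<^sup>+s. fib f x s - ennreal t \<partial>lborel) = (\<integral>\<^sup>+s. fib (steiner f) x s - ennreal t \<partial>lborel)"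
    by (subst (1 2) nn_integral_excess) (auto intro!: nn_integral_cong simp: tail_fib_steiner split: split_indicator)
  then show "(\<integral>\<^sup>+s. fib f x s - ennreal t \<partial>lborel) \<le> (\<integral>\<^sup>+s. fib (steiner f) x s - ennreal t \<partial>lborel)"
    by simp
qed

lemma nn_integral_steiner:
  assumes [measurable]: "f \<in> borel_measurable borel"
  shows "(\<integral>\<^sup>+x. steiner f x \<partial>lborel) = (\<integral>\<^sup>+x. f x \<partial>lborel)"
proof -
  have "(\<integral>\<^sup>+s. fib f x s \<partial>lborel) = (\<integral>\<^sup>+s. fib (steiner f) x s \<partial>lborel)" for x
    using nn_integral_excess[of "fib f x" 0] nn_integral_excess[of "fib (steiner f) x" 0]
    by (auto intro!: nn_integral_cong simp: tail_fib_steiner split: split_indicator)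
  then show ?thesis by (subst (1 2) nn_integral_fib) auto
qed

text \<open>Symmetrisation commutes with squaring, since both act on the superlevel sets; hence symmetrising \<open>|h|\<close> symmetrises the
density \<open>|h|\<^sup>2\<close> that enters the weighted norm.\<close>
lemma steiner_square:
  assumes [measurable]: "f \<in> borel_measurable borel"
  shows "steiner (\<lambda>x. f x * f x) x = steiner f x * steiner f x"
proof (rule ennreal_eqI_levels)
  fix \<tau> :: real assume \<tau>: "0 \<le> \<tau>"
  have sq: "ennreal \<tau> < a * a \<longleftrightarrow> ennreal (sqrt \<tau>) < a" for a
  proof (cases a)
    case (real r)
    then have "\<tau> < r * r \<longleftrightarrow> sqrt \<tau> < r"
      using \<tau> by (metis real_sqrt_less_iff real_sqrt_mult_self real_sqrt_mult abs_of_nonneg)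
    then show ?thesis using real \<tau> by (simp add: ennreal_mult[symmetric] ennreal_less_iff)
  qed simp
  have "tail (fib (\<lambda>x. f x * f x) x) \<tau> = tail (fib f x) (sqrt \<tau>)"
    by (simp add: tail_def fib_def sq)
  then show "ennreal \<tau> < steiner (\<lambda>x. f x * f x) x \<longleftrightarrow> ennreal \<tau> < steiner f x * steiner f x"
    unfolding sq using \<tau> by (simp add: steiner_level)
qed

text \<open>Majorisation and symmetric decrease on fibres are both preserved by convolution, so they propagate through the powers;
\<open>fib_majorised_square_le\<close> then compares the integrals of the squares.\<close>
lemma conv_power_steiner:
  assumes [measurable]: "f \<in> borel_measurable borel"
  shows "(\<integral>\<^sup>+x. conv_power f n x * conv_power f n x \<partial>lborel)
       \<le> (\<integral>\<^sup>+x. conv_power (steiner f) n x * conv_power (steiner f) n x \<partial>lborel)"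
proof -
  have "fib_majorised (conv_power f n) (conv_power (steiner f) n) \<and> fib_symdec (conv_power (steiner f) n)"
    by (induction n) (auto intro!: fib_majorised_conv fib_symdec_conv fib_majorised_steiner fib_symdec_steiner)
  then show ?thesis by (intro fib_majorised_square_le) auto
qed

lemma steiner_reflect:
  assumes [measurable]: "f \<in> borel_measurable borel"
  shows "steiner f (reflect x) = steiner f x"
proof -
  have "steiner f x = fib (steiner f) x (x \<bullet> e)" by (simp add: fib_self)
  also have "\<dots> = fib (steiner f) x (- (x \<bullet> e))"
    using fib_symdec_steiner[OF assms] by (auto simp: fib_symdec_def symdec_def intro!: antisym)
  also have "\<dots> = steiner f (reflect x)" unfolding fib_def reflect_fibre[symmetric] by (simp add: proj_def)
  finally show ?thesis by simp
qed

end

section \<open>Steiner symmetrisation and radial weights\<close>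

lemma nn_integral_eq_imp_AE_eq:
  assumes [measurable]: "f \<in> borel_measurable M" "g \<in> borel_measurable M"
    and le: "AE x in M. f x \<le> g x" and eq: "(\<integral>\<^sup>+x. f x \<partial>M) = (\<integral>\<^sup>+x. g x \<partial>M)"
    and fin: "(\<integral>\<^sup>+x. g x \<partial>M) \<noteq> \<infinity>"
  shows "AE x in M. f x = g x"
proof -
  have "(\<integral>\<^sup>+x. g x - f x \<partial>M) = 0"
    using le eq fin by (subst nn_integral_diff) auto
  then have "AE x in M. g x - f x = 0" by (subst (asm) nn_integral_0_iff_AE) auto
  moreover have "AE x in M. g x \<noteq> \<infinity>" using fin by (intro nn_integral_PInf_AE) auto
  ultimately show ?thesis
    using le by eventually_elim (auto simp: diff_eq_0_iff_ennreal less_top)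
qed

text \<open>Among sets of given length the centred interval \<open>I\<close> has the least integral of a symmetric increasing weight. The parts \<open>I - A\<close>
and \<open>A - I\<close> have equal measure, and the weight is at most \<open>\<omega> r\<close> on the first and at least \<open>\<omega> r\<close> on the second. Since
the weight is strictly below \<open>\<omega> r\<close> on \<open>I\<close>, equality of finite integrals makes \<open>I - A\<close> null.\<close>
lemma bathtub_line:
  fixes \<omega> :: "real \<Rightarrow> real"
  assumes [measurable]: "A \<in> sets borel" "\<omega> \<in> borel_measurable borel"
    and nonneg: "\<And>s. 0 \<le> \<omega> s"
    and mono: "\<And>s t. \<bar>s\<bar> \<le> \<bar>t\<bar> \<Longrightarrow> \<omega> s \<le> \<omega> t" and smono: "\<And>s t. \<bar>s\<bar> < \<bar>t\<bar> \<Longrightarrow> \<omega> s < \<omega> t"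
    and a: "emeasure lborel A = ennreal (2 * r)" "0 \<le> r"
  defines "I \<equiv> {-r<..<r}"
  shows "(\<integral>\<^sup>+s. indicator I s * ennreal (\<omega> s) \<partial>lborel) \<le> (\<integral>\<^sup>+s. indicator A s * ennreal (\<omega> s) \<partial>lborel)"
    and "(\<integral>\<^sup>+s. indicator I s * ennreal (\<omega> s) \<partial>lborel) = (\<integral>\<^sup>+s. indicator A s * ennreal (\<omega> s) \<partial>lborel) \<Longrightarrow>
      (\<integral>\<^sup>+s. indicator A s * ennreal (\<omega> s) \<partial>lborel) < \<infinity> \<Longrightarrow> AE s in lborel. s \<in> A \<longleftrightarrow> s \<in> I"
proof -
  have [measurable]: "I \<in> sets borel" by (simp add: I_def)
  have split: "(\<integral>\<^sup>+s. indicator A s * \<phi> s \<partial>lborel) = (\<integral>\<^sup>+s. indicator (A \<inter> B) s * \<phi> s \<partial>lborel) + (\<integral>\<^sup>+s. indicator (A - B) s * \<phi> s \<partial>lborel)"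
    if [measurable]: "A \<in> sets borel" "B \<in> sets borel" "\<phi> \<in> borel_measurable borel" for A B :: "real set" and \<phi> :: "real \<Rightarrow> ennreal"
  proof -
    have "(\<lambda>s. indicator A s * \<phi> s) = (\<lambda>s. indicator (A \<inter> B) s * \<phi> s + indicator (A - B) s * \<phi> s)"
      by (auto split: split_indicator)
    then show ?thesis by (simp add: nn_integral_add)
  qed
  have mI: "emeasure lborel I = ennreal (2 * r)" using a by (simp add: I_def)
  have IA_eq: "I \<inter> A = A \<inter> I" by auto
  have sum_eq: "emeasure lborel (A \<inter> I) + emeasure lborel (A - I) = emeasure lborel (A \<inter> I) + emeasure lborel (I - A)"
    using split[of A I "\<lambda>_. 1"] split[of I A "\<lambda>_. 1"] a(1) mI unfolding IA_eq by simp
  have "emeasure lborel (A \<inter> I) < \<infinity>"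
  proof -
    have "emeasure lborel (A \<inter> I) \<le> emeasure lborel I" by (intro emeasure_mono) auto
    then show ?thesis unfolding mI by (rule le_less_trans) simp
  qed
  then have diff: "emeasure lborel (A - I) = emeasure lborel (I - A)"
    using iffD1[OF ennreal_add_left_cancel sum_eq] by (auto simp only: infinity_ennreal_def)
  define x where "x = (\<integral>\<^sup>+s. indicator (I - A) s * ennreal (\<omega> s) \<partial>lborel)"
  define y where "y = (\<integral>\<^sup>+s. indicator (A - I) s * ennreal (\<omega> s) \<partial>lborel)"
  define z where "z = (\<integral>\<^sup>+s. indicator (A \<inter> I) s * ennreal (\<omega> s) \<partial>lborel)"
  have xle: "x \<le> (\<integral>\<^sup>+s. ennreal (\<omega> r) * indicator (I - A) s \<partial>lborel)"
    unfolding x_def by (intro nn_integral_mono) (auto split: split_indicator intro!: ennreal_leI mono simp: I_def)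
  have xy: "(\<integral>\<^sup>+s. ennreal (\<omega> r) * indicator (I - A) s \<partial>lborel) \<le> y"
  proof -
    have "(\<integral>\<^sup>+s. ennreal (\<omega> r) * indicator (I - A) s \<partial>lborel) = (\<integral>\<^sup>+s. ennreal (\<omega> r) * indicator (A - I) s \<partial>lborel)"
      by (simp add: nn_integral_cmult diff)
    also have "\<dots> \<le> y"
      unfolding y_def using a(2) by (intro nn_integral_mono) (auto split: split_indicator intro!: ennreal_leI mono simp: I_def)
    finally show ?thesis .
  qed
  have eqs: "(\<integral>\<^sup>+s. indicator I s * ennreal (\<omega> s) \<partial>lborel) = z + x" "(\<integral>\<^sup>+s. indicator A s * ennreal (\<omega> s) \<partial>lborel) = z + y"
    using split[of I A "\<lambda>s. ennreal (\<omega> s)"] split[of A I "\<lambda>s. ennreal (\<omega> s)"]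
    unfolding IA_eq by (simp_all add: x_def y_def z_def)
  show "(\<integral>\<^sup>+s. indicator I s * ennreal (\<omega> s) \<partial>lborel) \<le> (\<integral>\<^sup>+s. indicator A s * ennreal (\<omega> s) \<partial>lborel)"
    unfolding eqs using xle xy by (intro add_left_mono) auto
  assume "(\<integral>\<^sup>+s. indicator I s * ennreal (\<omega> s) \<partial>lborel) = (\<integral>\<^sup>+s. indicator A s * ennreal (\<omega> s) \<partial>lborel)"
    and "(\<integral>\<^sup>+s. indicator A s * ennreal (\<omega> s) \<partial>lborel) < \<infinity>"
  then have "x = y" "y < \<infinity>" unfolding eqs by auto
  then have xeq: "x = (\<integral>\<^sup>+s. ennreal (\<omega> r) * indicator (I - A) s \<partial>lborel)"
     and fin: "(\<integral>\<^sup>+s. ennreal (\<omega> r) * indicator (I - A) s \<partial>lborel) \<noteq> \<infinity>"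
    using xle xy by auto
  have "AE s in lborel. indicator (I - A) s * ennreal (\<omega> s) = ennreal (\<omega> r) * indicator (I - A) s"
    by (intro nn_integral_eq_imp_AE_eq fin xeq[unfolded x_def])
       (auto intro!: AE_I2 ennreal_leI mono split: split_indicator simp: I_def)
  then have IA: "AE s in lborel. s \<notin> I - A"
  proof eventually_elim
    case (elim s)
    show ?case
    proof
      assume s: "s \<in> I - A"
      then have "ennreal (\<omega> s) < ennreal (\<omega> r)"
        using nonneg smono[of s r] by (simp add: I_def ennreal_less_iff abs_less_iff)
      then show False using elim s by simp
    qed
  qed
  have "I - A \<in> null_sets lborel"
    by (rule AE_iff_null_sets[THEN iffD2, OF _ IA]) measurable
  then have "emeasure lborel (A - I) = 0" using diff by (simp add: null_setsD1)
  then have "A - I \<in> null_sets lborel" by (intro null_setsI) measurable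
  then have "AE s in lborel. s \<notin> A - I" by (rule AE_not_in)
  with IA show "AE s in lborel. s \<in> A \<longleftrightarrow> s \<in> I" by eventually_elim auto
qed

context direction
begin

text \<open>Layer cake and fibre decomposition together express the weighted integral through superlevel sets on lines, where
\<open>bathtub_line\<close> applies.\<close>
lemma weighted_levels:
  fixes w :: "'a \<Rightarrow> real"
  assumes [measurable]: "F \<in> borel_measurable borel" "w \<in> borel_measurable borel"
  shows "(\<integral>\<^sup>+x. ennreal (w x) * F x \<partial>lborel) = (\<integral>\<^sup>+y. indicator slab y * (\<integral>\<^sup>+\<tau>. indicator {0..} \<tau> *
     (\<integral>\<^sup>+s. indicator {s. ennreal \<tau> < fib F y s} s * ennreal (fib w y s) \<partial>lborel) \<partial>lborel) \<partial>lborel)"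
proof -
  have "(\<integral>\<^sup>+s. fib (\<lambda>x. ennreal (w x) * F x) y s \<partial>lborel) = (\<integral>\<^sup>+\<tau>. indicator {0..} \<tau> *
     (\<integral>\<^sup>+s. indicator {s. ennreal \<tau> < fib F y s} s * ennreal (fib w y s) \<partial>lborel) \<partial>lborel)" for y
  proof -
    have "(\<integral>\<^sup>+s. fib (\<lambda>x. ennreal (w x) * F x) y s \<partial>lborel) = (\<integral>\<^sup>+s. ennreal (fib w y s) *
        (\<integral>\<^sup>+\<tau>. indicator {0..} \<tau> * indicator {\<tau>. ennreal \<tau> < fib F y s} \<tau> \<partial>lborel) \<partial>lborel)"
      by (simp add: nn_integral_levels[of 0, simplified] fib_def)
    also have "\<dots> = (\<integral>\<^sup>+s. (\<integral>\<^sup>+\<tau>. ennreal (fib w y s) * (indicator {0..} \<tau> * indicator {\<tau>. ennreal \<tau> < fib F y s} \<tau>) \<partial>lborel) \<partial>lborel)"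
      by (subst nn_integral_cmult) (auto simp: indicator_def)
    also have "\<dots> = (\<integral>\<^sup>+\<tau>. (\<integral>\<^sup>+s. ennreal (fib w y s) * (indicator {0..} \<tau> * indicator {\<tau>. ennreal \<tau> < fib F y s} \<tau>) \<partial>lborel) \<partial>lborel)"
      by (subst lborel_pair.Fubini') (auto simp: indicator_def)
    also have "\<dots> = (\<integral>\<^sup>+\<tau>. (\<integral>\<^sup>+s. indicator {0..} \<tau> * (indicator {s. ennreal \<tau> < fib F y s} s * ennreal (fib w y s)) \<partial>lborel) \<partial>lborel)"
      by (intro nn_integral_cong) (auto split: split_indicator)
    also have "\<dots> = (\<integral>\<^sup>+\<tau>. indicator {0..} \<tau> * (\<integral>\<^sup>+s. indicator {s. ennreal \<tau> < fib F y s} s * ennreal (fib w y s) \<partial>lborel) \<partial>lborel)"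
      by (subst nn_integral_cmult) auto
    finally show ?thesis .
  qed
  then show ?thesis by (subst nn_integral_fib) auto
qed

lemma tail_finite:
  assumes [measurable]: "g \<in> borel_measurable borel" and "(\<integral>\<^sup>+s. g s \<partial>lborel) < \<infinity>" "0 < \<tau>"
  shows "tail g \<tau> < \<infinity>"
proof -
  have "ennreal \<tau> * tail g \<tau> = (\<integral>\<^sup>+s. ennreal \<tau> * indicator {s. ennreal \<tau> < g s} s \<partial>lborel)"
    by (simp add: nn_integral_cmult tail_def)
  also have "\<dots> \<le> (\<integral>\<^sup>+s. g s \<partial>lborel)"
    by (intro nn_integral_mono) (auto split: split_indicator)
  finally have "ennreal \<tau> * tail g \<tau> < \<infinity>" using assms by auto
  then show ?thesis using assms(3) by (auto simp: ennreal_mult_less_top)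
qed

text \<open>The weight restricted to a fibre is symmetric and strictly increasing in the distance from its centre, so
\<open>bathtub_line\<close> applies to almost every fibre and height. If the total integrals agree and are finite, the inequality is an
equality for almost every fibre and height; the superlevel sets then agree up to null sets, and the layer cake formula
recovers the function.\<close>
lemma steiner_weight:
  fixes w :: "'a \<Rightarrow> real"
  assumes F [measurable]: "F \<in> borel_measurable borel" and w [measurable]: "w \<in> borel_measurable borel"
    and nonneg: "\<And>x. 0 \<le> w x"
    and mono: "\<And>x y. norm x \<le> norm y \<Longrightarrow> w x \<le> w y" and smono: "\<And>x y. norm x < norm y \<Longrightarrow> w x < w y"
    and fin: "(\<integral>\<^sup>+x. F x \<partial>lborel) < \<infinity>"
  shows steiner_weight_le: "(\<integral>\<^sup>+x. ennreal (w x) * steiner F x \<partial>lborel) \<le> (\<integral>\<^sup>+x. ennreal (w x) * F x \<partial>lborel)"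
    and steiner_weight_eq: "(\<integral>\<^sup>+x. ennreal (w x) * steiner F x \<partial>lborel) = (\<integral>\<^sup>+x. ennreal (w x) * F x \<partial>lborel) \<Longrightarrow>
      (\<integral>\<^sup>+x. ennreal (w x) * F x \<partial>lborel) < \<infinity> \<Longrightarrow> AE x in lborel. F x = steiner F x"
proof -
  define A where "A F y \<tau> = (\<integral>\<^sup>+s. indicator {s. ennreal \<tau> < fib F y s} s * ennreal (fib w y s) \<partial>lborel)" for F y and \<tau> :: real
  have [measurable]: "(\<lambda>(y, \<tau>). A F y \<tau>) \<in> borel_measurable (borel \<Otimes>\<^sub>M borel)" if [measurable]: "F \<in> borel_measurable borel" for F
    unfolding A_def indicator_def by measurable
  have lev: "(\<integral>\<^sup>+x. ennreal (w x) * F x \<partial>lborel) = (\<integral>\<^sup>+y. indicator slab y * (\<integral>\<^sup>+\<tau>. indicator {0..} \<tau> * A F y \<tau> \<partial>lborel) \<partial>lborel)"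
    if [measurable]: "F \<in> borel_measurable borel" for F
    unfolding A_def by (rule weighted_levels) auto
  have AEpos: "AE \<tau>::real in lborel. \<tau> \<noteq> 0" by (rule AE_lborel_singleton)
  have "(\<integral>\<^sup>+y. indicator slab y * (\<integral>\<^sup>+s. fib F y s \<partial>lborel) \<partial>lborel) \<noteq> \<infinity>"
    using fin by (subst nn_integral_fib[symmetric]) auto
  then have "AE y in lborel. indicator slab y * (\<integral>\<^sup>+s. fib F y s \<partial>lborel) \<noteq> \<infinity>"
    by (intro nn_integral_PInf_AE) auto
  then have tail_fin: "AE y in lborel. y \<in> slab \<longrightarrow> (\<forall>\<tau>>0. tail (fib F y) \<tau> < \<infinity>)"
  proof eventually_elim
    case (elim y)
    have "tail (fib F y) \<tau> < \<infinity>" if "y \<in> slab" "0 < \<tau>" for \<tau>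
      using elim that by (intro tail_finite) (simp_all add: top.not_eq_extremum)
    then show ?case by blast
  qed
  (* A F y \<tau> is the weight of the superlevel set at height \<tau> on the fibre through y *)
  have key: "A (steiner F) y \<tau> \<le> A F y \<tau>"
     "A (steiner F) y \<tau> = A F y \<tau> \<Longrightarrow> A F y \<tau> < \<infinity> \<Longrightarrow> AE s in lborel. ennreal \<tau> < fib F y s \<longleftrightarrow> ennreal \<tau> < fib (steiner F) y s"
    if "tail (fib F y) \<tau> < \<infinity>" "0 < \<tau>" for y \<tau>
  proof -
    define r where "r = enn2real (tail (fib F y) \<tau>) / 2"
    have r: "tail (fib F y) \<tau> = ennreal (2 * r)" "0 \<le> r" using that by (auto simp: r_def)
    then have em: "emeasure lborel {s. ennreal \<tau> < fib F y s} = ennreal (2 * r)" by (simp add: tail_def)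
    have I: "{s. ennreal \<tau> < fib (steiner F) y s} = {-r<..<r}"
      using that r by (auto simp: fib_steiner_level ennreal_less_iff)
    have *: "0 \<le> fib w y s" "\<bar>s\<bar> \<le> \<bar>t\<bar> \<Longrightarrow> fib w y s \<le> fib w y t" "\<bar>s\<bar> < \<bar>t\<bar> \<Longrightarrow> fib w y s < fib w y t" for s t
      by (auto simp: fib_def nonneg intro!: mono smono norm_fibre_le norm_fibre_less)
    have m: "{s. ennreal \<tau> < fib F y s} \<in> sets borel" by measurable
    note b = bathtub_line[OF m measurable_fib[OF w] *(1) *(2) *(3) em r(2)]
    show "A (steiner F) y \<tau> \<le> A F y \<tau>"
      unfolding A_def I by (rule b(1))
    assume "A (steiner F) y \<tau> = A F y \<tau>" "A F y \<tau> < \<infinity>"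
    then have h: "(\<integral>\<^sup>+s. indicator {-r<..<r} s * ennreal (fib w y s) \<partial>lborel) = (\<integral>\<^sup>+s. indicator {s. ennreal \<tau> < fib F y s} s * ennreal (fib w y s) \<partial>lborel)"
       "(\<integral>\<^sup>+s. indicator {s. ennreal \<tau> < fib F y s} s * ennreal (fib w y s) \<partial>lborel) < \<infinity>"
      unfolding A_def I by auto
    have "AE s in lborel. s \<in> {s. ennreal \<tau> < fib F y s} \<longleftrightarrow> s \<in> {-r<..<r}"
      by (rule b(2)[OF _ _ h])
    then show "AE s in lborel. ennreal \<tau> < fib F y s \<longleftrightarrow> ennreal \<tau> < fib (steiner F) y s"
      unfolding I[symmetric] by simp
  qed
  define U where "U F y = (\<integral>\<^sup>+\<tau>. indicator {0..} \<tau> * A F y \<tau> \<partial>lborel)" for F y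
  have [measurable]: "U F \<in> borel_measurable borel" if [measurable]: "F \<in> borel_measurable borel" for F
    unfolding U_def by measurable
  have pt: "AE \<tau> in lborel. indicator {0..} \<tau> * A (steiner F) y \<tau> \<le> indicator {0..} \<tau> * A F y \<tau>"
    if "\<forall>\<tau>>0. tail (fib F y) \<tau> < \<infinity>" for y
    using AEpos by eventually_elim (use that key(1) in \<open>auto split: split_indicator\<close>)
  have U_le: "AE y in lborel. indicator slab y * U (steiner F) y \<le> indicator slab y * U F y"
    using tail_fin by eventually_elim (auto simp: U_def split: split_indicator intro!: nn_integral_mono_AE pt)
  show "(\<integral>\<^sup>+x. ennreal (w x) * steiner F x \<partial>lborel) \<le> (\<integral>\<^sup>+x. ennreal (w x) * F x \<partial>lborel)"
    unfolding lev[OF F] lev[OF measurable_steiner[OF F]] U_def[symmetric] by (intro nn_integral_mono_AE U_le)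
  assume eq: "(\<integral>\<^sup>+x. ennreal (w x) * steiner F x \<partial>lborel) = (\<integral>\<^sup>+x. ennreal (w x) * F x \<partial>lborel)"
    and wfin: "(\<integral>\<^sup>+x. ennreal (w x) * F x \<partial>lborel) < \<infinity>"
  have wfin': "(\<integral>\<^sup>+y. indicator slab y * U F y \<partial>lborel) \<noteq> \<infinity>"
    using wfin unfolding lev[OF F] U_def by simp
  have "AE y in lborel. indicator slab y * U (steiner F) y = indicator slab y * U F y"
    using eq unfolding lev[OF F] lev[OF measurable_steiner[OF F]] U_def[symmetric]
    by (intro nn_integral_eq_imp_AE_eq U_le wfin') auto
  moreover have "AE y in lborel. indicator slab y * U F y \<noteq> \<infinity>"
    using wfin' by (intro nn_integral_PInf_AE) auto
  ultimately have "AE y in lborel. y \<in> slab \<longrightarrow> (AE s in lborel. fib F y s = fib (steiner F) y s)"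
    using tail_fin
  proof eventually_elim
    case (elim y)
    show ?case
    proof
      assume y: "y \<in> slab"
      have Ueq: "(\<integral>\<^sup>+\<tau>. indicator {0..} \<tau> * A (steiner F) y \<tau> \<partial>lborel) = (\<integral>\<^sup>+\<tau>. indicator {0..} \<tau> * A F y \<tau> \<partial>lborel)"
        and Ufin: "(\<integral>\<^sup>+\<tau>. indicator {0..} \<tau> * A F y \<tau> \<partial>lborel) \<noteq> \<infinity>"
        using elim y by (auto simp: U_def)
      have tf: "\<forall>\<tau>>0. tail (fib F y) \<tau> < \<infinity>" using elim y by simp
      have "AE \<tau> in lborel. indicator {0..} \<tau> * A (steiner F) y \<tau> = indicator {0..} \<tau> * A F y \<tau>"
        by (intro nn_integral_eq_imp_AE_eq pt tf Ueq Ufin) auto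
      moreover have "AE \<tau> in lborel. indicator {0..} \<tau> * A F y \<tau> \<noteq> \<infinity>"
        using Ufin by (intro nn_integral_PInf_AE) auto
      ultimately have "AE \<tau> in lborel. AE s in lborel. 0 \<le> \<tau> \<longrightarrow> (ennreal \<tau> < fib F y s \<longleftrightarrow> ennreal \<tau> < fib (steiner F) y s)"
        using AEpos
      proof eventually_elim
        case (elim \<tau>)
        show ?case
        proof (cases "0 < \<tau>")
          case True
          then show ?thesis using elim key(2)[of y \<tau>] tf by (auto simp: less_top)
        qed (use elim in auto)
      qed
      then have "AE s in lborel. AE \<tau> in lborel. 0 \<le> \<tau> \<longrightarrow> (ennreal \<tau> < fib F y s \<longleftrightarrow> ennreal \<tau> < fib (steiner F) y s)"
        by (rule lborel_pair.AE_commute[THEN iffD1, rotated]) measurable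
      then show "AE s in lborel. fib F y s = fib (steiner F) y s"
      proof eventually_elim
        case (elim s)
        have "fib F y s = (\<integral>\<^sup>+\<tau>. indicator {0..} \<tau> * indicator {\<tau>. ennreal \<tau> < fib F y s} \<tau> \<partial>lborel)"
          using nn_integral_levels[of 0 "fib F y s"] by simp
        also have "\<dots> = (\<integral>\<^sup>+\<tau>. indicator {0..} \<tau> * indicator {\<tau>. ennreal \<tau> < fib (steiner F) y s} \<tau> \<partial>lborel)"
          using elim by (intro nn_integral_cong_AE) (auto split: split_indicator)
        also have "\<dots> = fib (steiner F) y s"
          using nn_integral_levels[of 0 "fib (steiner F) y s"] by simp
        finally show ?case .
      qed
    qed
  qed
  then have "AE y in lborel. indicator slab y * (\<integral>\<^sup>+s. fib (\<lambda>x. if F x = steiner F x then 0 else 1) y s \<partial>lborel) = 0"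
  proof eventually_elim
    case (elim y)
    have fibI: "fib (\<lambda>x. if F x = steiner F x then 0 else 1) y s = (if fib F y s = fib (steiner F) y s then 0 else (1::ennreal))" for s
      by (simp add: fib_def)
    show ?case
      using elim by (auto simp: fibI split: split_indicator intro!: nn_integral_0_iff_AE[THEN iffD2])
  qed
  then have "(\<integral>\<^sup>+x. (if F x = steiner F x then 0 else 1) \<partial>lborel) = (0::ennreal)"
    by (subst nn_integral_fib) (auto simp: nn_integral_0_iff_AE)
  then show "AE x in lborel. F x = steiner F x"
    by (subst (asm) nn_integral_0_iff_AE) (auto elim!: eventually_mono split: if_splits)
qed

end

section \<open>The Fourier transform on integrable functions\<close>

lemma lborel_affine_integral:
  fixes f :: "'a::euclidean_space \<Rightarrow> 'b::{banach, second_countable_topology}"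
  assumes c: "c \<noteq> 0" and [measurable]: "f \<in> borel_measurable borel"
  shows "(LINT x|lborel. f x) = \<bar>c\<bar> ^ DIM('a) *\<^sub>R (LINT x|lborel. f (t + c *\<^sub>R x))"
  by (subst lborel_affine[OF c, of t])
     (simp add: integral_density integral_distr)

lemma lborel_affine_integrable:
  fixes f :: "'a::euclidean_space \<Rightarrow> 'b::{banach, second_countable_topology}"
  assumes c: "c \<noteq> 0" and [measurable]: "f \<in> borel_measurable borel"
  shows "integrable lborel (\<lambda>x. f (t + c *\<^sub>R x)) \<longleftrightarrow> integrable lborel f"
proof -
  define k where "k = \<bar>c\<bar> ^ DIM('a)"
  have k: "k > 0" using c by (simp add: k_def)
  have "integrable lborel f \<longleftrightarrow> integrable lborel (\<lambda>x. k *\<^sub>R f (t + c *\<^sub>R x))"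
    by (subst lborel_affine[OF c, of t])
       (use k in \<open>simp add: integrable_density integrable_distr_eq k_def[symmetric]\<close>)
  also have "\<dots> \<longleftrightarrow> integrable lborel (\<lambda>x. f (t + c *\<^sub>R x))"
  proof
    assume "integrable lborel (\<lambda>x. k *\<^sub>R f (t + c *\<^sub>R x))"
    then have "integrable lborel (\<lambda>x. (1 / k) *\<^sub>R (k *\<^sub>R f (t + c *\<^sub>R x)))" by (rule integrable_scaleR_right)
    then show "integrable lborel (\<lambda>x. f (t + c *\<^sub>R x))" using k by simp
  qed (rule integrable_scaleR_right)
  finally show ?thesis ..
qed

text \<open>The sign makes \<open>fourier h\<close> the superposition of plane waves with density \<open>h\<close>. All computations take place on the
side of the density, and no separate inverse transform is introduced.\<close>
definition fourier :: "('a::euclidean_space \<Rightarrow> complex) \<Rightarrow> 'a \<Rightarrow> complex" where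
  "fourier h x = (LINT \<xi>|lborel. cis (2 * pi * (x \<bullet> \<xi>)) * h \<xi>)"

lemma measurable_cis [measurable (raw)]:
  "f \<in> borel_measurable M \<Longrightarrow> (\<lambda>x. cis (f x)) \<in> borel_measurable M"
  unfolding cis_conv_exp by measurable

lemma integrable_cis_mult:
  fixes h :: "'a::euclidean_space \<Rightarrow> complex"
  assumes "integrable lborel h" "g \<in> borel_measurable borel"
  shows "integrable lborel (\<lambda>\<xi>. cis (g \<xi>) * h \<xi>)"
proof (rule Bochner_Integration.integrable_bound[OF assms(1)])
  have [measurable]: "h \<in> borel_measurable borel" using borel_measurable_integrable[OF assms(1)] by simp
  show "(\<lambda>\<xi>. cis (g \<xi>) * h \<xi>) \<in> borel_measurable lborel" using assms(2) by measurable
qed (simp add: norm_mult)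

lemma measurable_fourier [measurable]:
  assumes [measurable]: "h \<in> borel_measurable borel"
  shows "fourier h \<in> borel_measurable borel"
  unfolding fourier_def by measurable

lemma norm_fourier_le: "norm (fourier h x) \<le> (LINT \<xi>|lborel. norm (h \<xi>))"
  unfolding fourier_def by (rule order_trans[OF integral_norm_bound]) (simp add: norm_mult)

lemma fourier_diff: "integrable lborel h \<Longrightarrow> integrable lborel k \<Longrightarrow> fourier (\<lambda>x. h x - k x) x = fourier h x - fourier k x"
  unfolding fourier_def by (simp add: right_diff_distrib integrable_cis_mult)

lemma fourier_cmult: "fourier (\<lambda>x. c * h x) x = c * fourier h x"
  unfolding fourier_def by (simp add: mult.left_commute)

lemma cnj_fourier: "cnj (fourier h x) = fourier (\<lambda>\<xi>. cnj (h \<xi>)) (- x)"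
  unfolding fourier_def
  by (subst integral_bounded_linear'[OF bounded_linear_cnj bounded_linear_cnj, symmetric]) (auto simp: cis_cnj)

text \<open>The modulus of continuity is bounded by a function of the increment alone, which tends to zero by dominated convergence.\<close>
lemma fourier_uniformly_continuous:
  fixes h :: "'a::euclidean_space \<Rightarrow> complex"
  assumes h: "integrable lborel h"
  shows "uniformly_continuous_on UNIV (fourier h)"
  unfolding uniformly_continuous_on_def
proof (intro allI impI)
  fix e :: real assume "0 < e"
  have hm [measurable]: "h \<in> borel_measurable borel" using borel_measurable_integrable[OF h] by simp
  define \<omega> where "\<omega> d = (LINT \<xi>|lborel. cmod (cis (2 * pi * (d \<bullet> \<xi>)) - 1) * cmod (h \<xi>))" for d :: 'a
  have bd: "cmod (cis t - 1) \<le> 2" for t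
    using norm_triangle_ineq4[of "cis t" 1] by simp
  have int: "integrable lborel (\<lambda>\<xi>. cmod (cis (2 * pi * (d \<bullet> \<xi>)) - 1) * cmod (h \<xi>))" for d
    by (rule Bochner_Integration.integrable_bound[OF integrable_mult_right[OF integrable_norm[OF h], of 2]])
       (auto intro!: AE_I2 mult_right_mono bd simp: abs_mult)
  have diff: "cmod (fourier h x - fourier h y) \<le> \<omega> (x - y)" for x y
  proof -
    have "fourier h x - fourier h y = (LINT \<xi>|lborel. cis (2 * pi * (x \<bullet> \<xi>)) * h \<xi> - cis (2 * pi * (y \<bullet> \<xi>)) * h \<xi>)"
      unfolding fourier_def by (subst Bochner_Integration.integral_diff) (auto intro!: integrable_cis_mult h)
    also have "cmod \<dots> \<le> (LINT \<xi>|lborel. cmod (cis (2 * pi * (x \<bullet> \<xi>)) * h \<xi> - cis (2 * pi * (y \<bullet> \<xi>)) * h \<xi>))"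
      by (rule integral_norm_bound)
    also have "\<dots> = \<omega> (x - y)"
      unfolding \<omega>_def
    proof (intro Bochner_Integration.integral_cong refl)
      fix \<xi>
      have "cis (2 * pi * (x \<bullet> \<xi>)) * h \<xi> - cis (2 * pi * (y \<bullet> \<xi>)) * h \<xi>
         = cis (2 * pi * (y \<bullet> \<xi>)) * ((cis (2 * pi * ((x - y) \<bullet> \<xi>)) - 1) * h \<xi>)"
        by (simp add: right_diff_distrib left_diff_distrib mult.assoc[symmetric] cis_mult inner_diff_left)
      then show "cmod (cis (2 * pi * (x \<bullet> \<xi>)) * h \<xi> - cis (2 * pi * (y \<bullet> \<xi>)) * h \<xi>)
         = cmod (cis (2 * pi * ((x - y) \<bullet> \<xi>)) - 1) * cmod (h \<xi>)"
        by (simp add: norm_mult)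
    qed
    finally show ?thesis .
  qed
  have "(\<omega> \<longlongrightarrow> 0) (at 0)"
  proof (rule tendsto_at_iff_sequentially[THEN iffD2], intro allI impI)
    fix X :: "nat \<Rightarrow> 'a" assume "X \<longlonglongrightarrow> 0"
    have "(\<lambda>n. \<omega> (X n)) \<longlonglongrightarrow> (LINT \<xi>|(lborel :: 'a measure). (0::real))"
      unfolding \<omega>_def comp_def
    proof (rule integral_dominated_convergence[where w="\<lambda>\<xi>. 2 * cmod (h \<xi>)" and M="lborel::'a measure"])
      show "AE \<xi> in lborel. (\<lambda>n. cmod (cis (2 * pi * (X n \<bullet> \<xi>)) - 1) * cmod (h \<xi>)) \<longlonglongrightarrow> 0"
      proof (rule AE_I2)
        fix \<xi>
        have "(\<lambda>n. cmod (cis (2 * pi * (X n \<bullet> \<xi>)) - 1) * cmod (h \<xi>)) \<longlonglongrightarrow> cmod (cis (2 * pi * (0 \<bullet> \<xi>)) - 1) * cmod (h \<xi>)"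
          unfolding cis_conv_exp by (intro tendsto_intros \<open>X \<longlonglongrightarrow> 0\<close>)
        then show "(\<lambda>n. cmod (cis (2 * pi * (X n \<bullet> \<xi>)) - 1) * cmod (h \<xi>)) \<longlonglongrightarrow> 0" by simp
      qed
      show "integrable lborel (\<lambda>\<xi>. 2 * cmod (h \<xi>))" using h by simp
      show "AE \<xi> in lborel. norm (cmod (cis (2 * pi * (X n \<bullet> \<xi>)) - 1) * cmod (h \<xi>)) \<le> 2 * cmod (h \<xi>)" for n
        by (rule AE_I2) (simp only: real_norm_def abs_mult abs_norm_cancel, rule mult_right_mono[OF bd norm_ge_zero])
    qed measurable
    then show "(\<omega> \<circ> X) \<longlonglongrightarrow> 0" by (simp add: comp_def)
  qed
  then have "eventually (\<lambda>x. dist (\<omega> x) 0 < e) (at 0)"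
    using \<open>0 < e\<close> by (rule tendstoD)
  then obtain d where "0 < d" and d: "\<And>x. x \<noteq> 0 \<Longrightarrow> dist x 0 < d \<Longrightarrow> dist (\<omega> x) 0 < e"
    unfolding eventually_at by blast
  show "\<exists>d>0. \<forall>x\<in>UNIV. \<forall>x'\<in>UNIV. dist x' x < d \<longrightarrow> dist (fourier h x') (fourier h x) < e"
  proof (intro exI[of _ d] conjI ballI impI \<open>0 < d\<close>)
    fix x x' :: 'a assume xx: "dist x' x < d"
    show "dist (fourier h x') (fourier h x) < e"
    proof (cases "x' = x")
      case False
      then have "dist (\<omega> (x' - x)) 0 < e" using xx by (intro d) (auto simp: dist_norm)
      then show ?thesis using diff[of x' x] by (simp add: dist_norm)
    qed (use \<open>0 < e\<close> in simp)
  qed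
qed

text \<open>Fubini's theorem; the symmetric kernel moves from one factor to the other. This identity is the basis of the duality
definition \<open>fourier_pair\<close> below.\<close>
lemma fourier_multiplication:
  fixes h k :: "'a::euclidean_space \<Rightarrow> complex"
  assumes h: "integrable lborel h" and k: "integrable lborel k"
  shows "(LINT x|lborel. fourier h x * k x) = (LINT x|lborel. h x * fourier k x)"
proof -
  have [measurable]: "h \<in> borel_measurable borel" "k \<in> borel_measurable borel"
    using borel_measurable_integrable[OF h] borel_measurable_integrable[OF k] by auto
  have "integrable (lborel \<Otimes>\<^sub>M lborel) (\<lambda>(x, \<xi>). cis (2 * pi * (x \<bullet> \<xi>)) * h \<xi> * k x)"
  proof (rule lborel_pair.Fubini_integrable)
    show "integrable lborel (\<lambda>x. LINT \<xi>|lborel. norm (case (x, \<xi>) of (x, \<xi>) \<Rightarrow> cis (2 * pi * (x \<bullet> \<xi>)) * h \<xi> * k x))"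
      using k by (simp add: norm_mult)
    show "AE x in lborel. integrable lborel (\<lambda>\<xi>. case (x, \<xi>) of (x, \<xi>) \<Rightarrow> cis (2 * pi * (x \<bullet> \<xi>)) * h \<xi> * k x)"
      using h by (auto intro!: AE_I2 integrable_cis_mult)
  qed measurable
  then have "(LINT \<xi>|lborel. LINT x|lborel. cis (2 * pi * (x \<bullet> \<xi>)) * h \<xi> * k x)
     = (LINT x|lborel. LINT \<xi>|lborel. cis (2 * pi * (x \<bullet> \<xi>)) * h \<xi> * k x)"
    by (rule lborel_pair.Fubini_integral)
  moreover have "(LINT \<xi>|lborel. cis (2 * pi * (x \<bullet> \<xi>)) * h \<xi> * k x) = fourier h x * k x" for x
    by (simp add: fourier_def)
  moreover have "(LINT x|lborel. cis (2 * pi * (x \<bullet> \<xi>)) * h \<xi> * k x) = h \<xi> * fourier k \<xi>" for \<xi>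
  proof -
    have "(LINT x|lborel. cis (2 * pi * (x \<bullet> \<xi>)) * h \<xi> * k x) = (LINT x|lborel. h \<xi> * (cis (2 * pi * (\<xi> \<bullet> x)) * k x))"
      by (simp add: mult_ac inner_commute)
    then show ?thesis by (simp add: fourier_def)
  qed
  ultimately show ?thesis by (simp only:)
qed

section \<open>Gaussians\<close>

definition gauss :: "'a::euclidean_space \<Rightarrow> real" where "gauss x = exp (- pi * (x \<bullet> x))"

lemma measurable_gauss [measurable]: "gauss \<in> borel_measurable borel"
  unfolding gauss_def by measurable

text \<open>The characteristic function of the standard normal distribution, rescaled by \<open>sqrt (2 \<pi>)\<close>.\<close>
lemma gauss_line:
  fixes s :: real
  shows "integrable lborel (\<lambda>t. cis (2 * pi * (s * t)) * complex_of_real (exp (- pi * t\<^sup>2)))" (is ?int)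
    and "(LINT t|lborel. cis (2 * pi * (s * t)) * complex_of_real (exp (- pi * t\<^sup>2))) = complex_of_real (exp (- pi * s\<^sup>2))" (is ?eq)
proof -
  define a where "a = sqrt (2 * pi)"
  have a: "a > 0" "a\<^sup>2 = 2 * pi" by (auto simp: a_def)
  have dens: "std_normal_density (0 + a *\<^sub>R t) = (1 / a) * exp (- pi * t\<^sup>2)" for t
    using a by (simp add: std_normal_density_def a_def[symmetric] power_mult_distrib)
  have "integrable lborel (\<lambda>t. std_normal_density (0 + a *\<^sub>R t))"
    using a by (subst lborel_affine_integrable) (auto intro: integrable_normal_density)
  then have "integrable lborel (\<lambda>t. a * ((1 / a) * exp (- pi * t\<^sup>2)))"
    unfolding dens by (rule integrable_mult_right)
  then have int: "integrable lborel (\<lambda>t. exp (- pi * t\<^sup>2))" using a by simp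
  then show ?int by (intro integrable_cis_mult integrable_of_real) auto
  have "complex_of_real (exp (- pi * s\<^sup>2)) = complex_of_real (exp (- ((a * s)\<^sup>2) / 2))"
    using a by (simp add: power_mult_distrib)
  also have "\<dots> = char std_normal_distribution (a * s)"
    by (simp add: char_std_normal_distribution)
  also have "\<dots> = (LINT x|lborel. std_normal_density x *\<^sub>R iexp (a * s * x))"
    unfolding char_def by (subst integral_density) (auto simp: normal_density_nonneg)
  also have "\<dots> = \<bar>a\<bar> ^ DIM(real) *\<^sub>R (LINT t|lborel. std_normal_density (0 + a *\<^sub>R t) *\<^sub>R iexp (a * s * (0 + a *\<^sub>R t)))"
    using a by (subst lborel_affine_integral[of a _ 0]) auto
  also have "\<dots> = (LINT t|lborel. a *\<^sub>R (std_normal_density (0 + a *\<^sub>R t) *\<^sub>R iexp (a * s * (0 + a *\<^sub>R t))))"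
    by (simp only: DIM_real power_one_right abs_of_pos[OF a(1)] integral_scaleR_right)
  also have "\<dots> = (LINT t|lborel. cis (2 * pi * (s * t)) * complex_of_real (exp (- pi * t\<^sup>2)))"
  proof (rule Bochner_Integration.integral_cong[OF refl])
    fix t :: real
    have "a * s * (0 + a *\<^sub>R t) = a\<^sup>2 * (s * t)" by (simp add: power2_eq_square)
    then have "iexp (a * s * (0 + a *\<^sub>R t)) = cis (2 * pi * (s * t))" unfolding a(2) by (simp only: cis_conv_exp)
    then show "a *\<^sub>R (std_normal_density (0 + a *\<^sub>R t) *\<^sub>R iexp (a * s * (0 + a *\<^sub>R t))) = cis (2 * pi * (s * t)) * complex_of_real (exp (- pi * t\<^sup>2))"
      unfolding dens using a by (simp add: scaleR_conv_of_real)
  qed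
  finally show ?eq by simp
qed

lemma lborel_integral_prod:
  fixes f :: "'a::euclidean_space \<Rightarrow> real \<Rightarrow> complex"
  assumes "\<And>b. b \<in> Basis \<Longrightarrow> integrable lborel (f b)"
  shows "integrable lborel (\<lambda>x. \<Prod>b\<in>Basis. f b (x \<bullet> b))"
    and "(LINT x|lborel. (\<Prod>b\<in>Basis. f b (x \<bullet> b))) = (\<Prod>b\<in>Basis. LINT t|lborel. f b t)"
proof -
  interpret P: product_sigma_finite "\<lambda>_::'a. lborel :: real measure"
    by (simp add: product_sigma_finite_def sigma_finite_lborel)
  have [measurable]: "f b \<in> borel_measurable borel" if "b \<in> Basis" for b
    using borel_measurable_integrable[OF assms[OF that]] by simp
  have *: "(\<lambda>g. \<Prod>b\<in>Basis. f b ((\<Sum>b'\<in>Basis. g b' *\<^sub>R b') \<bullet> b)) = (\<lambda>g. \<Prod>b\<in>Basis. f b (g b))"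
    by (intro ext prod.cong) (auto simp: inner_sum_left inner_Basis if_distrib cong: if_cong)
  show "integrable lborel (\<lambda>x. \<Prod>b\<in>Basis. f b (x \<bullet> b))"
    unfolding lborel_eq[where 'a='a]
    by (subst integrable_distr_eq) (auto simp: * intro!: P.product_integrable_prod assms)
  show "(LINT x|lborel. (\<Prod>b\<in>Basis. f b (x \<bullet> b))) = (\<Prod>b\<in>Basis. LINT t|lborel. f b t)"
    unfolding lborel_eq[where 'a='a]
    by (subst integral_distr) (auto simp: * lborel_eq[symmetric] intro!: P.product_integral_prod assms)
qed

lemma gauss_fourier:
  shows "integrable lborel (\<lambda>x. complex_of_real (gauss (x :: 'a::euclidean_space)))"
    and "fourier (\<lambda>x. complex_of_real (gauss x)) (y :: 'a) = complex_of_real (gauss y)"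
proof -
  have prod: "cis (2 * pi * (y \<bullet> x)) * complex_of_real (gauss x) =
      (\<Prod>b\<in>Basis. cis (2 * pi * ((y \<bullet> b) * (x \<bullet> b))) * complex_of_real (exp (- pi * (x \<bullet> b)\<^sup>2)))" for x y :: 'a
  proof -
    have "cis (2 * pi * (y \<bullet> x)) = (\<Prod>b\<in>Basis. cis (2 * pi * ((y \<bullet> b) * (x \<bullet> b))))"
      unfolding cis_conv_exp exp_sum[OF finite_Basis, symmetric]
      by (subst euclidean_inner) (simp add: sum_distrib_left)
    moreover have "gauss x = (\<Prod>b\<in>Basis. exp (- pi * (x \<bullet> b)\<^sup>2))"
      unfolding gauss_def exp_sum[OF finite_Basis, symmetric]
      by (subst euclidean_inner) (simp add: sum_distrib_left power2_eq_square)
    ultimately show ?thesis by (simp add: prod.distrib)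
  qed
  have "integrable lborel (\<lambda>x. cis (2 * pi * (0 \<bullet> x)) * complex_of_real (gauss (x::'a)))"
    unfolding prod by (intro lborel_integral_prod gauss_line)
  then show "integrable lborel (\<lambda>x. complex_of_real (gauss (x :: 'a)))" by simp
  have "fourier (\<lambda>x. complex_of_real (gauss x)) y = (\<Prod>b\<in>Basis. complex_of_real (exp (- pi * (y \<bullet> b)\<^sup>2)))"
    unfolding fourier_def prod
    by (subst lborel_integral_prod(2)) (rule gauss_line(1), simp only: gauss_line(2))
  also have "\<dots> = complex_of_real (gauss y)"
    using prod[of 0 y] by simp
  finally show "fourier (\<lambda>x. complex_of_real (gauss x)) y = complex_of_real (gauss y)" .
qed

section \<open>Plancherel's theorem\<close>

lemma translate_indicator_open_L1:
  fixes z :: "nat \<Rightarrow> 'a::euclidean_space"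
  assumes U: "open U" "emeasure lborel U < \<infinity>" and z: "z \<longlonglongrightarrow> 0"
  shows "(\<lambda>n. LINT x|lborel. \<bar>indicator U (x + z n) - indicator U x :: real\<bar>) \<longlonglongrightarrow> 0"
proof -
  have [measurable]: "U \<in> sets borel" using U by simp
  have int: "integrable lborel (indicator U :: 'a \<Rightarrow> real)" using U by (intro integrable_real_indicator) auto
  have int': "integrable lborel (\<lambda>x. indicator U (x + a) :: real)" for a :: 'a
    using lborel_affine_integrable[of 1 "indicator U :: 'a \<Rightarrow> real" a] int by (simp add: add.commute)
  have eq: "(LINT x|lborel. \<bar>indicator U (x + z n) - indicator U x :: real\<bar>)
     = (LINT x|lborel. 2 * (indicator U x * (1 - indicator U (x + z n))))" for n
  proof -
    have i2: "integrable lborel (\<lambda>x. 2 * (indicator U x * (1 - indicator U (x + z n))) :: real)"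
      by (rule Bochner_Integration.integrable_bound[OF integrable_mult_right[OF int, of 2]])
         (auto intro!: AE_I2 split: split_indicator)
    have "(LINT x|lborel. \<bar>indicator U (x + z n) - indicator U x :: real\<bar>)
      = (LINT x|lborel. (indicator U (x + z n) - indicator U x) + 2 * (indicator U x * (1 - indicator U (x + z n))))"
      by (intro Bochner_Integration.integral_cong) (auto split: split_indicator)
    also have "\<dots> = (LINT x|lborel. indicator U (x + z n)) - (LINT x|lborel. indicator U x :: real) +
       (LINT x|lborel. 2 * (indicator U x * (1 - indicator U (x + z n))))"
      using int int' i2 by simp
    also have "(LINT x|lborel. indicator U (x + z n)) = (LINT x|lborel. indicator U x :: real)"
      using lborel_affine_integral[of 1 "indicator U :: 'a \<Rightarrow> real" "z n"] by (simp add: add.commute)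
    finally show ?thesis by simp
  qed
  have "(\<lambda>n. LINT x|lborel. 2 * (indicator U x * (1 - indicator U (x + z n)))) \<longlonglongrightarrow> (LINT x|(lborel :: 'a measure). (0::real))"
  proof (rule integral_dominated_convergence[where w="\<lambda>x. 2 * indicator U x"])
    show "AE x in lborel. (\<lambda>n. 2 * (indicator U x * (1 - indicator U (x + z n))) :: real) \<longlonglongrightarrow> 0"
    proof (rule AE_I2)
      fix x
      show "(\<lambda>n. 2 * (indicator U x * (1 - indicator U (x + z n))) :: real) \<longlonglongrightarrow> 0"
      proof (cases "x \<in> U")
        case True
        have "(\<lambda>n. x + z n) \<longlonglongrightarrow> x + 0" by (intro tendsto_intros z)
        then have "eventually (\<lambda>n. x + z n \<in> U) sequentially"
          using topological_tendstoD[OF _ U(1), of _ x] True by simp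
        then have "eventually (\<lambda>n. 2 * (indicator U x * (1 - indicator U (x + z n))) = (0::real)) sequentially"
          by eventually_elim simp
        then show ?thesis by (rule tendsto_eventually)
      qed simp
    qed
    show "integrable lborel (\<lambda>x. 2 * indicator U x :: real)" using int by simp
  qed (auto split: split_indicator)
  then show ?thesis unfolding eq by simp
qed

text \<open>The property holds for indicators of open sets of finite measure and is stable under \<open>L\<^sup>1\<close> limits, because translation
is an isometry; outer regularity and induction over integrable functions do the rest.\<close>
lemma translation_continuous_L1:
  fixes h :: "'a::euclidean_space \<Rightarrow> real"
  assumes h: "integrable lborel h" and z: "z \<longlonglongrightarrow> 0"
  shows "(\<lambda>n. LINT x|lborel. \<bar>h (x + z n) - h x\<bar>) \<longlonglongrightarrow> 0"
proof -
  have trans: "integrable lborel (\<lambda>x. f (x + a))" "(LINT x|lborel. f (x + a)) = (LINT x|lborel. f x)"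
    if "integrable lborel f" for f :: "'a \<Rightarrow> real" and a
  proof -
    have [measurable]: "f \<in> borel_measurable borel" using borel_measurable_integrable[OF that] by simp
    show "integrable lborel (\<lambda>x. f (x + a))" "(LINT x|lborel. f (x + a)) = (LINT x|lborel. f x)"
      using lborel_affine_integrable[of 1 f a] lborel_affine_integral[of 1 f a] that by (simp_all add: add.commute)
  qed
  define d where "d f n = (LINT x|lborel. \<bar>f (x + z n) - f x\<bar>)" for f :: "'a \<Rightarrow> real" and n
  have d_le: "d f n \<le> d g n + 2 * (LINT x|lborel. \<bar>f x - g x\<bar>)"
    if f: "integrable lborel f" and g: "integrable lborel g" for f g n
  proof -
    note t = trans(1)[OF f, of "z n"] trans(1)[OF g, of "z n"]
    have "d f n \<le> (LINT x|lborel. \<bar>g (x + z n) - g x\<bar> + (\<bar>f (x + z n) - g (x + z n)\<bar> + \<bar>f x - g x\<bar>))"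
      unfolding d_def using f g t by (intro integral_mono) auto
    also have "\<dots> = d g n + (LINT x|lborel. \<bar>f (x + z n) - g (x + z n)\<bar>) + (LINT x|lborel. \<bar>f x - g x\<bar>)"
      unfolding d_def using f g t by simp
    also have "(LINT x|lborel. \<bar>f (x + z n) - g (x + z n)\<bar>) = (LINT x|lborel. \<bar>f x - g x\<bar>)"
      using f g trans(2)[of "\<lambda>x. \<bar>f x - g x\<bar>" "z n"] by simp
    finally show ?thesis by simp
  qed
  have d_nonneg: "0 \<le> d f n" for f n unfolding d_def by simp
  have approx: "d f \<longlonglongrightarrow> 0"
    if f: "integrable lborel f" and *: "\<And>e. e > 0 \<Longrightarrow> \<exists>g. integrable lborel g \<and> d g \<longlonglongrightarrow> 0 \<and> (LINT x|lborel. \<bar>f x - g x\<bar>) < e" for f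
  proof (rule LIMSEQ_I)
    fix e :: real assume "0 < e"
    then obtain g where g: "integrable lborel g" "d g \<longlonglongrightarrow> 0" "(LINT x|lborel. \<bar>f x - g x\<bar>) < e / 4"
      using *[of "e / 4"] by auto
    obtain N where "\<And>n. n \<ge> N \<Longrightarrow> d g n < e / 2"
      using LIMSEQ_D[OF g(2), of "e / 2"] \<open>0 < e\<close> d_nonneg[of g] by auto
    then show "\<exists>no. \<forall>n\<ge>no. norm (d f n - 0) < e"
      using d_le[OF f g(1)] g(3) d_nonneg[of f]
      by (intro exI[of _ N] allI impI) (force intro: le_less_trans)
  qed
  have "d h \<longlonglongrightarrow> 0"
    using h
  proof (induct rule: integrable_induct)
    case (base A c)
    have [measurable]: "A \<in> sets borel" using base by simp
    have iA: "integrable lborel (indicator A :: 'a \<Rightarrow> real)" using base by (intro integrable_real_indicator) auto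
    have "d (indicator A) \<longlonglongrightarrow> 0"
    proof (rule approx[OF iA])
      fix e :: real assume "0 < e"
      obtain U where U: "open U" "A \<subseteq> U" "emeasure lborel (U - A) < e"
        using outer_regular_lborel[of A e] \<open>0 < e\<close> by auto
      have [measurable]: "U \<in> sets borel" using U by simp
      have "emeasure lborel U = emeasure lborel A + emeasure lborel (U - A)"
        using U by (subst plus_emeasure) (auto simp: Un_absorb1)
      also have "\<dots> < \<infinity>" using base U(3) by (auto simp: less_top[symmetric])
      finally have Ufin: "emeasure lborel U < \<infinity>" .
      have "(LINT x|lborel. \<bar>indicator A x - indicator U x :: real\<bar>) = (LINT x|lborel. indicator (U - A) x)"
        using U by (intro Bochner_Integration.integral_cong) (auto split: split_indicator)
      also have "\<dots> = measure lborel (U - A)" by simp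
      also have "\<dots> < e"
      proof -
        have "emeasure lborel (U - A) \<noteq> \<infinity>" using U(3) by auto
        then show ?thesis using U(3) by (simp add: emeasure_eq_ennreal_measure ennreal_less_iff)
      qed
      finally show "\<exists>g. integrable lborel g \<and> d g \<longlonglongrightarrow> 0 \<and> (LINT x|lborel. \<bar>indicator A x - g x\<bar>) < e"
        using translate_indicator_open_L1[OF U(1) Ufin z] Ufin
        by (intro exI[of _ "indicator U"]) (auto simp: d_def[abs_def] intro!: integrable_real_indicator)
    qed
    then have "(\<lambda>n. \<bar>c\<bar> * d (indicator A) n) \<longlonglongrightarrow> \<bar>c\<bar> * 0" by (intro tendsto_intros)
    moreover have "d (\<lambda>x. indicator A x *\<^sub>R c) n = \<bar>c\<bar> * d (indicator A) n" for n
      unfolding d_def by (subst integral_mult_right_zero[symmetric])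
         (auto intro!: Bochner_Integration.integral_cong simp: abs_mult[symmetric] algebra_simps)
    ultimately show ?case by (simp add: fun_eq_iff[symmetric])
  next
    case (add f g)
    have "d (\<lambda>x. f x + g x) n \<le> d f n + d g n" for n
    proof -
      note t = trans(1)[OF add(1), of "z n"] trans(1)[OF add(3), of "z n"]
      have "d (\<lambda>x. f x + g x) n \<le> (LINT x|lborel. \<bar>f (x + z n) - f x\<bar> + \<bar>g (x + z n) - g x\<bar>)"
        unfolding d_def using add t by (intro integral_mono) auto
      then show ?thesis unfolding d_def using add t by simp
    qed
    moreover have "(\<lambda>n. d f n + d g n) \<longlonglongrightarrow> 0 + 0" by (intro tendsto_intros add)
    ultimately show ?case
      by (intro tendsto_sandwich[of "\<lambda>_. 0" "d (\<lambda>x. f x + g x)" _ "\<lambda>n. d f n + d g n"]) (auto simp: d_nonneg)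
  next
    case (lim f s)
    have "(\<lambda>i. LINT x|lborel. \<bar>f x - s i x\<bar>) \<longlonglongrightarrow> (LINT x|(lborel::'a measure). (0::real))"
    proof (rule integral_dominated_convergence[where w="\<lambda>x. 3 * \<bar>f x\<bar>"])
      show "AE x in lborel. (\<lambda>i. \<bar>f x - s i x\<bar>) \<longlonglongrightarrow> 0"
      proof (rule AE_I2)
        fix x :: 'a assume "x \<in> space lborel"
        then have "(\<lambda>i. \<bar>f x - s i x\<bar>) \<longlonglongrightarrow> \<bar>f x - f x\<bar>" by (intro tendsto_intros lim)
        then show "(\<lambda>i. \<bar>f x - s i x\<bar>) \<longlonglongrightarrow> 0" by simp
      qed
      show "AE x in lborel. norm \<bar>f x - s i x\<bar> \<le> 3 * \<bar>f x\<bar>" for i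
      proof (rule AE_I2)
        fix x :: 'a assume "x \<in> space lborel"
        then have "\<bar>s i x\<bar> \<le> 2 * \<bar>f x\<bar>" using lim(4)[of x i] by simp
        then show "norm \<bar>f x - s i x\<bar> \<le> 3 * \<bar>f x\<bar>" by simp
      qed
    qed (use lim in auto)
    then have lim0: "(\<lambda>i. LINT x|lborel. \<bar>f x - s i x\<bar>) \<longlonglongrightarrow> 0" by simp
    show ?case
    proof (rule approx[OF lim(5)])
      fix e :: real assume "0 < e"
      then obtain i where "(LINT x|lborel. \<bar>f x - s i x\<bar>) < e"
        using order_tendstoD(2)[OF lim0, of e] by (auto simp: eventually_sequentially)
      then show "\<exists>g. integrable lborel g \<and> d g \<longlonglongrightarrow> 0 \<and> (LINT x|lborel. \<bar>f x - g x\<bar>) < e"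
        using lim by (intro exI[of _ "s i"]) auto
    qed
  qed
  then show ?thesis by (simp add: d_def[abs_def])
qed

text \<open>The signed square \<open>a |a|\<close> maps \<open>L\<^sup>2\<close> to \<open>L\<^sup>1\<close>, and this inequality controls \<open>L\<^sup>2\<close> distances by \<open>L\<^sup>1\<close> distances of the images,
so that continuity of translation carries over from \<open>L\<^sup>1\<close> to \<open>L\<^sup>2\<close>.\<close>
lemma sq_diff_le_signed_square:
  fixes a b :: real
  shows "(a - b)\<^sup>2 \<le> 2 * \<bar>a * \<bar>a\<bar> - b * \<bar>b\<bar>\<bar>"
proof -
  have *: "(a - b)\<^sup>2 \<le> 2 * \<bar>a * \<bar>a\<bar> - b * \<bar>b\<bar>\<bar>" if "b \<le> a" for a b :: real
  proof -
    consider "0 \<le> b" | "b < 0" "0 \<le> a" | "a < 0" using that by linarith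
    then show ?thesis
    proof cases
      case 1
      then have "(a - b) * (a - b) \<le> (a - b) * (a + b)" "0 \<le> (a - b) * (a + b)"
        using that by (auto intro!: mult_left_mono mult_nonneg_nonneg)
      moreover have "a * \<bar>a\<bar> - b * \<bar>b\<bar> = (a - b) * (a + b)" using 1 that by (simp add: algebra_simps)
      ultimately have "(a - b)\<^sup>2 \<le> a * \<bar>a\<bar> - b * \<bar>b\<bar>" "0 \<le> a * \<bar>a\<bar> - b * \<bar>b\<bar>" by (simp_all only: power2_eq_square)
      then have "(a - b)\<^sup>2 \<le> 2 * (a * \<bar>a\<bar> - b * \<bar>b\<bar>)" unfolding mult_2 by (rule add_increasing2[rotated])
      also have "\<dots> \<le> 2 * \<bar>a * \<bar>a\<bar> - b * \<bar>b\<bar>\<bar>" by (intro mult_left_mono abs_ge_self) simp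
      finally show ?thesis .
    next
      case 2
      then have "a * \<bar>a\<bar> - b * \<bar>b\<bar> = a\<^sup>2 + b\<^sup>2" by (simp add: power2_eq_square)
      moreover have "(a - b)\<^sup>2 \<le> 2 * (a\<^sup>2 + b\<^sup>2)" using zero_le_power2[of "a + b"] by (simp add: power2_eq_square algebra_simps)
      ultimately show ?thesis by simp
    next
      case 3
      then have "(a - b) * (a - b) \<le> (a - b) * (- a - b)" "0 \<le> (a - b) * (- a - b)"
        using that by (auto intro!: mult_left_mono mult_nonneg_nonneg)
      moreover have "a * \<bar>a\<bar> - b * \<bar>b\<bar> = (a - b) * (- a - b)" using 3 that by (simp add: algebra_simps)
      ultimately have "(a - b)\<^sup>2 \<le> a * \<bar>a\<bar> - b * \<bar>b\<bar>" "0 \<le> a * \<bar>a\<bar> - b * \<bar>b\<bar>" by (simp_all only: power2_eq_square)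
      then have "(a - b)\<^sup>2 \<le> 2 * (a * \<bar>a\<bar> - b * \<bar>b\<bar>)" unfolding mult_2 by (rule add_increasing2[rotated])
      also have "\<dots> \<le> 2 * \<bar>a * \<bar>a\<bar> - b * \<bar>b\<bar>\<bar>" by (intro mult_left_mono abs_ge_self) simp
      finally show ?thesis .
    qed
  qed
  show ?thesis using *[of b a] *[of a b] by (cases "b \<le> a") (auto simp: power2_commute abs_minus_commute)
qed

text \<open>Borel measurable square integrable functions. Borel representatives are used throughout because product measures
are then available; \<open>L2_borel_representative\<close> provides them for Lebesgue measurable functions.\<close>
definition sqint :: "('a::euclidean_space \<Rightarrow> complex) \<Rightarrow> bool" where
  "sqint g \<longleftrightarrow> g \<in> borel_measurable borel \<and> integrable lborel (\<lambda>x. (cmod (g x))\<^sup>2)"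

lemma sqint_measurable: "sqint g \<Longrightarrow> g \<in> borel_measurable borel"
  and sqint_integrable: "sqint g \<Longrightarrow> integrable lborel (\<lambda>x. (cmod (g x))\<^sup>2)"
  by (auto simp: sqint_def)

lemma sqint_mult_integrable:
  assumes f: "sqint f" and g: "sqint g"
  shows "integrable lborel (\<lambda>x. f x * g x)"
proof (rule Bochner_Integration.integrable_bound)
  note [measurable] = sqint_measurable[OF f] sqint_measurable[OF g]
  show "integrable lborel (\<lambda>x. (cmod (f x))\<^sup>2 + (cmod (g x))\<^sup>2)"
    using f g by (auto simp: sqint_def)
  have "cmod (f x) * cmod (g x) \<le> (cmod (f x))\<^sup>2 + (cmod (g x))\<^sup>2" for x
  proof -
    have "2 * (cmod (f x) * cmod (g x)) \<le> (cmod (f x))\<^sup>2 + (cmod (g x))\<^sup>2"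
      using sum_squares_bound[of "cmod (f x)" "cmod (g x)"] by (simp add: mult.assoc)
    moreover have "0 \<le> cmod (f x) * cmod (g x)" by simp
    ultimately show ?thesis by linarith
  qed
  then show "AE x in lborel. norm (f x * g x) \<le> norm ((cmod (f x))\<^sup>2 + (cmod (g x))\<^sup>2)"
    by (auto simp: norm_mult)
qed (use f g in \<open>auto simp: sqint_def\<close>)

lemma sqint_add:
  assumes f: "sqint f" and g: "sqint g"
  shows "sqint (\<lambda>x. f x + g x)"
  unfolding sqint_def
proof
  note [measurable] = sqint_measurable[OF f] sqint_measurable[OF g]
  show "(\<lambda>x. f x + g x) \<in> borel_measurable borel" by measurable
  show "integrable lborel (\<lambda>x. (cmod (f x + g x))\<^sup>2)"
  proof (rule Bochner_Integration.integrable_bound)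
    show "integrable lborel (\<lambda>x. 2 * (cmod (f x))\<^sup>2 + 2 * (cmod (g x))\<^sup>2)"
      using f g by (auto simp: sqint_def)
    have "(cmod (f x + g x))\<^sup>2 \<le> 2 * (cmod (f x))\<^sup>2 + 2 * (cmod (g x))\<^sup>2" for x
    proof -
      have "(cmod (f x + g x))\<^sup>2 \<le> (cmod (f x) + cmod (g x))\<^sup>2" by (intro power_mono norm_triangle_ineq) simp
      also have "\<dots> \<le> 2 * (cmod (f x))\<^sup>2 + 2 * (cmod (g x))\<^sup>2"
        using sum_squares_bound[of "cmod (f x)" "cmod (g x)"] by (simp add: power2_sum)
      finally show ?thesis .
    qed
    then show "AE x in lborel. norm ((cmod (f x + g x))\<^sup>2) \<le> norm (2 * (cmod (f x))\<^sup>2 + 2 * (cmod (g x))\<^sup>2)" by auto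
  qed simp
qed

lemma sqint_cmult: "sqint f \<Longrightarrow> sqint (\<lambda>x. c * f x)"
  by (auto simp: sqint_def norm_mult power_mult_distrib)

lemma sqint_diff: "sqint f \<Longrightarrow> sqint g \<Longrightarrow> sqint (\<lambda>x. f x - g x)"
  using sqint_add[of f "\<lambda>x. - 1 * g x"] sqint_cmult[of g "-1"] by simp

lemma measurable_cnj [measurable (raw)]:
  "f \<in> borel_measurable M \<Longrightarrow> (\<lambda>x. cnj (f x)) \<in> borel_measurable M"
  by (rule measurable_compose[OF _ borel_measurable_continuous_onI[OF continuous_on_cnj[OF continuous_on_id]]])

lemma sqint_cnj: "sqint f \<Longrightarrow> sqint (\<lambda>x. cnj (f x))"
  by (auto simp: sqint_def)

lemma sqint_bound:
  assumes "sqint g" "f \<in> borel_measurable borel" "\<And>x. cmod (f x) \<le> cmod (g x)"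
  shows "sqint f"
  unfolding sqint_def
proof
  have [measurable]: "f \<in> borel_measurable borel" by fact
  show "integrable lborel (\<lambda>x. (cmod (f x))\<^sup>2)"
    by (rule Bochner_Integration.integrable_bound[OF sqint_integrable[OF assms(1)]])
       (auto intro!: AE_I2 power_mono assms)
qed fact

lemma translation_continuous_L2:
  fixes g :: "'a::euclidean_space \<Rightarrow> complex"
  assumes g: "sqint g" and z: "z \<longlonglongrightarrow> 0"
  shows "(\<lambda>n. LINT x|lborel. (cmod (g (x + z n) - g x))\<^sup>2) \<longlonglongrightarrow> 0"
proof -
  note [measurable] = sqint_measurable[OF g]
  define R where "R x = Re (g x) * \<bar>Re (g x)\<bar>" for x
  define I where "I x = Im (g x) * \<bar>Im (g x)\<bar>" for x
  have bd: "\<bar>Re w * \<bar>Re w\<bar>\<bar> \<le> (cmod w)\<^sup>2" "\<bar>Im w * \<bar>Im w\<bar>\<bar> \<le> (cmod w)\<^sup>2" for w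
  proof -
    have "\<bar>Re w\<bar> * \<bar>Re w\<bar> \<le> cmod w * cmod w" "\<bar>Im w\<bar> * \<bar>Im w\<bar> \<le> cmod w * cmod w"
      by (intro mult_mono abs_Re_le_cmod abs_Im_le_cmod; simp)+
    then show "\<bar>Re w * \<bar>Re w\<bar>\<bar> \<le> (cmod w)\<^sup>2" "\<bar>Im w * \<bar>Im w\<bar>\<bar> \<le> (cmod w)\<^sup>2"
      by (simp_all add: abs_mult power2_eq_square)
  qed
  have R: "integrable lborel R" and I: "integrable lborel I"
    unfolding R_def I_def
    by (rule Bochner_Integration.integrable_bound[OF sqint_integrable[OF g]]; auto intro!: AE_I2 bd)+
  have tr: "integrable lborel (\<lambda>x. f (x + a))" if "integrable lborel f" for f :: "'a \<Rightarrow> real" and a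
    using lborel_affine_integrable[of 1 f a] that borel_measurable_integrable[OF that] by (simp add: add.commute)
  have le: "(LINT x|lborel. (cmod (g (x + z n) - g x))\<^sup>2)
     \<le> 2 * (LINT x|lborel. \<bar>R (x + z n) - R x\<bar>) + 2 * (LINT x|lborel. \<bar>I (x + z n) - I x\<bar>)" for n
  proof -
    have pt: "(cmod (g (x + z n) - g x))\<^sup>2 \<le> 2 * \<bar>R (x + z n) - R x\<bar> + 2 * \<bar>I (x + z n) - I x\<bar>" for x
      using sq_diff_le_signed_square[of "Re (g (x + z n))" "Re (g x)"] sq_diff_le_signed_square[of "Im (g (x + z n))" "Im (g x)"]
      by (simp add: cmod_power2 R_def I_def)
    note t = tr[OF R, of "z n"] tr[OF I, of "z n"]
    have i: "integrable lborel (\<lambda>x. 2 * \<bar>R (x + z n) - R x\<bar> + 2 * \<bar>I (x + z n) - I x\<bar>)"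
      using R I t by auto
    have "(LINT x|lborel. (cmod (g (x + z n) - g x))\<^sup>2) \<le> (LINT x|lborel. 2 * \<bar>R (x + z n) - R x\<bar> + 2 * \<bar>I (x + z n) - I x\<bar>)"
      by (rule integral_mono_AE'[OF i]) (auto intro!: AE_I2 pt)
    also have "\<dots> = 2 * (LINT x|lborel. \<bar>R (x + z n) - R x\<bar>) + 2 * (LINT x|lborel. \<bar>I (x + z n) - I x\<bar>)"
      using R I t by (subst Bochner_Integration.integral_add) auto
    finally show ?thesis .
  qed
  have "(\<lambda>n. 2 * (LINT x|lborel. \<bar>R (x + z n) - R x\<bar>) + 2 * (LINT x|lborel. \<bar>I (x + z n) - I x\<bar>)) \<longlonglongrightarrow> 2 * 0 + 2 * 0"
    by (intro tendsto_intros translation_continuous_L1 R I z)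
  then have lim: "(\<lambda>n. 2 * (LINT x|lborel. \<bar>R (x + z n) - R x\<bar>) + 2 * (LINT x|lborel. \<bar>I (x + z n) - I x\<bar>)) \<longlonglongrightarrow> 0"
    by (simp only: mult_zero_right add_0)
  show ?thesis
  proof (rule tendsto_sandwich[OF always_eventually always_eventually tendsto_const lim])
    show "\<forall>n. 0 \<le> (LINT x|lborel. (cmod (g (x + z n) - g x))\<^sup>2)" by simp
  qed (use le in blast)
qed

lemma Cauchy_Schwarz_sqint:
  assumes f: "sqint f" and g: "sqint g"
  shows "(LINT x|lborel. cmod (f x) * cmod (g x)) \<le> sqrt (LINT x|lborel. (cmod (f x))\<^sup>2) * sqrt (LINT x|lborel. (cmod (g x))\<^sup>2)"
proof -
  note [measurable] = sqint_measurable[OF f] sqint_measurable[OF g]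
  have i: "integrable lborel (\<lambda>x. cmod (f x) * cmod (g x))"
    using integrable_norm[OF sqint_mult_integrable[OF f g]] by (simp add: norm_mult)
  have nn: "(\<integral>\<^sup>+x. ennreal (cmod (f x)) * ennreal (cmod (g x)) \<partial>lborel) = ennreal (LINT x|lborel. cmod (f x) * cmod (g x))"
    using nn_integral_eq_integral[OF i] by (simp add: ennreal_mult)
  have sq: "(\<integral>\<^sup>+x. (ennreal (cmod (k x)))\<^sup>2 \<partial>lborel) = ennreal (LINT x|lborel. (cmod (k x))\<^sup>2)" if "sqint k" for k
    using nn_integral_eq_integral[OF sqint_integrable[OF that]] by (simp add: ennreal_power)
  have "(ennreal (LINT x|lborel. cmod (f x) * cmod (g x)))\<^sup>2 \<le> ennreal (LINT x|lborel. (cmod (f x))\<^sup>2) * ennreal (LINT x|lborel. (cmod (g x))\<^sup>2)"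
    using Cauchy_Schwarz_nn_integral[of "\<lambda>x. ennreal (cmod (f x))" lborel "\<lambda>x. ennreal (cmod (g x))"]
    by (simp add: nn sq[OF f] sq[OF g])
  then have "(LINT x|lborel. cmod (f x) * cmod (g x))\<^sup>2 \<le> (LINT x|lborel. (cmod (f x))\<^sup>2) * (LINT x|lborel. (cmod (g x))\<^sup>2)"
    by (simp add: ennreal_power ennreal_mult[symmetric])
  then have "(LINT x|lborel. cmod (f x) * cmod (g x)) \<le> sqrt ((LINT x|lborel. (cmod (f x))\<^sup>2) * (LINT x|lborel. (cmod (g x))\<^sup>2))"
    by (rule real_le_rsqrt)
  then show ?thesis by (simp only: real_sqrt_mult)
qed

lemma sqint_translate:
  assumes g: "sqint g"
  shows "sqint (\<lambda>x. g (x + a))" "(LINT x|lborel. (cmod (g (x + a)))\<^sup>2) = (LINT x|lborel. (cmod (g x))\<^sup>2)"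
  using sqint_measurable[OF g] sqint_integrable[OF g]
    lborel_affine_integrable[of 1 "\<lambda>x. (cmod (g x))\<^sup>2" a] lborel_affine_integral[of 1 "\<lambda>x. (cmod (g x))\<^sup>2" a]
  by (auto simp: sqint_def add.commute)

lemma norm_integral_sqint_le:
  assumes f: "sqint f" and g: "sqint g"
  shows "cmod (LINT x|lborel. f x * g x) \<le> sqrt (LINT x|lborel. (cmod (f x))\<^sup>2) * sqrt (LINT x|lborel. (cmod (g x))\<^sup>2)"
  by (rule order_trans[OF integral_norm_bound]) (simp only: norm_mult Cauchy_Schwarz_sqint[OF f g])

lemma fourier_gauss_scaled:
  fixes y :: "'a::euclidean_space"
  assumes c: "c > 0"
  shows "integrable lborel (\<lambda>\<xi>::'a. complex_of_real (gauss (c *\<^sub>R \<xi>)))"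
    and "c ^ DIM('a) *\<^sub>R fourier (\<lambda>\<xi>. complex_of_real (gauss (c *\<^sub>R \<xi>))) (c *\<^sub>R y) = complex_of_real (gauss y)"
proof -
  show "integrable lborel (\<lambda>\<xi>::'a. complex_of_real (gauss (c *\<^sub>R \<xi>)))"
  proof -
    have "integrable lborel (\<lambda>\<xi>::'a. complex_of_real (gauss (0 + c *\<^sub>R \<xi>)))"
      by (rule lborel_affine_integrable[THEN iffD2, OF _ _ gauss_fourier(1)]) (use c in simp, measurable)
    then show ?thesis by (simp only: add_0)
  qed
  have "complex_of_real (gauss y) = (LINT \<xi>|lborel. cis (2 * pi * (y \<bullet> \<xi>)) * complex_of_real (gauss \<xi>))"
    by (subst gauss_fourier(2)[symmetric]) (simp only: fourier_def)
  also have "\<dots> = c ^ DIM('a) *\<^sub>R (LINT \<xi>|lborel. cis (2 * pi * (y \<bullet> (0 + c *\<^sub>R \<xi>))) * complex_of_real (gauss (0 + c *\<^sub>R \<xi>)))"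
    using c by (subst lborel_affine_integral[of c _ 0]) auto
  also have "\<dots> = c ^ DIM('a) *\<^sub>R fourier (\<lambda>\<xi>. complex_of_real (gauss (c *\<^sub>R \<xi>))) (c *\<^sub>R y)"
    by (simp add: fourier_def)
  finally show "c ^ DIM('a) *\<^sub>R fourier (\<lambda>\<xi>. complex_of_real (gauss (c *\<^sub>R \<xi>))) (c *\<^sub>R y) = complex_of_real (gauss y)" by simp
qed

lemma gauss_nonneg [simp]: "0 \<le> gauss x" and gauss_le_1: "gauss x \<le> 1"
  by (auto simp: gauss_def)

lemma integral_gauss: "(LINT x|(lborel::'a::euclidean_space measure). gauss x) = 1"
proof -
  have "complex_of_real (LINT x|(lborel::'a measure). gauss x) = fourier (\<lambda>x. complex_of_real (gauss x)) (0::'a)"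
    by (simp add: fourier_def)
  also have "\<dots> = 1" by (simp add: gauss_fourier(2)) (simp add: gauss_def)
  finally show ?thesis by simp
qed

lemma integrable_gauss: "integrable lborel (gauss :: 'a::euclidean_space \<Rightarrow> real)"
  using integrable_Re[OF gauss_fourier(1)] by simp

text \<open>Multiplying a transform by a wide Gaussian corresponds to averaging the function against a narrow one. The conjugate on
both sides prepares the pairing with \<open>fourier g\<close> in \<open>plancherel_L1\<close>.\<close>
lemma gauss_smoothing:
  fixes g :: "'a::euclidean_space \<Rightarrow> complex"
  assumes g: "integrable lborel g" and c: "c > 0"
  shows "fourier (\<lambda>\<xi>. cnj (fourier g \<xi>) * complex_of_real (gauss (c *\<^sub>R \<xi>))) x
     = (LINT z|lborel. complex_of_real (gauss z) * cnj (g (x + c *\<^sub>R z)))"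
proof -
  have gm [measurable]: "g \<in> borel_measurable borel" using borel_measurable_integrable[OF g] by simp
  define G where "G \<xi> = complex_of_real (gauss (c *\<^sub>R \<xi>))" for \<xi> :: 'a
  have Gm [measurable]: "G \<in> borel_measurable borel" unfolding G_def by measurable
  have Gi: "integrable lborel G" unfolding G_def by (rule fourier_gauss_scaled[OF c])
  have "fourier (\<lambda>\<xi>. cnj (fourier g \<xi>) * G \<xi>) x =
      (LINT \<xi>|lborel. cis (2 * pi * (x \<bullet> \<xi>)) * (fourier (\<lambda>\<xi>. cnj (g \<xi>)) (- \<xi>) * G \<xi>))"
    unfolding fourier_def[of _ x] by (simp add: cnj_fourier)
  also have "\<dots> = (LINT \<xi>|lborel. cis (2 * pi * (x \<bullet> (0 + (-1) *\<^sub>R \<xi>))) * (fourier (\<lambda>\<xi>. cnj (g \<xi>)) (- (0 + (-1) *\<^sub>R \<xi>)) * G (0 + (-1) *\<^sub>R \<xi>)))"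
    by (subst lborel_affine_integral[of "-1" _ 0]) auto
  also have "\<dots> = (LINT \<xi>|lborel. fourier (\<lambda>\<xi>. cnj (g \<xi>)) \<xi> * (cis (- (2 * pi * (x \<bullet> \<xi>))) * G \<xi>))"
    by (intro Bochner_Integration.integral_cong) (auto simp: G_def gauss_def)
  also have "\<dots> = (LINT y|lborel. cnj (g y) * fourier (\<lambda>\<xi>. cis (- (2 * pi * (x \<bullet> \<xi>))) * G \<xi>) y)"
    using g Gi by (intro fourier_multiplication integrable_cis_mult) auto
  also have "\<dots> = (LINT y|lborel. cnj (g y) * fourier G (y - x))"
  proof (intro Bochner_Integration.integral_cong refl arg_cong2[where f="(*)"])
    fix y show "fourier (\<lambda>\<xi>. cis (- (2 * pi * (x \<bullet> \<xi>))) * G \<xi>) y = fourier G (y - x)"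
      unfolding fourier_def
      by (simp add: mult.assoc[symmetric] cis_mult inner_diff_left right_diff_distrib)
  qed
  also have "\<dots> = c ^ DIM('a) *\<^sub>R (LINT z|lborel. cnj (g (x + c *\<^sub>R z)) * fourier G (x + c *\<^sub>R z - x))"
    using c by (subst lborel_affine_integral[of c _ x]) auto
  also have "\<dots> = (LINT z|lborel. cnj (g (x + c *\<^sub>R z)) * (c ^ DIM('a) *\<^sub>R fourier G (c *\<^sub>R z)))"
    by (subst integral_scaleR_right[symmetric]) (auto intro!: Bochner_Integration.integral_cong)
  also have "\<dots> = (LINT z|lborel. complex_of_real (gauss z) * cnj (g (x + c *\<^sub>R z)))"
    unfolding G_def fourier_gauss_scaled(2)[OF c] by (simp add: mult.commute)
  finally show ?thesis by (simp add: G_def)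
qed

text \<open>With a Gaussian factor inserted, the integral of \<open>|fourier g|\<^sup>2\<close> is a Gaussian average of the autocorrelation \<open>C\<close> of \<open>g\<close>
near zero. The function \<open>C\<close> is continuous at zero, where its value is the squared norm of \<open>g\<close>. As the Gaussian widens, the left side
converges monotonically, which yields integrability and the value at once.\<close>
lemma plancherel_L1:
  fixes g :: "'a::euclidean_space \<Rightarrow> complex"
  assumes g: "integrable lborel g" and sq: "sqint g"
  shows "sqint (fourier g)" and "(LINT x|lborel. (cmod (fourier g x))\<^sup>2) = (LINT x|lborel. (cmod (g x))\<^sup>2)"
proof -
  have gm [measurable]: "g \<in> borel_measurable borel" using sq by (rule sqint_measurable)
  define N where "N = (LINT x|lborel. (cmod (g x))\<^sup>2)"
  define \<epsilon> where "\<epsilon> n = 1 / real (Suc n)" for n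
  have \<epsilon>: "\<epsilon> n > 0" for n by (simp add: \<epsilon>_def)
  (* the autocorrelation of g *)
  define C where "C w = (LINT x|lborel. g x * cnj (g (x + w)))" for w
  have C_le: "cmod (C w) \<le> N" for w
  proof -
    have "cmod (C w) \<le> sqrt N * sqrt (LINT x|lborel. (cmod (cnj (g (x + w))))\<^sup>2)"
      unfolding C_def N_def by (intro norm_integral_sqint_le sq sqint_cnj sqint_translate)
    also have "\<dots> = N"
      using sqint_translate(2)[OF sq, of w] by (simp add: N_def)
    finally show ?thesis .
  qed
  have C_lim: "(\<lambda>n. C (w n)) \<longlonglongrightarrow> complex_of_real N" if w: "w \<longlonglongrightarrow> 0" for w
  proof -
    have le: "cmod (C (w n) - complex_of_real N) \<le> sqrt N * sqrt (LINT x|lborel. (cmod (g (x + w n) - g x))\<^sup>2)" for n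
    proof -
      have sd: "sqint (\<lambda>x. cnj (g (x + w n) - g x))"
        by (intro sqint_cnj sqint_diff sqint_translate sq)
      have "complex_of_real N = (LINT x|lborel. g x * cnj (g x))"
        unfolding N_def by (simp add: integral_complex_of_real[symmetric] complex_norm_square[symmetric] del: integral_complex_of_real)
      then have "C (w n) - complex_of_real N = (LINT x|lborel. g x * cnj (g (x + w n))) - (LINT x|lborel. g x * cnj (g x))"
        by (simp add: C_def)
      also have "\<dots> = (LINT x|lborel. g x * cnj (g (x + w n) - g x))"
        by (subst Bochner_Integration.integral_diff[symmetric])
           (auto intro!: sqint_mult_integrable sqint_cnj sqint_translate sq simp: algebra_simps)
      also have "cmod \<dots> \<le> sqrt N * sqrt (LINT x|lborel. (cmod (cnj (g (x + w n) - g x)))\<^sup>2)"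
        unfolding N_def by (intro norm_integral_sqint_le sq sd)
      finally show ?thesis by (simp only: complex_mod_cnj)
    qed
    have "(\<lambda>n. sqrt N * sqrt (LINT x|lborel. (cmod (g (x + w n) - g x))\<^sup>2)) \<longlonglongrightarrow> sqrt N * sqrt 0"
      by (intro tendsto_intros translation_continuous_L2 sq w)
    then have "(\<lambda>n. C (w n) - complex_of_real N) \<longlonglongrightarrow> 0"
      by (intro Lim_null_comparison[OF always_eventually[OF allI[OF le]]]) simp
    then show ?thesis by (rule LIM_zero_cancel)
  qed
  (* the Gaussian factor makes the integral converge before square integrability is known *)
  define A where "A n = (LINT \<xi>|lborel. (cmod (fourier g \<xi>))\<^sup>2 * gauss (\<epsilon> n *\<^sub>R \<xi>))" for n
  have Gi: "integrable lborel (\<lambda>\<xi>::'a. gauss (\<epsilon> n *\<^sub>R \<xi>) :: real)" for n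
    using integrable_Re[OF fourier_gauss_scaled(1)[OF \<epsilon>[of n], where 'a='a]] by simp
  define M where "M = (LINT \<xi>|lborel. cmod (g \<xi>))"
  have FM: "cmod (fourier g \<xi>) \<le> M" for \<xi> unfolding M_def by (rule norm_fourier_le)
  have M0: "0 \<le> M" unfolding M_def by simp
  have Ai: "integrable lborel (\<lambda>\<xi>. (cmod (fourier g \<xi>))\<^sup>2 * gauss (\<epsilon> n *\<^sub>R \<xi>))" for n
  proof (rule Bochner_Integration.integrable_bound[OF integrable_mult_right[OF Gi[of n], of "M\<^sup>2"]])
    show "AE \<xi> in lborel. norm ((cmod (fourier g \<xi>))\<^sup>2 * gauss (\<epsilon> n *\<^sub>R \<xi>)) \<le> norm (M\<^sup>2 * gauss (\<epsilon> n *\<^sub>R \<xi>))"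
      by (rule AE_I2) (simp add: abs_mult mult_right_mono power_mono FM)
  qed measurable
  have A_eq: "complex_of_real (A n) = (LINT z|lborel. complex_of_real (gauss z) * C (\<epsilon> n *\<^sub>R z))" for n
  proof -
    define k where "k \<xi> = cnj (fourier g \<xi>) * complex_of_real (gauss (\<epsilon> n *\<^sub>R \<xi>))" for \<xi>
    have km [measurable]: "k \<in> borel_measurable borel" unfolding k_def by measurable
    have k: "integrable lborel k"
    proof (rule Bochner_Integration.integrable_bound[OF integrable_mult_right[OF Gi[of n], of "M"]])
      show "AE \<xi> in lborel. norm (k \<xi>) \<le> norm (M * gauss (\<epsilon> n *\<^sub>R \<xi>))"
        by (rule AE_I2) (simp add: k_def norm_mult abs_mult mult_right_mono FM M0)
    qed measurable
    have "complex_of_real (A n) = (LINT \<xi>|lborel. fourier g \<xi> * k \<xi>)"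
      unfolding A_def k_def
      by (subst integral_complex_of_real[symmetric]) (auto simp: complex_norm_square mult.assoc simp del: of_real_power intro!: Bochner_Integration.integral_cong)
    also have "\<dots> = (LINT x|lborel. g x * fourier k x)"
      by (rule fourier_multiplication[OF g k])
    also have "\<dots> = (LINT x|lborel. LINT z|lborel. complex_of_real (gauss z) * (g x * cnj (g (x + \<epsilon> n *\<^sub>R z))))"
      unfolding k_def gauss_smoothing[OF g \<epsilon>]
      by (subst integral_mult_right_zero[symmetric]) (simp add: mult.left_commute)
    also have "\<dots> = (LINT z|lborel. LINT x|lborel. complex_of_real (gauss z) * (g x * cnj (g (x + \<epsilon> n *\<^sub>R z))))"
    proof (rule lborel_pair.Fubini_integral[symmetric, where f="\<lambda>z x. complex_of_real (gauss z) * (g x * cnj (g (x + \<epsilon> n *\<^sub>R z)))", symmetric])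
      show "integrable (lborel \<Otimes>\<^sub>M lborel) (\<lambda>(z, x). complex_of_real (gauss z) * (g x * cnj (g (x + \<epsilon> n *\<^sub>R z))))"
      proof (rule lborel_pair.Fubini_integrable)
        have ii: "integrable lborel (\<lambda>x. g x * cnj (g (x + w)))" for w
          by (intro sqint_mult_integrable sqint_cnj sqint_translate sq)
        show "AE z in lborel. integrable lborel (\<lambda>x. case (z, x) of (z, x) \<Rightarrow> complex_of_real (gauss z) * (g x * cnj (g (x + \<epsilon> n *\<^sub>R z))))"
          using ii by auto
        show "integrable lborel (\<lambda>z. LINT x|lborel. norm (case (z, x) of (z, x) \<Rightarrow> complex_of_real (gauss z) * (g x * cnj (g (x + \<epsilon> n *\<^sub>R z)))))"
        proof (rule Bochner_Integration.integrable_bound[OF integrable_mult_right[OF integrable_gauss, of N]])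
          show "AE z in lborel. norm (LINT x|lborel. norm (case (z, x) of (z, x) \<Rightarrow> complex_of_real (gauss z) * (g x * cnj (g (x + \<epsilon> n *\<^sub>R z)))))
            \<le> norm (N * gauss z)"
          proof (rule AE_I2)
            fix z :: 'a
            have "(LINT x|lborel. cmod (g x) * cmod (g (x + \<epsilon> n *\<^sub>R z))) \<le> N"
              using Cauchy_Schwarz_sqint[OF sq sqint_translate(1)[OF sq, of "\<epsilon> n *\<^sub>R z"]] sqint_translate(2)[OF sq]
              by (simp add: N_def)
            then have "gauss z * (LINT x|lborel. cmod (g x) * cmod (g (x + \<epsilon> n *\<^sub>R z))) \<le> gauss z * N"
              by (intro mult_left_mono) auto
            moreover have "0 \<le> N" by (simp add: N_def)
            ultimately show "norm (LINT x|lborel. norm (case (z, x) of (z, x) \<Rightarrow> complex_of_real (gauss z) * (g x * cnj (g (x + \<epsilon> n *\<^sub>R z)))))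
              \<le> norm (N * gauss z)"
              by (simp add: norm_mult abs_mult mult.commute)
          qed
        qed measurable
      qed measurable
    qed
    also have "\<dots> = (LINT z|lborel. complex_of_real (gauss z) * C (\<epsilon> n *\<^sub>R z))"
      by (simp add: C_def)
    finally show ?thesis .
  qed
  have "(\<lambda>n. LINT z|lborel. complex_of_real (gauss z) * C (\<epsilon> n *\<^sub>R z)) \<longlonglongrightarrow> (LINT z|(lborel::'a measure). complex_of_real (gauss z) * complex_of_real N)"
  proof (rule integral_dominated_convergence[where w="\<lambda>z. N * gauss z"])
    have [measurable]: "C \<in> borel_measurable borel" unfolding C_def by measurable
    show "(\<lambda>z. complex_of_real (gauss z) * C (\<epsilon> n *\<^sub>R z)) \<in> borel_measurable lborel" for n by measurable
    show "AE z in lborel. (\<lambda>n. complex_of_real (gauss z) * C (\<epsilon> n *\<^sub>R z)) \<longlonglongrightarrow> complex_of_real (gauss z) * complex_of_real N"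
    proof (rule AE_I2)
      fix z :: 'a
      have "\<epsilon> \<longlonglongrightarrow> 0" unfolding \<epsilon>_def using LIMSEQ_inverse_real_of_nat by (simp add: inverse_eq_divide)
      then have "(\<lambda>n. \<epsilon> n *\<^sub>R z) \<longlonglongrightarrow> 0 *\<^sub>R z" by (intro tendsto_intros)
      then show "(\<lambda>n. complex_of_real (gauss z) * C (\<epsilon> n *\<^sub>R z)) \<longlonglongrightarrow> complex_of_real (gauss z) * complex_of_real N"
        by (intro tendsto_intros C_lim) simp
    qed
    show "AE z in lborel. norm (complex_of_real (gauss z) * C (\<epsilon> n *\<^sub>R z)) \<le> N * gauss z" for n
      by (rule AE_I2) (simp add: norm_mult, subst mult.commute, rule mult_right_mono[OF C_le gauss_nonneg])
  qed (use integrable_gauss in auto)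
  also have "(LINT z|(lborel::'a measure). complex_of_real (gauss z) * complex_of_real N) = complex_of_real N"
    by (simp add: integral_gauss)
  finally have "(\<lambda>n. complex_of_real (A n)) \<longlonglongrightarrow> complex_of_real N" by (simp only: A_eq)
  then have A_lim: "A \<longlonglongrightarrow> N" by (simp only: tendsto_of_real_iff)
  have mono: "AE \<xi> in lborel. mono (\<lambda>n. (cmod (fourier g \<xi>))\<^sup>2 * gauss (\<epsilon> n *\<^sub>R \<xi>))"
  proof (intro AE_I2 monoI mult_left_mono)
    fix \<xi> :: 'a and m n :: nat assume "m \<le> n"
    then have "\<epsilon> n * \<epsilon> n \<le> \<epsilon> m * \<epsilon> m" unfolding \<epsilon>_def by (intro mult_mono frac_le) auto
    then have "\<epsilon> n * \<epsilon> n * (\<xi> \<bullet> \<xi>) \<le> \<epsilon> m * \<epsilon> m * (\<xi> \<bullet> \<xi>)" by (intro mult_right_mono) auto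
    then show "gauss (\<epsilon> m *\<^sub>R \<xi>) \<le> gauss (\<epsilon> n *\<^sub>R \<xi>)"
      by (simp add: gauss_def mult.assoc)
  qed simp
  have lim: "AE \<xi> in lborel. (\<lambda>n. (cmod (fourier g \<xi>))\<^sup>2 * gauss (\<epsilon> n *\<^sub>R \<xi>)) \<longlonglongrightarrow> (cmod (fourier g \<xi>))\<^sup>2"
  proof (rule AE_I2)
    fix \<xi> :: 'a
    have "\<epsilon> \<longlonglongrightarrow> 0" unfolding \<epsilon>_def using LIMSEQ_inverse_real_of_nat by (simp add: inverse_eq_divide)
    then have "(\<lambda>n. (cmod (fourier g \<xi>))\<^sup>2 * exp (- pi * ((\<epsilon> n *\<^sub>R \<xi>) \<bullet> (\<epsilon> n *\<^sub>R \<xi>)))) \<longlonglongrightarrow> (cmod (fourier g \<xi>))\<^sup>2 * exp (- pi * ((0 *\<^sub>R \<xi>) \<bullet> (0 *\<^sub>R \<xi>)))"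
      by (intro tendsto_intros)
    then show "(\<lambda>n. (cmod (fourier g \<xi>))\<^sup>2 * gauss (\<epsilon> n *\<^sub>R \<xi>)) \<longlonglongrightarrow> (cmod (fourier g \<xi>))\<^sup>2"
      by (simp add: gauss_def)
  qed
  have m: "(\<lambda>\<xi>. (cmod (fourier g \<xi>))\<^sup>2) \<in> borel_measurable lborel" by measurable
  show "sqint (fourier g)"
    using integrable_monotone_convergence[OF Ai mono lim A_lim[unfolded A_def] m] by (simp add: sqint_def)
  show "(LINT x|lborel. (cmod (fourier g x))\<^sup>2) = (LINT x|lborel. (cmod (g x))\<^sup>2)"
    using integral_monotone_convergence[OF Ai mono lim A_lim[unfolded A_def] m] by (simp add: N_def)
qed

section \<open>The Fourier transform on square integrable functions\<close>

lemma sqint_eq_0_AE: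
  assumes f: "sqint f" and "(LINT x|lborel. (cmod (f x))\<^sup>2) = 0"
  shows "AE x in lborel. f x = 0"
proof -
  have "AE x in lborel. (cmod (f x))\<^sup>2 = 0"
    using assms integral_nonneg_eq_0_iff_AE[OF sqint_integrable[OF f]] by simp
  then show ?thesis by simp
qed

lemma nn_integral_sqint: "sqint f \<Longrightarrow> (\<integral>\<^sup>+x. ennreal ((cmod (f x))\<^sup>2) \<partial>lborel) = ennreal (LINT x|lborel. (cmod (f x))\<^sup>2)"
  by (intro nn_integral_eq_integral sqint_integrable) auto

lemma sqint_gauss: "sqint (\<lambda>x::'a::euclidean_space. complex_of_real (gauss x))"
  unfolding sqint_def
proof
  show "integrable lborel (\<lambda>x::'a. (cmod (complex_of_real (gauss x)))\<^sup>2)"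
  proof (rule Bochner_Integration.integrable_bound[OF integrable_gauss])
    show "AE x in lborel. norm ((cmod (complex_of_real (gauss (x::'a))))\<^sup>2) \<le> norm (gauss x)"
      by (rule AE_I2) (simp add: power2_eq_square mult_left_le gauss_le_1)
  qed measurable
qed measurable

text \<open>Multiplying by a Gaussian, which is square integrable, turns an \<open>L\<^sup>2\<close> Cauchy sequence into an \<open>L\<^sup>1\<close> Cauchy sequence. That one has
a subsequence converging almost everywhere, and dividing by the positive Gaussian gives the limit. Fatou's lemma shows convergence in \<open>L\<^sup>2\<close>.\<close>
lemma L2_complete:
  fixes u :: "nat \<Rightarrow> 'a::euclidean_space \<Rightarrow> complex"
  assumes u: "\<And>n. sqint (u n)"
    and cauchy: "\<And>e. e > 0 \<Longrightarrow> \<exists>N. \<forall>i\<ge>N. \<forall>j\<ge>N. (LINT x|lborel. (cmod (u i x - u j x))\<^sup>2) < e"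
  shows "\<exists>v. sqint v \<and> (\<lambda>n. LINT x|lborel. (cmod (u n x - v x))\<^sup>2) \<longlonglongrightarrow> 0"
proof -
  have um [measurable]: "u n \<in> borel_measurable borel" for n using u by (rule sqint_measurable)
  define s where "s n x = complex_of_real (gauss x) * u n x" for n x
  define K where "K = sqrt (LINT x|(lborel::'a measure). (cmod (complex_of_real (gauss x)))\<^sup>2)"
  have K: "0 \<le> K" unfolding K_def by simp
  have s_int: "integrable lborel (s n)" for n
    unfolding s_def by (intro sqint_mult_integrable sqint_gauss u)
  have s_le: "(LINT x|lborel. norm (s i x - s j x)) \<le> K * sqrt (LINT x|lborel. (cmod (u i x - u j x))\<^sup>2)" for i j
  proof -
    have "(LINT x|lborel. norm (s i x - s j x)) = (LINT x|lborel. cmod (complex_of_real (gauss x)) * cmod (u i x - u j x))"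
      by (intro Bochner_Integration.integral_cong) (auto simp: s_def right_diff_distrib[symmetric] norm_mult)
    also have "\<dots> \<le> K * sqrt (LINT x|lborel. (cmod (u i x - u j x))\<^sup>2)"
      unfolding K_def by (intro Cauchy_Schwarz_sqint sqint_gauss sqint_diff u)
    finally show ?thesis .
  qed
  have s_cauchy: "\<exists>N. \<forall>i\<ge>N. \<forall>j\<ge>N. (LINT x|lborel. norm (s i x - s j x)) < e" if "e > 0" for e
  proof -
    have "0 < (e / (K + 1))\<^sup>2" using that K by simp
    from cauchy[OF this]
    obtain N where N: "\<And>i j. i \<ge> N \<Longrightarrow> j \<ge> N \<Longrightarrow> (LINT x|lborel. (cmod (u i x - u j x))\<^sup>2) < (e / (K + 1))\<^sup>2"
      by blast
    show ?thesis
    proof (intro exI[of _ N] allI impI)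
      fix i j assume "i \<ge> N" "j \<ge> N"
      then have "sqrt (LINT x|lborel. (cmod (u i x - u j x))\<^sup>2) < e / (K + 1)"
        using N[of i j] that K by (intro real_less_lsqrt) auto
      then have "K * sqrt (LINT x|lborel. (cmod (u i x - u j x))\<^sup>2) \<le> K * (e / (K + 1))"
        using K by (intro mult_left_mono) auto
      also have "\<dots> < e" using K that by (simp add: field_simps)
      finally show "(LINT x|lborel. norm (s i x - s j x)) < e" using s_le[of i j] by simp
    qed
  qed
  obtain r where r: "strict_mono r" "AE x in lborel. Cauchy (\<lambda>i. s (r i) x)"
    using cauchy_L1_AE_cauchy_subseq[OF s_int s_cauchy] by metis
  define v where "v x = lim (\<lambda>i. u (r i) x)" for x
  have vm [measurable]: "v \<in> borel_measurable borel"
    unfolding v_def by measurable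
  have conv: "AE x in lborel. (\<lambda>i. u (r i) x) \<longlonglongrightarrow> v x"
    using r(2)
  proof eventually_elim
    case (elim x)
    then obtain l where l: "(\<lambda>i. s (r i) x) \<longlonglongrightarrow> l" by (auto simp: Cauchy_convergent_iff convergent_def)
    have "gauss x \<noteq> 0" by (simp add: gauss_def)
    have "(\<lambda>i. s (r i) x / complex_of_real (gauss x)) \<longlonglongrightarrow> l / complex_of_real (gauss x)"
      using \<open>gauss x \<noteq> 0\<close> by (intro tendsto_intros l) simp
    then have "convergent (\<lambda>i. u (r i) x)" using \<open>gauss x \<noteq> 0\<close> by (auto simp: s_def convergent_def)
    then show ?case unfolding v_def by (simp add: convergent_LIMSEQ_iff)
  qed
  have fatou: "(\<integral>\<^sup>+x. ennreal ((cmod (u n x - v x))\<^sup>2) \<partial>lborel) \<le> ennreal e"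
    if N: "\<And>i j. i \<ge> N \<Longrightarrow> j \<ge> N \<Longrightarrow> (LINT x|lborel. (cmod (u i x - u j x))\<^sup>2) < e" and "n \<ge> N" for n N e
  proof -
    have "(\<integral>\<^sup>+x. ennreal ((cmod (u n x - v x))\<^sup>2) \<partial>lborel) = (\<integral>\<^sup>+x. liminf (\<lambda>i. ennreal ((cmod (u n x - u (r i) x))\<^sup>2)) \<partial>lborel)"
    proof (rule nn_integral_cong_AE)
      show "AE x in lborel. ennreal ((cmod (u n x - v x))\<^sup>2) = liminf (\<lambda>i. ennreal ((cmod (u n x - u (r i) x))\<^sup>2))"
        using conv
      proof eventually_elim
        case (elim x)
        have "(\<lambda>i. ennreal ((cmod (u n x - u (r i) x))\<^sup>2)) \<longlonglongrightarrow> ennreal ((cmod (u n x - v x))\<^sup>2)"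
          by (intro tendsto_intros tendsto_ennrealI elim)
        then show ?case by (rule lim_imp_Liminf[OF trivial_limit_sequentially, symmetric])
      qed
    qed
    also have "\<dots> \<le> liminf (\<lambda>i. \<integral>\<^sup>+x. ennreal ((cmod (u n x - u (r i) x))\<^sup>2) \<partial>lborel)"
      by (rule nn_integral_liminf) measurable
    also have "\<dots> \<le> ennreal e"
    proof (rule Liminf_le)
      show "eventually (\<lambda>i. (\<integral>\<^sup>+x. ennreal ((cmod (u n x - u (r i) x))\<^sup>2) \<partial>lborel) \<le> ennreal e) sequentially"
        using eventually_ge_at_top[of N]
      proof eventually_elim
        case (elim i)
        then have "r i \<ge> N" using seq_suble[OF r(1), of i] by simp
        then show ?case
          using N[OF \<open>n \<ge> N\<close>, of "r i"] nn_integral_sqint[OF sqint_diff[OF u[of n] u[of "r i"]]] by (simp add: ennreal_leI)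
      qed
    qed simp
    finally show ?thesis .
  qed
  have sq_diff: "sqint (\<lambda>x. u n x - v x)" if *: "(\<integral>\<^sup>+x. ennreal ((cmod (u n x - v x))\<^sup>2) \<partial>lborel) \<le> ennreal e" for n e
    unfolding sqint_def
  proof
    show "integrable lborel (\<lambda>x. (cmod (u n x - v x))\<^sup>2)"
      by (rule integrableI_nonneg) (use * in \<open>auto intro: le_less_trans\<close>)
  qed measurable
  have v: "sqint v"
  proof -
    obtain N where N: "\<And>i j. i \<ge> N \<Longrightarrow> j \<ge> N \<Longrightarrow> (LINT x|lborel. (cmod (u i x - u j x))\<^sup>2) < 1"
      using cauchy[of 1] by auto
    have "sqint (\<lambda>x. u N x - v x)" by (rule sq_diff[OF fatou[OF N]]) auto
    from sqint_diff[OF u[of N] this] show ?thesis by simp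
  qed
  have "(\<lambda>n. LINT x|lborel. (cmod (u n x - v x))\<^sup>2) \<longlonglongrightarrow> 0"
  proof (rule LIMSEQ_I)
    fix e :: real assume "0 < e"
    then obtain N where N: "\<And>i j. i \<ge> N \<Longrightarrow> j \<ge> N \<Longrightarrow> (LINT x|lborel. (cmod (u i x - u j x))\<^sup>2) < e / 2"
      using cauchy[of "e / 2"] by auto
    have "(LINT x|lborel. (cmod (u n x - v x))\<^sup>2) \<le> e / 2" if "n \<ge> N" for n
      using fatou[OF N that] nn_integral_sqint[OF sqint_diff[OF u v, of n]] \<open>0 < e\<close> by simp
    then show "\<exists>no. \<forall>n\<ge>no. norm ((LINT x|lborel. (cmod (u n x - v x))\<^sup>2) - 0) < e"
      using \<open>0 < e\<close> by (intro exI[of _ N]) (force intro: le_less_trans)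
  qed
  with v show ?thesis by blast
qed

definition trunc :: "('a::euclidean_space \<Rightarrow> complex) \<Rightarrow> nat \<Rightarrow> 'a \<Rightarrow> complex" where
  "trunc h n x = indicator (ball 0 (real n)) x * h x"

lemma trunc_norm_le: "cmod (trunc h n x) \<le> cmod (h x)"
  by (simp add: trunc_def norm_mult split: split_indicator)

lemma trunc:
  fixes h :: "'a::euclidean_space \<Rightarrow> complex"
  assumes h: "sqint h"
  shows sqint_trunc: "sqint (trunc h n)" and integrable_trunc: "integrable lborel (trunc h n)"
    and trunc_L2: "(\<lambda>n. LINT x|lborel. (cmod (h x - trunc h n x))\<^sup>2) \<longlonglongrightarrow> 0"
proof -
  note [measurable] = sqint_measurable[OF h]
  have [measurable]: "ball 0 (real n) \<in> sets (borel :: 'a measure)" for n by simp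
  have [measurable]: "trunc h n \<in> borel_measurable borel" for n unfolding trunc_def by measurable
  show "sqint (trunc h n)" by (rule sqint_bound[OF h]) (auto intro: trunc_norm_le)
  have "sqint (\<lambda>x. indicator (ball 0 (real n)) (x::'a) :: complex)"
    unfolding sqint_def
  proof
    have *: "(cmod (indicator (ball 0 (real n)) x))\<^sup>2 = indicator (ball 0 (real n)) x" for x :: 'a
      by (simp split: split_indicator)
    show "integrable lborel (\<lambda>x::'a. (cmod (indicator (ball 0 (real n)) x))\<^sup>2)"
      unfolding * by (intro integrable_real_indicator) (auto intro: emeasure_bounded_finite[simplified])
  qed measurable
  from sqint_mult_integrable[OF this h] show "integrable lborel (trunc h n)"
    by (simp add: trunc_def[abs_def])
  have "(\<lambda>n. LINT x|lborel. (cmod (h x - trunc h n x))\<^sup>2) \<longlonglongrightarrow> (LINT x|(lborel::'a measure). (0::real))"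
  proof (rule integral_dominated_convergence[where w="\<lambda>x. (cmod (h x))\<^sup>2"])
    show "AE x in lborel. (\<lambda>n. (cmod (h x - trunc h n x))\<^sup>2) \<longlonglongrightarrow> 0"
    proof (rule AE_I2)
      fix x :: 'a
      obtain n0 where "norm x < real n0" using reals_Archimedean2 by blast
      then have "eventually (\<lambda>n. (cmod (h x - trunc h n x))\<^sup>2 = 0) sequentially"
        by (intro eventually_sequentiallyI[of n0]) (auto simp: trunc_def split: split_indicator)
      then show "(\<lambda>n. (cmod (h x - trunc h n x))\<^sup>2) \<longlonglongrightarrow> 0" by (rule tendsto_eventually)
    qed
    show "AE x in lborel. norm ((cmod (h x - trunc h n x))\<^sup>2) \<le> (cmod (h x))\<^sup>2" for n
      by (rule AE_I2) (auto simp: trunc_def split: split_indicator)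
    show "integrable lborel (\<lambda>x. (cmod (h x))\<^sup>2)" by (rule sqint_integrable[OF h])
  qed measurable
  then show "(\<lambda>n. LINT x|lborel. (cmod (h x - trunc h n x))\<^sup>2) \<longlonglongrightarrow> 0" by simp
qed

text \<open>The Fourier transform of square integrable functions, defined by duality as the relation that extends
\<open>fourier_multiplication\<close>. A relation rather than a function fits the fact that \<open>u\<close> is determined only up to
null sets.\<close>
definition fourier_pair :: "('a::euclidean_space \<Rightarrow> complex) \<Rightarrow> ('a \<Rightarrow> complex) \<Rightarrow> bool" where
  "fourier_pair h u \<longleftrightarrow> sqint h \<and> sqint u \<and>
     (\<forall>k. integrable lborel k \<longrightarrow> sqint k \<longrightarrow> (LINT x|lborel. u x * k x) = (LINT x|lborel. h x * fourier k x))"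

lemma fourier_pairD:
  assumes "fourier_pair h u"
  shows "sqint h" "sqint u" "integrable lborel k \<Longrightarrow> sqint k \<Longrightarrow> (LINT x|lborel. u x * k x) = (LINT x|lborel. h x * fourier k x)"
  using assms by (auto simp: fourier_pair_def)

lemma fourier_pair_L1: "integrable lborel h \<Longrightarrow> sqint h \<Longrightarrow> fourier_pair h (fourier h)"
  by (simp add: fourier_pair_def plancherel_L1 fourier_multiplication)

lemma fourier_pair_cmult:
  assumes "fourier_pair h u"
  shows "fourier_pair (\<lambda>x. c * h x) (\<lambda>x. c * u x)"
  using assms by (auto simp: fourier_pair_def sqint_cmult mult.assoc)

lemma fourier_pair_add:
  assumes h: "fourier_pair h u" and k: "fourier_pair k v"
  shows "fourier_pair (\<lambda>x. h x + k x) (\<lambda>x. u x + v x)"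
  unfolding fourier_pair_def
proof (intro conjI allI impI sqint_add fourier_pairD[OF h] fourier_pairD[OF k])
  fix l :: "'a \<Rightarrow> complex" assume l: "integrable lborel l" "sqint l"
  have "sqint (fourier l)" by (rule plancherel_L1[OF l])
  then show "(LINT x|lborel. (u x + v x) * l x) = (LINT x|lborel. (h x + k x) * fourier l x)"
    using fourier_pairD[OF h] fourier_pairD[OF k] l
    by (simp add: distrib_right sqint_mult_integrable)
qed

lemma fourier_pair_diff:
  assumes h: "fourier_pair h u" and k: "fourier_pair k v"
  shows "fourier_pair (\<lambda>x. h x - k x) (\<lambda>x. u x - v x)"
  using fourier_pair_add[OF h fourier_pair_cmult[OF k, of "-1"]] by simp

lemma fourier_pair_cong_AE:
  assumes p: "fourier_pair h u" and [measurable]: "h' \<in> borel_measurable borel" "u' \<in> borel_measurable borel"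
    and h: "AE x in lborel. h x = h' x" and u: "AE x in lborel. u x = u' x"
  shows "fourier_pair h' u'"
proof -
  have sq: "sqint f'" if "sqint f" "AE x in lborel. f x = f' x" "f' \<in> borel_measurable borel" for f f' :: "'a \<Rightarrow> complex"
  proof -
    note [measurable] = that(3) sqint_measurable[OF that(1)]
    have "integrable lborel (\<lambda>x. (cmod (f x))\<^sup>2) = integrable lborel (\<lambda>x. (cmod (f' x))\<^sup>2)"
      using that(2) by (intro integrable_cong_AE) auto
    then show ?thesis using that by (simp add: sqint_def)
  qed
  have sq': "sqint h'" "sqint u'" using sq[OF _ h] sq[OF _ u] fourier_pairD(1,2)[OF p] by auto
  note [measurable] = fourier_pairD(1,2)[OF p, THEN sqint_measurable]
  show ?thesis
    unfolding fourier_pair_def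
  proof (intro conjI sq' allI impI)
    fix k :: "'a \<Rightarrow> complex" assume k: "integrable lborel k" "sqint k"
    note [measurable] = sqint_measurable[OF k(2)]
    have "(LINT x|lborel. u' x * k x) = (LINT x|lborel. u x * k x)"
      using u by (intro integral_cong_AE) auto
    also have "\<dots> = (LINT x|lborel. h x * fourier k x)" by (rule fourier_pairD(3)[OF p k])
    also have "\<dots> = (LINT x|lborel. h' x * fourier k x)"
      using h by (intro integral_cong_AE) auto
    finally show "(LINT x|lborel. u' x * k x) = (LINT x|lborel. h' x * fourier k x)" .
  qed
qed

text \<open>Testing against the conjugate of \<open>u\<close>, truncated to balls so that it is an admissible test function.\<close>
lemma fourier_pair_zero_imp:
  assumes p: "fourier_pair (\<lambda>x. 0) u"
  shows "AE x in lborel. u x = 0"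
proof -
  have u: "sqint u" by (rule fourier_pairD[OF p])
  note [measurable] = sqint_measurable[OF u]
  have "AE x in lborel. trunc (\<lambda>x. cnj (u x)) n x = 0" for n
  proof -
    define k where "k = trunc (\<lambda>x. cnj (u x)) n"
    have k: "integrable lborel k" "sqint k" unfolding k_def by (intro trunc sqint_cnj u)+
    have "complex_of_real (LINT x|lborel. (cmod (k x))\<^sup>2) = (LINT x|lborel. u x * k x)"
    proof -
      have "complex_of_real ((cmod (k x))\<^sup>2) = u x * k x" for x
        by (cases "x \<in> ball 0 (real n)") (simp_all add: k_def trunc_def complex_norm_square mult.commute del: of_real_power)
      then show ?thesis by (simp only: integral_complex_of_real[symmetric])
    qed
    also have "\<dots> = 0" using fourier_pairD(3)[OF p k] by simp
    finally show ?thesis using sqint_eq_0_AE[OF k(2)] by (simp add: k_def)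
  qed
  then have "AE x in lborel. \<forall>n. trunc (\<lambda>x. cnj (u x)) n x = 0" by (simp add: AE_all_countable)
  then show ?thesis
  proof eventually_elim
    case (elim x)
    obtain n where "norm x < real n" using reals_Archimedean2 by blast
    with elim[THEN spec, of n] show ?case by (simp add: trunc_def)
  qed
qed

lemma fourier_pair_unique:
  assumes "fourier_pair h u" "fourier_pair h u'"
  shows "AE x in lborel. u x = u' x"
  using fourier_pair_zero_imp[of "\<lambda>x. u x - u' x"] fourier_pair_diff[OF assms] by simp

lemma tendsto_integral_sqint:
  assumes u: "\<And>n. sqint (u n)" "sqint v" and k: "sqint k"
    and lim: "(\<lambda>n. LINT x|lborel. (cmod (u n x - v x))\<^sup>2) \<longlonglongrightarrow> 0"
  shows "(\<lambda>n. LINT x|lborel. u n x * k x) \<longlonglongrightarrow> (LINT x|lborel. v x * k x)"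
proof -
  let ?K = "sqrt (LINT x|lborel. (cmod (k x))\<^sup>2)"
  have le: "cmod ((LINT x|lborel. u n x * k x) - (LINT x|lborel. v x * k x)) \<le> sqrt (LINT x|lborel. (cmod (u n x - v x))\<^sup>2) * ?K" for n
  proof -
    have "(LINT x|lborel. u n x * k x) - (LINT x|lborel. v x * k x) = (LINT x|lborel. (u n x - v x) * k x)"
      by (subst Bochner_Integration.integral_diff[symmetric]) (auto intro!: sqint_mult_integrable u k simp: left_diff_distrib)
    then show ?thesis by (simp only: norm_integral_sqint_le[OF sqint_diff[OF u(1) u(2)] k])
  qed
  have "(\<lambda>n. sqrt (LINT x|lborel. (cmod (u n x - v x))\<^sup>2) * ?K) \<longlonglongrightarrow> sqrt 0 * ?K"
    by (intro tendsto_intros lim)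
  then have "(\<lambda>n. (LINT x|lborel. u n x * k x) - (LINT x|lborel. v x * k x)) \<longlonglongrightarrow> 0"
    by (intro Lim_null_comparison[OF always_eventually[OF allI[OF le]]]) simp
  then show ?thesis by (rule LIM_zero_cancel)
qed

lemma tendsto_norm_sqint:
  assumes u: "\<And>n. sqint (u n)" "sqint v"
    and lim: "(\<lambda>n. LINT x|lborel. (cmod (u n x - v x))\<^sup>2) \<longlonglongrightarrow> 0"
  shows "(\<lambda>n. LINT x|lborel. (cmod (u n x))\<^sup>2) \<longlonglongrightarrow> (LINT x|lborel. (cmod (v x))\<^sup>2)"
proof -
  have eq: "(LINT x|lborel. (cmod (u n x))\<^sup>2) = (LINT x|lborel. (cmod (u n x - v x))\<^sup>2)
     + 2 * Re (LINT x|lborel. u n x * cnj (v x)) - (LINT x|lborel. (cmod (v x))\<^sup>2)" for n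
  proof -
    have pt: "(cmod (u n x))\<^sup>2 = (cmod (u n x - v x))\<^sup>2 + 2 * Re (u n x * cnj (v x)) - (cmod (v x))\<^sup>2" for x
      by (simp add: cmod_power2) (simp add: power2_eq_square algebra_simps)
    have i: "integrable lborel (\<lambda>x. u n x * cnj (v x))" by (intro sqint_mult_integrable sqint_cnj u)
    define R where "R x = Re (u n x * cnj (v x))" for x
    have R: "integrable lborel R" "(LINT x|lborel. R x) = Re (LINT x|lborel. u n x * cnj (v x))"
      unfolding R_def using integrable_bounded_linear[OF bounded_linear_Re i] integral_bounded_linear[OF bounded_linear_Re i] by auto
    show ?thesis
      using R sqint_integrable[OF u(2)] sqint_integrable[OF sqint_diff[OF u(1)[of n] u(2)]]
      unfolding pt R_def[symmetric] by simp
  qed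
  have "(\<lambda>n. (LINT x|lborel. (cmod (u n x - v x))\<^sup>2)
     + 2 * Re (LINT x|lborel. u n x * cnj (v x)) - (LINT x|lborel. (cmod (v x))\<^sup>2)) \<longlonglongrightarrow>
     0 + 2 * Re (LINT x|lborel. v x * cnj (v x)) - (LINT x|lborel. (cmod (v x))\<^sup>2)"
    by (intro tendsto_intros lim tendsto_integral_sqint u sqint_cnj)
  moreover have "Re (LINT x|lborel. v x * cnj (v x)) = (LINT x|lborel. (cmod (v x))\<^sup>2)"
    by (simp add: complex_norm_square[symmetric] integral_complex_of_real del: of_real_power)
  ultimately show ?thesis by (simp add: eq[symmetric])
qed

text \<open>The transforms of the truncations of \<open>h\<close> form a Cauchy sequence in \<open>L\<^sup>2\<close> by Plancherel's theorem, and the defining identity and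
the norm pass to the limit.\<close>
lemma fourier_pair_ex:
  fixes h :: "'a::euclidean_space \<Rightarrow> complex"
  assumes h: "sqint h"
  shows "\<exists>u. fourier_pair h u \<and> (LINT x|lborel. (cmod (u x))\<^sup>2) = (LINT x|lborel. (cmod (h x))\<^sup>2)"
proof -
  define H where "H n = trunc h n" for n
  have H: "sqint (H n)" "integrable lborel (H n)" for n unfolding H_def using h by (auto intro: trunc)
  have Hlim: "(\<lambda>n. LINT x|lborel. (cmod (H n x - h x))\<^sup>2) \<longlonglongrightarrow> 0"
    using trunc_L2[OF h] by (simp add: H_def norm_minus_commute)
  have F: "sqint (fourier (H n))" for n by (rule plancherel_L1[OF H(2,1)])
  have dist: "(LINT x|lborel. (cmod (fourier (H i) x - fourier (H j) x))\<^sup>2) = (LINT x|lborel. (cmod (H i x - H j x))\<^sup>2)" for i j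
    using plancherel_L1(2)[of "\<lambda>x. H i x - H j x"] H by (simp add: fourier_diff sqint_diff)
  have tri: "(LINT x|lborel. (cmod (H i x - H j x))\<^sup>2) \<le> 2 * (LINT x|lborel. (cmod (H i x - h x))\<^sup>2) + 2 * (LINT x|lborel. (cmod (H j x - h x))\<^sup>2)" for i j
  proof -
    have pt: "(cmod (H i x - H j x))\<^sup>2 \<le> 2 * (cmod (H i x - h x))\<^sup>2 + 2 * (cmod (H j x - h x))\<^sup>2" for x
    proof -
      have "(cmod (H i x - H j x))\<^sup>2 \<le> (cmod (H i x - h x) + cmod (H j x - h x))\<^sup>2"
        using norm_triangle_ineq4[of "H i x - h x" "H j x - h x"] by (intro power_mono) auto
      also have "\<dots> \<le> 2 * (cmod (H i x - h x))\<^sup>2 + 2 * (cmod (H j x - h x))\<^sup>2"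
        using sum_squares_bound[of "cmod (H i x - h x)" "cmod (H j x - h x)"] by (simp add: power2_sum)
      finally show ?thesis .
    qed
    have i: "integrable lborel (\<lambda>x. (cmod (H i x - h x))\<^sup>2)" for i by (intro sqint_integrable sqint_diff H h)
    have "(LINT x|lborel. (cmod (H i x - H j x))\<^sup>2) \<le> (LINT x|lborel. 2 * (cmod (H i x - h x))\<^sup>2 + 2 * (cmod (H j x - h x))\<^sup>2)"
      using i by (intro integral_mono sqint_integrable sqint_diff H pt) auto
    then show ?thesis using i by simp
  qed
  have "\<exists>v. sqint v \<and> (\<lambda>n. LINT x|lborel. (cmod (fourier (H n) x - v x))\<^sup>2) \<longlonglongrightarrow> 0"
  proof (rule L2_complete[OF F])
    fix e :: real assume "e > 0"
    then obtain N where N: "\<And>n. n \<ge> N \<Longrightarrow> (LINT x|lborel. (cmod (H n x - h x))\<^sup>2) < e / 4"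
      using order_tendstoD(2)[OF Hlim, of "e / 4"] by (auto simp: eventually_sequentially)
    show "\<exists>N. \<forall>i\<ge>N. \<forall>j\<ge>N. (LINT x|lborel. (cmod (fourier (H i) x - fourier (H j) x))\<^sup>2) < e"
    proof (intro exI[of _ N] allI impI)
      fix i j assume "i \<ge> N" "j \<ge> N"
      then show "(LINT x|lborel. (cmod (fourier (H i) x - fourier (H j) x))\<^sup>2) < e"
        unfolding dist using tri[of i j] N[of i] N[of j] by simp
    qed
  qed
  then obtain v where v: "sqint v" "(\<lambda>n. LINT x|lborel. (cmod (fourier (H n) x - v x))\<^sup>2) \<longlonglongrightarrow> 0" by blast
  have "fourier_pair h v"
    unfolding fourier_pair_def
  proof (intro conjI h v(1) allI impI)
    fix k :: "'a \<Rightarrow> complex" assume k: "integrable lborel k" "sqint k"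
    have "(\<lambda>n. LINT x|lborel. fourier (H n) x * k x) \<longlonglongrightarrow> (LINT x|lborel. v x * k x)"
      by (intro tendsto_integral_sqint F v k)
    moreover have "(\<lambda>n. LINT x|lborel. fourier (H n) x * k x) \<longlonglongrightarrow> (LINT x|lborel. h x * fourier k x)"
      unfolding fourier_multiplication[OF H(2) k(1)]
      by (intro tendsto_integral_sqint H h Hlim plancherel_L1 k)
    ultimately show "(LINT x|lborel. v x * k x) = (LINT x|lborel. h x * fourier k x)"
      by (rule LIMSEQ_unique)
  qed
  moreover have "(LINT x|lborel. (cmod (v x))\<^sup>2) = (LINT x|lborel. (cmod (h x))\<^sup>2)"
    using LIMSEQ_unique[OF tendsto_norm_sqint[OF F v] tendsto_norm_sqint[OF H(1) h Hlim, folded plancherel_L1(2)[OF H(2,1)]]] .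
  ultimately show ?thesis by blast
qed

lemma fourier_pair_plancherel:
  assumes p: "fourier_pair h u"
  shows "(LINT x|lborel. (cmod (u x))\<^sup>2) = (LINT x|lborel. (cmod (h x))\<^sup>2)"
proof -
  obtain v where v: "fourier_pair h v" "(LINT x|lborel. (cmod (v x))\<^sup>2) = (LINT x|lborel. (cmod (h x))\<^sup>2)"
    using fourier_pair_ex[OF fourier_pairD(1)[OF p]] by blast
  note [measurable] = fourier_pairD(2)[OF p, THEN sqint_measurable] fourier_pairD(2)[OF v(1), THEN sqint_measurable]
  have "(LINT x|lborel. (cmod (u x))\<^sup>2) = (LINT x|lborel. (cmod (v x))\<^sup>2)"
    using fourier_pair_unique[OF p v(1)] by (intro integral_cong_AE) auto
  with v show ?thesis by simp
qed

lemma fourier_pair_trunc_L2: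
  assumes p: "fourier_pair h u"
  shows "(\<lambda>n. LINT x|lborel. (cmod (fourier (trunc h n) x - u x))\<^sup>2) \<longlonglongrightarrow> 0"
proof -
  have h: "sqint h" by (rule fourier_pairD[OF p])
  have "(LINT x|lborel. (cmod (fourier (trunc h n) x - u x))\<^sup>2) = (LINT x|lborel. (cmod (h x - trunc h n x))\<^sup>2)" for n
    using fourier_pair_plancherel[OF fourier_pair_diff[OF fourier_pair_L1[OF integrable_trunc[OF h] sqint_trunc[OF h]] p]]
    by (simp add: norm_minus_commute)
  then show ?thesis using trunc_L2[OF h] by simp
qed

lemma fourier_pair_multiplication:
  assumes p: "fourier_pair h u" and q: "fourier_pair k v"
  shows "(LINT x|lborel. u x * k x) = (LINT x|lborel. h x * v x)"
proof (rule LIMSEQ_unique)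
  note sq = fourier_pairD(1,2)[OF p] fourier_pairD(1,2)[OF q]
  show "(\<lambda>n. LINT x|lborel. u x * trunc k n x) \<longlonglongrightarrow> (LINT x|lborel. u x * k x)"
    using tendsto_integral_sqint[of "trunc k" k u] trunc_L2[OF sq(3)] sq
    by (simp add: sqint_trunc norm_minus_commute mult.commute)
  have "(\<lambda>n. LINT x|lborel. fourier (trunc k n) x * h x) \<longlonglongrightarrow> (LINT x|lborel. v x * h x)"
    by (intro tendsto_integral_sqint fourier_pair_trunc_L2 q sq plancherel_L1 integrable_trunc sqint_trunc)
  moreover have "(LINT x|lborel. u x * trunc k n x) = (LINT x|lborel. fourier (trunc k n) x * h x)" for n
    using fourier_pairD(3)[OF p integrable_trunc[OF sq(3)] sqint_trunc[OF sq(3)], of n] by (simp add: mult.commute)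
  ultimately show "(\<lambda>n. LINT x|lborel. u x * trunc k n x) \<longlonglongrightarrow> (LINT x|lborel. h x * v x)" by (simp add: mult.commute)
qed

lemma lborel_flip:
  fixes f :: "'a::euclidean_space \<Rightarrow> 'b::{banach, second_countable_topology}"
  assumes "f \<in> borel_measurable borel"
  shows "(LINT x|lborel. f (- x)) = (LINT x|lborel. f x)" "integrable lborel (\<lambda>x. f (- x)) \<longleftrightarrow> integrable lborel f"
  using lborel_affine_integral[of "-1" f 0] lborel_affine_integrable[of "-1" f 0] assms by auto

lemma sqint_flip: "sqint f \<Longrightarrow> sqint (\<lambda>x. f (- x))"
  unfolding sqint_def using lborel_flip(2)[of "\<lambda>x. (cmod (f x))\<^sup>2"] by auto

lemma fourier_pair_cnj:
  assumes p: "fourier_pair h u"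
  shows "fourier_pair (\<lambda>x. cnj (h x)) (\<lambda>x. cnj (u (- x)))"
  unfolding fourier_pair_def
proof (intro conjI allI impI sqint_cnj sqint_flip fourier_pairD[OF p])
  fix k :: "'a \<Rightarrow> complex" assume k: "integrable lborel k" "sqint k"
  note [measurable] = sqint_measurable[OF k(2)] fourier_pairD(2)[OF p, THEN sqint_measurable]
  define l where "l x = cnj (k (- x))" for x
  have l: "integrable lborel l" "sqint l"
    unfolding l_def using k lborel_flip(2)[of k] by (auto intro: sqint_cnj sqint_flip)
  have Fl: "fourier l x = cnj (fourier k x)" for x
  proof -
    have "fourier l x = (LINT \<xi>|lborel. cis (2 * pi * (x \<bullet> (- \<xi>))) * cnj (k \<xi>))"
      unfolding fourier_def l_def by (subst lborel_flip(1)[symmetric]) auto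
    then show ?thesis unfolding cnj_fourier by (simp add: fourier_def)
  qed
  have "(LINT x|lborel. cnj (u (- x)) * k x) = (LINT x|lborel. cnj (u x) * k (- x))"
    using lborel_flip(1)[of "\<lambda>x. cnj (u x) * k (- x)"] by simp
  also have "\<dots> = cnj (LINT x|lborel. u x * l x)"
    unfolding Bochner_Integration.integral_cnj[symmetric] by (simp add: l_def)
  also have "\<dots> = cnj (LINT x|lborel. h x * fourier l x)"
    using fourier_pairD(3)[OF p l] by simp
  also have "\<dots> = (LINT x|lborel. cnj (h x) * fourier k x)"
    unfolding Bochner_Integration.integral_cnj[symmetric] by (simp add: Fl)
  finally show "(LINT x|lborel. cnj (u (- x)) * k x) = (LINT x|lborel. cnj (h x) * fourier k x)" .
qed

text \<open>If \<open>w\<close> is a transform of the reflection of \<open>a\<close>, duality gives \<open>\<langle>w, u\<rangle> = |u|\<^sup>2\<close>, while \<open>w\<close> and \<open>u\<close> have the same norm; hence \<open>w = u\<close>.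
This makes \<open>L\<^sup>2\<close> inversion a consequence of Plancherel's theorem.\<close>
lemma fourier_pair_inverse:
  assumes q: "fourier_pair u a"
  shows "fourier_pair (\<lambda>x. a (- x)) u"
proof -
  have sq: "sqint u" "sqint a" by (rule fourier_pairD[OF q])+
  note [measurable] = sqint_measurable[OF sq(1)] sqint_measurable[OF sq(2)]
  define h where "h x = a (- x)" for x
  have h: "sqint h" unfolding h_def by (rule sqint_flip[OF sq(2)])
  obtain w where w: "fourier_pair h w" using fourier_pair_ex[OF h] by blast
  have sw: "sqint w" by (rule fourier_pairD[OF w])
  note [measurable] = sqint_measurable[OF sw]
  define N where "N = (LINT x|lborel. (cmod (u x))\<^sup>2)"
  have hN: "(LINT x|lborel. (cmod (h x))\<^sup>2) = N"
    unfolding h_def N_def using fourier_pair_plancherel[OF q] lborel_flip(1)[of "\<lambda>x. (cmod (a x))\<^sup>2"] by simp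
  have wN: "(LINT x|lborel. (cmod (w x))\<^sup>2) = N"
    using fourier_pair_plancherel[OF w] hN by simp
  have "(LINT x|lborel. w x * cnj (u x)) = (LINT x|lborel. h x * cnj (a (- x)))"
    by (rule fourier_pair_multiplication[OF w fourier_pair_cnj[OF q]])
  also have "\<dots> = complex_of_real N"
    unfolding hN[symmetric] integral_complex_of_real[symmetric] complex_norm_square by (simp add: h_def)
  finally have wu: "(LINT x|lborel. w x * cnj (u x)) = complex_of_real N" .
  have pt: "(cmod (w x - u x))\<^sup>2 = (cmod (w x))\<^sup>2 - 2 * Re (w x * cnj (u x)) + (cmod (u x))\<^sup>2" for x
    by (simp add: cmod_power2) (simp add: power2_eq_square algebra_simps)
  have i: "integrable lborel (\<lambda>x. w x * cnj (u x))" by (intro sqint_mult_integrable sqint_cnj sw sq)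
  have "(LINT x|lborel. (cmod (w x - u x))\<^sup>2) = N - 2 * Re (complex_of_real N) + N"
  proof -
    define R where "R x = Re (w x * cnj (u x))" for x
    have R: "integrable lborel R" "(LINT x|lborel. R x) = Re (LINT x|lborel. w x * cnj (u x))"
      unfolding R_def using integrable_bounded_linear[OF bounded_linear_Re i] integral_bounded_linear[OF bounded_linear_Re i] by auto
    show ?thesis
      unfolding pt R_def[symmetric] using R sqint_integrable[OF sw] sqint_integrable[OF sq(1)]
      by (simp add: wN wu N_def[symmetric])
  qed
  then have "AE x in lborel. w x - u x = 0"
    by (intro sqint_eq_0_AE sqint_diff sw sq) simp
  then show ?thesis
    unfolding h_def[symmetric]
    by (intro fourier_pair_cong_AE[OF w]) (use h in \<open>auto simp: sqint_def\<close>)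
qed

lemma fourier_pair_surj:
  assumes "sqint u"
  shows "\<exists>h. fourier_pair h u"
  using fourier_pair_ex[OF assms] fourier_pair_inverse by blast

section \<open>Test functions\<close>

text \<open>The function \<open>exp (- 1 / t)\<close> and its products with powers of \<open>1 / t\<close>, extended by zero. The family is closed
under differentiation up to linear combinations, which gives smoothness at once.\<close>
definition flat :: "nat \<Rightarrow> real \<Rightarrow> real" where
  "flat n t = (if t > 0 then exp (- inverse t) * inverse t ^ n else 0)"

lemma flat_at_0: "(flat n \<longlongrightarrow> 0) (at 0)"
proof -
  have "((\<lambda>s::real. s ^ n / exp s) \<longlongrightarrow> 0) at_top" by (rule tendsto_power_div_exp_0)
  then have "((\<lambda>t::real. inverse t ^ n / exp (inverse t)) \<longlongrightarrow> 0) (at_right 0)"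
    by (rule filterlim_compose[OF _ filterlim_inverse_at_top_right])
  then have right: "(flat n \<longlongrightarrow> 0) (at_right 0)"
    by (rule Lim_transform_eventually)
       (auto simp: eventually_at_filter flat_def exp_minus field_simps)
  have left: "(flat n \<longlongrightarrow> 0) (at_left 0)"
    by (rule tendsto_eventually) (auto simp: eventually_at_filter flat_def)
  show ?thesis using left right by (rule filterlim_split_at)
qed

lemma flat_has_derivative:
  "(flat n has_real_derivative - real n * flat (n + 1) t + flat (n + 2) t) (at t)"
proof -
  consider "t > 0" | "t < 0" | "t = 0" by linarith
  then show ?thesis
  proof cases
    case 1
    have "((\<lambda>t. exp (- inverse t) * inverse t ^ n) has_real_derivative - real n * flat (n + 1) t + flat (n + 2) t) (at t)"
      using 1
      by (auto intro!: derivative_eq_intros simp: flat_def power2_eq_square)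
         (cases n; simp add: field_simps power2_eq_square)
    then show ?thesis
      by (rule DERIV_cong_ev[OF refl _ refl, THEN iffD1, rotated])
         (use 1 eventually_gt_at_top in \<open>auto simp: flat_def intro!: eventually_nhds_in_open[of "{0<..}", THEN eventually_mono]\<close>)
  next
    case 2
    have "((\<lambda>t. 0) has_real_derivative - real n * flat (n + 1) t + flat (n + 2) t) (at t)"
      using 2 by (auto simp: flat_def)
    then show ?thesis
      by (rule DERIV_cong_ev[OF refl _ refl, THEN iffD1, rotated])
         (use 2 in \<open>auto simp: flat_def intro!: eventually_nhds_in_open[of "{..<0}", THEN eventually_mono]\<close>)
  next
    case 3
    have "((\<lambda>h. (flat n (0 + h) - flat n 0) / h) \<longlongrightarrow> 0) (at 0)"
    proof (rule Lim_transform_eventually[OF flat_at_0[of "n + 1"]])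
      show "eventually (\<lambda>h. flat (n + 1) h = (flat n (0 + h) - flat n 0) / h) (at 0)"
        by (auto simp: eventually_at_filter flat_def field_simps)
    qed
    then show ?thesis using 3 by (simp add: DERIV_def flat_def)
  qed
qed

lemma flat_nonneg: "0 \<le> flat n t"
  by (simp add: flat_def)

lemma power_le_fact_exp:
  fixes s :: real
  assumes "0 \<le> s"
  shows "s ^ n \<le> fact n * exp s"
proof -
  have "s ^ n /\<^sub>R fact n \<le> (\<Sum>k. s ^ k /\<^sub>R fact k)"
    using assms by (intro sum_le_suminf[of _ "{n}", simplified] summable_exp_generic) auto
  then show ?thesis by (simp add: exp_def field_simps)
qed

lemma flat_le: "flat n t \<le> fact n"
  using power_le_fact_exp[of "inverse t" n] by (auto simp: flat_def exp_minus field_simps)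

text \<open>A class of functions closed under partial derivatives and rich enough to contain a compactly supported bump
multiplied by cosines and sines. Membership therefore implies smoothness without any further argument about
iterated derivatives.\<close>
inductive elementary :: "(real^4 \<Rightarrow> real) \<Rightarrow> bool" where
  const: "elementary (\<lambda>x. c)"
| coord: "elementary (\<lambda>x. x $ i)"
| cos: "elementary (\<lambda>x. cos (a \<bullet> x))"
| sin: "elementary (\<lambda>x. sin (a \<bullet> x))"
| flat: "elementary (\<lambda>x. flat n (c - d * (x \<bullet> x)))"
| add: "elementary f \<Longrightarrow> elementary g \<Longrightarrow> elementary (\<lambda>x. f x + g x)"
| mult: "elementary f \<Longrightarrow> elementary g \<Longrightarrow> elementary (\<lambda>x. f x * g x)"

text \<open>A derivative given by a tuple of component functions, so that closure under differentiation can be stated for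
functions of \<open>x\<close> rather than for linear maps.\<close>
definition gradient :: "(real^4 \<Rightarrow> real) \<Rightarrow> (4 \<Rightarrow> real^4 \<Rightarrow> real) \<Rightarrow> bool" where
  "gradient f f' \<longleftrightarrow> (\<forall>x. (f has_derivative (\<lambda>h. \<Sum>i\<in>UNIV. h $ i * f' i x)) (at x))"

lemma gradient_partial:
  assumes "gradient f f'"
  shows "partial i f = f' i"
proof
  fix x
  have "frechet_derivative f (at x) = (\<lambda>h. \<Sum>i\<in>UNIV. h $ i * f' i x)"
    using assms by (auto simp: gradient_def intro!: frechet_derivative_at[symmetric])
  then show "partial i f x = f' i x"
    by (simp add: partial_def axis_def if_distrib if_distribR cong: if_cong)
qed

lemma gradient_differentiable: "gradient f f' \<Longrightarrow> f differentiable_on UNIV"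
  by (auto simp: gradient_def differentiable_on_def differentiable_def)

lemma gradient_const: "gradient (\<lambda>x. c) (\<lambda>i x. 0)"
  by (simp add: gradient_def)

lemma gradient_add:
  assumes "gradient f f'" "gradient g g'"
  shows "gradient (\<lambda>x. f x + g x) (\<lambda>i x. f' i x + g' i x)"
  unfolding gradient_def
proof
  fix x
  have "((\<lambda>x. f x + g x) has_derivative (\<lambda>h. (\<Sum>i\<in>UNIV. h $ i * f' i x) + (\<Sum>i\<in>UNIV. h $ i * g' i x))) (at x)"
    using assms by (intro has_derivative_add) (auto simp: gradient_def)
  then show "((\<lambda>x. f x + g x) has_derivative (\<lambda>h. \<Sum>i\<in>UNIV. h $ i * (f' i x + g' i x))) (at x)"
    by (simp add: distrib_left sum.distrib)
qed

lemma gradient_mult: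
  assumes "gradient f f'" "gradient g g'"
  shows "gradient (\<lambda>x. f x * g x) (\<lambda>i x. f x * g' i x + f' i x * g x)"
  unfolding gradient_def
proof
  fix x
  have "((\<lambda>x. f x * g x) has_derivative (\<lambda>h. f x * (\<Sum>i\<in>UNIV. h $ i * g' i x) + (\<Sum>i\<in>UNIV. h $ i * f' i x) * g x)) (at x)"
    using assms by (intro has_derivative_mult) (auto simp: gradient_def)
  then show "((\<lambda>x. f x * g x) has_derivative (\<lambda>h. \<Sum>i\<in>UNIV. h $ i * (f x * g' i x + f' i x * g x))) (at x)"
    by (simp add: distrib_left sum.distrib sum_distrib_left sum_distrib_right mult_ac)
qed

lemma inner_sum_coords: "(a::real^4) \<bullet> h = (\<Sum>i\<in>UNIV. h $ i * a $ i)"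
  by (simp add: inner_vec_def mult.commute)

lemma gradient_compose_linear:
  assumes "\<And>t. (F has_real_derivative F' t) (at t)"
  shows "gradient (\<lambda>x. F (a \<bullet> x)) (\<lambda>i x. F' (a \<bullet> x) * a $ i)"
  unfolding gradient_def
proof
  fix x
  have "((\<lambda>x. F (a \<bullet> x)) has_derivative (\<lambda>h. F' (a \<bullet> x) * (a \<bullet> h))) (at x)"
    by (rule has_derivative_compose[OF has_derivative_inner_right[OF has_derivative_ident] assms[unfolded has_field_derivative_def]])
  moreover have "F' (a \<bullet> x) * (a \<bullet> h) = (\<Sum>i\<in>UNIV. h $ i * (F' (a \<bullet> x) * a $ i))" for h
    by (subst inner_sum_coords[of a h]) (simp add: sum_distrib_left mult.left_commute)
  ultimately show "((\<lambda>x. F (a \<bullet> x)) has_derivative (\<lambda>h. \<Sum>i\<in>UNIV. h $ i * (F' (a \<bullet> x) * a $ i))) (at x)"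
    by (simp only:)
qed

lemma gradient_compose_radial:
  assumes "\<And>t. (F has_real_derivative F' t) (at t)"
  shows "gradient (\<lambda>x. F (c - d * (x \<bullet> x))) (\<lambda>i x. F' (c - d * (x \<bullet> x)) * (- 2 * d * x $ i))"
  unfolding gradient_def
proof
  fix x :: "real^4"
  have "((\<lambda>x. c - d * (x \<bullet> x)) has_derivative (\<lambda>h. - (d * (2 * (x \<bullet> h))))) (at x)"
    by (auto intro!: derivative_eq_intros simp: inner_commute)
  then have "((\<lambda>x. F (c - d * (x \<bullet> x))) has_derivative (\<lambda>h. F' (c - d * (x \<bullet> x)) * (- (d * (2 * (x \<bullet> h)))))) (at x)"
    by (rule has_derivative_compose[OF _ assms[unfolded has_field_derivative_def]])
  moreover have "F' (c - d * (x \<bullet> x)) * (- (d * (2 * (x \<bullet> h)))) = (\<Sum>i\<in>UNIV. h $ i * (F' (c - d * (x \<bullet> x)) * (- 2 * d * x $ i)))" for h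
    by (subst inner_sum_coords[of x h]) (simp add: sum_distrib_left sum_negf[symmetric] mult_ac)
  ultimately show "((\<lambda>x. F (c - d * (x \<bullet> x))) has_derivative (\<lambda>h. \<Sum>i\<in>UNIV. h $ i * (F' (c - d * (x \<bullet> x)) * (- 2 * d * x $ i)))) (at x)"
    by (simp only:)
qed

lemma gradient_coord: "gradient (\<lambda>x. x $ j) (\<lambda>i x. if i = j then 1 else 0)"
  unfolding gradient_def
proof
  fix x :: "real^4"
  have "((\<lambda>x. x $ j) has_derivative (\<lambda>h. h $ j)) (at x)"
    by (rule bounded_linear_imp_has_derivative[OF bounded_linear_vec_nth])
  then show "((\<lambda>x. x $ j) has_derivative (\<lambda>h. \<Sum>i\<in>UNIV. h $ i * (if i = j then 1 else 0))) (at x)"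
    by (simp add: if_distrib cong: if_cong)
qed

lemma elementary_gradient: "elementary f \<Longrightarrow> \<exists>f'. gradient f f' \<and> (\<forall>i. elementary (f' i))"
proof (induction rule: elementary.induct)
  case (const c)
  show ?case using gradient_const elementary.const by blast
next
  case (coord j)
  have "elementary (\<lambda>x. if i = j then 1 else 0)" for i by (simp add: elementary.const)
  then show ?case using gradient_coord[of j] by blast
next
  case (cos a)
  have "gradient (\<lambda>x. cos (a \<bullet> x)) (\<lambda>i x. - sin (a \<bullet> x) * a $ i)"
    by (rule gradient_compose_linear) (auto intro!: derivative_eq_intros)
  moreover have "elementary (\<lambda>x. - sin (a \<bullet> x) * a $ i)" for i
    using elementary.mult[OF elementary.sin[of a] elementary.const[of "- (a $ i)"]] by simp
  ultimately show ?case by blast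
next
  case (sin a)
  have "gradient (\<lambda>x. sin (a \<bullet> x)) (\<lambda>i x. cos (a \<bullet> x) * a $ i)"
    by (rule gradient_compose_linear) (auto intro!: derivative_eq_intros)
  moreover have "elementary (\<lambda>x. cos (a \<bullet> x) * a $ i)" for i
    by (intro elementary.intros)
  ultimately show ?case by blast
next
  case (flat n c d)
  have "gradient (\<lambda>x. flat n (c - d * (x \<bullet> x))) (\<lambda>i x. (- real n * flat (n + 1) (c - d * (x \<bullet> x)) + flat (n + 2) (c - d * (x \<bullet> x))) * (- 2 * d * x $ i))"
    by (rule gradient_compose_radial[OF flat_has_derivative])
  moreover have "elementary (\<lambda>x. (- real n * flat (n + 1) (c - d * (x \<bullet> x)) + flat (n + 2) (c - d * (x \<bullet> x))) * (- 2 * d * x $ i))" for i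
    by (intro elementary.intros)
  ultimately show ?case by blast
next
  case (add f g)
  then obtain f' g' where "gradient f f'" "\<forall>i. elementary (f' i)" "gradient g g'" "\<forall>i. elementary (g' i)" by blast
  then show ?case
    by (intro exI[of _ "\<lambda>i x. f' i x + g' i x"] conjI allI gradient_add elementary.add) auto
next
  case (mult f g)
  then obtain f' g' where "gradient f f'" "\<forall>i. elementary (f' i)" "gradient g g'" "\<forall>i. elementary (g' i)" by blast
  then show ?case
    by (intro exI[of _ "\<lambda>i x. f x * g' i x + f' i x * g x"] conjI allI gradient_mult elementary.add elementary.mult)
       (use mult.hyps in auto)
qed

lemma elementary_partial: "elementary f \<Longrightarrow> elementary (partial i f)"
  using elementary_gradient[of f] gradient_partial[of f] by metis

lemma elementary_differentiable: "elementary f \<Longrightarrow> f differentiable_on UNIV"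
  using elementary_gradient[of f] gradient_differentiable by blast

lemma elementary_foldr_partial: "elementary f \<Longrightarrow> elementary (foldr partial is f)"
  by (induction "is") (auto intro: elementary_partial)

lemma test_function_elementary:
  assumes "elementary \<phi>" and "\<And>x. \<phi> x \<noteq> 0 \<Longrightarrow> norm x \<le> r"
  shows "test_function \<phi>"
proof -
  have "bounded {x. \<phi> x \<noteq> 0}"
    using assms(2) by (auto simp: bounded_iff)
  then show ?thesis
    unfolding test_function_def
    using elementary_differentiable[OF elementary_foldr_partial[OF assms(1)]] by simp
qed

lemma test_functionD:
  assumes "test_function \<phi>"
  shows "\<phi> differentiable (at x)" "continuous_on UNIV \<phi>"
proof -
  have d: "\<phi> differentiable_on UNIV"
    using assms by (auto simp: test_function_def dest: spec[of _ "[]"])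
  then show "continuous_on UNIV \<phi>" by (rule differentiable_imp_continuous_on)
  from d show "\<phi> differentiable (at x)" by (simp add: differentiable_on_def)
qed

lemma partial_eq_0:
  assumes "x \<notin> closure {x. \<phi> x \<noteq> 0}"
  shows "partial i \<phi> x = 0"
proof -
  have o: "open (- closure {x. \<phi> x \<noteq> 0})" by (intro open_Compl closed_closure)
  have "((\<lambda>x. 0) has_derivative (\<lambda>h. 0)) (at x)" by simp
  then have "(\<phi> has_derivative (\<lambda>h. 0)) (at x)"
  proof (rule has_derivative_transform_within_open[OF _ o])
    show "0 = \<phi> y" if "y \<in> - closure {x. \<phi> x \<noteq> 0}" for y
      using that closure_subset[of "{x. \<phi> x \<noteq> 0}"] by auto
  qed (use assms in auto)
  then have "frechet_derivative \<phi> (at x) = (\<lambda>h. 0)" by (rule frechet_derivative_at[symmetric])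
  then show ?thesis by (simp add: partial_def)
qed

lemma test_function_partial:
  assumes "test_function \<phi>"
  shows "test_function (partial i \<phi>)"
  unfolding test_function_def
proof
  show "\<forall>is. foldr partial is (partial i \<phi>) differentiable_on UNIV"
  proof
    fix "is"
    show "foldr partial is (partial i \<phi>) differentiable_on UNIV"
      using assms unfolding test_function_def by (auto dest: spec[of _ "is @ [i]"])
  qed
  have "{x. partial i \<phi> x \<noteq> 0} \<subseteq> closure {x. \<phi> x \<noteq> 0}"
    using partial_eq_0 by auto
  moreover have "bounded (closure {x. \<phi> x \<noteq> 0})"
    using assms by (auto simp: test_function_def compact_imp_bounded)
  ultimately show "compact (closure {x. partial i \<phi> x \<noteq> 0})"
    by (auto intro: bounded_subset)
qed

lemma test_function_bounded_support:
  assumes "test_function \<phi>"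
  obtains M r where "0 \<le> M" "\<And>x. \<bar>\<phi> x\<bar> \<le> M" "\<And>x. r \<le> norm x \<Longrightarrow> \<phi> x = 0"
proof -
  let ?S = "closure {x. \<phi> x \<noteq> 0}"
  have S: "compact ?S" using assms by (simp add: test_function_def)
  have "compact (\<phi> ` ?S)"
    by (rule compact_continuous_image[OF continuous_on_subset[OF test_functionD(2)[OF assms] subset_UNIV] S])
  then obtain M where M: "\<And>x. x \<in> ?S \<Longrightarrow> \<bar>\<phi> x\<bar> \<le> M"
    using compact_imp_bounded by (force simp: bounded_iff)
  obtain r where r: "\<And>x. x \<in> ?S \<Longrightarrow> norm x \<le> r"
    using compact_imp_bounded[OF S] by (auto simp: bounded_iff)
  show ?thesis
  proof (rule that[of "max M 0" "r + 1"])
    show "\<bar>\<phi> x\<bar> \<le> max M 0" for x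
      using M[of x] closure_subset[of "{x. \<phi> x \<noteq> 0}"] by (cases "\<phi> x = 0") (auto simp: le_max_iff_disj)
    show "\<phi> x = 0" if "r + 1 \<le> norm x" for x
      using that r[of x] closure_subset[of "{x. \<phi> x \<noteq> 0}"] by (cases "\<phi> x = 0") auto
  qed simp
qed

lemma integrable_indicator_cball: "integrable lborel (indicator (cball 0 r) :: 'a::euclidean_space \<Rightarrow> real)"
  by (intro integrable_real_indicator) (auto intro: emeasure_bounded_finite[simplified])

lemma bounded_support_L12:
  fixes f :: "'a::euclidean_space \<Rightarrow> complex"
  assumes [measurable]: "f \<in> borel_measurable borel" and M: "\<And>x. cmod (f x) \<le> M" and r: "\<And>x. r < norm x \<Longrightarrow> f x = 0"
  shows "integrable lborel f" "sqint f"
proof -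
  show "integrable lborel f"
    by (rule Bochner_Integration.integrable_bound[OF integrable_mult_right[OF integrable_indicator_cball[of r], of M]])
       (use r in \<open>auto intro!: AE_I2 order_trans[OF M abs_ge_self] split: split_indicator\<close>)
  have "integrable lborel (\<lambda>x. (cmod (f x))\<^sup>2)"
  proof (rule Bochner_Integration.integrable_bound[OF integrable_mult_right[OF integrable_indicator_cball[of r], of "M\<^sup>2"]])
    show "AE x in lborel. norm ((cmod (f x))\<^sup>2) \<le> norm (M\<^sup>2 * indicator (cball 0 r) x)"
      by (rule AE_I2) (use r M in \<open>auto split: split_indicator intro!: power_mono\<close>)
  qed measurable
  then show "sqint f" by (simp add: sqint_def)
qed

lemma test_function_L12:
  assumes "test_function \<phi>"
  shows "(\<lambda>x. complex_of_real (\<phi> x)) \<in> borel_measurable borel"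
    "integrable lborel (\<lambda>x. complex_of_real (\<phi> x))" "sqint (\<lambda>x. complex_of_real (\<phi> x))"
proof -
  obtain M r where *: "\<And>x. \<bar>\<phi> x\<bar> \<le> M" "\<And>x. r \<le> norm x \<Longrightarrow> \<phi> x = 0"
    using test_function_bounded_support[OF assms] by metis
  have [measurable]: "\<phi> \<in> borel_measurable borel"
    by (rule borel_measurable_continuous_onI[OF test_functionD(2)[OF assms]])
  show m: "(\<lambda>x. complex_of_real (\<phi> x)) \<in> borel_measurable borel" by measurable
  show "integrable lborel (\<lambda>x. complex_of_real (\<phi> x))" "sqint (\<lambda>x. complex_of_real (\<phi> x))"
    using bounded_support_L12[OF m, of M r] * by auto
qed

lemma test_function_line_derivative:
  assumes "test_function \<phi>"
  shows "((\<lambda>t. \<phi> (x + t *\<^sub>R axis i 1)) has_real_derivative partial i \<phi> (x + s *\<^sub>R axis i 1)) (at s)"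
proof -
  let ?y = "x + s *\<^sub>R axis i 1"
  have d: "(\<phi> has_derivative frechet_derivative \<phi> (at ?y)) (at ?y)"
    using test_functionD(1)[OF assms] by (simp add: frechet_derivative_works)
  have "((\<lambda>t. x + t *\<^sub>R axis i (1::real)) has_derivative (\<lambda>h. h *\<^sub>R axis i 1)) (at s)"
    by (auto intro!: derivative_eq_intros)
  from has_derivative_compose[OF this d]
  have "((\<lambda>t. \<phi> (x + t *\<^sub>R axis i 1)) has_derivative (\<lambda>h. frechet_derivative \<phi> (at ?y) (h *\<^sub>R axis i 1))) (at s)" .
  moreover have "frechet_derivative \<phi> (at ?y) (h *\<^sub>R axis i 1) = partial i \<phi> ?y * h" for h
    using linear_scale[OF has_derivative_linear[OF d], of h "axis i 1"] by (simp add: partial_def)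
  ultimately show ?thesis by (simp add: has_field_derivative_def mult_commute_abs)
qed

text \<open>The transforms of the difference quotients are those of the function multiplied by an explicit factor; the quotients converge boundedly with
uniformly bounded support. The sign is opposite to that for densities, since here the derivative acts on the
integrated variable.\<close>
lemma fourier_partial:
  assumes t: "test_function \<phi>"
  shows "fourier (\<lambda>x. complex_of_real (partial i \<phi> x)) \<xi> = - (2 * pi * \<i> * \<xi> $ i) * fourier (\<lambda>x. complex_of_real (\<phi> x)) \<xi>"
proof -
  define e where "e = (axis i 1 :: real^4)"
  define \<tau> where "\<tau> n = 1 / real (Suc n)" for n
  have \<tau>: "\<tau> n > 0" "\<tau> n \<le> 1" for n by (auto simp: \<tau>_def)
  have \<tau>0: "\<tau> \<longlonglongrightarrow> 0" unfolding \<tau>_def using LIMSEQ_inverse_real_of_nat by (simp add: inverse_eq_divide)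
  have norm_e: "norm e = 1" by (simp add: e_def)
  define D where "D n x = complex_of_real ((\<phi> (x + \<tau> n *\<^sub>R e) - \<phi> x) / \<tau> n)" for n x
  note m [measurable] = test_function_L12(1)[OF t] test_function_L12(1)[OF test_function_partial[OF t, of i]]
  have [measurable]: "\<phi> \<in> borel_measurable borel"
    by (rule borel_measurable_continuous_onI[OF test_functionD(2)[OF t]])
  have shift_int: "integrable lborel (\<lambda>x. complex_of_real (\<phi> (x + a)))" for a
    using lborel_affine_integrable[of 1 "\<lambda>x. complex_of_real (\<phi> x)" a] test_function_L12(2)[OF t] by (simp add: add.commute)
  have shift: "fourier (\<lambda>x. complex_of_real (\<phi> (x + a))) \<xi> = cis (- 2 * pi * (\<xi> \<bullet> a)) * fourier (\<lambda>x. complex_of_real (\<phi> x)) \<xi>" for a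
  proof -
    have "fourier (\<lambda>x. complex_of_real (\<phi> (x + a))) \<xi> = (LINT x|lborel. cis (2 * pi * (\<xi> \<bullet> (- a + 1 *\<^sub>R x))) * complex_of_real (\<phi> (- a + 1 *\<^sub>R x + a)))"
      unfolding fourier_def by (subst lborel_affine_integral[of 1 _ "- a"]) auto
    also have "\<dots> = (LINT x|lborel. cis (- 2 * pi * (\<xi> \<bullet> a)) * (cis (2 * pi * (\<xi> \<bullet> x)) * complex_of_real (\<phi> x)))"
    proof (rule Bochner_Integration.integral_cong[OF refl])
      fix x
      have "2 * pi * (\<xi> \<bullet> (- a + 1 *\<^sub>R x)) = - 2 * pi * (\<xi> \<bullet> a) + 2 * pi * (\<xi> \<bullet> x)"
        by (simp add: inner_diff_right right_diff_distrib)
      then have "cis (2 * pi * (\<xi> \<bullet> (- a + 1 *\<^sub>R x))) = cis (- 2 * pi * (\<xi> \<bullet> a)) * cis (2 * pi * (\<xi> \<bullet> x))"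
        by (simp only: cis_mult)
      then show "cis (2 * pi * (\<xi> \<bullet> (- a + 1 *\<^sub>R x))) * complex_of_real (\<phi> (- a + 1 *\<^sub>R x + a))
        = cis (- 2 * pi * (\<xi> \<bullet> a)) * (cis (2 * pi * (\<xi> \<bullet> x)) * complex_of_real (\<phi> x))"
        by (simp only: mult.assoc) simp
    qed
    finally show ?thesis by (simp add: fourier_def)
  qed
  have FD: "fourier (D n) \<xi> = (cis (- 2 * pi * (\<tau> n * \<xi> $ i)) - 1) / \<tau> n * fourier (\<lambda>x. complex_of_real (\<phi> x)) \<xi>" for n
  proof -
    have "fourier (D n) \<xi> = fourier (\<lambda>x. (1 / \<tau> n) * (complex_of_real (\<phi> (x + \<tau> n *\<^sub>R e)) - complex_of_real (\<phi> x))) \<xi>"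
      by (simp add: D_def[abs_def])
    also have "\<dots> = (1 / \<tau> n) * (fourier (\<lambda>x. complex_of_real (\<phi> (x + \<tau> n *\<^sub>R e))) \<xi> - fourier (\<lambda>x. complex_of_real (\<phi> x)) \<xi>)"
      by (subst fourier_cmult, subst fourier_diff) (auto intro: shift_int test_function_L12(2)[OF t])
    also have "fourier (\<lambda>x. complex_of_real (\<phi> (x + \<tau> n *\<^sub>R e))) \<xi> = cis (- 2 * pi * (\<tau> n * \<xi> $ i)) * fourier (\<lambda>x. complex_of_real (\<phi> x)) \<xi>"
    proof -
      have "\<xi> \<bullet> (\<tau> n *\<^sub>R e) = \<tau> n * \<xi> $ i" by (simp add: e_def inner_axis)
      then show ?thesis unfolding shift by (simp only:)
    qed
    finally show ?thesis by (simp add: algebra_simps diff_divide_distrib)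
  qed
  have lim1: "(\<lambda>n. (cis (- 2 * pi * (\<tau> n * \<xi> $ i)) - 1) / \<tau> n) \<longlonglongrightarrow> - (2 * pi * \<i> * \<xi> $ i)"
  proof -
    define c where "c = - (2 * pi * \<i> * \<xi> $ i)"
    have "((\<lambda>z. exp (c * z)) has_field_derivative c) (at 0)"
      by (auto intro!: derivative_eq_intros)
    then have "((\<lambda>h. (exp (c * h) - 1) / h) \<longlongrightarrow> c) (at 0)" by (simp add: DERIV_def)
    moreover have "filterlim (\<lambda>n. complex_of_real (\<tau> n)) (at 0) sequentially"
      unfolding filterlim_at using \<tau>(1) \<tau>0 by (auto simp: less_imp_neq[symmetric] tendsto_of_real_iff[of \<tau> 0, simplified])
    ultimately have "(\<lambda>n. (exp (c * complex_of_real (\<tau> n)) - 1) / complex_of_real (\<tau> n)) \<longlonglongrightarrow> c"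
      by (rule filterlim_compose)
    moreover have "exp (c * complex_of_real (\<tau> n)) = cis (- 2 * pi * (\<tau> n * \<xi> $ i))" for n
      by (simp add: cis_conv_exp c_def mult_ac)
    ultimately show ?thesis by (simp only: c_def)
  qed
  obtain M r where M: "0 \<le> M" "\<And>x. \<bar>partial i \<phi> x\<bar> \<le> M" using test_function_bounded_support[OF test_function_partial[OF t, of i]] by metis
  obtain r where r: "\<And>x. r \<le> norm x \<Longrightarrow> \<phi> x = 0" using test_function_bounded_support[OF t] by metis
  have D_le: "cmod (D n x) \<le> M * indicator (cball 0 (r + 1)) x" for n x
  proof (cases "x \<in> cball 0 (r + 1)")
    case True
    have "\<exists>z. 0 < z \<and> z < \<tau> n \<and> \<phi> (x + \<tau> n *\<^sub>R e) - \<phi> (x + 0 *\<^sub>R e) = (\<tau> n - 0) * partial i \<phi> (x + z *\<^sub>R e)"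
      using \<tau>(1)[of n] test_function_line_derivative[OF t] unfolding e_def by (intro MVT2) auto
    then obtain z where "\<phi> (x + \<tau> n *\<^sub>R e) - \<phi> x = \<tau> n * partial i \<phi> (x + z *\<^sub>R e)" by auto
    then have "D n x = complex_of_real (partial i \<phi> (x + z *\<^sub>R e))" using \<tau>(1)[of n] by (simp add: D_def)
    then show ?thesis using True M(2) by simp
  next
    case False
    then have "r + 1 < norm x" by simp
    moreover have "norm x - \<tau> n \<le> norm (x + \<tau> n *\<^sub>R e)"
      using norm_triangle_ineq2[of x "- (\<tau> n *\<^sub>R e)"] \<tau>(1)[of n] by (simp add: norm_e)
    ultimately have "\<phi> x = 0" "\<phi> (x + \<tau> n *\<^sub>R e) = 0" using \<tau>(2)[of n] by (auto intro!: r)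
    then show ?thesis using M(1) by (simp add: D_def)
  qed
  have "(\<lambda>n. fourier (D n) \<xi>) \<longlonglongrightarrow> fourier (\<lambda>x. complex_of_real (partial i \<phi> x)) \<xi>"
    unfolding fourier_def
  proof (rule integral_dominated_convergence[where w="\<lambda>x. M * indicator (cball 0 (r + 1)) x"])
    show "AE x in lborel. (\<lambda>n. cis (2 * pi * (\<xi> \<bullet> x)) * D n x) \<longlonglongrightarrow> cis (2 * pi * (\<xi> \<bullet> x)) * complex_of_real (partial i \<phi> x)"
    proof (rule AE_I2)
      fix x
      have "((\<lambda>h. (\<phi> (x + h *\<^sub>R e) - \<phi> x) / h) \<longlongrightarrow> partial i \<phi> x) (at 0)"
        using test_function_line_derivative[OF t, of x i 0] by (simp add: DERIV_def e_def)
      then have "((\<lambda>h. (\<phi> (x + h *\<^sub>R e) - \<phi> x) / h) \<circ> \<tau>) \<longlonglongrightarrow> partial i \<phi> x"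
        using \<tau>0 \<tau>(1) by (subst (asm) tendsto_at_iff_sequentially) (auto simp: less_imp_neq[symmetric])
      then show "(\<lambda>n. cis (2 * pi * (\<xi> \<bullet> x)) * D n x) \<longlonglongrightarrow> cis (2 * pi * (\<xi> \<bullet> x)) * complex_of_real (partial i \<phi> x)"
        unfolding D_def comp_def by (intro tendsto_intros)
    qed
    show "AE x in lborel. norm (cis (2 * pi * (\<xi> \<bullet> x)) * D n x) \<le> M * indicator (cball 0 (r + 1)) x" for n
      using D_le by (auto simp: norm_mult)
    show "integrable lborel (\<lambda>x. M * indicator (cball 0 (r + 1)) x)"
      by (intro integrable_mult_right integrable_indicator_cball)
    show "(\<lambda>x. cis (2 * pi * (\<xi> \<bullet> x)) * D n x) \<in> borel_measurable lborel" for n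
      unfolding D_def by measurable
  qed measurable
  moreover have "(\<lambda>n. fourier (D n) \<xi>) \<longlonglongrightarrow> - (2 * pi * \<i> * \<xi> $ i) * fourier (\<lambda>x. complex_of_real (\<phi> x)) \<xi>"
    unfolding FD by (intro tendsto_intros lim1)
  ultimately show ?thesis by (rule LIMSEQ_unique)
qed

section \<open>The Sobolev space on the Fourier side\<close>

lemma elementary_gradient_partial:
  assumes "elementary f"
  shows "gradient f (\<lambda>i. partial i f)"
proof -
  obtain f' where f': "gradient f f'" using elementary_gradient[OF assms] by blast
  have "(\<lambda>i. partial i f) = f'" by (rule ext) (rule gradient_partial[OF f'])
  then show ?thesis using f' by simp
qed

lemma partial_mult:
  assumes "elementary f" "elementary g"
  shows "partial i (\<lambda>x. f x * g x) = (\<lambda>x. f x * partial i g x + partial i f x * g x)"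
  by (rule gradient_partial[OF gradient_mult]; rule elementary_gradient_partial; fact)

lemma partial_add:
  assumes "elementary f" "elementary g"
  shows "partial i (\<lambda>x. f x + g x) = (\<lambda>x. partial i f x + partial i g x)"
  by (rule gradient_partial[OF gradient_add]; rule elementary_gradient_partial; fact)

lemma partial_const: "partial i (\<lambda>x. c) = (\<lambda>x. 0)"
  by (rule gradient_partial[OF gradient_const])

lemma partial_coord: "partial i (\<lambda>x. x $ j) = (\<lambda>x. if i = j then 1 else 0)"
  by (rule gradient_partial[OF gradient_coord])

lemma partial_cos: "partial i (\<lambda>x. cos (a \<bullet> x)) = (\<lambda>x. - sin (a \<bullet> x) * a $ i)"
  by (rule gradient_partial[OF gradient_compose_linear]) (auto intro!: derivative_eq_intros)

lemma partial_sin: "partial i (\<lambda>x. sin (a \<bullet> x)) = (\<lambda>x. cos (a \<bullet> x) * a $ i)"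
  by (rule gradient_partial[OF gradient_compose_linear]) (auto intro!: derivative_eq_intros)

lemma partial_flat: "partial i (\<lambda>x. flat n (c - d * (x \<bullet> x))) =
    (\<lambda>x. (- real n * flat (n + 1) (c - d * (x \<bullet> x)) + flat (n + 2) (c - d * (x \<bullet> x))) * (- 2 * d * x $ i))"
  by (rule gradient_partial[OF gradient_compose_radial[OF flat_has_derivative]])

lemma second_partial_modulated:
  assumes b: "elementary b"
  shows "partial i (partial i (\<lambda>x. b x * cos (a \<bullet> x))) =
      (\<lambda>x. partial i (partial i b) x * cos (a \<bullet> x) - 2 * (a $ i) * (partial i b x * sin (a \<bullet> x)) - (a $ i)\<^sup>2 * (b x * cos (a \<bullet> x)))"
    and "partial i (partial i (\<lambda>x. b x * sin (a \<bullet> x))) =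
      (\<lambda>x. partial i (partial i b) x * sin (a \<bullet> x) + 2 * (a $ i) * (partial i b x * cos (a \<bullet> x)) - (a $ i)\<^sup>2 * (b x * sin (a \<bullet> x)))"
proof -
  note el = elementary.intros elementary_partial[OF b] b
  have s: "elementary (\<lambda>x. sin (a \<bullet> x) * k)" "elementary (\<lambda>x. cos (a \<bullet> x) * k)" for k by (intro el)+
  have ps: "partial i (\<lambda>x. sin (a \<bullet> x) * k) = (\<lambda>x. cos (a \<bullet> x) * a $ i * k)"
    and pc: "partial i (\<lambda>x. cos (a \<bullet> x) * k) = (\<lambda>x. - sin (a \<bullet> x) * a $ i * k)" for k
    unfolding partial_mult[OF elementary.sin elementary.const] partial_mult[OF elementary.cos elementary.const]
      partial_const partial_sin partial_cos by simp_all
  have c1: "partial i (\<lambda>x. b x * cos (a \<bullet> x)) = (\<lambda>x. b x * (sin (a \<bullet> x) * (- a $ i)) + partial i b x * cos (a \<bullet> x))"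
    unfolding partial_mult[OF b elementary.cos] partial_cos by simp
  have s1: "partial i (\<lambda>x. b x * sin (a \<bullet> x)) = (\<lambda>x. b x * (cos (a \<bullet> x) * (a $ i)) + partial i b x * sin (a \<bullet> x))"
    unfolding partial_mult[OF b elementary.sin] partial_sin by simp
  note pb = elementary_partial[OF b, of i]
  show "partial i (partial i (\<lambda>x. b x * cos (a \<bullet> x))) =
      (\<lambda>x. partial i (partial i b) x * cos (a \<bullet> x) - 2 * (a $ i) * (partial i b x * sin (a \<bullet> x)) - (a $ i)\<^sup>2 * (b x * cos (a \<bullet> x)))"
    unfolding c1 partial_add[OF elementary.mult[OF b s(1)] elementary.mult[OF pb elementary.cos]]
      partial_mult[OF b s(1)] partial_mult[OF pb elementary.cos] ps partial_cos
    by (simp add: fun_eq_iff power2_eq_square algebra_simps)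
  show "partial i (partial i (\<lambda>x. b x * sin (a \<bullet> x))) =
      (\<lambda>x. partial i (partial i b) x * sin (a \<bullet> x) + 2 * (a $ i) * (partial i b x * cos (a \<bullet> x)) - (a $ i)\<^sup>2 * (b x * sin (a \<bullet> x)))"
    unfolding s1 partial_add[OF elementary.mult[OF b s(2)] elementary.mult[OF pb elementary.sin]]
      partial_mult[OF b s(2)] partial_mult[OF pb elementary.sin] pc partial_sin
    by (simp add: fun_eq_iff power2_eq_square algebra_simps)
qed

text \<open>Bumps of radius \<open>n + 1\<close> that tend to the constant \<open>exp (- 1)\<close>, with derivatives of order \<open>1 / n\<close>. Normalising the limit
to one would only complicate the formulas.\<close>
definition cutoff :: "nat \<Rightarrow> real^4 \<Rightarrow> real" where
  "cutoff n x = flat 0 (1 - 1 / (real (Suc n))\<^sup>2 * (x \<bullet> x))"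

lemma elementary_cutoff: "elementary (cutoff n)"
  unfolding cutoff_def[abs_def] by (rule elementary.flat)

lemma cutoff_partial: "partial i (cutoff n) =
   (\<lambda>x. flat 2 (1 - 1 / (real (Suc n))\<^sup>2 * (x \<bullet> x)) * (- 2 / (real (Suc n))\<^sup>2 * x $ i))"
  unfolding cutoff_def[abs_def] partial_flat by (simp add: numeral_2_eq_2)

lemma cutoff_partial2: "partial i (partial i (cutoff n)) =
   (\<lambda>x. flat 2 (1 - 1 / (real (Suc n))\<^sup>2 * (x \<bullet> x)) * (- 2 / (real (Suc n))\<^sup>2)
      + (- 2 * flat 3 (1 - 1 / (real (Suc n))\<^sup>2 * (x \<bullet> x)) + flat 4 (1 - 1 / (real (Suc n))\<^sup>2 * (x \<bullet> x)))
         * (- 2 / (real (Suc n))\<^sup>2 * x $ i)\<^sup>2)"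
proof -
  define d where "d = 1 / (real (Suc n))\<^sup>2"
  define q where "q = - 2 / (real (Suc n))\<^sup>2"
  have q: "- 2 * d * y = q * y" for y by (simp add: q_def d_def)
  have el: "elementary (\<lambda>x. q * x $ i)" "elementary (\<lambda>x. flat 2 (1 - d * (x \<bullet> x)))"
    by (intro elementary.intros)+
  have lin: "partial i (\<lambda>x. q * x $ i) = (\<lambda>x. q)"
    unfolding partial_mult[OF elementary.const elementary.coord] partial_const partial_coord by simp
  have num: "(2::nat) + 1 = 3" "(2::nat) + 2 = 4" by auto
  show ?thesis
    unfolding cutoff_partial d_def[symmetric] q_def[symmetric] partial_mult[OF el(2,1)] lin partial_flat num q
    by (simp add: power2_eq_square fun_eq_iff mult_ac)
qed

lemma cutoff_support: "flat k (1 - 1 / (real (Suc n))\<^sup>2 * (x \<bullet> x)) \<noteq> 0 \<Longrightarrow> norm x \<le> real (Suc n)"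
proof -
  assume "flat k (1 - 1 / (real (Suc n))\<^sup>2 * (x \<bullet> x)) \<noteq> 0"
  then have "(x \<bullet> x) < (real (Suc n))\<^sup>2" by (simp add: flat_def field_simps split: if_splits)
  then have "(norm x)\<^sup>2 \<le> (real (Suc n))\<^sup>2" by (simp add: power2_norm_eq_inner)
  then show "norm x \<le> real (Suc n)" by (rule power2_le_imp_le) simp
qed

lemma cutoff_bounds:
  shows "\<bar>cutoff n x\<bar> \<le> 1"
    and "\<bar>partial i (cutoff n) x\<bar> \<le> 4 / real (Suc n)"
    and "\<bar>partial i (partial i (cutoff n)) x\<bar> \<le> 148 / real (Suc n)"
proof -
  let ?N = "real (Suc n)"
  let ?t = "1 - 1 / (real (Suc n))\<^sup>2 * (x \<bullet> x)"
  have N: "?N \<ge> 1" by simp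
  show "\<bar>cutoff n x\<bar> \<le> 1"
    using flat_le[of 0 ?t] flat_nonneg[of 0 ?t] by (simp add: cutoff_def)
  (* flat k is at most k!, which gives 2 * 6 + 24 = 36; below, 148 = 2 * 2 + 36 * 4 *)
  have f: "\<bar>flat 2 ?t\<bar> \<le> 2" "\<bar>- 2 * flat 3 ?t + flat 4 ?t\<bar> \<le> 36"
    using flat_le[of 2 ?t] flat_nonneg[of 2 ?t] flat_le[of 3 ?t] flat_nonneg[of 3 ?t] flat_le[of 4 ?t] flat_nonneg[of 4 ?t]
    by (auto simp: fact_numeral)
  have "\<bar>partial i (cutoff n) x\<bar> \<le> 4 / ?N \<and> \<bar>partial i (partial i (cutoff n)) x\<bar> \<le> 148 / ?N"
  proof (cases "norm x \<le> ?N")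
    case True
    have xi: "\<bar>- 2 / ?N\<^sup>2 * x $ i\<bar> \<le> 2 / ?N"
    proof -
      have "\<bar>x $ i\<bar> \<le> ?N" using component_le_norm_cart[of x i] True by simp
      then have "2 / ?N\<^sup>2 * \<bar>x $ i\<bar> \<le> 2 / ?N\<^sup>2 * ?N" by (intro mult_left_mono) auto
      also have "\<dots> = 2 / ?N" by (simp add: power2_eq_square del: of_nat_Suc)
      finally show ?thesis by (simp add: abs_mult)
    qed
    have "\<bar>flat 2 ?t * (- 2 / ?N\<^sup>2 * x $ i)\<bar> \<le> 2 * (2 / ?N)"
      unfolding abs_mult[of "flat 2 ?t"] by (intro mult_mono f xi) auto
    moreover have "\<bar>flat 2 ?t * (- 2 / ?N\<^sup>2)\<bar> \<le> 2 * (2 / ?N)"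
    proof -
      have "2 / ?N\<^sup>2 \<le> 2 / ?N" using N by (intro divide_left_mono) (auto simp: power2_eq_square)
      then show ?thesis unfolding abs_mult by (intro mult_mono f) auto
    qed
    moreover have "\<bar>(- 2 * flat 3 ?t + flat 4 ?t) * (- 2 / ?N\<^sup>2 * x $ i)\<^sup>2\<bar> \<le> 36 * (4 / ?N)"
    proof -
      have "(- 2 / ?N\<^sup>2 * x $ i)\<^sup>2 \<le> (2 / ?N)\<^sup>2"
        using xi by (subst abs_le_square_iff[symmetric]) simp
      also have "\<dots> = 4 / ?N\<^sup>2" by (simp add: power_divide del: of_nat_Suc)
      also have "\<dots> \<le> 4 / ?N" using N by (intro divide_left_mono) (auto simp: power2_eq_square)
      finally show ?thesis unfolding abs_mult by (intro mult_mono f) auto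
    qed
    ultimately show ?thesis
      unfolding cutoff_partial2 unfolding cutoff_partial
      by (intro conjI order_trans[OF abs_triangle_ineq]) (auto simp del: of_nat_Suc)
  next
    case False
    then have "flat k ?t = 0" for k using cutoff_support[of k n x] by auto
    then show ?thesis unfolding cutoff_partial2 unfolding cutoff_partial by simp
  qed
  then show "\<bar>partial i (cutoff n) x\<bar> \<le> 4 / ?N" "\<bar>partial i (partial i (cutoff n)) x\<bar> \<le> 148 / ?N" by auto
qed

lemma cutoff_tendsto: "(\<lambda>n. cutoff n x) \<longlonglongrightarrow> exp (- 1)"
proof -
  have "isCont (flat 0) 1"
    using flat_has_derivative[of 0 1] by (rule DERIV_isCont)
  moreover have "(\<lambda>n. 1 - 1 / (real (Suc n))\<^sup>2 * (x \<bullet> x)) \<longlonglongrightarrow> 1"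
  proof -
    have "(\<lambda>n. 1 - (1 / real (Suc n))\<^sup>2 * (x \<bullet> x)) \<longlonglongrightarrow> 1 - 0\<^sup>2 * (x \<bullet> x)"
      using LIMSEQ_inverse_real_of_nat by (intro tendsto_intros) (simp add: inverse_eq_divide)
    then show ?thesis by (simp add: power_divide)
  qed
  ultimately have "(\<lambda>n. flat 0 (1 - 1 / (real (Suc n))\<^sup>2 * (x \<bullet> x))) \<longlonglongrightarrow> flat 0 1"
    by (rule isCont_tendsto_compose)
  then show ?thesis by (simp add: cutoff_def flat_def)
qed

lemma continuous_elementary: "elementary f \<Longrightarrow> continuous_on UNIV f"
  by (rule differentiable_imp_continuous_on[OF elementary_differentiable])

text \<open>A bounded sequence of compactly supported multipliers with constant limit \<open>\<kappa>\<close> acts on the \<open>L\<^sup>2\<close> transform as \<open>\<kappa>\<close> in the limit, by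
Plancherel's theorem and dominated convergence; the cut functions are integrable, so their transforms are honest integrals.\<close>
lemma multiplier_limit:
  fixes u :: "'a::euclidean_space \<Rightarrow> complex" and m :: "nat \<Rightarrow> 'a \<Rightarrow> real"
  assumes p: "fourier_pair u a" and m: "\<And>n. m n \<in> borel_measurable borel"
    and B: "\<And>n x. \<bar>m n x\<bar> \<le> B" and r: "\<And>n x. r n < norm x \<Longrightarrow> m n x = 0"
    and lim: "\<And>x. (\<lambda>n. m n x) \<longlonglongrightarrow> \<kappa>"
  shows "integrable lborel (\<lambda>x. complex_of_real (m n x) * u x)" (is "?A n")
    and "sqint (\<lambda>\<xi>. fourier (\<lambda>x. complex_of_real (m n x) * u x) \<xi> - \<kappa> * a \<xi>)" (is "?B n")
    and "(\<lambda>n. LINT \<xi>|lborel. (cmod (fourier (\<lambda>x. complex_of_real (m n x) * u x) \<xi> - \<kappa> * a \<xi>))\<^sup>2) \<longlonglongrightarrow> 0"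
proof -
  note [measurable] = m fourier_pairD(1)[OF p, THEN sqint_measurable]
  have mm: "(\<lambda>x. complex_of_real (m n x)) \<in> borel_measurable borel" for n by measurable
  have sm: "sqint (\<lambda>x. complex_of_real (m n x))" for n
    using bounded_support_L12(2)[OF mm, of n B "r n"] B r by auto
  show i: "?A n" for n
    by (rule sqint_mult_integrable[OF sm fourier_pairD(1)[OF p]])
  have Bu: "sqint (\<lambda>x. complex_of_real B * u x)" by (rule sqint_cmult[OF fourier_pairD(1)[OF p]])
  have s: "sqint (\<lambda>x. complex_of_real (m n x) * u x)" for n
  proof (rule sqint_bound[OF Bu])
    show "cmod (complex_of_real (m n x) * u x) \<le> cmod (complex_of_real B * u x)" for x
      using B[of n x] by (auto simp: norm_mult intro!: mult_right_mono)
  qed measurable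
  have d: "fourier_pair (\<lambda>x. complex_of_real (m n x) * u x - \<kappa> * u x) (\<lambda>\<xi>. fourier (\<lambda>x. complex_of_real (m n x) * u x) \<xi> - \<kappa> * a \<xi>)" for n
    by (intro fourier_pair_diff fourier_pair_L1 fourier_pair_cmult i s p)
  then show "?B n" for n by (rule fourier_pairD)
  have "(\<lambda>n. LINT x|lborel. (cmod (complex_of_real (m n x) * u x - \<kappa> * u x))\<^sup>2) \<longlonglongrightarrow> (LINT x|(lborel::'a measure). (0::real))"
  proof (rule integral_dominated_convergence[where w="\<lambda>x. (B + \<bar>\<kappa>\<bar>)\<^sup>2 * (cmod (u x))\<^sup>2"])
    have eq: "(cmod (complex_of_real (m n x) * u x - \<kappa> * u x))\<^sup>2 = \<bar>m n x - \<kappa>\<bar>\<^sup>2 * (cmod (u x))\<^sup>2" for n x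
      by (simp add: left_diff_distrib[symmetric] norm_mult power_mult_distrib of_real_diff[symmetric] del: of_real_diff)
    show "AE x in lborel. (\<lambda>n. (cmod (complex_of_real (m n x) * u x - \<kappa> * u x))\<^sup>2) \<longlonglongrightarrow> 0"
    proof (rule AE_I2)
      fix x
      have "(\<lambda>n. \<bar>m n x - \<kappa>\<bar>\<^sup>2 * (cmod (u x))\<^sup>2) \<longlonglongrightarrow> \<bar>\<kappa> - \<kappa>\<bar>\<^sup>2 * (cmod (u x))\<^sup>2"
        by (intro tendsto_intros lim)
      then show "(\<lambda>n. (cmod (complex_of_real (m n x) * u x - \<kappa> * u x))\<^sup>2) \<longlonglongrightarrow> 0" unfolding eq by simp
    qed
    have "\<bar>m n x - \<kappa>\<bar> \<le> B + \<bar>\<kappa>\<bar>" for n x using B[of n x] by linarith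
    then have "\<bar>m n x - \<kappa>\<bar>\<^sup>2 * (cmod (u x))\<^sup>2 \<le> (B + \<bar>\<kappa>\<bar>)\<^sup>2 * (cmod (u x))\<^sup>2" for n x
      by (intro mult_right_mono power_mono) simp_all
    then show "AE x in lborel. norm ((cmod (complex_of_real (m n x) * u x - \<kappa> * u x))\<^sup>2) \<le> (B + \<bar>\<kappa>\<bar>)\<^sup>2 * (cmod (u x))\<^sup>2" for n
      unfolding eq by (intro AE_I2) (simp only: real_norm_def abs_mult abs_power2)
    show "integrable lborel (\<lambda>x. (B + \<bar>\<kappa>\<bar>)\<^sup>2 * (cmod (u x))\<^sup>2)"
      by (intro integrable_mult_right sqint_integrable fourier_pairD[OF p])
  qed measurable
  then show "(\<lambda>n. LINT \<xi>|lborel. (cmod (fourier (\<lambda>x. complex_of_real (m n x) * u x) \<xi> - \<kappa> * a \<xi>))\<^sup>2) \<longlonglongrightarrow> 0"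
    by (simp add: fourier_pair_plancherel[OF d])
qed

text \<open>The weak derivative is tested with \<open>cutoff n\<close> times a cosine or sine of frequency \<open>\<xi>\<close>. For each \<open>\<xi>\<close> this is an exact identity
between transforms of cut functions; the terms in which the cutoff is differentiated vanish in \<open>L\<^sup>2\<close> as \<open>n\<close> grows, by \<open>multiplier_limit\<close>,
and a subsequence converges almost everywhere.\<close>
lemma fourier_second_weak_derivative:
  fixes u g :: "real^4 \<Rightarrow> complex"
  assumes pu: "fourier_pair u a" and pg: "fourier_pair g c"
    and weak: "\<And>\<phi>. test_function \<phi> \<Longrightarrow>
      (LINT x|lborel. complex_of_real (partial i (partial i \<phi>) x) * u x) = (LINT x|lborel. complex_of_real (\<phi> x) * g x)"
  shows "AE \<xi> in lborel. c \<xi> = - complex_of_real (4 * pi\<^sup>2 * (\<xi> $ i)\<^sup>2) * a \<xi>"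
proof -
  define b1 where "b1 n = partial i (cutoff n)" for n
  define b2 where "b2 n = partial i (partial i (cutoff n))" for n
  have el: "elementary (cutoff n)" "elementary (b1 n)" "elementary (b2 n)" for n
    unfolding b1_def b2_def by (intro elementary_partial elementary_cutoff)+
  note m = el[THEN continuous_elementary, THEN borel_measurable_continuous_onI]
  have supp: "cutoff n x = 0" "b1 n x = 0" "b2 n x = 0" if "real (Suc n) < norm x" for n x
  proof -
    have "flat k (1 - 1 / (real (Suc n))\<^sup>2 * (x \<bullet> x)) = 0" for k using cutoff_support[of k n x] that by auto
    then show "cutoff n x = 0" "b1 n x = 0" "b2 n x = 0"
      unfolding b1_def b2_def cutoff_partial2 unfolding cutoff_partial cutoff_def by auto
  qed
  have inv0: "(\<lambda>n. K / real (Suc n)) \<longlonglongrightarrow> 0" for K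
    using tendsto_mult[OF tendsto_const[of K] LIMSEQ_inverse_real_of_nat] by (simp add: field_simps)
  have le1: "K / real (Suc n) \<le> K" if "0 \<le> K" for K n
    using that by (simp add: field_simps mult_left_le)
  have bd: "\<bar>b1 n x\<bar> \<le> 4" "\<bar>b2 n x\<bar> \<le> 148" for n x
    using cutoff_bounds(2)[of i n x] cutoff_bounds(3)[of i n x] le1[of 4 n] le1[of 148 n] by (auto simp: b1_def b2_def)
  have lim: "(\<lambda>n. b1 n x) \<longlonglongrightarrow> 0" "(\<lambda>n. b2 n x) \<longlonglongrightarrow> 0" for x
  proof -
    show "(\<lambda>n. b1 n x) \<longlonglongrightarrow> 0"
      by (rule Lim_null_comparison[OF always_eventually inv0[of 4]]) (auto simp: b1_def simp del: of_nat_Suc intro!: cutoff_bounds)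
    show "(\<lambda>n. b2 n x) \<longlonglongrightarrow> 0"
      by (rule Lim_null_comparison[OF always_eventually inv0[of 148]]) (auto simp: b2_def simp del: of_nat_Suc intro!: cutoff_bounds)
  qed
  define \<kappa> where "\<kappa> = exp (- 1 :: real)"
  have \<kappa>: "\<kappa> \<noteq> 0" by (simp add: \<kappa>_def)
  define G where "G n = fourier (\<lambda>x. complex_of_real (cutoff n x) * g x)" for n
  define U where "U n = fourier (\<lambda>x. complex_of_real (cutoff n x) * u x)" for n
  define U1 where "U1 n = fourier (\<lambda>x. complex_of_real (b1 n x) * u x)" for n
  define U2 where "U2 n = fourier (\<lambda>x. complex_of_real (b2 n x) * u x)" for n
  note mG = multiplier_limit[OF pg m(1) cutoff_bounds(1) supp(1) cutoff_tendsto[folded \<kappa>_def], folded G_def]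
  note mU = multiplier_limit[OF pu m(1) cutoff_bounds(1) supp(1) cutoff_tendsto[folded \<kappa>_def], folded U_def]
  note mU1 = multiplier_limit[OF pu m(2) bd(1) supp(2) lim(1), folded U1_def]
  note mU2 = multiplier_limit[OF pu m(3) bd(2) supp(3) lim(2), folded U2_def]
  have id: "G n \<xi> = U2 n \<xi> + 2 * \<i> * complex_of_real (2 * pi * \<xi> $ i) * U1 n \<xi> - complex_of_real ((2 * pi * \<xi> $ i)\<^sup>2) * U n \<xi>" for n \<xi>
  proof -
    (* real and imaginary parts are needed separately because test functions are real valued *)
    define \<omega> where "\<omega> = (2 * pi) *\<^sub>R \<xi>"
    have \<omega>i: "\<omega> $ i = 2 * pi * \<xi> $ i" by (simp add: \<omega>_def)
    have cis: "cis (2 * pi * (\<xi> \<bullet> x)) = complex_of_real (cos (\<omega> \<bullet> x)) + \<i> * complex_of_real (sin (\<omega> \<bullet> x))" for x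
      by (simp add: \<omega>_def complex_eq_iff)
    define C where "C f v = (LINT x|lborel. complex_of_real (f x * cos (\<omega> \<bullet> x)) * v x)" for f :: "real^4 \<Rightarrow> real" and v :: "real^4 \<Rightarrow> complex"
    define S where "S f v = (LINT x|lborel. complex_of_real (f x * sin (\<omega> \<bullet> x)) * v x)" for f :: "real^4 \<Rightarrow> real" and v :: "real^4 \<Rightarrow> complex"
    have int: "integrable lborel (\<lambda>x. complex_of_real (f x * cos (\<omega> \<bullet> x)) * v x)"
        "integrable lborel (\<lambda>x. complex_of_real (f x * sin (\<omega> \<bullet> x)) * v x)"
      if "integrable lborel (\<lambda>x. complex_of_real (f x) * v x)" for f v
    proof -
      have [measurable]: "(\<lambda>x. complex_of_real (f x) * v x) \<in> borel_measurable borel" using borel_measurable_integrable[OF that] by simp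
      have "integrable lborel (\<lambda>x. complex_of_real (cos (\<omega> \<bullet> x)) * (complex_of_real (f x) * v x))"
        by (rule Bochner_Integration.integrable_bound[OF that]) (auto simp: norm_mult mult_left_le_one_le)
      then show "integrable lborel (\<lambda>x. complex_of_real (f x * cos (\<omega> \<bullet> x)) * v x)" by (simp add: mult_ac)
      have "integrable lborel (\<lambda>x. complex_of_real (sin (\<omega> \<bullet> x)) * (complex_of_real (f x) * v x))"
        by (rule Bochner_Integration.integrable_bound[OF that]) (auto simp: norm_mult mult_left_le_one_le)
      then show "integrable lborel (\<lambda>x. complex_of_real (f x * sin (\<omega> \<bullet> x)) * v x)" by (simp add: mult_ac)
    qed
    have F: "fourier (\<lambda>x. complex_of_real (f x) * v x) \<xi> = C f v + \<i> * S f v"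
      if "integrable lborel (\<lambda>x. complex_of_real (f x) * v x)" for f v
    proof -
      have "fourier (\<lambda>x. complex_of_real (f x) * v x) \<xi> = (LINT x|lborel. complex_of_real (f x * cos (\<omega> \<bullet> x)) * v x + \<i> * (complex_of_real (f x * sin (\<omega> \<bullet> x)) * v x))"
        unfolding fourier_def cis by (intro Bochner_Integration.integral_cong) (auto simp: algebra_simps)
      also have "\<dots> = C f v + \<i> * S f v"
        using int[OF that] by (simp add: C_def S_def)
      finally show ?thesis .
    qed
    note i = mG(1)[where n=n] mU(1)[where n=n] mU1(1)[where n=n] mU2(1)[where n=n]
    have tf: "test_function (\<lambda>x. cutoff n x * cos (\<omega> \<bullet> x))" "test_function (\<lambda>x. cutoff n x * sin (\<omega> \<bullet> x))"
      using supp(1)[of n] by (intro test_function_elementary[of _ "real (Suc n)"] elementary.mult el elementary.intros; force)+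
    have "C (cutoff n) g = (LINT x|lborel. complex_of_real (b2 n x * cos (\<omega> \<bullet> x)) * u x
        - complex_of_real (2 * (\<omega> $ i)) * (complex_of_real (b1 n x * sin (\<omega> \<bullet> x)) * u x)
        - complex_of_real ((\<omega> $ i)\<^sup>2) * (complex_of_real (cutoff n x * cos (\<omega> \<bullet> x)) * u x))"
      unfolding C_def weak[OF tf(1), symmetric] second_partial_modulated(1)[OF el(1)] b2_def[symmetric] unfolding b1_def[symmetric]
      by (intro Bochner_Integration.integral_cong) (auto simp: algebra_simps)
    also have "\<dots> = C (b2 n) u - complex_of_real (2 * (\<omega> $ i)) * S (b1 n) u - complex_of_real ((\<omega> $ i)\<^sup>2) * C (cutoff n) u"
      using int[OF i(2)] int[OF i(3)] int[OF i(4)] by (simp add: C_def S_def)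
    finally have Cg: "C (cutoff n) g = \<dots>" .
    have "S (cutoff n) g = (LINT x|lborel. complex_of_real (b2 n x * sin (\<omega> \<bullet> x)) * u x
        + complex_of_real (2 * (\<omega> $ i)) * (complex_of_real (b1 n x * cos (\<omega> \<bullet> x)) * u x)
        - complex_of_real ((\<omega> $ i)\<^sup>2) * (complex_of_real (cutoff n x * sin (\<omega> \<bullet> x)) * u x))"
      unfolding S_def weak[OF tf(2), symmetric] second_partial_modulated(2)[OF el(1)] b2_def[symmetric] unfolding b1_def[symmetric]
      by (intro Bochner_Integration.integral_cong) (auto simp: algebra_simps)
    also have "\<dots> = S (b2 n) u + complex_of_real (2 * (\<omega> $ i)) * C (b1 n) u - complex_of_real ((\<omega> $ i)\<^sup>2) * S (cutoff n) u"
      using int[OF i(2)] int[OF i(3)] int[OF i(4)] by (simp add: C_def S_def)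
    finally have Sg: "S (cutoff n) g = \<dots>" .
    have ii: "\<i> * (\<i> * z) = - z" for z by (simp add: mult.assoc[symmetric])
    have "G n \<xi> = C (cutoff n) g + \<i> * S (cutoff n) g" unfolding G_def by (rule F[OF i(1)])
    moreover have "U n \<xi> = C (cutoff n) u + \<i> * S (cutoff n) u" unfolding U_def by (rule F[OF i(2)])
    moreover have "U1 n \<xi> = C (b1 n) u + \<i> * S (b1 n) u" unfolding U1_def by (rule F[OF i(3)])
    moreover have "U2 n \<xi> = C (b2 n) u + \<i> * S (b2 n) u" unfolding U2_def by (rule F[OF i(4)])
    ultimately show ?thesis
      unfolding Cg Sg \<omega>i[symmetric] by (simp add: algebra_simps ii)
  qed
  (* one integrable quantity controls all four transforms, so a single subsequence suffices *)
  define s where "s n \<xi> = (cmod (G n \<xi> - \<kappa> * c \<xi>))\<^sup>2 + (cmod (U n \<xi> - \<kappa> * a \<xi>))\<^sup>2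
      + (cmod (U1 n \<xi> - (0::real) * a \<xi>))\<^sup>2 + (cmod (U2 n \<xi> - (0::real) * a \<xi>))\<^sup>2" for n \<xi>
  note sqi = mG(2)[THEN sqint_integrable] mU(2)[THEN sqint_integrable] mU1(2)[THEN sqint_integrable] mU2(2)[THEN sqint_integrable]
  have s_int: "integrable lborel (s n)" for n
    unfolding s_def by (intro Bochner_Integration.integrable_add sqi)
  have s_eq: "(LINT \<xi>|lborel. norm (s n \<xi>)) = (LINT \<xi>|lborel. (cmod (G n \<xi> - \<kappa> * c \<xi>))\<^sup>2) + (LINT \<xi>|lborel. (cmod (U n \<xi> - \<kappa> * a \<xi>))\<^sup>2)
      + (LINT \<xi>|lborel. (cmod (U1 n \<xi> - (0::real) * a \<xi>))\<^sup>2) + (LINT \<xi>|lborel. (cmod (U2 n \<xi> - (0::real) * a \<xi>))\<^sup>2)" for n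
  proof -
    have "(LINT \<xi>|lborel. norm (s n \<xi>)) = (LINT \<xi>|lborel. s n \<xi>)" by (simp add: s_def)
    then show ?thesis unfolding s_def
      by (simp only: Bochner_Integration.integral_add Bochner_Integration.integrable_add sqi)
  qed
  have "(\<lambda>n. LINT \<xi>|lborel. norm (s n \<xi>)) \<longlonglongrightarrow> 0 + 0 + 0 + 0"
    unfolding s_eq by (intro tendsto_add mG(3) mU(3) mU1(3) mU2(3))
  then have "(\<lambda>n. LINT \<xi>|lborel. norm (s n \<xi>)) \<longlonglongrightarrow> 0" by simp
  from tendsto_L1_AE_subseq[OF s_int this]
  obtain r where r: "AE \<xi> in lborel. (\<lambda>n. s (r n) \<xi>) \<longlonglongrightarrow> 0" by blast
  then show ?thesis
  proof eventually_elim
    case (elim \<xi>)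
    have comp: "(\<lambda>n. X (r n)) \<longlonglongrightarrow> L" if "\<And>n. (cmod (X n - L))\<^sup>2 \<le> s n \<xi>" for X L
    proof -
      have "(\<lambda>n. (cmod (X (r n) - L))\<^sup>2) \<longlonglongrightarrow> 0"
        by (rule Lim_null_comparison[OF always_eventually elim]) (simp add: that)
      then have "(\<lambda>n. sqrt ((cmod (X (r n) - L))\<^sup>2)) \<longlonglongrightarrow> sqrt 0" by (intro tendsto_intros)
      then have "(\<lambda>n. X (r n) - L) \<longlonglongrightarrow> 0" by (simp add: tendsto_norm_zero_iff)
      then show ?thesis by (rule LIM_zero_cancel)
    qed
    have "(\<lambda>n. G (r n) \<xi>) \<longlonglongrightarrow> \<kappa> * c \<xi>" by (rule comp) (simp add: s_def)
    moreover have "(\<lambda>n. U2 (r n) \<xi> + 2 * \<i> * complex_of_real (2 * pi * \<xi> $ i) * U1 (r n) \<xi> - complex_of_real ((2 * pi * \<xi> $ i)\<^sup>2) * U (r n) \<xi>)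
       \<longlonglongrightarrow> 0 + 2 * \<i> * complex_of_real (2 * pi * \<xi> $ i) * 0 - complex_of_real ((2 * pi * \<xi> $ i)\<^sup>2) * (\<kappa> * a \<xi>)"
      by (intro tendsto_intros comp) (simp_all add: s_def)
    ultimately have "\<kappa> * c \<xi> = - complex_of_real ((2 * pi * \<xi> $ i)\<^sup>2) * (\<kappa> * a \<xi>)"
      unfolding id by (simp add: LIMSEQ_unique)
    then have "\<kappa> * (c \<xi> + complex_of_real ((2 * pi * \<xi> $ i)\<^sup>2) * a \<xi>) = 0" by (simp add: algebra_simps)
    then show ?case using \<kappa> by (simp add: power_mult_distrib eq_neg_iff_add_eq_0)
  qed
qed

text \<open>The density of the squared norm: a second derivative multiplies the frequency density, up to sign, by \<open>4 \<pi>\<^sup>2\<close> times two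
coordinates, so the squared Laplacian contributes \<open>16 \<pi>\<^sup>4 |\<xi>|\<^sup>4\<close>.\<close>
definition weight :: "real^4 \<Rightarrow> real" where
  "weight \<xi> = 1 + 16 * pi ^ 4 * norm \<xi> ^ 4"

lemma measurable_weight [measurable]: "weight \<in> borel_measurable borel"
  unfolding weight_def by measurable

lemma weight_ge_1: "1 \<le> weight \<xi>"
  by (simp add: weight_def)

lemma weight_pos: "0 < weight \<xi>"
  using weight_ge_1[of \<xi>] by linarith

lemma integral_lebesgue_borel:
  fixes f :: "'a::euclidean_space \<Rightarrow> 'b::{banach, second_countable_topology}"
  assumes "f \<in> borel_measurable borel"
  shows "(LINT x|lebesgue. f x) = (LINT x|lborel. f x)"
  using assms by (intro integral_completion) auto

lemma integrable_lebesgue_borel: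
  fixes f :: "'a::euclidean_space \<Rightarrow> 'b::{banach, second_countable_topology}"
  assumes "f \<in> borel_measurable borel"
  shows "integrable lebesgue f \<longleftrightarrow> integrable lborel f"
  using assms by (intro integrable_completion) auto

lemma L2_iff_sqint:
  assumes "f \<in> borel_measurable borel"
  shows "f \<in> L2 \<longleftrightarrow> sqint f"
proof -
  have [measurable]: "f \<in> borel_measurable borel" by fact
  have "f \<in> borel_measurable lebesgue" using assms by (simp add: measurable_completion)
  then show ?thesis
    using assms integrable_lebesgue_borel[of "\<lambda>x. (cmod (f x))\<^sup>2"] by (simp add: L2_def sqint_def)
qed

lemma L2_borel_representative:
  assumes "u \<in> L2"
  shows "\<exists>u'. sqint u' \<and> (AE x in lborel. u x = u' x)"
proof -
  have u: "u \<in> borel_measurable lebesgue" "integrable lebesgue (\<lambda>x. (cmod (u x))\<^sup>2)"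
    using assms by (auto simp: L2_def)
  have [measurable]: "(\<lambda>x. Re (u x)) \<in> borel_measurable lebesgue" "(\<lambda>x. Im (u x)) \<in> borel_measurable lebesgue"
    using u(1) by measurable
  obtain R where R: "R \<in> borel_measurable lborel" "AE x in lborel. Re (u x) = R x"
    using completion_ex_borel_measurable_real[of "\<lambda>x. Re (u x)" lborel] by auto
  obtain I where I: "I \<in> borel_measurable lborel" "AE x in lborel. Im (u x) = I x"
    using completion_ex_borel_measurable_real[of "\<lambda>x. Im (u x)" lborel] by auto
  note [measurable] = R(1) I(1)
  define u' where "u' x = Complex (R x) (I x)" for x
  have ae: "AE x in lborel. u x = u' x"
    using R(2) I(2) by eventually_elim (simp add: u'_def complex_eq_iff)
  have "u' = (\<lambda>x. complex_of_real (R x) + \<i> * complex_of_real (I x))"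
    by (simp add: fun_eq_iff u'_def complex_eq_iff)
  then have u'm [measurable]: "u' \<in> borel_measurable borel" using R(1) I(1) by simp
  have "integrable lebesgue (\<lambda>x. (cmod (u' x))\<^sup>2)"
  proof (rule integrable_cong_AE[THEN iffD1, OF _ _ _ u(2)])
    show "AE x in lebesgue. (cmod (u x))\<^sup>2 = (cmod (u' x))\<^sup>2"
      by (rule AE_completion) (use ae in eventually_elim, simp)
    show "(\<lambda>x. (cmod (u x))\<^sup>2) \<in> borel_measurable lebesgue" using u(1) by measurable
    show "(\<lambda>x. (cmod (u' x))\<^sup>2) \<in> borel_measurable lebesgue" by (intro measurable_completion) measurable
  qed
  then have "sqint u'" by (simp add: sqint_def integrable_lebesgue_borel)
  with ae show ?thesis by blast
qed

lemma integral_lebesgue_cong: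
  assumes u: "u \<in> borel_measurable lebesgue" and u': "u' \<in> borel_measurable borel" and ae: "AE x in lborel. u x = u' x"
    and \<psi>: "\<psi> \<in> borel_measurable borel"
  shows "(LINT x|lebesgue. \<psi> x *\<^sub>R u x) = (LINT x|lborel. complex_of_real (\<psi> x) * u' x)"
proof -
  have \<psi>': "\<psi> \<in> borel_measurable lebesgue" and u'': "u' \<in> borel_measurable lebesgue"
    using \<psi> u' by (simp_all add: measurable_completion)
  have "(LINT x|lebesgue. \<psi> x *\<^sub>R u x) = (LINT x|lebesgue. complex_of_real (\<psi> x) * u' x)"
  proof (rule integral_cong_AE)
    show "AE x in lebesgue. \<psi> x *\<^sub>R u x = complex_of_real (\<psi> x) * u' x"
      by (rule AE_completion) (use ae in eventually_elim, simp add: scaleR_conv_of_real)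
  qed (use u u'' \<psi>' in measurable)
  also have "\<dots> = (LINT x|lborel. complex_of_real (\<psi> x) * u' x)"
    using u' \<psi> by (intro integral_lebesgue_borel) measurable
  finally show ?thesis .
qed

lemma test_function_foldr: "test_function \<phi> \<Longrightarrow> test_function (foldr partial is \<phi>)"
  by (induction "is") (auto intro: test_function_partial)

lemma test_function_measurable: "test_function \<phi> \<Longrightarrow> \<phi> \<in> borel_measurable borel"
  by (rule borel_measurable_continuous_onI[OF test_functionD(2)])

text \<open>The multiplier of an iterated partial derivative.\<close>
definition symbol :: "4 list \<Rightarrow> real^4 \<Rightarrow> complex" where
  "symbol is \<xi> = prod_list (map (\<lambda>j. 2 * pi * \<i> * \<xi> $ j) is)"

lemma fourier_foldr_partial:
  assumes "test_function \<phi>"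
  shows "fourier (\<lambda>x. complex_of_real (foldr partial is \<phi> x)) \<xi> = (-1) ^ length is * symbol is \<xi> * fourier (\<lambda>x. complex_of_real (\<phi> x)) \<xi>"
proof (induction "is")
  case (Cons i "is")
  show ?case
    using fourier_partial[OF test_function_foldr[OF assms, of "is"], of i \<xi>] Cons.IH
    by (simp add: symbol_def)
qed (simp add: symbol_def)

lemma measurable_symbol [measurable]: "symbol is \<in> borel_measurable borel"
proof (induction "is")
  case Nil
  then show ?case by (simp add: symbol_def[abs_def])
next
  case (Cons i "is")
  have [measurable]: "(\<lambda>\<xi>::real^4. \<xi> $ i) \<in> borel_measurable borel"
    by (intro borel_measurable_continuous_onI continuous_intros)
  note [measurable] = Cons.IH
  have "symbol (i # is) = (\<lambda>\<xi>. 2 * pi * \<i> * \<xi> $ i * symbol is \<xi>)" by (simp add: symbol_def fun_eq_iff)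
  then show ?case by simp
qed

lemma norm_symbol_le: "cmod (symbol is \<xi>) \<le> (2 * pi * norm \<xi>) ^ length is"
proof (induction "is")
  case (Cons i "is")
  have "cmod (symbol (i # is) \<xi>) = (2 * pi * \<bar>\<xi> $ i\<bar>) * cmod (symbol is \<xi>)"
    by (simp add: symbol_def norm_mult)
  also have "\<dots> \<le> (2 * pi * norm \<xi>) * (2 * pi * norm \<xi>) ^ length is"
    by (intro mult_mono Cons.IH mult_left_mono component_le_norm_cart) auto
  finally show ?case by simp
qed (simp add: symbol_def)

lemma norm_symbol_weight:
  assumes "length is \<le> 2"
  shows "(cmod (symbol is \<xi>))\<^sup>2 \<le> weight \<xi>"
proof -
  let ?t = "2 * pi * norm \<xi>"
  have t: "0 \<le> ?t" by simp
  have "(cmod (symbol is \<xi>))\<^sup>2 \<le> (?t ^ length is)\<^sup>2" by (intro power_mono norm_symbol_le) simp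
  also have "\<dots> \<le> 1 + ?t ^ 4"
  proof -
    consider "length is = 0" | "length is = 1" | "length is = 2" using assms by linarith
    then show ?thesis
    proof cases
      case 2
      have "?t\<^sup>2 \<le> 1 + (?t\<^sup>2)\<^sup>2"
      proof -
        have "2 * ?t\<^sup>2 \<le> (?t\<^sup>2)\<^sup>2 + 1"
          using zero_le_power2[of "?t\<^sup>2 - 1"] by (simp add: power2_diff del: zero_le_power2)
        moreover have "0 \<le> ?t\<^sup>2" by (rule zero_le_power2)
        ultimately show ?thesis by linarith
      qed
      then show ?thesis using 2 by (simp flip: power_mult)
    next
      case 3
      then show ?thesis by (simp flip: power_mult)
    qed simp
  qed
  also have "\<dots> = weight \<xi>" by (simp add: weight_def power_mult_distrib)
  finally show ?thesis .
qed

text \<open>The weight dominates the squared symbols of all derivatives of order at most two, so \<open>symbol is * h\<close> has a square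
integrable transform, and duality identifies this transform as the weak derivative.\<close>
lemma fourier_pair_in_H2:
  assumes p: "fourier_pair h v" and w: "integrable lborel (\<lambda>\<xi>. weight \<xi> * (cmod (h \<xi>))\<^sup>2)"
  shows "v \<in> H2"
proof -
  note sq = fourier_pairD(1,2)[OF p]
  note [measurable] = sqint_measurable[OF sq(1)] sqint_measurable[OF sq(2)]
  have "\<exists>g\<in>L2. has_weak_deriv is v g" if len: "length is \<le> 2" for "is"
  proof -
    have hs: "sqint (\<lambda>\<xi>. symbol is \<xi> * h \<xi>)"
      unfolding sqint_def
    proof
      show "integrable lborel (\<lambda>\<xi>. (cmod (symbol is \<xi> * h \<xi>))\<^sup>2)"
      proof (rule Bochner_Integration.integrable_bound[OF w])
        show "AE \<xi> in lborel. norm ((cmod (symbol is \<xi> * h \<xi>))\<^sup>2) \<le> norm (weight \<xi> * (cmod (h \<xi>))\<^sup>2)"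
        proof (rule AE_I2)
          fix \<xi>
          have "(cmod (symbol is \<xi>))\<^sup>2 * (cmod (h \<xi>))\<^sup>2 \<le> weight \<xi> * (cmod (h \<xi>))\<^sup>2"
            by (intro mult_right_mono norm_symbol_weight len) simp
          then show "norm ((cmod (symbol is \<xi> * h \<xi>))\<^sup>2) \<le> norm (weight \<xi> * (cmod (h \<xi>))\<^sup>2)"
            using weight_pos[of \<xi>] by (simp add: norm_mult power_mult_distrib abs_mult)
        qed
      qed measurable
    qed measurable
    then obtain g where g: "fourier_pair (\<lambda>\<xi>. symbol is \<xi> * h \<xi>) g" using fourier_pair_ex by blast
    note [measurable] = fourier_pairD(2)[OF g, THEN sqint_measurable]
    have "has_weak_deriv is v g"
      unfolding has_weak_deriv_def
    proof (intro allI impI)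
      fix \<phi> assume t: "test_function \<phi>"
      note t' = test_function_foldr[OF t, of "is"]
      have mv: "v \<in> borel_measurable lebesgue" "g \<in> borel_measurable lebesgue" by (auto intro: measurable_completion)
      have "(LINT x|lebesgue. foldr partial is \<phi> x *\<^sub>R v x) = (LINT x|lborel. complex_of_real (foldr partial is \<phi> x) * v x)"
        by (rule integral_lebesgue_cong[OF mv(1)]) (auto intro: test_function_measurable t')
      also have "\<dots> = (LINT x|lborel. v x * complex_of_real (foldr partial is \<phi> x))"
        by (simp add: mult.commute)
      also have "\<dots> = (LINT x|lborel. h x * fourier (\<lambda>x. complex_of_real (foldr partial is \<phi> x)) x)"
        by (rule fourier_pairD(3)[OF p]; rule test_function_L12[OF t'])
      also have "\<dots> = (LINT x|lborel. (-1) ^ length is * (symbol is x * h x * fourier (\<lambda>x. complex_of_real (\<phi> x)) x))"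
        unfolding fourier_foldr_partial[OF t] by (simp add: mult_ac)
      also have "\<dots> = (-1) ^ length is * (LINT x|lborel. symbol is x * h x * fourier (\<lambda>x. complex_of_real (\<phi> x)) x)"
        by (rule integral_mult_right_zero)
      also have "(LINT x|lborel. symbol is x * h x * fourier (\<lambda>x. complex_of_real (\<phi> x)) x) = (LINT x|lborel. g x * complex_of_real (\<phi> x))"
        by (rule fourier_pairD(3)[OF g, symmetric]; rule test_function_L12[OF t])
      also have "\<dots> = (LINT x|lborel. complex_of_real (\<phi> x) * g x)"
        by (simp add: mult.commute)
      also have "\<dots> = (LINT x|lebesgue. \<phi> x *\<^sub>R g x)"
        by (rule integral_lebesgue_cong[OF mv(2), symmetric]) (auto intro: test_function_measurable t)
      finally show "(LINT x|lebesgue. foldr partial is \<phi> x *\<^sub>R v x) = (-1) ^ length is * (LINT x|lebesgue. \<phi> x *\<^sub>R g x)" .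
    qed
    moreover have "g \<in> L2" using fourier_pairD(2)[OF g] by (simp add: L2_iff_sqint)
    ultimately show ?thesis by blast
  qed
  moreover have "v \<in> L2" using sq by (simp add: L2_iff_sqint)
  ultimately show ?thesis by (simp add: H2_def)
qed

lemma sum_coords_square: "(\<Sum>i\<in>UNIV. (\<xi> $ i)\<^sup>2) = (norm (\<xi>::real^4))\<^sup>2"
  unfolding power2_norm_eq_inner inner_vec_def by (simp add: power2_eq_square)

lemma fourier_pair_sum:
  assumes "finite I" "\<And>i. i \<in> I \<Longrightarrow> fourier_pair (h i) (u i)"
  shows "fourier_pair (\<lambda>x. \<Sum>i\<in>I. h i x) (\<lambda>x. \<Sum>i\<in>I. u i x)"
  using assms
proof (induction I rule: finite_induct)
  case empty
  have "sqint (\<lambda>x. 0)" by (simp add: sqint_def)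
  then show ?case by (simp add: fourier_pair_def)
next
  case (insert i I)
  then show ?case using fourier_pair_add[of "h i" "u i" "\<lambda>x. \<Sum>i\<in>I. h i x" "\<lambda>x. \<Sum>i\<in>I. u i x"] by simp
qed

lemma AE_lborel_flip:
  fixes P :: "'a::euclidean_space \<Rightarrow> bool"
  assumes "AE x in lborel. P x" and [measurable]: "Measurable.pred borel P"
  shows "AE x in lborel. P (- x)"
proof -
  have "AE x in density (distr lborel borel (\<lambda>x. 0 + (-1) *\<^sub>R x)) (\<lambda>_. ennreal (\<bar>-1\<bar> ^ DIM('a))). P x"
    by (subst lborel_affine[of "-1" "0::'a", symmetric]) (simp_all add: assms(1))
  then show ?thesis by (simp add: AE_density AE_distr_iff)
qed

text \<open>The unmixed second weak derivatives have the expected transforms by \<open>fourier_second_weak_derivative\<close>; their sum is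
\<open>- 4 \<pi>\<^sup>2 |\<xi>|\<^sup>2\<close> times the density, and Plancherel's theorem adds up the two parts of the norm. The reflection
\<open>a (- \<xi>)\<close> appears because \<open>h\<close> transforms to \<open>u\<close> while \<open>a\<close> is the transform of \<open>u\<close>.\<close>
lemma H2_norm_fourier:
  assumes u: "u \<in> H2" and u': "AE x in lborel. u x = u' x" and p: "fourier_pair h u'"
  shows "integrable lborel (\<lambda>\<xi>. weight \<xi> * (cmod (h \<xi>))\<^sup>2)"
    and "H2_norm u = sqrt (LINT \<xi>|lborel. weight \<xi> * (cmod (h \<xi>))\<^sup>2)"
proof -
  note sq = fourier_pairD(1,2)[OF p]
  note [measurable] = sqint_measurable[OF sq(1)] sqint_measurable[OF sq(2)]
  have uL: "u \<in> borel_measurable lebesgue" using u by (simp add: H2_def L2_def)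
  obtain a where a: "fourier_pair u' a" using fourier_pair_ex[OF sq(2)] by blast
  note [measurable] = fourier_pairD(2)[OF a, THEN sqint_measurable]
  have ah: "AE \<xi> in lborel. a (- \<xi>) = h \<xi>"
  proof -
    have "fourier_pair (\<lambda>x. a (- x) - h x) (\<lambda>x. 0)"
      using fourier_pair_diff[OF fourier_pair_inverse[OF a] p] by simp
    from fourier_pair_plancherel[OF this] have "(LINT x|lborel. (cmod (a (- x) - h x))\<^sup>2) = 0" by simp
    then have "AE x in lborel. a (- x) - h x = 0"
      by (intro sqint_eq_0_AE sqint_diff sqint_flip fourier_pairD(2)[OF a] sq)
    then show ?thesis by simp
  qed
  have wd: "weak_deriv [i, i] u \<in> L2 \<and> has_weak_deriv [i, i] u (weak_deriv [i, i] u)" for i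
  proof -
    have "\<exists>g. g \<in> L2 \<and> has_weak_deriv [i, i] u g"
      using u by (auto simp: H2_def dest!: spec[of _ "[i, i]"])
    then show ?thesis unfolding weak_deriv_def by (rule someI_ex)
  qed
  have "\<exists>g. sqint g \<and> (AE x in lborel. weak_deriv [i, i] u x = g x)" for i
    using L2_borel_representative wd by blast
  then obtain g where g: "\<And>i. sqint (g i)" "\<And>i. AE x in lborel. weak_deriv [i, i] u x = g i x" by metis
  note [measurable] = sqint_measurable[OF g(1)]
  have "\<exists>c. fourier_pair (g i) c" for i using fourier_pair_ex[OF g(1)] by blast
  then obtain c where c: "\<And>i. fourier_pair (g i) (c i)" by metis
  note [measurable] = fourier_pairD(2)[OF c, THEN sqint_measurable]
  have ci: "AE \<xi> in lborel. c i \<xi> = - complex_of_real (4 * pi\<^sup>2 * (\<xi> $ i)\<^sup>2) * a \<xi>" for i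
  proof (rule fourier_second_weak_derivative[OF a c])
    fix \<phi> assume t: "test_function \<phi>"
    have "(LINT x|lborel. complex_of_real (partial i (partial i \<phi>) x) * u' x) = (LINT x|lebesgue. partial i (partial i \<phi>) x *\<^sub>R u x)"
      by (rule integral_lebesgue_cong[OF uL _ u', symmetric])
         (auto intro: test_function_measurable test_function_partial t)
    also have "\<dots> = (LINT x|lebesgue. \<phi> x *\<^sub>R weak_deriv [i, i] u x)"
      using wd[of i] t by (simp add: has_weak_deriv_def)
    also have "\<dots> = (LINT x|lborel. complex_of_real (\<phi> x) * g i x)"
      by (rule integral_lebesgue_cong[OF _ _ g(2)])
         (use wd[of i] in \<open>auto simp: L2_def intro: test_function_measurable t\<close>)
    finally show "(LINT x|lborel. complex_of_real (partial i (partial i \<phi>) x) * u' x) = (LINT x|lborel. complex_of_real (\<phi> x) * g i x)" .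
  qed
  define G where "G x = (\<Sum>i\<in>UNIV. g i x)" for x
  define C where "C \<xi> = (\<Sum>i\<in>UNIV. c i \<xi>)" for \<xi>
  have GC: "fourier_pair G C" unfolding G_def C_def by (intro fourier_pair_sum c) simp
  note sG = fourier_pairD(1,2)[OF GC]
  note [measurable] = sqint_measurable[OF sG(1)] sqint_measurable[OF sG(2)]
  have lap: "AE x in lborel. laplacian u x = G x"
  proof -
    have "AE x in lborel. \<forall>i\<in>UNIV. weak_deriv [i, i] u x = g i x"
      by (intro AE_finite_allI g(2)) simp
    then show ?thesis by eventually_elim (simp add: laplacian_def G_def)
  qed
  have Ca: "AE \<xi> in lborel. C \<xi> = - complex_of_real (4 * pi\<^sup>2 * (norm \<xi>)\<^sup>2) * a \<xi>"
  proof -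
    have "AE \<xi> in lborel. \<forall>i\<in>UNIV. c i \<xi> = - complex_of_real (4 * pi\<^sup>2 * (\<xi> $ i)\<^sup>2) * a \<xi>"
      by (intro AE_finite_allI ci) simp
    then show ?thesis
    proof eventually_elim
      case (elim \<xi>)
      then show ?case
        unfolding C_def sum_coords_square[symmetric] by (simp add: sum_distrib_left sum_distrib_right sum_negf)
    qed
  qed
  have Ch: "AE \<xi> in lborel. C (- \<xi>) = - complex_of_real (4 * pi\<^sup>2 * (norm \<xi>)\<^sup>2) * h \<xi>"
  proof -
    define P where "P \<xi> \<longleftrightarrow> C \<xi> = - complex_of_real (4 * pi\<^sup>2 * (norm \<xi>)\<^sup>2) * a \<xi>" for \<xi>
    have [measurable]: "Measurable.pred borel P" unfolding P_def by measurable
    have "AE \<xi> in lborel. P (- \<xi>)"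
      using Ca by (intro AE_lborel_flip) (simp_all add: P_def)
    then show ?thesis using ah by eventually_elim (simp add: P_def)
  qed
  have sum_eq: "(cmod (h \<xi>))\<^sup>2 + (cmod (- complex_of_real (4 * pi\<^sup>2 * (norm \<xi>)\<^sup>2) * h \<xi>))\<^sup>2 = weight \<xi> * (cmod (h \<xi>))\<^sup>2" for \<xi>
  proof -
    have "cmod (- complex_of_real (4 * pi\<^sup>2 * (norm \<xi>)\<^sup>2) * h \<xi>) = \<bar>4 * pi\<^sup>2 * (norm \<xi>)\<^sup>2\<bar> * cmod (h \<xi>)"
      by (simp only: norm_mult norm_minus_cancel norm_of_real)
    then have "(cmod (- complex_of_real (4 * pi\<^sup>2 * (norm \<xi>)\<^sup>2) * h \<xi>))\<^sup>2 = 16 * pi ^ 4 * norm \<xi> ^ 4 * (cmod (h \<xi>))\<^sup>2"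
      by (simp add: power_mult_distrib flip: power_mult)
    then show ?thesis by (simp add: weight_def distrib_right)
  qed
  have sCn: "sqint (\<lambda>\<xi>. C (- \<xi>))" by (rule sqint_flip[OF sG(2)])
  have ae2: "AE \<xi> in lborel. (cmod (h \<xi>))\<^sup>2 + (cmod (C (- \<xi>)))\<^sup>2 = weight \<xi> * (cmod (h \<xi>))\<^sup>2"
    using Ch by eventually_elim (simp only: sum_eq)
  have i2: "integrable lborel (\<lambda>\<xi>. (cmod (h \<xi>))\<^sup>2 + (cmod (C (- \<xi>)))\<^sup>2)"
    by (intro Bochner_Integration.integrable_add sqint_integrable sq sCn)
  show "integrable lborel (\<lambda>\<xi>. weight \<xi> * (cmod (h \<xi>))\<^sup>2)"
    by (rule integrable_cong_AE[THEN iffD1, OF _ _ ae2 i2]) measurable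
  have lapm: "laplacian u \<in> borel_measurable lebesgue"
    unfolding laplacian_def using wd by (intro borel_measurable_sum) (auto simp: L2_def)
  have "(LINT x|lebesgue. (cmod (u x))\<^sup>2 + (cmod (laplacian u x))\<^sup>2) = (LINT x|lebesgue. (cmod (u' x))\<^sup>2 + (cmod (G x))\<^sup>2)"
  proof (rule integral_cong_AE)
    show "AE x in lebesgue. (cmod (u x))\<^sup>2 + (cmod (laplacian u x))\<^sup>2 = (cmod (u' x))\<^sup>2 + (cmod (G x))\<^sup>2"
      by (rule AE_completion) (use u' lap in eventually_elim, simp)
    show "(\<lambda>x. (cmod (u x))\<^sup>2 + (cmod (laplacian u x))\<^sup>2) \<in> borel_measurable lebesgue" using uL lapm by measurable
    show "(\<lambda>x. (cmod (u' x))\<^sup>2 + (cmod (G x))\<^sup>2) \<in> borel_measurable lebesgue" by (intro measurable_completion) measurable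
  qed
  also have "\<dots> = (LINT x|lborel. (cmod (u' x))\<^sup>2 + (cmod (G x))\<^sup>2)"
    by (rule integral_lebesgue_borel) measurable
  also have "\<dots> = (LINT x|lborel. (cmod (u' x))\<^sup>2) + (LINT x|lborel. (cmod (G x))\<^sup>2)"
    by (intro Bochner_Integration.integral_add sqint_integrable sq sG)
  also have "(LINT x|lborel. (cmod (u' x))\<^sup>2) = (LINT \<xi>|lborel. (cmod (h \<xi>))\<^sup>2)"
    by (rule fourier_pair_plancherel[OF p])
  also have "(LINT x|lborel. (cmod (G x))\<^sup>2) = (LINT \<xi>|lborel. (cmod (C (- \<xi>)))\<^sup>2)"
    using fourier_pair_plancherel[OF GC] lborel_flip(1)[of "\<lambda>\<xi>. (cmod (C \<xi>))\<^sup>2"] by simp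
  also have "(LINT \<xi>|lborel. (cmod (h \<xi>))\<^sup>2) + (LINT \<xi>|lborel. (cmod (C (- \<xi>)))\<^sup>2) = (LINT \<xi>|lborel. (cmod (h \<xi>))\<^sup>2 + (cmod (C (- \<xi>)))\<^sup>2)"
    by (intro Bochner_Integration.integral_add[symmetric] sqint_integrable sq sCn)
  also have "\<dots> = (LINT \<xi>|lborel. weight \<xi> * (cmod (h \<xi>))\<^sup>2)"
    by (rule integral_cong_AE[OF _ _ ae2]) measurable
  finally show "H2_norm u = sqrt (LINT \<xi>|lborel. weight \<xi> * (cmod (h \<xi>))\<^sup>2)"
    by (simp add: H2_norm_def)
qed

section \<open>Powers of a Fourier transform\<close>

definition cconv :: "('a::euclidean_space \<Rightarrow> complex) \<Rightarrow> ('a \<Rightarrow> complex) \<Rightarrow> 'a \<Rightarrow> complex" where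
  "cconv h k x = (LINT y|lborel. h y * k (x - y))"

lemma measurable_cconv [measurable]:
  assumes [measurable]: "h \<in> borel_measurable borel" "k \<in> borel_measurable borel"
  shows "cconv h k \<in> borel_measurable borel"
  unfolding cconv_def by measurable

lemma sqint_reflect_translate:
  assumes "sqint k"
  shows "sqint (\<lambda>y. k (x - y))" "(LINT y|lborel. (cmod (k (x - y)))\<^sup>2) = (LINT y|lborel. (cmod (k y))\<^sup>2)"
  using sqint_measurable[OF assms] sqint_integrable[OF assms]
    lborel_affine_integrable[of "-1" "\<lambda>y. (cmod (k y))\<^sup>2" x] lborel_affine_integral[of "-1" "\<lambda>y. (cmod (k y))\<^sup>2" x]
  by (auto simp: sqint_def)

lemma norm_cconv_le:
  assumes "sqint h" "sqint k"
  shows "cmod (cconv h k x) \<le> sqrt (LINT y|lborel. (cmod (h y))\<^sup>2) * sqrt (LINT y|lborel. (cmod (k y))\<^sup>2)"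
  unfolding cconv_def
  using norm_integral_sqint_le[OF assms(1) sqint_reflect_translate(1)[OF assms(2), of x]] sqint_reflect_translate(2)[OF assms(2), of x]
  by simp

lemma ennreal_norm_cconv_le:
  assumes "h \<in> borel_measurable borel" "k \<in> borel_measurable borel"
  shows "ennreal (cmod (cconv h k x)) \<le> conv (\<lambda>y. ennreal (cmod (h y))) (\<lambda>y. ennreal (cmod (k y))) x"
proof (cases "integrable lborel (\<lambda>y. h y * k (x - y))")
  case True
  have "ennreal (cmod (cconv h k x)) \<le> (\<integral>\<^sup>+y. ennreal (cmod (h y * k (x - y))) \<partial>lborel)"
    unfolding cconv_def by (rule integral_norm_bound_ennreal[OF True])
  then show ?thesis by (simp add: conv_def norm_mult ennreal_mult)
next
  case False
  then show ?thesis by (simp add: cconv_def not_integrable_integral_eq)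
qed

text \<open>Fubini's theorem, with the inner variable translated.\<close>
lemma cconv_L1:
  fixes h k :: "'a::euclidean_space \<Rightarrow> complex"
  assumes h: "integrable lborel h" and k: "integrable lborel k"
  shows integrable_cconv: "integrable lborel (cconv h k)"
    and fourier_cconv: "fourier (cconv h k) x = fourier h x * fourier k x"
proof -
  have [measurable]: "h \<in> borel_measurable borel" "k \<in> borel_measurable borel"
    using borel_measurable_integrable[OF h] borel_measurable_integrable[OF k] by auto
  have kt: "integrable lborel (\<lambda>z. f (z - y))" "(LINT z|lborel. f (z - y)) = (LINT z|lborel. f z)"
    if "f \<in> borel_measurable borel" "integrable lborel f" for f :: "'a \<Rightarrow> 'c::{banach, second_countable_topology}" and y
    using lborel_affine_integrable[of 1 f "- y"] lborel_affine_integral[of 1 f "- y"] that by auto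
  have prod: "integrable (lborel \<Otimes>\<^sub>M lborel) (\<lambda>(y, z). h y * k (z - y))"
  proof (rule lborel_pair.Fubini_integrable)
    show "integrable lborel (\<lambda>y. LINT z|lborel. norm (case (y, z) of (y, z) \<Rightarrow> h y * k (z - y)))"
      using kt(2)[of "\<lambda>z. norm (k z)"] h k by (simp add: norm_mult)
    show "AE y in lborel. integrable lborel (\<lambda>z. case (y, z) of (y, z) \<Rightarrow> h y * k (z - y))"
      using kt(1)[of k] k by auto
  qed measurable
  have "integrable lborel (\<lambda>z. LINT y|lborel. h y * k (z - y))"
    using lborel_pair.integrable_snd[OF prod] by simp
  then show "integrable lborel (cconv h k)" by (simp add: cconv_def[abs_def])
  have prod2: "integrable (lborel \<Otimes>\<^sub>M lborel) (\<lambda>(y, z). cis (2 * pi * (x \<bullet> z)) * (h y * k (z - y)))"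
    by (rule Bochner_Integration.integrable_bound[OF prod]) (auto simp: norm_mult)
  have "fourier (cconv h k) x = (LINT z|lborel. LINT y|lborel. cis (2 * pi * (x \<bullet> z)) * (h y * k (z - y)))"
    by (simp add: fourier_def cconv_def)
  also have "\<dots> = (LINT y|lborel. LINT z|lborel. cis (2 * pi * (x \<bullet> z)) * (h y * k (z - y)))"
    by (rule lborel_pair.Fubini_integral[OF prod2])
  also have "\<dots> = (LINT y|lborel. cis (2 * pi * (x \<bullet> y)) * h y * fourier k x)"
  proof (rule Bochner_Integration.integral_cong[OF refl])
    fix y
    have "(LINT z|lborel. cis (2 * pi * (x \<bullet> z)) * (h y * k (z - y)))
       = (LINT z|lborel. cis (2 * pi * (x \<bullet> (y + 1 *\<^sub>R z))) * (h y * k (y + 1 *\<^sub>R z - y)))"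
      by (subst lborel_affine_integral[of 1 _ y]) auto
    also have "\<dots> = (LINT z|lborel. cis (2 * pi * (x \<bullet> y)) * h y * (cis (2 * pi * (x \<bullet> z)) * k z))"
      by (intro Bochner_Integration.integral_cong refl)
         (simp add: inner_add_right distrib_left cis_mult[symmetric])
    finally show "(LINT z|lborel. cis (2 * pi * (x \<bullet> z)) * (h y * k (z - y))) = cis (2 * pi * (x \<bullet> y)) * h y * fourier k x"
      by (simp add: fourier_def)
  qed
  finally show "fourier (cconv h k) x = fourier h x * fourier k x" by (simp add: fourier_def)
qed

text \<open>A convolution of square integrable functions is bounded, so an integrable one is square integrable.\<close>
lemma sqint_cconv:
  assumes h: "integrable lborel h" "sqint h" and k: "integrable lborel k" "sqint k"
  shows "sqint (cconv h k)"
proof -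
  note [measurable] = sqint_measurable[OF h(2)] sqint_measurable[OF k(2)]
  define M where "M = sqrt (LINT y|lborel. (cmod (h y))\<^sup>2) * sqrt (LINT y|lborel. (cmod (k y))\<^sup>2)"
  have M: "cmod (cconv h k x) \<le> M" for x unfolding M_def by (rule norm_cconv_le[OF h(2) k(2)])
  have "integrable lborel (\<lambda>x. M * cmod (cconv h k x))"
    by (intro integrable_mult_right integrable_norm integrable_cconv h k)
  then have "integrable lborel (\<lambda>x. (cmod (cconv h k x))\<^sup>2)"
  proof (rule Bochner_Integration.integrable_bound)
    show "AE x in lborel. norm ((cmod (cconv h k x))\<^sup>2) \<le> norm (M * cmod (cconv h k x))"
    proof (rule AE_I2)
      fix x
      have "(cmod (cconv h k x))\<^sup>2 \<le> M * cmod (cconv h k x)"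
        unfolding power2_eq_square by (intro mult_right_mono M) simp
      then show "norm ((cmod (cconv h k x))\<^sup>2) \<le> norm (M * cmod (cconv h k x))" by simp
    qed
  qed measurable
  then show ?thesis by (simp add: sqint_def)
qed

fun cconv_power :: "('a::euclidean_space \<Rightarrow> complex) \<Rightarrow> nat \<Rightarrow> 'a \<Rightarrow> complex" where
  "cconv_power h 0 = h"
| "cconv_power h (Suc n) = cconv h (cconv_power h n)"

lemma cconv_power:
  assumes h: "integrable lborel h" "sqint h"
  shows "integrable lborel (cconv_power h n)" "sqint (cconv_power h n)"
    "fourier (cconv_power h n) x = fourier h x ^ Suc n"
    "ennreal (cmod (cconv_power h n x)) \<le> conv_power (\<lambda>y. ennreal (cmod (h y))) n x"
proof -
  have "integrable lborel (cconv_power h n) \<and> sqint (cconv_power h n) \<and> (\<forall>x. fourier (cconv_power h n) x = fourier h x ^ Suc n) \<and>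
    (\<forall>x. ennreal (cmod (cconv_power h n x)) \<le> conv_power (\<lambda>y. ennreal (cmod (h y))) n x)"
  proof (induction n)
    case 0
    then show ?case using h by simp
  next
    case (Suc n)
    note [measurable] = sqint_measurable[OF h(2)]
    have IH: "integrable lborel (cconv_power h n)" "sqint (cconv_power h n)"
      "\<And>x. fourier (cconv_power h n) x = fourier h x ^ Suc n"
      "\<And>x. ennreal (cmod (cconv_power h n x)) \<le> conv_power (\<lambda>y. ennreal (cmod (h y))) n x" using Suc by auto
    have "ennreal (cmod (cconv_power h (Suc n) x)) \<le> conv_power (\<lambda>y. ennreal (cmod (h y))) (Suc n) x" for x
    proof -
      have "ennreal (cmod (cconv_power h (Suc n) x)) \<le> conv (\<lambda>y. ennreal (cmod (h y))) (\<lambda>y. ennreal (cmod (cconv_power h n y))) x"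
        using ennreal_norm_cconv_le[OF sqint_measurable[OF h(2)] sqint_measurable[OF IH(2)]] by simp
      also have "\<dots> \<le> conv (\<lambda>y. ennreal (cmod (h y))) (conv_power (\<lambda>y. ennreal (cmod (h y))) n) x"
        unfolding conv_def by (intro nn_integral_mono mult_left_mono IH(4)) simp
      finally show ?thesis by simp
    qed
    then show ?case
      using integrable_cconv[OF h(1) IH(1)] sqint_cconv[OF h IH(1,2)] fourier_cconv[OF h(1) IH(1)] IH(3) by simp
  qed
  then show "integrable lborel (cconv_power h n)" "sqint (cconv_power h n)"
    "fourier (cconv_power h n) x = fourier h x ^ Suc n"
    "ennreal (cmod (cconv_power h n x)) \<le> conv_power (\<lambda>y. ennreal (cmod (h y))) n x" by auto
qed

text \<open>For nonnegative integrable and square integrable functions the Bochner and the extended convolution powers coincide; the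
convolutions are finite everywhere by the Cauchy--Schwarz inequality.\<close>
lemma cconv_power_nonneg:
  fixes f :: "'a::euclidean_space \<Rightarrow> real"
  assumes f: "\<And>x. 0 \<le> f x" and h: "integrable lborel (\<lambda>x. complex_of_real (f x))" "sqint (\<lambda>x. complex_of_real (f x))"
  shows "\<exists>g. (\<forall>x. 0 \<le> g x) \<and> cconv_power (\<lambda>x. complex_of_real (f x)) n = (\<lambda>x. complex_of_real (g x))
    \<and> conv_power (\<lambda>x. ennreal (f x)) n = (\<lambda>x. ennreal (g x))"
proof (induction n)
  case 0
  then show ?case using f by auto
next
  case (Suc n)
  then obtain g where g: "\<And>x. 0 \<le> g x" "cconv_power (\<lambda>x. complex_of_real (f x)) n = (\<lambda>x. complex_of_real (g x))"
    "conv_power (\<lambda>x. ennreal (f x)) n = (\<lambda>x. ennreal (g x))" by auto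
  have gs: "sqint (\<lambda>x. complex_of_real (g x))" using cconv_power(2)[OF h, of n] g(2) by simp
  have i: "integrable lborel (\<lambda>y. f y * g (x - y))" for x
  proof -
    have "integrable lborel (\<lambda>y. complex_of_real (f y) * complex_of_real (g (x - y)))"
      by (rule sqint_mult_integrable[OF h(2) sqint_reflect_translate(1)[OF gs]])
    then have "integrable lborel (\<lambda>y. Re (complex_of_real (f y) * complex_of_real (g (x - y))))" by (rule integrable_Re)
    then show ?thesis by simp
  qed
  define G where "G x = (LINT y|lborel. f y * g (x - y))" for x
  have "cconv_power (\<lambda>x. complex_of_real (f x)) (Suc n) = (\<lambda>x. complex_of_real (G x))"
    by (simp add: g(2) cconv_def fun_eq_iff G_def of_real_mult[symmetric] integral_complex_of_real del: of_real_mult)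
  moreover have "conv_power (\<lambda>x. ennreal (f x)) (Suc n) = (\<lambda>x. ennreal (G x))"
  proof
    fix x
    have "conv_power (\<lambda>x. ennreal (f x)) (Suc n) x = (\<integral>\<^sup>+y. ennreal (f y * g (x - y)) \<partial>lborel)"
      by (simp add: g(3) conv_def ennreal_mult f g(1))
    also have "\<dots> = ennreal (G x)"
      unfolding G_def by (intro nn_integral_eq_integral i) (simp add: f g(1))
    finally show "conv_power (\<lambda>x. ennreal (f x)) (Suc n) x = ennreal (G x)" .
  qed
  moreover have "0 \<le> G x" for x unfolding G_def by (simp add: f g(1))
  ultimately show ?case by blast
qed

text \<open>Plancherel's theorem applied to the convolution power, whose transform is a power of \<open>fourier h\<close>.\<close>
lemma nn_integral_fourier_power:
  assumes h: "integrable lborel h" "sqint h"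
  shows "(\<integral>\<^sup>+x. ennreal (((cmod (fourier h x))\<^sup>2) ^ Suc n) \<partial>lborel) = (\<integral>\<^sup>+x. ennreal ((cmod (cconv_power h n x))\<^sup>2) \<partial>lborel)"
proof -
  note c = cconv_power[OF h, of n]
  have "(\<integral>\<^sup>+x. ennreal (((cmod (fourier h x))\<^sup>2) ^ Suc n) \<partial>lborel) = (\<integral>\<^sup>+x. ennreal ((cmod (fourier (cconv_power h n) x))\<^sup>2) \<partial>lborel)"
    unfolding c(3) norm_power power_mult[symmetric] mult.commute[of 2] ..
  also have "\<dots> = ennreal (LINT x|lborel. (cmod (fourier (cconv_power h n) x))\<^sup>2)"
    by (rule nn_integral_sqint[OF plancherel_L1(1)[OF c(1,2)]])
  also have "\<dots> = ennreal (LINT x|lborel. (cmod (cconv_power h n x))\<^sup>2)"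
    by (simp only: plancherel_L1(2)[OF c(1,2)])
  also have "\<dots> = (\<integral>\<^sup>+x. ennreal ((cmod (cconv_power h n x))\<^sup>2) \<partial>lborel)"
    by (rule nn_integral_sqint[OF c(2), symmetric])
  finally show ?thesis .
qed

lemma fourier_power_le:
  assumes h: "integrable lborel h" "sqint h"
  defines "f \<equiv> \<lambda>x. ennreal (cmod (h x))"
  shows "(\<integral>\<^sup>+x. ennreal (((cmod (fourier h x))\<^sup>2) ^ Suc n) \<partial>lborel) \<le> (\<integral>\<^sup>+x. conv_power f n x * conv_power f n x \<partial>lborel)"
  unfolding nn_integral_fourier_power[OF h]
proof (intro nn_integral_mono)
  fix x
  have "ennreal (cmod (cconv_power h n x)) * ennreal (cmod (cconv_power h n x)) \<le> conv_power f n x * conv_power f n x"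
    unfolding f_def by (intro mult_mono cconv_power(4)[OF h]) auto
  then show "ennreal ((cmod (cconv_power h n x))\<^sup>2) \<le> conv_power f n x * conv_power f n x"
    by (simp add: power2_eq_square ennreal_mult)
qed

lemma fourier_power_eq:
  fixes f :: "'a::euclidean_space \<Rightarrow> real"
  assumes f: "\<And>x. 0 \<le> f x" and h: "integrable lborel (\<lambda>x. complex_of_real (f x))" "sqint (\<lambda>x. complex_of_real (f x))"
  shows "(\<integral>\<^sup>+x. ennreal (((cmod (fourier (\<lambda>x. complex_of_real (f x)) x))\<^sup>2) ^ Suc n) \<partial>lborel)
     = (\<integral>\<^sup>+x. conv_power (\<lambda>x. ennreal (f x)) n x * conv_power (\<lambda>x. ennreal (f x)) n x \<partial>lborel)"
proof -
  obtain g where g: "\<And>x. 0 \<le> g x" "cconv_power (\<lambda>x. complex_of_real (f x)) n = (\<lambda>x. complex_of_real (g x))"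
    "conv_power (\<lambda>x. ennreal (f x)) n = (\<lambda>x. ennreal (g x))" using cconv_power_nonneg[OF f h, of n] by auto
  show ?thesis
    unfolding nn_integral_fourier_power[OF h] g(2,3) by (simp add: g(1) power2_eq_square ennreal_mult)
qed

section \<open>Exponential integrability\<close>

lemma emeasure_ball_R4: "emeasure lborel (ball (0::real^4) (2 * r)) = 16 * emeasure lborel (ball (0::real^4) r)" if "0 < r" for r
proof -
  have "emeasure lborel (ball (0::real^4) (2 * r)) = (\<integral>\<^sup>+x. indicator (ball 0 (2 * r)) x \<partial>(lborel :: (real^4) measure))"
    by simp
  also have "\<dots> = (\<integral>\<^sup>+x. indicator (ball 0 (2 * r)) (0 + 2 *\<^sub>R x) \<partial>(lborel :: (real^4) measure)) * ennreal (\<bar>2\<bar> ^ DIM(real^4))"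
    by (rule nn_integral_lborel_affine[symmetric]) (auto intro!: borel_measurable_indicator)
  also have "(\<lambda>x::real^4. indicator (ball 0 (2 * r)) (0 + 2 *\<^sub>R x)) = (indicator (ball 0 r) :: real^4 \<Rightarrow> ennreal)"
    by (auto simp: fun_eq_iff split: split_indicator)
  finally show ?thesis by (simp add: mult.commute)
qed

text \<open>Balls rather than annuli; the radius doubles, so the volume in dimension four is multiplied by 16, exactly the
factor by which the weight grows.\<close>
definition dyadic :: "nat \<Rightarrow> (real^4) set" where
  "dyadic n = ball 0 (2 ^ n)"

lemma dyadic_sets [measurable]: "dyadic n \<in> sets borel" by (simp add: dyadic_def)

definition ball_vol :: real where
  "ball_vol = measure lborel (ball (0::real^4) 1)"

lemma measure_dyadic: "measure lborel (dyadic n) = 16 ^ n * ball_vol"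
proof (induction n)
  case (Suc n)
  have "measure lborel (dyadic (Suc n)) = 16 * measure lborel (dyadic n)"
    using emeasure_ball_R4[of "2 ^ n"] by (simp add: measure_def dyadic_def enn2real_mult)
  then show ?case using Suc by simp
qed (simp add: dyadic_def ball_vol_def)

lemma emeasure_dyadic_finite: "emeasure lborel (dyadic n) < \<infinity>"
  unfolding dyadic_def by (rule emeasure_bounded_finite) simp

text \<open>Each dyadic annulus contributes a bounded amount, so the integral of \<open>1 / weight\<close> over the ball of radius \<open>2\<close> to the
power \<open>n\<close> grows at most linearly in \<open>n\<close>. This logarithmic divergence is the reason for the critical exponential growth.\<close>
lemma integral_inverse_weight:
  "integrable lborel (\<lambda>\<xi>. indicator (dyadic n) \<xi> * (1 / weight \<xi>))"
  "(LINT \<xi>|lborel. indicator (dyadic n) \<xi> * (1 / weight \<xi>)) \<le> ball_vol * (1 + real n)"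
proof -
  have int: "integrable lborel (\<lambda>\<xi>. indicator (dyadic n) \<xi> * (1 / weight \<xi>))" for n
  proof (rule Bochner_Integration.integrable_bound)
    show "integrable lborel (indicator (dyadic n) :: real^4 \<Rightarrow> real)"
      using emeasure_dyadic_finite by (intro integrable_real_indicator) auto
    show "AE \<xi> in lborel. norm (indicator (dyadic n) \<xi> * (1 / weight \<xi>)) \<le> norm (indicator (dyadic n) \<xi> :: real)"
    proof (rule AE_I2)
      fix \<xi>
      show "norm (indicator (dyadic n) \<xi> * (1 / weight \<xi>)) \<le> norm (indicator (dyadic n) \<xi> :: real)"
        using weight_ge_1[of \<xi>] by (auto split: split_indicator)
    qed
  qed measurable
  then show "integrable lborel (\<lambda>\<xi>. indicator (dyadic n) \<xi> * (1 / weight \<xi>))" .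
  show "(LINT \<xi>|lborel. indicator (dyadic n) \<xi> * (1 / weight \<xi>)) \<le> ball_vol * (1 + real n)"
  proof (induction n)
    case 0
    have "(LINT \<xi>|lborel. indicator (dyadic 0) \<xi> * (1 / weight \<xi>)) \<le> (LINT \<xi>|lborel. indicator (dyadic 0) \<xi>)"
    proof (intro integral_mono int)
      show "integrable lborel (indicator (dyadic 0) :: real^4 \<Rightarrow> real)"
        using emeasure_dyadic_finite by (intro integrable_real_indicator) auto
      show "indicator (dyadic 0) \<xi> * (1 / weight \<xi>) \<le> indicator (dyadic 0) \<xi>" for \<xi>
        using weight_ge_1[of \<xi>] by (auto simp: field_simps split: split_indicator)
    qed
    also have "\<dots> = ball_vol" using measure_dyadic[of 0] by simp
    finally show ?case by simp
  next
    case (Suc n)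
    let ?c = "1 / (16 * pi ^ 4 * 16 ^ n)"
    have ii: "integrable lborel (indicator (dyadic (Suc n)) :: real^4 \<Rightarrow> real)"
      using emeasure_dyadic_finite by (intro integrable_real_indicator) auto
    have "(LINT \<xi>|lborel. indicator (dyadic (Suc n)) \<xi> * (1 / weight \<xi>))
      \<le> (LINT \<xi>|lborel. indicator (dyadic n) \<xi> * (1 / weight \<xi>) + ?c * indicator (dyadic (Suc n)) \<xi>)"
    proof (intro integral_mono int Bochner_Integration.integrable_add integrable_mult_right ii)
      fix \<xi> :: "real^4"
      show "indicator (dyadic (Suc n)) \<xi> * (1 / weight \<xi>) \<le> indicator (dyadic n) \<xi> * (1 / weight \<xi>) + ?c * indicator (dyadic (Suc n)) \<xi>"
      proof (cases "\<xi> \<in> dyadic n")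
        case True
        then show ?thesis using weight_pos[of \<xi>] by (auto split: split_indicator)
      next
        case False
        then have "2 ^ n \<le> norm \<xi>" by (simp add: dyadic_def not_less)
        then have "(2 ^ n) ^ 4 \<le> norm \<xi> ^ 4" by (intro power_mono) auto
        moreover have "((2::real) ^ n) ^ 4 = 16 ^ n" by (simp add: power_mult[symmetric] mult.commute[of n]) (simp add: power_mult)
        ultimately have "16 * pi ^ 4 * 16 ^ n \<le> 16 * pi ^ 4 * norm \<xi> ^ 4" by (intro mult_left_mono) auto
        then have "16 * pi ^ 4 * 16 ^ n \<le> weight \<xi>" unfolding weight_def by linarith
        then have "1 / weight \<xi> \<le> ?c" by (intro divide_left_mono) (auto intro!: mult_pos_pos weight_pos)
        then show ?thesis using False by (auto split: split_indicator)
      qed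
    qed
    also have "\<dots> = (LINT \<xi>|lborel. indicator (dyadic n) \<xi> * (1 / weight \<xi>)) + ?c * (LINT \<xi>|lborel. indicator (dyadic (Suc n)) \<xi>)"
      using int[of n] ii by (subst Bochner_Integration.integral_add) auto
    also have "?c * (LINT \<xi>|lborel. indicator (dyadic (Suc n)) \<xi>) \<le> ball_vol"
    proof -
      have "?c * (LINT \<xi>|lborel. indicator (dyadic (Suc n)) \<xi>) = ball_vol / pi ^ 4"
        using measure_dyadic[of "Suc n"] by simp
      also have "\<dots> \<le> ball_vol / 1"
        using pi_gt3 by (intro divide_left_mono one_le_power) (auto simp: ball_vol_def)
      finally show ?thesis by simp
    qed
    finally show ?case using Suc by (simp add: algebra_simps)
  qed
qed

text \<open>The truncation of \<open>h\<close> to frequencies below \<open>2\<close> to the power \<open>n\<close> has transform bounded by \<open>a n\<close>, of order \<open>sqrt (\<eta> n)\<close> with \<open>\<eta>\<close> as small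
as desired: the main part of \<open>h\<close> contributes the constant \<open>C0\<close>, and the remaining part has small weighted norm. On the set where
\<open>|u|\<close> lies between \<open>2 a n\<close> and \<open>2 a (n + 1)\<close> the high frequencies account for at least half of \<open>|u|\<close>, and their squared \<open>L\<^sup>2\<close>
norm is at most \<open>D\<close> divided by \<open>16\<close> to the power \<open>n\<close>, which beats the exponential, of order \<open>2\<close> to the power \<open>n\<close>.\<close>
lemma exp_integrability:
  fixes h u :: "real^4 \<Rightarrow> complex" and \<gamma> :: real
  assumes p: "fourier_pair h u" and w: "integrable lborel (\<lambda>\<xi>. weight \<xi> * (cmod (h \<xi>))\<^sup>2)" and \<gamma>: "0 < \<gamma>"
  shows "(\<integral>\<^sup>+x. ennreal ((cmod (u x))\<^sup>2 * exp (\<gamma> * (cmod (u x))\<^sup>2)) \<partial>lborel) < \<infinity>"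
proof -
  note sq = fourier_pairD(1,2)[OF p]
  note [measurable] = sqint_measurable[OF sq(1)] sqint_measurable[OF sq(2)]
  (* chosen so that \<gamma> (2 a (n + 1))^2 grows like n ln 2, the exponential hence like 2^n *)
  define \<eta> where "\<eta> = ln 2 / (8 * \<gamma>)"
  have \<eta>: "\<eta> > 0" using \<gamma> by (simp add: \<eta>_def)
  (* the square integrable function whose norm is the weighted norm of h; cutting it at N0 leaves
     a remainder whose squared norm, times the volume of the unit ball, is at most \<eta> *)
  define k where "k \<xi> = complex_of_real (sqrt (weight \<xi>)) * h \<xi>" for \<xi>
  have kn: "(cmod (k \<xi>))\<^sup>2 = weight \<xi> * (cmod (h \<xi>))\<^sup>2" for \<xi>
    using weight_pos[of \<xi>] by (simp add: k_def norm_mult power_mult_distrib)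
  have km [measurable]: "k \<in> borel_measurable borel" unfolding k_def by measurable
  have k: "sqint k" using w by (simp add: sqint_def kn)
  have "eventually (\<lambda>n. (LINT x|lborel. (cmod (k x - trunc k n x))\<^sup>2) < \<eta> / (ball_vol + 1)) sequentially"
    using \<eta> by (intro order_tendstoD(2)[OF trunc_L2[OF k]] divide_pos_pos) (auto simp: ball_vol_def add_nonneg_pos)
  then obtain N0 where N0: "(LINT x|lborel. (cmod (k x - trunc k N0 x))\<^sup>2) < \<eta> / (ball_vol + 1)"
    by (auto simp: eventually_sequentially)
  define \<epsilon> where "\<epsilon> = (LINT x|lborel. (cmod (k x - trunc k N0 x))\<^sup>2)"
  have \<epsilon>: "0 \<le> \<epsilon>" "\<epsilon> * ball_vol \<le> \<eta>"
  proof -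
    have bv: "0 \<le> ball_vol" by (simp add: ball_vol_def)
    show e0: "0 \<le> \<epsilon>" by (simp add: \<epsilon>_def)
    have "\<epsilon> * ball_vol \<le> \<epsilon> * (ball_vol + 1)" using e0 by (intro mult_left_mono) auto
    also have "\<dots> \<le> \<eta>" using N0 bv by (simp add: \<epsilon>_def[symmetric] field_simps)
    finally show "\<epsilon> * ball_vol \<le> \<eta>" .
  qed
  define C0 where "C0 = (LINT x|lborel. cmod (trunc h N0 x))"
  have C0: "0 \<le> C0" by (simp add: C0_def)
  define a where "a n = C0 + sqrt (\<eta> * (1 + real n))" for n
  have a0: "0 \<le> a n" for n using C0 \<eta> by (simp add: a_def)
  define T where "T n = trunc h (2 ^ n)" for n
  have T: "integrable lborel (T n)" "sqint (T n)" for n using sq by (auto simp: T_def intro: trunc)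
  have fa: "cmod (fourier (T n) x) \<le> a n" for n x
  proof -
    have d: "sqint (\<lambda>\<xi>. k \<xi> - trunc k N0 \<xi>)" by (intro sqint_diff k sqint_trunc)
    define r where "r \<xi> = complex_of_real (indicator (dyadic n) \<xi> / sqrt (weight \<xi>))" for \<xi>
    have rn: "(cmod (r \<xi>))\<^sup>2 = indicator (dyadic n) \<xi> * (1 / weight \<xi>)" for \<xi>
      using weight_pos[of \<xi>] by (simp add: r_def power_divide norm_divide split: split_indicator)
    have [measurable]: "r \<in> borel_measurable borel" unfolding r_def by measurable
    have r: "sqint r" unfolding sqint_def rn by (intro conjI integral_inverse_weight) measurable
    have pt: "cmod (T n \<xi>) \<le> cmod (trunc h N0 \<xi>) + cmod (k \<xi> - trunc k N0 \<xi>) * cmod (r \<xi>)" for \<xi>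
    proof -
      have "sqrt (weight \<xi>) > 0" using weight_pos by simp
      then show ?thesis
        by (auto simp: T_def trunc_def r_def k_def dyadic_def norm_mult norm_divide split: split_indicator)
    qed
    have i1: "integrable lborel (\<lambda>\<xi>. cmod (trunc h N0 \<xi>))" by (intro integrable_norm integrable_trunc sq)
    have i2: "integrable lborel (\<lambda>\<xi>. cmod (k \<xi> - trunc k N0 \<xi>) * cmod (r \<xi>))"
      using integrable_norm[OF sqint_mult_integrable[OF d r]] by (simp add: norm_mult)
    have "cmod (fourier (T n) x) \<le> (LINT \<xi>|lborel. cmod (T n \<xi>))" by (rule norm_fourier_le)
    also have "\<dots> \<le> (LINT \<xi>|lborel. cmod (trunc h N0 \<xi>) + cmod (k \<xi> - trunc k N0 \<xi>) * cmod (r \<xi>))"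
      using T(1)[of n] by (intro integral_mono Bochner_Integration.integrable_add i1 i2 integrable_norm pt)
    also have "\<dots> = C0 + (LINT \<xi>|lborel. cmod (k \<xi> - trunc k N0 \<xi>) * cmod (r \<xi>))"
      using i1 i2 by (simp add: C0_def)
    also have "(LINT \<xi>|lborel. cmod (k \<xi> - trunc k N0 \<xi>) * cmod (r \<xi>)) \<le> sqrt \<epsilon> * sqrt (LINT \<xi>|lborel. (cmod (r \<xi>))\<^sup>2)"
      unfolding \<epsilon>_def by (rule Cauchy_Schwarz_sqint[OF d r])
    also have "\<dots> \<le> sqrt \<epsilon> * sqrt (ball_vol * (1 + real n))"
      unfolding rn using \<epsilon> by (intro mult_left_mono real_sqrt_le_mono integral_inverse_weight) auto
    also have "\<dots> = sqrt ((\<epsilon> * ball_vol) * (1 + real n))" by (simp add: real_sqrt_mult mult.assoc)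
    also have "\<dots> \<le> sqrt (\<eta> * (1 + real n))" using \<epsilon> by (intro real_sqrt_le_mono mult_right_mono) auto
    finally show ?thesis by (simp add: a_def)
  qed
  define D where "D = (LINT \<xi>|lborel. weight \<xi> * (cmod (h \<xi>))\<^sup>2)"
  have D: "0 \<le> D" unfolding D_def by (intro integral_nonneg_AE AE_I2 mult_nonneg_nonneg less_imp_le[OF weight_pos]) simp
  have pd: "fourier_pair (\<lambda>\<xi>. h \<xi> - T n \<xi>) (\<lambda>x. u x - fourier (T n) x)" for n
    by (intro fourier_pair_diff p fourier_pair_L1 T)
  have tail: "(LINT x|lborel. (cmod (u x - fourier (T n) x))\<^sup>2) \<le> D / 16 ^ n" for n
  proof -
    have "(LINT x|lborel. (cmod (u x - fourier (T n) x))\<^sup>2) = (LINT \<xi>|lborel. (cmod (h \<xi> - T n \<xi>))\<^sup>2)"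
      by (rule fourier_pair_plancherel[OF pd])
    also have "\<dots> \<le> (LINT \<xi>|lborel. (1 / 16 ^ n) * (weight \<xi> * (cmod (h \<xi>))\<^sup>2))"
    proof (intro integral_mono sqint_integrable sqint_diff sq T integrable_mult_right w)
      fix \<xi>
      show "(cmod (h \<xi> - T n \<xi>))\<^sup>2 \<le> (1 / 16 ^ n) * (weight \<xi> * (cmod (h \<xi>))\<^sup>2)"
      proof (cases "norm \<xi> < 2 ^ n")
        case True
        then have "h \<xi> - T n \<xi> = 0" by (simp add: T_def trunc_def)
        then show ?thesis using weight_pos[of \<xi>] by simp
      next
        case False
        then have "(2 ^ n) ^ 4 \<le> norm \<xi> ^ 4" by (intro power_mono) auto
        moreover have "((2::real) ^ n) ^ 4 = 16 ^ n" by (simp add: power_mult[symmetric] mult.commute[of n]) (simp add: power_mult)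
        moreover have "norm \<xi> ^ 4 \<le> weight \<xi>"
        proof -
          have "1 \<le> pi ^ 4" using pi_gt3 by (intro one_le_power) simp
          then have "1 * norm \<xi> ^ 4 \<le> (16 * pi ^ 4) * norm \<xi> ^ 4" by (intro mult_right_mono) auto
          then show ?thesis by (simp add: weight_def)
        qed
        ultimately have "16 ^ n \<le> weight \<xi>" by simp
        then have "16 ^ n * (cmod (h \<xi>))\<^sup>2 \<le> weight \<xi> * (cmod (h \<xi>))\<^sup>2" by (intro mult_right_mono) auto
        moreover have "h \<xi> - T n \<xi> = h \<xi>" using False by (simp add: T_def trunc_def)
        ultimately show ?thesis by (simp add: field_simps)
      qed
    qed
    also have "\<dots> = D / 16 ^ n" by (simp add: D_def)
    finally show ?thesis .
  qed
  (* on E n the low frequency part, bounded by a n, is at most half of |u| *)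
  define E where "E n = {x. 2 * a n \<le> cmod (u x) \<and> cmod (u x) < 2 * a (Suc n)}" for n
  have Em [measurable]: "E n \<in> sets borel" for n unfolding E_def by measurable
  define \<Phi> where "\<Phi> x = ennreal ((cmod (u x))\<^sup>2 * exp (\<gamma> * (cmod (u x))\<^sup>2))" for x
  have [measurable]: "\<Phi> \<in> borel_measurable borel" unfolding \<Phi>_def by measurable
  have a_unbounded: "\<exists>n. t < 2 * a n" for t
  proof -
    obtain n where n: "t\<^sup>2 / \<eta> < real n" using reals_Archimedean2 by blast
    then have "t\<^sup>2 < \<eta> * (1 + real n)" using \<eta> by (simp add: field_simps)
    then have "sqrt (t\<^sup>2) < sqrt (\<eta> * (1 + real n))" by (rule real_sqrt_less_mono)
    then have "t < a n" using C0 by (simp add: a_def)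
    then show ?thesis using a0[of n] by (intro exI[of _ n]) linarith
  qed
  define A0 where "A0 = exp (\<gamma> * (2 * a 0)\<^sup>2)"
  have cover: "\<Phi> x \<le> ennreal A0 * ennreal ((cmod (u x))\<^sup>2) + (\<Sum>n. indicator (E n) x * \<Phi> x)" for x
  proof (cases "cmod (u x) < 2 * a 0")
    case True
    have "(cmod (u x))\<^sup>2 * exp (\<gamma> * (cmod (u x))\<^sup>2) \<le> (cmod (u x))\<^sup>2 * A0"
    proof -
      have "(cmod (u x))\<^sup>2 \<le> (2 * a 0)\<^sup>2" using True by (intro power_mono) auto
      then have "exp (\<gamma> * (cmod (u x))\<^sup>2) \<le> A0" unfolding A0_def using \<gamma> by simp
      then show ?thesis by (intro mult_left_mono) auto
    qed
    then have "\<Phi> x \<le> ennreal A0 * ennreal ((cmod (u x))\<^sup>2)"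
      unfolding \<Phi>_def by (subst ennreal_mult[symmetric]) (auto simp: A0_def mult.commute intro!: ennreal_leI)
    then show ?thesis by (rule order_trans) simp
  next
    case False
    (* the index of the first level above |u x| is positive here, and its predecessor locates x *)
    define m where "m = (LEAST n. cmod (u x) < 2 * a n)"
    have m: "cmod (u x) < 2 * a m" unfolding m_def using a_unbounded by (rule LeastI_ex)
    then obtain j where j: "m = Suc j" using False by (cases m) auto
    have "\<not> cmod (u x) < 2 * a j" using not_less_Least[of j "\<lambda>n. cmod (u x) < 2 * a n"] j by (simp add: m_def[symmetric])
    then have "x \<in> E j" using m j by (simp add: E_def)
    then have "\<Phi> x = indicator (E j) x * \<Phi> x" by simp
    also have "\<dots> \<le> (\<Sum>n. indicator (E n) x * \<Phi> x)"
    proof -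
      define f where "f n = indicator (E n) x * \<Phi> x" for n
      have "sum f {j} \<le> suminf f" by (rule sum_le_suminf) auto
      moreover have "f = (\<lambda>n. indicator (E n) x * \<Phi> x)" by (simp add: f_def fun_eq_iff)
      ultimately show ?thesis by (simp only: sum.insert sum.empty finite.emptyI empty_iff not_False_eq_True add_0_right)
    qed
    finally show ?thesis by (rule order_trans) simp
  qed
  define K where "K = exp (8 * \<gamma> * C0\<^sup>2)"
  have E_le: "(\<integral>\<^sup>+x. indicator (E n) x * \<Phi> x \<partial>lborel) \<le> ennreal (16 * K * D * (1 / 8) ^ n)" for n
  proof -
    define B where "B = exp (\<gamma> * (2 * a (Suc n))\<^sup>2)"
    have "(\<integral>\<^sup>+x. indicator (E n) x * \<Phi> x \<partial>lborel) \<le> (\<integral>\<^sup>+x. ennreal (4 * B) * ennreal ((cmod (u x - fourier (T n) x))\<^sup>2) \<partial>lborel)"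
    proof (intro nn_integral_mono)
      fix x
      show "indicator (E n) x * \<Phi> x \<le> ennreal (4 * B) * ennreal ((cmod (u x - fourier (T n) x))\<^sup>2)"
      proof (cases "x \<in> E n")
        case True
        then have x: "2 * a n \<le> cmod (u x)" "cmod (u x) \<le> 2 * a (Suc n)" by (auto simp: E_def)
        have "cmod (u x) - cmod (fourier (T n) x) \<le> cmod (u x - fourier (T n) x)" by (rule norm_triangle_ineq2)
        then have "cmod (u x) \<le> 2 * cmod (u x - fourier (T n) x)" using fa[of n x] x(1) by linarith
        then have "(cmod (u x))\<^sup>2 \<le> (2 * cmod (u x - fourier (T n) x))\<^sup>2" by (intro power_mono) auto
        then have 1: "(cmod (u x))\<^sup>2 \<le> 4 * (cmod (u x - fourier (T n) x))\<^sup>2" by (simp add: power_mult_distrib)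
        have 2: "exp (\<gamma> * (cmod (u x))\<^sup>2) \<le> B"
        proof -
          have "(cmod (u x))\<^sup>2 \<le> (2 * a (Suc n))\<^sup>2" using x by (intro power_mono) auto
          then show ?thesis unfolding B_def using \<gamma> by simp
        qed
        have "(cmod (u x))\<^sup>2 * exp (\<gamma> * (cmod (u x))\<^sup>2) \<le> 4 * (cmod (u x - fourier (T n) x))\<^sup>2 * B"
          by (intro mult_mono 1 2) auto
        then show ?thesis using True unfolding \<Phi>_def
          by (subst ennreal_mult[symmetric]) (auto simp: B_def mult_ac intro!: ennreal_leI)
      qed simp
    qed
    also have "\<dots> = ennreal (4 * B) * ennreal (LINT x|lborel. (cmod (u x - fourier (T n) x))\<^sup>2)"
      using nn_integral_sqint[OF fourier_pairD(2)[OF pd]] sqint_measurable[OF fourier_pairD(2)[OF pd]]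
      by (subst nn_integral_cmult) auto
    also have "\<dots> = ennreal (4 * B * (LINT x|lborel. (cmod (u x - fourier (T n) x))\<^sup>2))"
      by (subst ennreal_mult) (auto simp: B_def)
    also have "\<dots> \<le> ennreal (16 * K * D * (1 / 8) ^ n)"
    proof (rule ennreal_leI)
      have "(a (Suc n))\<^sup>2 \<le> 2 * C0\<^sup>2 + 2 * (\<eta> * (2 + real n))"
      proof -
        have "(a (Suc n))\<^sup>2 \<le> 2 * C0\<^sup>2 + 2 * (sqrt (\<eta> * (1 + real (Suc n))))\<^sup>2"
          unfolding a_def using sum_squares_bound[of C0 "sqrt (\<eta> * (1 + real (Suc n)))"] by (simp only: power2_sum)
        then show ?thesis using \<eta> by simp
      qed
      then have "\<gamma> * (2 * a (Suc n))\<^sup>2 \<le> \<gamma> * (4 * (2 * C0\<^sup>2 + 2 * (\<eta> * (2 + real n))))"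
        using \<gamma> by (intro mult_left_mono) (auto simp: power_mult_distrib)
      also have "\<dots> = 8 * \<gamma> * C0\<^sup>2 + (2 + real n) * ln 2" using \<gamma> by (simp add: \<eta>_def field_simps)
      finally have "B \<le> exp (8 * \<gamma> * C0\<^sup>2 + (2 + real n) * ln 2)" unfolding B_def by simp
      also have "\<dots> = K * (4 * 2 ^ n)"
      proof -
        have "exp ((2 + real n) * ln 2) = 2 ^ (2 + n)"
          using exp_of_nat_mult[of "2 + n" "ln (2::real)"] by simp
        then show ?thesis by (simp add: exp_add K_def power_add)
      qed
      finally have B: "B \<le> K * (4 * 2 ^ n)" .
      have "4 * B * (LINT x|lborel. (cmod (u x - fourier (T n) x))\<^sup>2) \<le> 4 * (K * (4 * 2 ^ n)) * (D / 16 ^ n)"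
        using B by (intro mult_mono tail) (auto simp: K_def B_def)
      also have "\<dots> = 16 * K * D * (2 ^ n / 16 ^ n)" by simp
      also have "(2::real) ^ n / 16 ^ n = (1 / 8) ^ n" by (simp add: power_divide[symmetric])
      finally show "4 * B * (LINT x|lborel. (cmod (u x - fourier (T n) x))\<^sup>2) \<le> 16 * K * D * (1 / 8) ^ n" .
    qed
    finally show ?thesis .
  qed
  have "(\<integral>\<^sup>+x. \<Phi> x \<partial>lborel) \<le> (\<integral>\<^sup>+x. ennreal A0 * ennreal ((cmod (u x))\<^sup>2) + (\<Sum>n. indicator (E n) x * \<Phi> x) \<partial>lborel)"
    by (intro nn_integral_mono cover)
  also have "\<dots> = ennreal A0 * ennreal (LINT x|lborel. (cmod (u x))\<^sup>2) + (\<Sum>n. \<integral>\<^sup>+x. indicator (E n) x * \<Phi> x \<partial>lborel)"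
    by (subst nn_integral_add, simp, simp, subst nn_integral_cmult, simp, subst nn_integral_suminf, simp)
       (simp only: nn_integral_sqint[OF sq(2)])
  also have "\<dots> \<le> ennreal A0 * ennreal (LINT x|lborel. (cmod (u x))\<^sup>2) + (\<Sum>n. ennreal (16 * K * D * (1 / 8) ^ n))"
    by (intro add_left_mono suminf_le E_le) auto
  also have "(\<Sum>n. ennreal (16 * K * D * (1 / 8) ^ n)) = ennreal (\<Sum>n. 16 * K * D * (1 / 8) ^ n)"
    using D by (intro suminf_ennreal2 summable_mult summable_geometric) (auto simp: K_def)
  finally have "(\<integral>\<^sup>+x. \<Phi> x \<partial>lborel) < \<infinity>"
    by (rule le_less_trans) (simp add: ennreal_mult_less_top)
  then show ?thesis by (simp add: \<Phi>_def)
qed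

section \<open>Integrability of the Fourier transform of a maximiser\<close>

text \<open>The integrand as a function of \<open>s = |u|\<^sup>2\<close>.\<close>
definition Psi :: "real \<Rightarrow> real \<Rightarrow> real" where
  "Psi \<alpha> s = exp (32 * pi\<^sup>2 * s) - 1 - \<alpha> * s"

text \<open>The functional \<open>J\<close> as a nonnegative integral over Borel functions (\<open>J_eq_energy\<close>).\<close>
definition energy :: "real \<Rightarrow> (real^4 \<Rightarrow> complex) \<Rightarrow> ennreal" where
  "energy \<alpha> u = (\<integral>\<^sup>+x. ennreal (Psi \<alpha> ((cmod (u x))\<^sup>2)) \<partial>lborel)"

lemma measurable_Psi [measurable]: "Psi \<alpha> \<in> borel_measurable borel"
  unfolding Psi_def by measurable

lemma Psi_ge: "(32 * pi\<^sup>2 - \<alpha>) * s \<le> Psi \<alpha> s"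
  using exp_ge_add_one_self[of "32 * pi\<^sup>2 * s"] by (simp add: Psi_def algebra_simps)

lemma Psi_nonneg: "\<alpha> < 32 * pi\<^sup>2 \<Longrightarrow> 0 \<le> s \<Longrightarrow> 0 \<le> Psi \<alpha> s"
  by (rule order_trans[OF _ Psi_ge]) simp

text \<open>The gain from scaling is at least linear in \<open>s\<close> with the positive slope \<open>32 \<pi>\<^sup>2 - \<alpha>\<close>, which is the slope of \<open>Psi\<close> at zero.\<close>
lemma Psi_scale:
  assumes "0 \<le> s" "1 \<le> m"
  shows "Psi \<alpha> s + (m - 1) * (32 * pi\<^sup>2 - \<alpha>) * s \<le> Psi \<alpha> (m * s)"
proof -
  let ?b = "32 * pi\<^sup>2"
  have x: "0 \<le> ?b * ((m - 1) * s)" using assms by (intro mult_nonneg_nonneg) auto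
  have "y \<le> 1 * (exp y - 1)" for y :: real unfolding mult_1_left using exp_ge_add_one_self[of y] by linarith
  then have "?b * ((m - 1) * s) \<le> 1 * (exp (?b * ((m - 1) * s)) - 1)" .
  also have "\<dots> \<le> exp (?b * s) * (exp (?b * ((m - 1) * s)) - 1)"
    using assms x by (intro mult_right_mono) auto
  also have "\<dots> = exp (?b * (m * s)) - exp (?b * s)"
    by (simp add: right_diff_distrib exp_add[symmetric] algebra_simps)
  finally show ?thesis by (simp add: Psi_def algebra_simps)
qed

definition dPsi :: "real \<Rightarrow> real \<Rightarrow> real" where
  "dPsi \<alpha> s = 32 * pi\<^sup>2 * exp (32 * pi\<^sup>2 * s) - \<alpha>"

lemma measurable_dPsi [measurable]: "dPsi \<alpha> \<in> borel_measurable borel"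
  unfolding dPsi_def by measurable

lemma Psi_convex: "Psi \<alpha> s + dPsi \<alpha> s * (t - s) \<le> Psi \<alpha> t"
proof -
  let ?b = "32 * pi\<^sup>2"
  have "exp (?b * s) * (1 + ?b * (t - s)) \<le> exp (?b * s) * exp (?b * (t - s))"
    by (intro mult_left_mono exp_ge_add_one_self) simp
  also have "\<dots> = exp (?b * t)" by (simp add: exp_add[symmetric] algebra_simps)
  finally show ?thesis by (simp add: Psi_def dPsi_def algebra_simps)
qed

lemma dPsi_nonneg: "\<alpha> < 32 * pi\<^sup>2 \<Longrightarrow> 0 \<le> s \<Longrightarrow> 0 \<le> dPsi \<alpha> s"
proof -
  assume a: "\<alpha> < 32 * pi\<^sup>2" "0 \<le> s"
  have "32 * pi\<^sup>2 * 1 \<le> 32 * pi\<^sup>2 * exp (32 * pi\<^sup>2 * s)" using a(2) by (intro mult_left_mono) auto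
  then show ?thesis using a(1) unfolding dPsi_def by linarith
qed

lemma J_eq_energy:
  assumes \<alpha>: "\<alpha> < 32 * pi\<^sup>2" and ae: "AE x in lborel. u x = u' x" and [measurable]: "u' \<in> borel_measurable borel"
  shows "J \<alpha> u = enn2ereal (energy \<alpha> u')"
proof -
  have pos: "0 \<le> exp (32 * pi^2 * (cmod (u x))^2) - 1 - \<alpha> * (cmod (u x))^2" for x
    using Psi_nonneg[OF \<alpha>, of "(cmod (u x))\<^sup>2"] by (simp add: Psi_def)
  have "(\<integral>\<^sup>+x. ennreal (- (exp (32 * pi^2 * (cmod (u x))^2) - 1 - \<alpha> * (cmod (u x))^2)) \<partial>lebesgue) = (\<integral>\<^sup>+(x::real^4). 0 \<partial>lebesgue)"
    using pos by (intro nn_integral_cong) (simp add: ennreal_neg)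
  moreover have "(\<integral>\<^sup>+x. ennreal (exp (32 * pi^2 * (cmod (u x))^2) - 1 - \<alpha> * (cmod (u x))^2) \<partial>lebesgue) = energy \<alpha> u'"
  proof -
    have "(\<integral>\<^sup>+x. ennreal (exp (32 * pi^2 * (cmod (u x))^2) - 1 - \<alpha> * (cmod (u x))^2) \<partial>lebesgue) = (\<integral>\<^sup>+x. ennreal (Psi \<alpha> ((cmod (u' x))\<^sup>2)) \<partial>lebesgue)"
      by (rule nn_integral_cong_AE, rule AE_completion) (use ae in eventually_elim, simp add: Psi_def)
    then show ?thesis by (simp add: energy_def nn_integral_completion)
  qed
  ultimately show ?thesis by (simp add: J_def ext_integral_def zero_ennreal.rep_eq)
qed

text \<open>The extremal problem transferred to pairs of a density and its transform; the constraint becomes an integral over the density alone.\<close>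
definition maximiser :: "real \<Rightarrow> (real^4 \<Rightarrow> complex) \<Rightarrow> (real^4 \<Rightarrow> complex) \<Rightarrow> bool" where
  "maximiser \<alpha> h u \<longleftrightarrow> fourier_pair h u \<and> integrable lborel (\<lambda>\<xi>. weight \<xi> * (cmod (h \<xi>))\<^sup>2)
     \<and> (LINT \<xi>|lborel. weight \<xi> * (cmod (h \<xi>))\<^sup>2) = 1
     \<and> (\<forall>k v. fourier_pair k v \<longrightarrow> integrable lborel (\<lambda>\<xi>. weight \<xi> * (cmod (k \<xi>))\<^sup>2)
           \<longrightarrow> (LINT \<xi>|lborel. weight \<xi> * (cmod (k \<xi>))\<^sup>2) = 1 \<longrightarrow> energy \<alpha> v \<le> energy \<alpha> u)"

lemma extremal_maximiser:
  assumes \<alpha>: "\<alpha> < 32 * pi\<^sup>2" and ext: "extremal \<alpha> u"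
  shows "\<exists>h u'. (AE x in lborel. u x = u' x) \<and> maximiser \<alpha> h u'"
proof -
  have u: "u \<in> H2" "H2_norm u = 1" and J: "J \<alpha> u = S \<alpha>" using ext by (auto simp: extremal_def H2_sphere_def)
  then have "u \<in> L2" by (simp add: H2_def)
  then obtain u' where u': "sqint u'" "AE x in lborel. u x = u' x" using L2_borel_representative by blast
  obtain h where p: "fourier_pair h u'" using fourier_pair_surj[OF u'(1)] by blast
  note n = H2_norm_fourier[OF u(1) u'(2) p]
  have one: "(LINT \<xi>|lborel. weight \<xi> * (cmod (h \<xi>))\<^sup>2) = 1" using n(2) u(2) by simp
  have "energy \<alpha> v \<le> energy \<alpha> u'"
    if q: "fourier_pair k v" and w: "integrable lborel (\<lambda>\<xi>. weight \<xi> * (cmod (k \<xi>))\<^sup>2)"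
      and o: "(LINT \<xi>|lborel. weight \<xi> * (cmod (k \<xi>))\<^sup>2) = 1" for k v
  proof -
    have v: "v \<in> H2" by (rule fourier_pair_in_H2[OF q w])
    have "H2_norm v = 1" using H2_norm_fourier(2)[OF v _ q] o by simp
    with v have "v \<in> H2_sphere" by (simp add: H2_sphere_def)
    then have "J \<alpha> v \<le> S \<alpha>" unfolding S_def by (rule SUP_upper)
    then have "enn2ereal (energy \<alpha> v) \<le> enn2ereal (energy \<alpha> u')"
      using J J_eq_energy[OF \<alpha> u'(2) sqint_measurable[OF u'(1)]]
        J_eq_energy[OF \<alpha> _ sqint_measurable[OF fourier_pairD(2)[OF q]], of v] by simp
    then show ?thesis by (simp add: less_eq_ennreal.rep_eq)
  qed
  then have "maximiser \<alpha> h u'" unfolding maximiser_def using p n(1) one by blast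
  then show ?thesis using u'(2) by blast
qed

lemma Psi_le_sq_exp:
  assumes "0 \<le> s"
  shows "Psi \<alpha> s \<le> (32 * pi\<^sup>2 + \<bar>\<alpha>\<bar>) * (s * exp (32 * pi\<^sup>2 * s))"
proof -
  let ?b = "32 * pi\<^sup>2"
  have "1 - ?b * s \<le> exp (- (?b * s))" using exp_ge_add_one_self[of "- (?b * s)"] by simp
  then have "exp (?b * s) * (1 - ?b * s) \<le> exp (?b * s) * exp (- (?b * s))" by (intro mult_left_mono) auto
  then have "exp (?b * s) - 1 \<le> ?b * (s * exp (?b * s))" by (simp add: exp_minus algebra_simps)
  moreover have "- \<alpha> * s \<le> \<bar>\<alpha>\<bar> * (s * exp (?b * s))"
  proof -
    have "- \<alpha> * s \<le> \<bar>\<alpha>\<bar> * (s * 1)" using mult_right_mono[of "- \<alpha>" "\<bar>\<alpha>\<bar>" s] assms by simp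
    also have "\<dots> \<le> \<bar>\<alpha>\<bar> * (s * exp (?b * s))" using assms by (intro mult_left_mono) auto
    finally show ?thesis .
  qed
  ultimately show ?thesis by (simp add: Psi_def distrib_right)
qed

lemma maximiser_energy_finite:
  assumes "maximiser \<alpha> h u"
  shows "energy \<alpha> u < \<infinity>"
proof -
  have p: "fourier_pair h u" and w: "integrable lborel (\<lambda>\<xi>. weight \<xi> * (cmod (h \<xi>))\<^sup>2)" using assms by (auto simp: maximiser_def)
  note [measurable] = sqint_measurable[OF fourier_pairD(2)[OF p]]
  let ?c = "32 * pi\<^sup>2 + \<bar>\<alpha>\<bar>"
  have "energy \<alpha> u \<le> (\<integral>\<^sup>+x. ennreal ?c * ennreal ((cmod (u x))\<^sup>2 * exp (32 * pi\<^sup>2 * (cmod (u x))\<^sup>2)) \<partial>lborel)"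
    unfolding energy_def
    by (intro nn_integral_mono) (subst ennreal_mult[symmetric], auto intro!: ennreal_leI Psi_le_sq_exp)
  also have "\<dots> = ennreal ?c * (\<integral>\<^sup>+x. ennreal ((cmod (u x))\<^sup>2 * exp (32 * pi\<^sup>2 * (cmod (u x))\<^sup>2)) \<partial>lborel)"
    by (rule nn_integral_cmult) measurable
  also have "\<dots> < \<infinity>" using exp_integrability[OF p w, of "32 * pi\<^sup>2"] by (simp add: ennreal_mult_less_top)
  finally show ?thesis .
qed

text \<open>A competitor of squared norm \<open>q \<le> 1\<close> can be scaled up to norm one, and \<open>Psi_scale\<close> quantifies the gain of energy.\<close>
lemma maximiser_strict_scaling:
  assumes \<alpha>: "\<alpha> < 32 * pi\<^sup>2" and m: "maximiser \<alpha> h u" and p: "fourier_pair k v"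
    and w: "integrable lborel (\<lambda>\<xi>. weight \<xi> * (cmod (k \<xi>))\<^sup>2)"
    and q: "(LINT \<xi>|lborel. weight \<xi> * (cmod (k \<xi>))\<^sup>2) = q" "0 < q" "q \<le> 1"
  shows "energy \<alpha> v + ennreal ((1 / q - 1) * (32 * pi\<^sup>2 - \<alpha>) * (LINT x|lborel. (cmod (v x))\<^sup>2)) \<le> energy \<alpha> u"
proof -
  define l where "l = complex_of_real (1 / sqrt q)"
  have l: "(cmod (l * z))\<^sup>2 = (1 / q) * (cmod z)\<^sup>2" for z
    using q by (simp add: l_def norm_mult norm_divide power_mult_distrib power_divide)
  have v: "sqint v" by (rule fourier_pairD[OF p])
  note [measurable] = sqint_measurable[OF v]
  have "fourier_pair (\<lambda>\<xi>. l * k \<xi>) (\<lambda>x. l * v x)" by (rule fourier_pair_cmult[OF p])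
  moreover have wl: "weight \<xi> * (cmod (l * k \<xi>))\<^sup>2 = (1 / q) * (weight \<xi> * (cmod (k \<xi>))\<^sup>2)" for \<xi> by (simp add: l)
  have "integrable lborel (\<lambda>\<xi>. weight \<xi> * (cmod (l * k \<xi>))\<^sup>2)" unfolding wl by (intro integrable_mult_right w)
  moreover have "(LINT \<xi>|lborel. weight \<xi> * (cmod (l * k \<xi>))\<^sup>2) = 1" unfolding wl using q by simp
  ultimately have le: "energy \<alpha> (\<lambda>x. l * v x) \<le> energy \<alpha> u" using m by (auto simp: maximiser_def)
  let ?c = "(1 / q - 1) * (32 * pi\<^sup>2 - \<alpha>)"
  have c: "0 \<le> ?c" using \<alpha> q by (intro mult_nonneg_nonneg) auto
  have "energy \<alpha> v + ennreal (?c * (LINT x|lborel. (cmod (v x))\<^sup>2)) = (\<integral>\<^sup>+x. ennreal (Psi \<alpha> ((cmod (v x))\<^sup>2)) + ennreal ?c * ennreal ((cmod (v x))\<^sup>2) \<partial>lborel)"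
    unfolding energy_def using c
    by (subst nn_integral_add, simp, simp, subst nn_integral_cmult, simp) (simp only: nn_integral_sqint[OF v] ennreal_mult'[OF c])
  also have "\<dots> \<le> energy \<alpha> (\<lambda>x. l * v x)"
    unfolding energy_def
  proof (intro nn_integral_mono)
    fix x
    have "ennreal (Psi \<alpha> ((cmod (v x))\<^sup>2)) + ennreal ?c * ennreal ((cmod (v x))\<^sup>2) = ennreal (Psi \<alpha> ((cmod (v x))\<^sup>2) + ?c * (cmod (v x))\<^sup>2)"
      using c Psi_nonneg[OF \<alpha>] by (simp add: ennreal_mult' ennreal_plus)
    also have "\<dots> \<le> ennreal (Psi \<alpha> ((1 / q) * (cmod (v x))\<^sup>2))"
      using Psi_scale[of "(cmod (v x))\<^sup>2" "1 / q" \<alpha>] q by (intro ennreal_leI) auto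
    finally show "ennreal (Psi \<alpha> ((cmod (v x))\<^sup>2)) + ennreal ?c * ennreal ((cmod (v x))\<^sup>2) \<le> ennreal (Psi \<alpha> ((cmod (l * v x))\<^sup>2))"
      by (simp only: l)
  qed
  finally show ?thesis using le by (rule order_trans)
qed

text \<open>Unlike \<open>1 / weight\<close> itself, its square is integrable, so that the integrals stay bounded in \<open>n\<close>.\<close>
lemma integral_inverse_weight_square:
  "integrable lborel (\<lambda>\<xi>. indicator (dyadic n) \<xi> * (1 / weight \<xi>)\<^sup>2)"
  "(LINT \<xi>|lborel. indicator (dyadic n) \<xi> * (1 / weight \<xi>)\<^sup>2) \<le> 2 * ball_vol"
proof -
  have ind: "integrable lborel (indicator (dyadic n) :: real^4 \<Rightarrow> real)" for n
    using emeasure_dyadic_finite by (intro integrable_real_indicator) auto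
  have w1: "(1 / weight \<xi>)\<^sup>2 \<le> 1" for \<xi>
    using weight_ge_1[of \<xi>] by (simp add: power_divide)
  have int: "integrable lborel (\<lambda>\<xi>. indicator (dyadic n) \<xi> * (1 / weight \<xi>)\<^sup>2)" for n
  proof (rule Bochner_Integration.integrable_bound[OF ind[of n]])
    show "AE \<xi> in lborel. norm (indicator (dyadic n) \<xi> * (1 / weight \<xi>)\<^sup>2) \<le> norm (indicator (dyadic n) \<xi> :: real)"
      by (rule AE_I2) (use w1 in \<open>auto split: split_indicator\<close>)
  qed measurable
  then show "integrable lborel (\<lambda>\<xi>. indicator (dyadic n) \<xi> * (1 / weight \<xi>)\<^sup>2)" .
  have bv: "0 \<le> ball_vol" by (simp add: ball_vol_def)
  have "(LINT \<xi>|lborel. indicator (dyadic n) \<xi> * (1 / weight \<xi>)\<^sup>2) \<le> ball_vol * (2 - 1 / 16 ^ n)"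
  proof (induction n)
    case 0
    have "(LINT \<xi>|lborel. indicator (dyadic 0) \<xi> * (1 / weight \<xi>)\<^sup>2) \<le> (LINT \<xi>|lborel. indicator (dyadic 0) \<xi>)"
      by (intro integral_mono int ind) (use w1 in \<open>auto split: split_indicator\<close>)
    also have "\<dots> = ball_vol" using measure_dyadic[of 0] by simp
    finally show ?case by simp
  next
    case (Suc n)
    let ?c = "(1 / (16 * 16 ^ n))\<^sup>2 :: real"
    have "(LINT \<xi>|lborel. indicator (dyadic (Suc n)) \<xi> * (1 / weight \<xi>)\<^sup>2)
      \<le> (LINT \<xi>|lborel. indicator (dyadic n) \<xi> * (1 / weight \<xi>)\<^sup>2 + ?c * indicator (dyadic (Suc n)) \<xi>)"
    proof (intro integral_mono int Bochner_Integration.integrable_add integrable_mult_right ind)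
      fix \<xi> :: "real^4"
      show "indicator (dyadic (Suc n)) \<xi> * (1 / weight \<xi>)\<^sup>2 \<le> indicator (dyadic n) \<xi> * (1 / weight \<xi>)\<^sup>2 + ?c * indicator (dyadic (Suc n)) \<xi>"
      proof (cases "\<xi> \<in> dyadic n")
        case True
        then show ?thesis by (auto split: split_indicator)
      next
        case False
        then have "2 ^ n \<le> norm \<xi>" by (simp add: dyadic_def not_less)
        then have "(2 ^ n) ^ 4 \<le> norm \<xi> ^ 4" by (intro power_mono) auto
        moreover have "((2::real) ^ n) ^ 4 = 16 ^ n" by (simp add: power_mult[symmetric] mult.commute[of n]) (simp add: power_mult)
        moreover have "1 \<le> pi ^ 4" using pi_gt3 by (intro one_le_power) simp
        ultimately have "16 * 1 * 16 ^ n \<le> 16 * pi ^ 4 * norm \<xi> ^ 4" by (intro mult_mono) auto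
        then have "16 * 16 ^ n \<le> weight \<xi>" unfolding weight_def by linarith
        then have "1 / weight \<xi> \<le> 1 / (16 * 16 ^ n)" by (intro divide_left_mono) (auto intro!: mult_pos_pos weight_pos)
        then have "(1 / weight \<xi>)\<^sup>2 \<le> ?c" using weight_pos[of \<xi>] by (intro power_mono) auto
        then show ?thesis using False by (auto split: split_indicator)
      qed
    qed
    also have "\<dots> = (LINT \<xi>|lborel. indicator (dyadic n) \<xi> * (1 / weight \<xi>)\<^sup>2) + ?c * (LINT \<xi>|lborel. indicator (dyadic (Suc n)) \<xi>)"
      using int[of n] ind[of "Suc n"] by (subst Bochner_Integration.integral_add) auto
    also have "?c * (LINT \<xi>|lborel. indicator (dyadic (Suc n)) \<xi>) = ball_vol * (1 / (16 * 16 ^ n))"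
      using measure_dyadic[of "Suc n"] by (simp add: power2_eq_square)
    finally have "(LINT \<xi>|lborel. indicator (dyadic (Suc n)) \<xi> * (1 / weight \<xi>)\<^sup>2) \<le> ball_vol * (2 - 1 / 16 ^ n) + ball_vol * (1 / (16 * 16 ^ n))"
      using Suc by simp
    also have "\<dots> = ball_vol * (2 - 1 / 16 ^ n + 1 / (16 * 16 ^ n))" by (simp only: distrib_left)
    also have "\<dots> \<le> ball_vol * (2 - 1 / 16 ^ Suc n)"
      using bv by (intro mult_left_mono) (auto simp: field_simps)
    finally show ?case .
  qed
  also have "\<dots> \<le> ball_vol * 2" using bv by (intro mult_left_mono) auto
  finally show "(LINT \<xi>|lborel. indicator (dyadic n) \<xi> * (1 / weight \<xi>)\<^sup>2) \<le> 2 * ball_vol" by simp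
qed

lemma maximiser_nontrivial:
  assumes "maximiser \<alpha> h u"
  shows "0 < (LINT x|lborel. (cmod (u x))\<^sup>2)" "(LINT x|lborel. (cmod (u x))\<^sup>2) = (LINT \<xi>|lborel. (cmod (h \<xi>))\<^sup>2)"
proof -
  have p: "fourier_pair h u" and one: "(LINT \<xi>|lborel. weight \<xi> * (cmod (h \<xi>))\<^sup>2) = 1" using assms by (auto simp: maximiser_def)
  show eq: "(LINT x|lborel. (cmod (u x))\<^sup>2) = (LINT \<xi>|lborel. (cmod (h \<xi>))\<^sup>2)" by (rule fourier_pair_plancherel[OF p])
  show "0 < (LINT x|lborel. (cmod (u x))\<^sup>2)"
  proof (rule ccontr)
    assume "\<not> ?thesis"
    moreover have "0 \<le> (LINT \<xi>|lborel. (cmod (h \<xi>))\<^sup>2)" by simp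
    ultimately have "(LINT \<xi>|lborel. (cmod (h \<xi>))\<^sup>2) = 0" using eq by simp
    then have "AE \<xi> in lborel. h \<xi> = 0" by (rule sqint_eq_0_AE[OF fourier_pairD(1)[OF p]])
    then have "(LINT \<xi>|lborel. weight \<xi> * (cmod (h \<xi>))\<^sup>2) = 0"
      by (intro integral_eq_zero_AE) (auto elim: eventually_mono)
    then show False using one by simp
  qed
qed

text \<open>Perturb the maximiser to \<open>v = u - \<epsilon> \<phi>\<close>, where \<open>\<phi>\<close> is the transform of \<open>g = sgn h / weight\<close>
restricted to a dyadic ball. This lowers the squared norm by about \<open>2 \<epsilon> P\<close>, with \<open>P\<close> the integral of \<open>|h|\<close> over the
ball, and rescaling gains energy at least proportional to \<open>\<epsilon> P\<close>. By convexity of \<open>Psi\<close> the perturbation itself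
loses at most \<open>2 \<epsilon>\<close> times the pairing of \<open>|F|\<close> with \<open>|\<phi>|\<close>, where \<open>F = dPsi \<alpha> (|u|\<^sup>2) u\<close> is the term from the Euler--Lagrange equation.
Both \<open>F\<close> and \<open>\<phi>\<close> are bounded in \<open>L\<^sup>2\<close> independently of the ball, so maximality bounds \<open>P\<close> uniformly.\<close>
lemma maximiser_integrable:
  assumes \<alpha>: "\<alpha> < 32 * pi\<^sup>2" and m: "maximiser \<alpha> h u"
  shows "integrable lborel h"
proof -
  have p: "fourier_pair h u" and w: "integrable lborel (\<lambda>\<xi>. weight \<xi> * (cmod (h \<xi>))\<^sup>2)"
    and one: "(LINT \<xi>|lborel. weight \<xi> * (cmod (h \<xi>))\<^sup>2) = 1" using m by (auto simp: maximiser_def)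
  note sq = fourier_pairD(1,2)[OF p]
  note [measurable] = sqint_measurable[OF sq(1)] sqint_measurable[OF sq(2)]
  define b where "b = 32 * pi\<^sup>2"
  have b: "0 < b" "\<alpha> < b" using \<alpha> by (auto simp: b_def)
  define F where "F x = complex_of_real (dPsi \<alpha> ((cmod (u x))\<^sup>2)) * u x" for x
  have [measurable]: "F \<in> borel_measurable borel" unfolding F_def by measurable
  have F: "sqint F"
    unfolding sqint_def
  proof
    have "integrable lborel (\<lambda>x. (cmod (u x))\<^sup>2 * exp (2 * b * (cmod (u x))\<^sup>2))"
      using exp_integrability[OF p w, of "2 * b"] b by (intro integrableI_nonneg) auto
    then have "integrable lborel (\<lambda>x. (b + \<bar>\<alpha>\<bar>)\<^sup>2 * ((cmod (u x))\<^sup>2 * exp (2 * b * (cmod (u x))\<^sup>2)))"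
      by (rule integrable_mult_right)
    then show "integrable lborel (\<lambda>x. (cmod (F x))\<^sup>2)"
    proof (rule Bochner_Integration.integrable_bound)
      show "AE x in lborel. norm ((cmod (F x))\<^sup>2) \<le> norm ((b + \<bar>\<alpha>\<bar>)\<^sup>2 * ((cmod (u x))\<^sup>2 * exp (2 * b * (cmod (u x))\<^sup>2)))"
      proof (rule AE_I2)
        fix x
        let ?s = "(cmod (u x))\<^sup>2"
        have e: "1 \<le> exp (b * ?s)" using b by simp
        have "\<bar>dPsi \<alpha> ?s\<bar> \<le> b * exp (b * ?s) + \<bar>\<alpha>\<bar> * 1"
          using b unfolding dPsi_def b_def[symmetric] by (intro order_trans[OF abs_triangle_ineq4]) (simp add: abs_mult)
        also have "\<dots> \<le> b * exp (b * ?s) + \<bar>\<alpha>\<bar> * exp (b * ?s)" using e by (intro add_left_mono mult_left_mono) auto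
        also have "\<dots> = (b + \<bar>\<alpha>\<bar>) * exp (b * ?s)" by (simp add: distrib_right)
        finally have "\<bar>dPsi \<alpha> ?s\<bar>\<^sup>2 \<le> ((b + \<bar>\<alpha>\<bar>) * exp (b * ?s))\<^sup>2" by (intro power_mono) auto
        also have "\<dots> = (b + \<bar>\<alpha>\<bar>)\<^sup>2 * exp (2 * b * ?s)"
          by (simp add: power_mult_distrib power2_eq_square exp_add[symmetric] algebra_simps)
        finally have "\<bar>dPsi \<alpha> ?s\<bar>\<^sup>2 * ?s \<le> (b + \<bar>\<alpha>\<bar>)\<^sup>2 * exp (2 * b * ?s) * ?s" by (intro mult_right_mono) auto
        then show "norm ((cmod (F x))\<^sup>2) \<le> norm ((b + \<bar>\<alpha>\<bar>)\<^sup>2 * (?s * exp (2 * b * ?s)))"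
          by (simp add: F_def norm_mult power_mult_distrib mult_ac abs_mult)
      qed
    qed measurable
  qed measurable
  define A where "A = sqrt (LINT x|lborel. (cmod (F x))\<^sup>2)"
  define Nu where "Nu = (LINT x|lborel. (cmod (u x))\<^sup>2)"
  have Nu: "0 < Nu" unfolding Nu_def by (rule maximiser_nontrivial[OF m])
  have efin: "energy \<alpha> u < \<infinity>" by (rule maximiser_energy_finite[OF m])
  define C where "C = 8 * (A * sqrt (2 * ball_vol)) / ((b - \<alpha>) * Nu)"
  have ii: "integrable lborel (\<lambda>\<xi>. indicator (dyadic n) \<xi> * cmod (h \<xi>))" for n
  proof -
    have "integrable lborel (\<lambda>\<xi>. cmod (trunc h (2 ^ n) \<xi>))" by (intro integrable_norm integrable_trunc sq)
    moreover have "cmod (trunc h (2 ^ n) \<xi>) = indicator (dyadic n) \<xi> * cmod (h \<xi>)" for \<xi>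
      by (simp add: trunc_def dyadic_def norm_mult split: split_indicator)
    ultimately show ?thesis by simp
  qed
  have bound: "(LINT \<xi>|lborel. indicator (dyadic n) \<xi> * cmod (h \<xi>)) \<le> C" for n
  proof -
    define P where "P = (LINT \<xi>|lborel. indicator (dyadic n) \<xi> * cmod (h \<xi>))"
    define g where "g \<xi> = complex_of_real (indicator (dyadic n) \<xi> / weight \<xi>) * sgn (h \<xi>)" for \<xi>
    have gm [measurable]: "g \<in> borel_measurable borel" unfolding g_def sgn_div_norm by measurable
    have gn: "cmod (g \<xi>) \<le> indicator (dyadic n) \<xi> * (1 / weight \<xi>)" for \<xi>
      using weight_pos[of \<xi>] by (simp add: g_def norm_mult norm_sgn norm_divide split: split_indicator)
    have gn2: "(cmod (g \<xi>))\<^sup>2 \<le> indicator (dyadic n) \<xi> * (1 / weight \<xi>)\<^sup>2" for \<xi>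
      using power_mono[OF gn[of \<xi>], of 2] by (simp add: power_mult_distrib split: split_indicator_asm)
    have g: "sqint g"
      unfolding sqint_def
    proof
      show "integrable lborel (\<lambda>x. (cmod (g x))\<^sup>2)"
        by (rule Bochner_Integration.integrable_bound[OF integral_inverse_weight_square(1)[of n]])
           (auto intro!: AE_I2 order_trans[OF gn2])
    qed measurable
    obtain \<phi> where \<phi>: "fourier_pair g \<phi>" using fourier_pair_ex[OF g] by blast
    have s\<phi>: "sqint \<phi>" by (rule fourier_pairD[OF \<phi>])
    note [measurable] = sqint_measurable[OF s\<phi>]
    define N where "N = (LINT x|lborel. (cmod (\<phi> x))\<^sup>2)"
    have N: "0 \<le> N" by (simp add: N_def)
    have N_le: "N \<le> 2 * ball_vol"
    proof -
      have "N = (LINT \<xi>|lborel. (cmod (g \<xi>))\<^sup>2)" unfolding N_def by (rule fourier_pair_plancherel[OF \<phi>])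
      also have "\<dots> \<le> (LINT \<xi>|lborel. indicator (dyadic n) \<xi> * (1 / weight \<xi>)\<^sup>2)"
        by (intro integral_mono sqint_integrable g integral_inverse_weight_square gn2)
      also have "\<dots> \<le> 2 * ball_vol" by (rule integral_inverse_weight_square)
      finally show ?thesis .
    qed
    have wg: "integrable lborel (\<lambda>\<xi>. weight \<xi> * (cmod (g \<xi>))\<^sup>2)"
    proof (rule Bochner_Integration.integrable_bound[OF integral_inverse_weight(1)[of n]])
      show "AE \<xi> in lborel. norm (weight \<xi> * (cmod (g \<xi>))\<^sup>2) \<le> norm (indicator (dyadic n) \<xi> * (1 / weight \<xi>))"
      proof (rule AE_I2)
        fix \<xi>
        have "weight \<xi> * (cmod (g \<xi>))\<^sup>2 \<le> weight \<xi> * (indicator (dyadic n) \<xi> * (1 / weight \<xi>)\<^sup>2)"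
          using weight_pos[of \<xi>] by (intro mult_left_mono gn2) auto
        also have "\<dots> = indicator (dyadic n) \<xi> * (1 / weight \<xi>)" using weight_pos[of \<xi>] by (simp add: power2_eq_square)
        finally show "norm (weight \<xi> * (cmod (g \<xi>))\<^sup>2) \<le> norm (indicator (dyadic n) \<xi> * (1 / weight \<xi>))"
          using weight_pos[of \<xi>] by simp
      qed
    qed measurable
    define R where "R = (LINT \<xi>|lborel. weight \<xi> * (cmod (g \<xi>))\<^sup>2)"
    have R: "0 \<le> R" unfolding R_def by (intro integral_nonneg_AE AE_I2 mult_nonneg_nonneg less_imp_le[OF weight_pos]) simp
    have "P \<le> C"
    proof (cases "0 < P")
      case False
      have "0 \<le> C" unfolding C_def A_def using b Nu by (intro divide_nonneg_nonneg mult_nonneg_nonneg) (auto simp: ball_vol_def)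
      then show ?thesis using False by simp
    next
      case True
      (* the bounds by P / (R + 1) and 1 / (4 P) keep q positive and at most 1 - \<epsilon> P; the other two keep
         the L^2 norm of v comparable to that of u *)
      define \<epsilon> where "\<epsilon> = min (min 1 (P / (R + 1))) (min (1 / (4 * P)) (Nu / (4 * (N + 1))))"
      have \<epsilon>0: "0 < \<epsilon>" using True R N Nu by (simp add: \<epsilon>_def)
      have le: "\<epsilon> \<le> 1" "\<epsilon> \<le> P / (R + 1)" "\<epsilon> \<le> 1 / (4 * P)" "\<epsilon> \<le> Nu / (4 * (N + 1))"
        unfolding \<epsilon>_def by (simp_all only: min.cobounded1 min.cobounded2 min.coboundedI1 min.coboundedI2)
      have eR: "\<epsilon> * R \<le> P"
      proof -
        have "\<epsilon> * R \<le> \<epsilon> * (R + 1)" using \<epsilon>0 by simp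
        also have "\<dots> \<le> P" using le(2) R by (simp add: field_simps)
        finally show ?thesis .
      qed
      have eP: "4 * (\<epsilon> * P) \<le> 1" using le(3) True by (simp add: field_simps)
      have eN: "4 * (\<epsilon>\<^sup>2 * N) \<le> Nu"
      proof -
        have "\<epsilon>\<^sup>2 * N \<le> \<epsilon> * (N + 1)" using le(1) \<epsilon>0 N by (intro mult_mono) (auto simp: power2_eq_square mult_left_le)
        moreover have "4 * (\<epsilon> * (N + 1)) \<le> Nu" using le(4) N by (simp add: field_simps)
        ultimately show ?thesis by linarith
      qed
      define k where "k \<xi> = h \<xi> - complex_of_real \<epsilon> * g \<xi>" for \<xi>
      define v where "v x = u x - complex_of_real \<epsilon> * \<phi> x" for x
      have kv: "fourier_pair k v" unfolding k_def v_def by (intro fourier_pair_diff fourier_pair_cmult p \<phi>)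
      have sv: "sqint v" by (rule fourier_pairD[OF kv])
      note [measurable] = sqint_measurable[OF sv]
      have wk: "weight \<xi> * (cmod (k \<xi>))\<^sup>2 = weight \<xi> * (cmod (h \<xi>))\<^sup>2 - 2 * \<epsilon> * (indicator (dyadic n) \<xi> * cmod (h \<xi>)) + \<epsilon>\<^sup>2 * (weight \<xi> * (cmod (g \<xi>))\<^sup>2)" for \<xi>
      proof -
        have e1: "(cmod (k \<xi>))\<^sup>2 = (cmod (h \<xi>))\<^sup>2 - 2 * \<epsilon> * Re (h \<xi> * cnj (g \<xi>)) + \<epsilon>\<^sup>2 * (cmod (g \<xi>))\<^sup>2"
          unfolding k_def by (simp add: cmod_power2) (simp add: power2_eq_square algebra_simps)
        have e2: "weight \<xi> * Re (h \<xi> * cnj (g \<xi>)) = indicator (dyadic n) \<xi> * cmod (h \<xi>)"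
        proof -
          have "h \<xi> * cnj (sgn (h \<xi>)) = complex_of_real (cmod (h \<xi>))"
          proof (cases "h \<xi> = 0")
            case False
            have "h \<xi> * cnj (sgn (h \<xi>)) = (h \<xi> * cnj (h \<xi>)) / complex_of_real (cmod (h \<xi>))"
              by (simp add: sgn_eq)
            also have "\<dots> = complex_of_real (cmod (h \<xi>))"
              using False by (simp add: complex_norm_square[symmetric] power2_eq_square)
            finally show ?thesis .
          qed simp
          then have "h \<xi> * cnj (g \<xi>) = complex_of_real (indicator (dyadic n) \<xi> / weight \<xi> * cmod (h \<xi>))"
            by (simp add: g_def mult.left_commute)
          then show ?thesis using weight_pos[of \<xi>] by simp
        qed
        have "weight \<xi> * (X - 2 * \<epsilon> * Y + \<epsilon>\<^sup>2 * Z) = weight \<xi> * X - 2 * \<epsilon> * (weight \<xi> * Y) + \<epsilon>\<^sup>2 * (weight \<xi> * Z)" for X Y Z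
          by (simp add: algebra_simps)
        then show ?thesis by (simp only: e1 e2)
      qed
      have wki: "integrable lborel (\<lambda>\<xi>. weight \<xi> * (cmod (k \<xi>))\<^sup>2)"
        unfolding wk by (intro Bochner_Integration.integrable_add Bochner_Integration.integrable_diff integrable_mult_right w ii wg)
      define q where "q = (LINT \<xi>|lborel. weight \<xi> * (cmod (k \<xi>))\<^sup>2)"
      have q: "q = 1 - 2 * \<epsilon> * P + \<epsilon>\<^sup>2 * R"
        unfolding q_def wk using w ii[of n] wg by (simp add: one P_def R_def)
      have q_le: "q \<le> 1 - \<epsilon> * P" using mult_left_mono[OF eR, of \<epsilon>] \<epsilon>0 by (simp add: q power2_eq_square algebra_simps)
      have q1: "q \<le> 1" using q_le mult_pos_pos[OF \<epsilon>0 True] by linarith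
      have q0: "0 < q"
      proof -
        have "0 \<le> \<epsilon>\<^sup>2 * R" using R by simp
        then show ?thesis using eP unfolding q by linarith
      qed
      define Nv where "Nv = (LINT x|lborel. (cmod (v x))\<^sup>2)"
      have Nv: "Nu \<le> 4 * Nv"
      proof -
        have "Nu \<le> (LINT x|lborel. 2 * (cmod (v x))\<^sup>2 + 2 * (\<epsilon>\<^sup>2 * (cmod (\<phi> x))\<^sup>2))"
          unfolding Nu_def
        proof (intro integral_mono sqint_integrable sq Bochner_Integration.integrable_add integrable_mult_right sv s\<phi>)
          fix x
          have "cmod (u x) \<le> cmod (v x) + \<epsilon> * cmod (\<phi> x)"
            using norm_triangle_ineq[of "v x" "complex_of_real \<epsilon> * \<phi> x"] \<epsilon>0 by (simp add: v_def norm_mult)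
          then have "(cmod (u x))\<^sup>2 \<le> (cmod (v x) + \<epsilon> * cmod (\<phi> x))\<^sup>2" by (intro power_mono) auto
          also have "\<dots> \<le> 2 * (cmod (v x))\<^sup>2 + 2 * (\<epsilon> * cmod (\<phi> x))\<^sup>2"
            using sum_squares_bound[of "cmod (v x)" "\<epsilon> * cmod (\<phi> x)"] by (simp only: power2_sum)
          finally show "(cmod (u x))\<^sup>2 \<le> 2 * (cmod (v x))\<^sup>2 + 2 * (\<epsilon>\<^sup>2 * (cmod (\<phi> x))\<^sup>2)" by (simp add: power_mult_distrib)
        qed
        also have "\<dots> = 2 * Nv + 2 * (\<epsilon>\<^sup>2 * N)"
          using sqint_integrable[OF sv] sqint_integrable[OF s\<phi>] by (simp add: Nv_def N_def)
        finally show ?thesis using eN by linarith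
      qed
      define G where "G = (LINT x|lborel. cmod (F x) * cmod (\<phi> x))"
      have Gi: "integrable lborel (\<lambda>x. cmod (F x) * cmod (\<phi> x))"
        using integrable_norm[OF sqint_mult_integrable[OF F s\<phi>]] by (simp add: norm_mult)
      have G_le: "G \<le> A * sqrt (2 * ball_vol)"
      proof -
        have "G \<le> A * sqrt N" unfolding G_def A_def N_def by (rule Cauchy_Schwarz_sqint[OF F s\<phi>])
        also have "\<dots> \<le> A * sqrt (2 * ball_vol)" unfolding A_def using N_le by (intro mult_left_mono) auto
        finally show ?thesis .
      qed
      have G0: "0 \<le> G" by (simp add: G_def)
      have conv: "energy \<alpha> u \<le> energy \<alpha> v + ennreal (2 * \<epsilon> * G)"
      proof -
        have "energy \<alpha> u \<le> (\<integral>\<^sup>+x. ennreal (Psi \<alpha> ((cmod (v x))\<^sup>2)) + ennreal (2 * \<epsilon>) * ennreal (cmod (F x) * cmod (\<phi> x)) \<partial>lborel)"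
          unfolding energy_def
        proof (intro nn_integral_mono)
          fix x
          let ?s = "(cmod (u x))\<^sup>2"
          have d: "0 \<le> dPsi \<alpha> ?s" by (rule dPsi_nonneg[OF \<alpha>]) simp
          have "?s - (cmod (v x))\<^sup>2 \<le> 2 * \<epsilon> * (cmod (u x) * cmod (\<phi> x))"
          proof -
            have "(cmod (v x))\<^sup>2 = ?s - 2 * \<epsilon> * Re (u x * cnj (\<phi> x)) + \<epsilon>\<^sup>2 * (cmod (\<phi> x))\<^sup>2"
              unfolding v_def by (simp add: cmod_power2) (simp add: power2_eq_square algebra_simps)
            moreover have "Re (u x * cnj (\<phi> x)) \<le> cmod (u x) * cmod (\<phi> x)"
              using complex_Re_le_cmod[of "u x * cnj (\<phi> x)"] by (simp add: norm_mult)
            then have "2 * \<epsilon> * Re (u x * cnj (\<phi> x)) \<le> 2 * \<epsilon> * (cmod (u x) * cmod (\<phi> x))" using \<epsilon>0 by (intro mult_left_mono) auto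
            moreover have "0 \<le> \<epsilon>\<^sup>2 * (cmod (\<phi> x))\<^sup>2" by simp
            ultimately show ?thesis by linarith
          qed
          from mult_left_mono[OF this d] Psi_convex[of \<alpha> ?s "(cmod (v x))\<^sup>2"]
          have "Psi \<alpha> ?s \<le> Psi \<alpha> ((cmod (v x))\<^sup>2) + 2 * \<epsilon> * (dPsi \<alpha> ?s * cmod (u x) * cmod (\<phi> x))"
            by (simp add: algebra_simps)
          also have "dPsi \<alpha> ?s * cmod (u x) = cmod (F x)" using d by (simp add: F_def norm_mult)
          finally have "ennreal (Psi \<alpha> ?s) \<le> ennreal (Psi \<alpha> ((cmod (v x))\<^sup>2) + 2 * \<epsilon> * (cmod (F x) * cmod (\<phi> x)))" by (rule ennreal_leI)
          also have "\<dots> = ennreal (Psi \<alpha> ((cmod (v x))\<^sup>2)) + ennreal (2 * \<epsilon>) * ennreal (cmod (F x) * cmod (\<phi> x))"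
            using \<epsilon>0 Psi_nonneg[OF \<alpha>] by (simp add: ennreal_plus ennreal_mult[symmetric])
          finally show "ennreal (Psi \<alpha> ?s) \<le> \<dots>" .
        qed
        also have "\<dots> = energy \<alpha> v + ennreal (2 * \<epsilon>) * (\<integral>\<^sup>+x. ennreal (cmod (F x) * cmod (\<phi> x)) \<partial>lborel)"
          unfolding energy_def by (subst nn_integral_add, simp, simp, subst nn_integral_cmult, simp) simp
        also have "(\<integral>\<^sup>+x. ennreal (cmod (F x) * cmod (\<phi> x)) \<partial>lborel) = ennreal G"
          unfolding G_def by (intro nn_integral_eq_integral Gi) auto
        also have "ennreal (2 * \<epsilon>) * ennreal G = ennreal (2 * \<epsilon> * G)" using \<epsilon>0 G0 by (simp add: ennreal_mult)
        finally show ?thesis .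
      qed
      have sc: "energy \<alpha> v + ennreal ((1 / q - 1) * (b - \<alpha>) * Nv) \<le> energy \<alpha> u"
        using maximiser_strict_scaling[OF \<alpha> m kv wki q_def[symmetric] q0 q1] by (simp add: b_def Nv_def)
      have evfin: "energy \<alpha> v < \<infinity>"
      proof -
        have "energy \<alpha> v \<le> energy \<alpha> v + ennreal ((1 / q - 1) * (b - \<alpha>) * Nv)" by simp
        also note sc
        finally show ?thesis using efin by (rule le_less_trans)
      qed
      have "energy \<alpha> v + ennreal ((1 / q - 1) * (b - \<alpha>) * Nv) \<le> energy \<alpha> v + ennreal (2 * \<epsilon> * G)"
        using sc conv by (rule order_trans)
      then have "ennreal ((1 / q - 1) * (b - \<alpha>) * Nv) \<le> ennreal (2 * \<epsilon> * G)"
        using evfin by (simp only: ennreal_add_left_cancel_le) auto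
      then have main: "(1 / q - 1) * (b - \<alpha>) * Nv \<le> 2 * \<epsilon> * G"
        using \<epsilon>0 G0 by (simp add: ennreal_le_iff)
      have "\<epsilon> * P \<le> 1 / q - 1"
      proof -
        have "(1 - q) * q \<le> 1 - q" using q0 q1 by (intro mult_left_le) auto
        then have "1 - q \<le> (1 - q) / q" using q0 by (simp add: pos_le_divide_eq)
        also have "\<dots> = 1 / q - 1" using q0 by (simp add: field_simps)
        finally show ?thesis using q_le by linarith
      qed
      then have "\<epsilon> * P * ((b - \<alpha>) * (Nu / 4)) \<le> (1 / q - 1) * ((b - \<alpha>) * Nv)"
        using b Nv Nu \<epsilon>0 True q0 q1 by (intro mult_mono) (auto simp: pos_le_divide_eq)
      also have "\<dots> \<le> 2 * \<epsilon> * (A * sqrt (2 * ball_vol))"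
        using main mult_left_mono[OF G_le, of "2 * \<epsilon>"] \<epsilon>0 by (simp only: mult.assoc) linarith
      finally have "\<epsilon> * (P * ((b - \<alpha>) * (Nu / 4))) \<le> \<epsilon> * (2 * (A * sqrt (2 * ball_vol)))" by (simp add: mult_ac)
      then have "P * ((b - \<alpha>) * (Nu / 4)) \<le> 2 * (A * sqrt (2 * ball_vol))" using \<epsilon>0 by simp
      then have "P * ((b - \<alpha>) * Nu) \<le> 8 * (A * sqrt (2 * ball_vol))" by simp
      then show ?thesis unfolding C_def using b Nu by (simp add: pos_le_divide_eq)
    qed
    then show ?thesis by (simp add: P_def)
  qed
  have "(\<integral>\<^sup>+\<xi>. ennreal (cmod (h \<xi>)) \<partial>lborel) = (\<integral>\<^sup>+\<xi>. (SUP n. ennreal (indicator (dyadic n) \<xi> * cmod (h \<xi>))) \<partial>lborel)"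
  proof (intro nn_integral_cong)
    fix \<xi> :: "real^4"
    obtain n where "norm \<xi> < 2 ^ n" using real_arch_pow[of 2 "norm \<xi>"] by auto
    then have n: "\<xi> \<in> dyadic n" by (simp add: dyadic_def)
    show "ennreal (cmod (h \<xi>)) = (SUP n. ennreal (indicator (dyadic n) \<xi> * cmod (h \<xi>)))"
      using n by (intro antisym SUP_upper2[of n] SUP_least) (auto split: split_indicator)
  qed
  also have "\<dots> = (SUP n. \<integral>\<^sup>+\<xi>. ennreal (indicator (dyadic n) \<xi> * cmod (h \<xi>)) \<partial>lborel)"
  proof (intro nn_integral_monotone_convergence_SUP)
    show "incseq (\<lambda>n \<xi>. ennreal (indicator (dyadic n) \<xi> * cmod (h \<xi>)))"
    proof (intro incseq_SucI le_funI)
      fix n \<xi>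
      have "dyadic n \<subseteq> dyadic (Suc n)" unfolding dyadic_def by (intro subset_ball) simp
      then show "ennreal (indicator (dyadic n) \<xi> * cmod (h \<xi>)) \<le> ennreal (indicator (dyadic (Suc n)) \<xi> * cmod (h \<xi>))"
        by (auto split: split_indicator)
    qed
  qed measurable
  also have "\<dots> \<le> ennreal C"
  proof (rule SUP_least)
    fix n
    have "(\<integral>\<^sup>+\<xi>. ennreal (indicator (dyadic n) \<xi> * cmod (h \<xi>)) \<partial>lborel) = ennreal (LINT \<xi>|lborel. indicator (dyadic n) \<xi> * cmod (h \<xi>))"
      by (intro nn_integral_eq_integral ii) auto
    then show "(\<integral>\<^sup>+\<xi>. ennreal (indicator (dyadic n) \<xi> * cmod (h \<xi>)) \<partial>lborel) \<le> ennreal C"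
      using bound[of n] by (simp add: ennreal_leI)
  qed
  finally have "(\<integral>\<^sup>+\<xi>. ennreal (cmod (h \<xi>)) \<partial>lborel) < \<infinity>" by (rule le_less_trans) simp
  then show ?thesis by (intro integrableI_bounded) auto
qed

section \<open>Symmetry of the modulus of the Fourier transform\<close>

text \<open>The Taylor coefficients of \<open>Psi\<close>, indexed from the power one. The linear one is \<open>32 \<pi>\<^sup>2 - \<alpha>\<close>, the only place where \<open>\<alpha>\<close> enters.\<close>
definition Psi_coeff :: "real \<Rightarrow> nat \<Rightarrow> real" where
  "Psi_coeff \<alpha> k = (32 * pi\<^sup>2) ^ Suc k / fact (Suc k) - (if k = 0 then \<alpha> else 0)"

lemma Psi_coeff_pos: "\<alpha> < 32 * pi\<^sup>2 \<Longrightarrow> 0 < Psi_coeff \<alpha> k"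
  by (cases k) (auto simp: Psi_coeff_def)

lemma Psi_sums: "(\<lambda>k. Psi_coeff \<alpha> k * s ^ Suc k) sums Psi \<alpha> s"
proof -
  let ?b = "32 * pi\<^sup>2"
  have "(\<lambda>k. (?b * s) ^ k /\<^sub>R fact k) sums exp (?b * s)" by (rule exp_converges)
  from sums_split_initial_segment[OF this, of 1]
  have "(\<lambda>k. (?b * s) ^ Suc k /\<^sub>R fact (Suc k)) sums (exp (?b * s) - 1)" by simp
  moreover have "(\<lambda>k. if k = 0 then \<alpha> * s else 0) sums (\<alpha> * s)" by (rule sums_single[of 0 "\<lambda>_. \<alpha> * s", simplified])
  ultimately have "(\<lambda>k. (?b * s) ^ Suc k /\<^sub>R fact (Suc k) - (if k = 0 then \<alpha> * s else 0)) sums (exp (?b * s) - 1 - \<alpha> * s)"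
    by (rule sums_diff)
  moreover have "(?b * s) ^ Suc k /\<^sub>R fact (Suc k) - (if k = 0 then \<alpha> * s else 0) = Psi_coeff \<alpha> k * s ^ Suc k" for k
    by (cases "k = 0") (simp_all add: Psi_coeff_def power_mult_distrib divide_inverse left_diff_distrib right_diff_distrib mult_ac del: power_Suc fact_Suc)
  ultimately show ?thesis by (simp only: Psi_def)
qed

lemma energy_series:
  assumes \<alpha>: "\<alpha> < 32 * pi\<^sup>2" and [measurable]: "u \<in> borel_measurable borel"
  shows "energy \<alpha> u = (\<Sum>k. ennreal (Psi_coeff \<alpha> k) * (\<integral>\<^sup>+x. ennreal (((cmod (u x))\<^sup>2) ^ Suc k) \<partial>lborel))"
proof -
  note c = less_imp_le[OF Psi_coeff_pos[OF \<alpha>]]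
  have "ennreal (Psi \<alpha> ((cmod (u x))\<^sup>2)) = (\<Sum>k. ennreal (Psi_coeff \<alpha> k) * ennreal (((cmod (u x))\<^sup>2) ^ Suc k))" for x
  proof -
    have "(\<Sum>k. ennreal (Psi_coeff \<alpha> k * ((cmod (u x))\<^sup>2) ^ Suc k)) = ennreal (Psi \<alpha> ((cmod (u x))\<^sup>2))"
      using c Psi_sums[of \<alpha> "(cmod (u x))\<^sup>2"]
      by (intro suminf_ennreal_eq) (auto intro!: mult_nonneg_nonneg)
    moreover have "ennreal (Psi_coeff \<alpha> k * ((cmod (u x))\<^sup>2) ^ Suc k) = ennreal (Psi_coeff \<alpha> k) * ennreal (((cmod (u x))\<^sup>2) ^ Suc k)" for k
      by (rule ennreal_mult[OF c]) simp
    ultimately show ?thesis by (simp only:)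
  qed
  then have "energy \<alpha> u = (\<integral>\<^sup>+x. (\<Sum>k. ennreal (Psi_coeff \<alpha> k) * ennreal (((cmod (u x))\<^sup>2) ^ Suc k)) \<partial>lborel)"
    by (simp only: energy_def)
  also have "\<dots> = (\<Sum>k. \<integral>\<^sup>+x. ennreal (Psi_coeff \<alpha> k) * ennreal (((cmod (u x))\<^sup>2) ^ Suc k) \<partial>lborel)"
    by (rule nn_integral_suminf) measurable
  also have "\<dots> = (\<Sum>k. ennreal (Psi_coeff \<alpha> k) * (\<integral>\<^sup>+x. ennreal (((cmod (u x))\<^sup>2) ^ Suc k) \<partial>lborel))"
    by (intro suminf_cong nn_integral_cmult) measurable
  finally show ?thesis .
qed

text \<open>The energy of \<open>fourier f\<close> for nonnegative \<open>f\<close>, expressed through convolution powers so that rearrangement applies.\<close>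
definition conv_energy :: "real \<Rightarrow> (real^4 \<Rightarrow> ennreal) \<Rightarrow> ennreal" where
  "conv_energy \<alpha> f = (\<Sum>k. ennreal (Psi_coeff \<alpha> k) * (\<integral>\<^sup>+x. conv_power f k x * conv_power f k x \<partial>lborel))"

lemma energy_fourier_le:
  assumes \<alpha>: "\<alpha> < 32 * pi\<^sup>2" and h: "integrable lborel h" "sqint h"
  shows "energy \<alpha> (fourier h) \<le> conv_energy \<alpha> (\<lambda>x. ennreal (cmod (h x)))"
proof -
  note [measurable] = sqint_measurable[OF h(2)]
  show ?thesis
    unfolding energy_series[OF \<alpha> measurable_fourier[OF sqint_measurable[OF h(2)]]] conv_energy_def
    by (intro suminf_le mult_left_mono fourier_power_le h) auto
qed

lemma energy_fourier_nonneg: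
  fixes f :: "real^4 \<Rightarrow> real"
  assumes \<alpha>: "\<alpha> < 32 * pi\<^sup>2" and f: "\<And>x. 0 \<le> f x" and h: "integrable lborel (\<lambda>x. complex_of_real (f x))" "sqint (\<lambda>x. complex_of_real (f x))"
  shows "energy \<alpha> (fourier (\<lambda>x. complex_of_real (f x))) = conv_energy \<alpha> (\<lambda>x. ennreal (f x))"
  unfolding energy_series[OF \<alpha> measurable_fourier[OF sqint_measurable[OF h(2)]]] conv_energy_def fourier_power_eq[OF f h] ..

lemma suminf_ennreal_eq_imp:
  fixes p q :: "nat \<Rightarrow> ennreal"
  assumes le: "\<And>k. p k \<le> q k" and eq: "(\<Sum>k. p k) = (\<Sum>k. q k)" and fin: "(\<Sum>k. q k) < \<infinity>"
  shows "p k = q k"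
proof -
  have "AE k in count_space UNIV. p k = q k"
    using eq fin le by (intro nn_integral_eq_imp_AE_eq) (auto simp: nn_integral_count_space_nat)
  then show ?thesis by (simp add: AE_count_space)
qed

lemma energy_cong_AE:
  "AE x in lborel. u x = u' x \<Longrightarrow> energy \<alpha> u = energy \<alpha> u'"
  unfolding energy_def by (rule nn_integral_cong_AE) (auto elim: eventually_mono)

lemma maximiser_cong_AE:
  assumes m: "maximiser \<alpha> h u" and "AE x in lborel. u x = u' x" "u' \<in> borel_measurable borel"
  shows "maximiser \<alpha> h u'"
proof -
  have p: "fourier_pair h u" using m by (simp add: maximiser_def)
  have "fourier_pair h u'"
    by (rule fourier_pair_cong_AE[OF p _ assms(3) _ assms(2)]) (auto intro: sqint_measurable fourier_pairD[OF p])
  then show ?thesis using m energy_cong_AE[OF assms(2), of \<alpha>] by (simp add: maximiser_def)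
qed

lemma maximiser_fourier:
  assumes \<alpha>: "\<alpha> < 32 * pi\<^sup>2" and m: "maximiser \<alpha> h u"
  shows "AE x in lborel. u x = fourier h x" "maximiser \<alpha> h (fourier h)"
proof -
  have p: "fourier_pair h u" using m by (simp add: maximiser_def)
  have h: "integrable lborel h" "sqint h" using maximiser_integrable[OF \<alpha> m] fourier_pairD[OF p] by auto
  show ae: "AE x in lborel. u x = fourier h x" by (rule fourier_pair_unique[OF p fourier_pair_L1[OF h]])
  show "maximiser \<alpha> h (fourier h)"
    by (rule maximiser_cong_AE[OF m ae]) (intro measurable_fourier sqint_measurable h)
qed

text \<open>Passing to \<open>|h|\<close> keeps the constraint and does not decrease any term of the series, so \<open>|h|\<close> is again a maximiser. As the sums are
equal and finite and the coefficients positive, the terms agree one by one.\<close>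
lemma maximiser_modulus:
  assumes \<alpha>: "\<alpha> < 32 * pi\<^sup>2" and m: "maximiser \<alpha> h (fourier h)"
  defines "H \<equiv> \<lambda>\<xi>. complex_of_real (cmod (h \<xi>))"
  shows "maximiser \<alpha> H (fourier H)"
    and "(\<integral>\<^sup>+x. ennreal (((cmod (fourier h x))\<^sup>2) ^ Suc k) \<partial>lborel) = (\<integral>\<^sup>+x. ennreal (((cmod (fourier H x))\<^sup>2) ^ Suc k) \<partial>lborel)"
proof -
  have p: "fourier_pair h (fourier h)" and w: "integrable lborel (\<lambda>\<xi>. weight \<xi> * (cmod (h \<xi>))\<^sup>2)"
    and one: "(LINT \<xi>|lborel. weight \<xi> * (cmod (h \<xi>))\<^sup>2) = 1"
    and max: "\<And>k v. fourier_pair k v \<Longrightarrow> integrable lborel (\<lambda>\<xi>. weight \<xi> * (cmod (k \<xi>))\<^sup>2)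
           \<Longrightarrow> (LINT \<xi>|lborel. weight \<xi> * (cmod (k \<xi>))\<^sup>2) = 1 \<Longrightarrow> energy \<alpha> v \<le> energy \<alpha> (fourier h)"
    using m by (auto simp: maximiser_def)
  have h: "integrable lborel h" "sqint h" using maximiser_integrable[OF \<alpha> m] fourier_pairD[OF p] by auto
  note [measurable] = sqint_measurable[OF h(2)]
  have H: "integrable lborel H" "sqint H"
    unfolding H_def using h by (auto simp: sqint_def)
  have pH: "fourier_pair H (fourier H)" by (rule fourier_pair_L1[OF H])
  have wH: "weight \<xi> * (cmod (H \<xi>))\<^sup>2 = weight \<xi> * (cmod (h \<xi>))\<^sup>2" for \<xi> by (simp add: H_def)
  have le: "energy \<alpha> (fourier H) \<le> energy \<alpha> (fourier h)" by (rule max[OF pH]) (simp_all add: wH w one)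
  have eH: "energy \<alpha> (fourier H) = conv_energy \<alpha> (\<lambda>x. ennreal (cmod (h x)))"
    using energy_fourier_nonneg[OF \<alpha>, of "\<lambda>x. cmod (h x)"] H by (simp add: H_def)
  have ge: "energy \<alpha> (fourier h) \<le> energy \<alpha> (fourier H)" unfolding eH by (rule energy_fourier_le[OF \<alpha> h])
  have eq: "energy \<alpha> (fourier h) = energy \<alpha> (fourier H)" using le ge by (rule antisym[rotated])
  show "maximiser \<alpha> H (fourier H)"
    unfolding maximiser_def wH using pH w one max eq by auto
  let ?p = "\<lambda>k. ennreal (Psi_coeff \<alpha> k) * (\<integral>\<^sup>+x. ennreal (((cmod (fourier h x))\<^sup>2) ^ Suc k) \<partial>lborel)"
  let ?q = "\<lambda>k. ennreal (Psi_coeff \<alpha> k) * (\<integral>\<^sup>+x. ennreal (((cmod (fourier H x))\<^sup>2) ^ Suc k) \<partial>lborel)"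
  have "?p k = ?q k"
  proof (rule suminf_ennreal_eq_imp[of ?p ?q])
    show "?p k \<le> ?q k" for k
      unfolding H_def fourier_power_eq[OF norm_ge_zero H[unfolded H_def]]
      by (intro mult_left_mono fourier_power_le h) simp
    show "(\<Sum>k. ?p k) = (\<Sum>k. ?q k)"
      using eq unfolding energy_series[OF \<alpha> measurable_fourier[OF sqint_measurable[OF h(2)]]]
        energy_series[OF \<alpha> measurable_fourier[OF sqint_measurable[OF H(2)]]] .
    show "(\<Sum>k. ?q k) < \<infinity>"
      using maximiser_energy_finite[OF m] eq unfolding energy_series[OF \<alpha> measurable_fourier[OF sqint_measurable[OF H(2)]]] by simp
  qed
  moreover have "ennreal (Psi_coeff \<alpha> k) \<noteq> 0" "ennreal (Psi_coeff \<alpha> k) \<noteq> \<infinity>" using Psi_coeff_pos[OF \<alpha>, of k] by auto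
  ultimately show "(\<integral>\<^sup>+x. ennreal (((cmod (fourier h x))\<^sup>2) ^ Suc k) \<partial>lborel) = (\<integral>\<^sup>+x. ennreal (((cmod (fourier H x))\<^sup>2) ^ Suc k) \<partial>lborel)"
    by (simp add: ennreal_mult_cancel_left)
qed

lemma AE_flip_translate:
  fixes P :: "'a::euclidean_space \<Rightarrow> bool"
  assumes "AE x in lborel. P x" and [measurable]: "Measurable.pred borel P"
  shows "AE y in lborel. P (x - y)"
proof -
  have "(\<integral>\<^sup>+y. indicator {y. \<not> P y} (x - y) \<partial>lborel) = (\<integral>\<^sup>+y. indicator {y. \<not> P y} y \<partial>(lborel :: 'a measure))"
    by (rule nn_integral_lborel_flip) measurable
  also have "\<dots> = 0"
    using assms(1) by (subst nn_integral_0_iff_AE) (auto elim!: eventually_mono)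
  finally show ?thesis
    by (subst (asm) nn_integral_0_iff_AE) (auto elim!: eventually_mono simp: indicator_def split: if_splits)
qed

lemma conv_power_cong_AE:
  assumes [measurable]: "f \<in> borel_measurable borel" "g \<in> borel_measurable borel" and ae: "AE x in lborel. f x = g x"
  shows "AE x in lborel. conv_power f n x = conv_power g n x"
proof (induction n)
  case (Suc n)
  have "conv_power f (Suc n) x = conv_power g (Suc n) x" for x
  proof -
    have "AE y in lborel. conv_power f n (x - y) = conv_power g n (x - y)"
      using Suc by (rule AE_flip_translate) measurable
    with ae have "AE y in lborel. f y * conv_power f n (x - y) = g y * conv_power g n (x - y)"
      by eventually_elim simp
    then show ?thesis by (simp add: conv_def nn_integral_cong_AE)
  qed
  then show ?case by simp
qed (use ae in simp)

lemma ennreal_square_inj: "a * a = b * b \<Longrightarrow> a = b" for a b :: ennreal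
proof -
  assume eq: "a * a = b * b"
  have lt: False if "a < b" "a * a = b * b" for a b :: ennreal
  proof -
    have "a < top" using that(1) top_greatest by (rule less_le_trans)
    then obtain r where r: "a = ennreal r" "0 \<le> r" by (cases a) auto
    show False
    proof (cases b)
      case (real s)
      then have "r < s" using that(1) r by (simp add: ennreal_less_iff)
      then have "r * r < s * s" using r(2) by (intro mult_strict_mono') auto
      then show False using that(2) r real by (simp add: ennreal_mult[symmetric])
    next
      case top
      then show False using that r by (simp add: ennreal_mult[symmetric])
    qed
  qed
  show "a = b" using lt[of a b] lt[of b a] eq by (metis linorder_cases)
qed

lemma weight_mono: "norm x \<le> norm y \<Longrightarrow> weight x \<le> weight y"
  unfolding weight_def by (intro add_left_mono mult_left_mono power_mono) auto

lemma weight_strict_mono: "norm x < norm y \<Longrightarrow> weight x < weight y"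
  unfolding weight_def by (intro add_strict_left_mono mult_strict_left_mono power_strict_mono) auto

text \<open>The symmetrised density \<open>K\<close> has at least the same energy and a squared norm \<open>q \<le> 1\<close>. If \<open>q < 1\<close>, scaling would give
strictly more energy. So \<open>q = 1\<close>, and equality in \<open>steiner_weight\<close> makes \<open>f\<close> its own symmetrisation almost everywhere.\<close>
lemma maximiser_reflection:
  fixes f :: "real^4 \<Rightarrow> real"
  assumes \<alpha>: "\<alpha> < 32 * pi\<^sup>2" and f: "\<And>x. 0 \<le> f x" and m: "maximiser \<alpha> (\<lambda>\<xi>. complex_of_real (f \<xi>)) (fourier (\<lambda>\<xi>. complex_of_real (f \<xi>)))"
    and e: "norm e = 1"
  shows "AE \<xi> in lborel. f (direction.reflect e \<xi>) = f \<xi>"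
proof -
  interpret direction e using e by unfold_locales
  define H where "H \<xi> = complex_of_real (f \<xi>)" for \<xi>
  have m': "maximiser \<alpha> H (fourier H)" using m by (simp add: H_def[abs_def])
  have p: "fourier_pair H (fourier H)" and w: "integrable lborel (\<lambda>\<xi>. weight \<xi> * (cmod (H \<xi>))\<^sup>2)"
    and one: "(LINT \<xi>|lborel. weight \<xi> * (cmod (H \<xi>))\<^sup>2) = 1"
    using m' by (auto simp: maximiser_def)
  have H: "integrable lborel H" "sqint H" using maximiser_integrable[OF \<alpha> m'] fourier_pairD[OF p] by auto
  have fi: "integrable lborel f" using integrable_Re[OF H(1)] by (simp add: H_def)
  have fm [measurable]: "f \<in> borel_measurable borel" using borel_measurable_integrable[OF fi] by simp
  define F where "F x = ennreal (f x)" for x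
  have Fm [measurable]: "F \<in> borel_measurable borel" unfolding F_def by measurable
  define FF where "FF x = F x * F x" for x
  have FFm [measurable]: "FF \<in> borel_measurable borel" unfolding FF_def by measurable
  have FF_eq: "FF x = ennreal ((cmod (H x))\<^sup>2)" for x using f by (simp add: FF_def F_def H_def power2_eq_square ennreal_mult)
  define N where "N = (LINT x|lborel. (cmod (H x))\<^sup>2)"
  have N: "0 < N" unfolding N_def using maximiser_nontrivial[OF m'] by simp
  have intFF: "(\<integral>\<^sup>+x. FF x \<partial>lborel) = ennreal N" unfolding FF_eq N_def by (rule nn_integral_sqint[OF H(2)])
  have intF: "(\<integral>\<^sup>+x. F x \<partial>lborel) < \<infinity>" unfolding F_def using fi f by (simp add: nn_integral_eq_integral)
  have wFF: "(\<integral>\<^sup>+x. ennreal (weight x) * FF x \<partial>lborel) = 1"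
  proof -
    have "(\<integral>\<^sup>+x. ennreal (weight x) * FF x \<partial>lborel) = (\<integral>\<^sup>+x. ennreal (weight x * (cmod (H x))\<^sup>2) \<partial>lborel)"
      unfolding FF_eq by (intro nn_integral_cong ennreal_mult[symmetric] less_imp_le[OF weight_pos]) simp
    also have "\<dots> = ennreal (LINT x|lborel. weight x * (cmod (H x))\<^sup>2)"
      by (intro nn_integral_eq_integral w AE_I2 mult_nonneg_nonneg less_imp_le[OF weight_pos]) simp
    finally show ?thesis by (simp add: one)
  qed
  define G where "G = steiner F"
  have Gm [measurable]: "G \<in> borel_measurable borel" unfolding G_def by measurable
  have GG: "steiner FF x = G x * G x" for x unfolding FF_def[abs_def] G_def by (rule steiner_square[OF Fm])
  have intG: "(\<integral>\<^sup>+x. G x \<partial>lborel) < \<infinity>" using intF by (simp add: G_def nn_integral_steiner)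
  have "AE x in lborel. G x \<noteq> \<infinity>" using intG by (intro nn_integral_PInf_AE) auto
  define g where "g x = enn2real (G x)" for x
  have gm [measurable]: "g \<in> borel_measurable borel" unfolding g_def by measurable
  have g0: "0 \<le> g x" for x by (simp add: g_def)
  have gG: "AE x in lborel. ennreal (g x) = G x"
    using \<open>AE x in lborel. G x \<noteq> \<infinity>\<close> by eventually_elim (simp add: g_def less_top[symmetric])
  have gG2: "AE x in lborel. ennreal ((g x)\<^sup>2) = G x * G x"
    using gG by eventually_elim (simp add: power2_eq_square ennreal_mult g0)
  define K where "K x = complex_of_real (g x)" for x
  have Km [measurable]: "K \<in> borel_measurable borel" unfolding K_def by measurable
  have Kn: "(cmod (K x))\<^sup>2 = (g x)\<^sup>2" for x by (simp add: K_def)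
  have Ki: "integrable lborel K"
  proof (rule integrableI_bounded)
    have "(\<integral>\<^sup>+x. ennreal (norm (K x)) \<partial>lborel) = (\<integral>\<^sup>+x. G x \<partial>lborel)"
      using gG by (intro nn_integral_cong_AE) (auto elim!: eventually_mono simp: K_def g0)
    then show "(\<integral>\<^sup>+x. ennreal (norm (K x)) \<partial>lborel) < \<infinity>" using intG by simp
  qed measurable
  have K2: "(\<integral>\<^sup>+x. ennreal ((cmod (K x))\<^sup>2) \<partial>lborel) = ennreal N"
  proof -
    have "(\<integral>\<^sup>+x. ennreal ((cmod (K x))\<^sup>2) \<partial>lborel) = (\<integral>\<^sup>+x. steiner FF x \<partial>lborel)"
      unfolding GG Kn by (rule nn_integral_cong_AE[OF gG2])
    also have "\<dots> = ennreal N" by (simp add: nn_integral_steiner intFF)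
    finally show ?thesis .
  qed
  have Ks: "sqint K"
    unfolding sqint_def
  proof
    show "integrable lborel (\<lambda>x. (cmod (K x))\<^sup>2)" by (rule integrableI_nonneg) (auto simp: K2)
  qed measurable
  have KN: "(LINT x|lborel. (cmod (K x))\<^sup>2) = N"
    using nn_integral_sqint[OF Ks] K2 N by simp
  have wK: "(\<integral>\<^sup>+x. ennreal (weight x * (cmod (K x))\<^sup>2) \<partial>lborel) = (\<integral>\<^sup>+x. ennreal (weight x) * steiner FF x \<partial>lborel)"
  proof (rule nn_integral_cong_AE)
    show "AE x in lborel. ennreal (weight x * (cmod (K x))\<^sup>2) = ennreal (weight x) * steiner FF x"
      using gG2 by eventually_elim (simp add: GG Kn ennreal_mult less_imp_le[OF weight_pos])
  qed
  have finFF: "(\<integral>\<^sup>+x. FF x \<partial>lborel) < \<infinity>" by (simp add: intFF)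
  have w0: "0 \<le> weight x" for x using weight_pos[of x] by simp
  have wK_le: "(\<integral>\<^sup>+x. ennreal (weight x * (cmod (K x))\<^sup>2) \<partial>lborel) \<le> 1"
    unfolding wK wFF[symmetric] by (rule steiner_weight_le[OF FFm measurable_weight w0 weight_mono weight_strict_mono finFF])
  have wKi: "integrable lborel (\<lambda>x. weight x * (cmod (K x))\<^sup>2)"
    by (rule integrableI_nonneg) (use wK_le w0 in \<open>auto intro: le_less_trans\<close>)
  define q where "q = (LINT x|lborel. weight x * (cmod (K x))\<^sup>2)"
  have q_nn: "(\<integral>\<^sup>+x. ennreal (weight x * (cmod (K x))\<^sup>2) \<partial>lborel) = ennreal q"
    unfolding q_def by (intro nn_integral_eq_integral wKi) (simp add: w0)
  have Nq: "N \<le> q"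
    unfolding KN[symmetric] q_def
  proof (intro integral_mono sqint_integrable Ks wKi)
    fix x show "(cmod (K x))\<^sup>2 \<le> weight x * (cmod (K x))\<^sup>2"
      using mult_right_mono[OF weight_ge_1, of "(cmod (K x))\<^sup>2" x] by simp
  qed
  have q: "0 < q" "q \<le> 1" using Nq N wK_le unfolding q_nn by auto
  have pK: "fourier_pair K (fourier K)" by (rule fourier_pair_L1[OF Ki Ks])
  have sc: "energy \<alpha> (fourier K) + ennreal ((1 / q - 1) * (32 * pi\<^sup>2 - \<alpha>) * N) \<le> energy \<alpha> (fourier H)"
    using maximiser_strict_scaling[OF \<alpha> m' pK wKi q_def[symmetric] q] fourier_pair_plancherel[OF pK] KN by simp
  have eH: "energy \<alpha> (fourier H) = conv_energy \<alpha> F"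
    using energy_fourier_nonneg[OF \<alpha> f] H by (simp add: H_def[abs_def] F_def[abs_def])
  have eK: "energy \<alpha> (fourier K) = conv_energy \<alpha> G"
  proof -
    have "energy \<alpha> (fourier K) = conv_energy \<alpha> (\<lambda>x. ennreal (g x))"
      using energy_fourier_nonneg[OF \<alpha> g0] Ki Ks by (simp add: K_def[abs_def])
    also have "\<dots> = conv_energy \<alpha> G"
      unfolding conv_energy_def
    proof (intro suminf_cong arg_cong2[where f="(*)"] refl nn_integral_cong_AE)
      fix k
      have "AE x in lborel. conv_power (\<lambda>x. ennreal (g x)) k x = conv_power G k x"
        by (rule conv_power_cong_AE[OF _ Gm gG]) measurable
      then show "AE x in lborel. conv_power (\<lambda>x. ennreal (g x)) k x * conv_power (\<lambda>x. ennreal (g x)) k x = conv_power G k x * conv_power G k x"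
        by eventually_elim simp
    qed
    finally show ?thesis .
  qed
  have "conv_energy \<alpha> F \<le> conv_energy \<alpha> G"
    unfolding conv_energy_def G_def by (intro suminf_le mult_left_mono conv_power_steiner Fm) auto
  then have "energy \<alpha> (fourier H) + ennreal ((1 / q - 1) * (32 * pi\<^sup>2 - \<alpha>) * N) \<le> energy \<alpha> (fourier K) + ennreal ((1 / q - 1) * (32 * pi\<^sup>2 - \<alpha>) * N)"
    unfolding eH eK by (rule add_right_mono)
  also note sc
  finally have "energy \<alpha> (fourier H) + ennreal ((1 / q - 1) * (32 * pi\<^sup>2 - \<alpha>) * N) \<le> energy \<alpha> (fourier H) + 0" by simp
  then have "ennreal ((1 / q - 1) * (32 * pi\<^sup>2 - \<alpha>) * N) \<le> 0"
    using maximiser_energy_finite[OF m'] by (simp only: ennreal_add_left_cancel_le) auto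
  then have "(1 / q - 1) * (32 * pi\<^sup>2 - \<alpha>) * N \<le> 0" by (simp add: ennreal_eq_0_iff)
  then have "1 / q - 1 \<le> 0" using \<alpha> N by (simp add: mult_le_0_iff)
  then have "q = 1" using q by (simp add: field_simps)
  then have weq: "(\<integral>\<^sup>+x. ennreal (weight x) * steiner FF x \<partial>lborel) = (\<integral>\<^sup>+x. ennreal (weight x) * FF x \<partial>lborel)"
    using q_nn wK wFF by simp
  have wfin: "(\<integral>\<^sup>+x. ennreal (weight x) * FF x \<partial>lborel) < \<infinity>" by (simp add: wFF)
  have "AE x in lborel. FF x = steiner FF x"
    by (rule steiner_weight_eq[OF FFm measurable_weight w0 weight_mono weight_strict_mono finFF weq wfin])
  then have FG: "AE x in lborel. F x = G x"
    by eventually_elim (rule ennreal_square_inj, simp only: GG FF_def)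
  have "AE x in distr lborel borel reflect. F x = G x" unfolding distr_reflect by (rule FG)
  then have "AE x in lborel. F (reflect x) = G (reflect x)" by (rule AE_distrD[rotated]) measurable
  with FG show ?thesis
  proof eventually_elim
    case (elim x)
    then have "F (reflect x) = F x" using steiner_reflect[OF Fm, of x] by (simp add: G_def)
    then show ?case using f by (simp add: F_def)
  qed
qed

text \<open>Reflections preserve Lebesgue measure and inner products.\<close>
lemma fourier_reflection:
  fixes H :: "'a::euclidean_space \<Rightarrow> complex"
  assumes e: "norm e = 1" and Hm [measurable]: "H \<in> borel_measurable borel" and inv: "AE \<xi> in lborel. H (direction.reflect e \<xi>) = H \<xi>"
  shows "fourier H (direction.reflect e x) = fourier H x"
proof -
  interpret direction e using e by unfold_locales
  have "fourier H (reflect x) = (LINT \<xi>|distr lborel borel reflect. cis (2 * pi * (reflect x \<bullet> \<xi>)) * H \<xi>)"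
    by (simp add: fourier_def distr_reflect)
  also have "\<dots> = (LINT \<xi>|lborel. cis (2 * pi * (reflect x \<bullet> reflect \<xi>)) * H (reflect \<xi>))"
    by (subst integral_distr) auto
  also have "\<dots> = (LINT \<xi>|lborel. cis (2 * pi * (x \<bullet> \<xi>)) * H \<xi>)"
    unfolding reflect_inner using inv by (intro integral_cong_AE) (auto elim!: eventually_mono)
  finally show ?thesis by (simp add: fourier_def)
qed

text \<open>The reflection that exchanges \<open>x\<close> and \<open>y\<close> is the one along \<open>x - y\<close>.\<close>
lemma exists_reflection:
  fixes x y :: "'a::euclidean_space"
  assumes "norm x = norm y" "x \<noteq> y"
  obtains e where "norm e = 1" "direction.reflect e x = y"
proof -
  define d where "d = x - y"
  define e where "e = (1 / norm d) *\<^sub>R d"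
  have d: "norm d > 0" using assms by (simp add: d_def)
  have e: "norm e = 1" using d by (simp add: e_def)
  interpret direction e using e by unfold_locales
  have "2 * (x \<bullet> d) = (norm d)\<^sup>2"
    using assms(1) unfolding d_def
    by (simp add: power2_norm_eq_inner inner_diff_left inner_diff_right inner_commute norm_eq)
  then have "(2 * (x \<bullet> e)) *\<^sub>R e = d" using d by (simp add: e_def power2_eq_square)
  then have "reflect x = y" by (simp add: reflect_def d_def)
  with e show ?thesis by (rule that)
qed

section \<open>Recovering the phase\<close>

text \<open>A uniformly continuous function that is not small at a point is not small on a ball of fixed size around it, which
square integrability forbids far from the origin.\<close>
lemma fourier_vanishes_at_infinity:
  fixes h :: "'a::euclidean_space \<Rightarrow> complex"
  assumes h: "integrable lborel h" "sqint h" and c: "0 < c"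
  shows "\<exists>r. \<forall>x. r \<le> norm x \<longrightarrow> cmod (fourier h x) \<le> c"
proof -
  define u where "u = fourier h"
  have u: "sqint u" unfolding u_def by (rule plancherel_L1[OF h])
  note [measurable] = sqint_measurable[OF u]
  obtain \<delta> where \<delta>: "0 < \<delta>" "\<And>x y. dist x y < \<delta> \<Longrightarrow> dist (u x) (u y) < c / 2"
    using fourier_uniformly_continuous[OF h(1)] c unfolding uniformly_continuous_on_def u_def[symmetric]
    by (metis UNIV_I half_gt_zero dist_commute)
  define B where "B = measure lborel (ball (0::'a) \<delta>)"
  have B: "0 < B" unfolding B_def using content_ball_pos[OF \<delta>(1)] by simp
  have "eventually (\<lambda>n. (LINT x|lborel. (cmod (u x - trunc u n x))\<^sup>2) < (c / 2)\<^sup>2 * B) sequentially"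
    using c B by (intro order_tendstoD(2)[OF trunc_L2[OF u]]) auto
  then obtain n where n: "(LINT x|lborel. (cmod (u x - trunc u n x))\<^sup>2) < (c / 2)\<^sup>2 * B" by (auto simp: eventually_sequentially)
  have "cmod (u x) \<le> c" if x: "real n + \<delta> \<le> norm x" for x
  proof (rule ccontr)
    assume "\<not> ?thesis"
    then have ux: "c < cmod (u x)" by simp
    have bm: "measure lborel (ball x \<delta>) = B"
      unfolding B_def using content_ball_conv_unit_ball[of \<delta> x] content_ball_conv_unit_ball[of \<delta> "0::'a"] \<delta>(1) by simp
    have bi: "integrable lborel (indicator (ball x \<delta>) :: 'a \<Rightarrow> real)"
      by (intro integrable_real_indicator) (auto intro: emeasure_bounded_finite[simplified])
    have "(c / 2)\<^sup>2 * B = (LINT y|lborel. (c / 2)\<^sup>2 * indicator (ball x \<delta>) y)"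
      using bm by simp
    also have "\<dots> \<le> (LINT y|lborel. (cmod (u y - trunc u n y))\<^sup>2)"
    proof (intro integral_mono integrable_mult_right bi sqint_integrable sqint_diff sqint_trunc u)
      fix y
      show "(c / 2)\<^sup>2 * indicator (ball x \<delta>) y \<le> (cmod (u y - trunc u n y))\<^sup>2"
      proof (cases "y \<in> ball x \<delta>")
        case True
        then have y: "dist x y < \<delta>" by simp
        have "norm x \<le> norm y + dist x y" using norm_triangle_ineq2[of x y] by (simp add: dist_norm)
        then have "trunc u n y = 0" using x y by (simp add: trunc_def)
        moreover have "cmod (u x) \<le> cmod (u y) + dist (u x) (u y)" using norm_triangle_ineq2[of "u x" "u y"] by (simp add: dist_norm)
        then have "c / 2 \<le> cmod (u y)" using \<delta>(2)[OF y] ux by linarith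
        then have "(c / 2)\<^sup>2 \<le> (cmod (u y))\<^sup>2" using c by (intro power_mono) auto
        ultimately show ?thesis using True by simp
      qed simp
    qed
    finally show False using n by simp
  qed
  then show ?thesis unfolding u_def by blast
qed

text \<open>Suppose \<open>|u| < V\<close> everywhere, with \<open>V = v 0\<close> the integral of \<open>|h|\<close>. As \<open>u\<close> is continuous and vanishes at infinity, \<open>|u| \<le> M\<close> for some \<open>M < V\<close>,
while \<open>|v|\<close> exceeds some \<open>M' > M\<close> on a ball. Then the integral of \<open>|v|\<close> to the power \<open>2 k\<close> grows at least like the \<open>2 k\<close>-th power of
\<open>M'\<close> and that of \<open>|u|\<close> at most like that of \<open>M\<close>, which contradicts their equality for large \<open>k\<close>.\<close>
lemma modulus_maximum:
  fixes h :: "'a::euclidean_space \<Rightarrow> complex"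
  assumes h: "integrable lborel h" "sqint h"
  defines "H \<equiv> \<lambda>\<xi>. complex_of_real (cmod (h \<xi>))"
  assumes V: "0 < (LINT \<xi>|lborel. cmod (h \<xi>))"
    and eq: "\<And>k. (\<integral>\<^sup>+x. ennreal (((cmod (fourier h x))\<^sup>2) ^ Suc k) \<partial>lborel) = (\<integral>\<^sup>+x. ennreal (((cmod (fourier H x))\<^sup>2) ^ Suc k) \<partial>lborel)"
  shows "\<exists>x\<^sub>0. (LINT \<xi>|lborel. cmod (h \<xi>)) \<le> cmod (fourier h x\<^sub>0)"
proof (rule ccontr)
  define V where "V = (LINT \<xi>|lborel. cmod (h \<xi>))"
  define u where "u = fourier h"
  define v where "v = fourier H"
  assume "\<not> ?thesis"
  then have lt: "cmod (u x) < V" for x by (auto simp: V_def u_def not_le)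
  have V0: "0 < V" using V by (simp add: V_def)
  note [measurable] = sqint_measurable[OF h(2)]
  have H: "integrable lborel H" unfolding H_def using h by auto
  have Hm [measurable]: "H \<in> borel_measurable borel" unfolding H_def by measurable
  have uc: "continuous_on UNIV u" "continuous_on UNIV v"
    unfolding u_def v_def by (intro uniformly_continuous_imp_continuous fourier_uniformly_continuous h H)+
  have um [measurable]: "u \<in> borel_measurable borel" "v \<in> borel_measurable borel" unfolding u_def v_def by measurable
  obtain r where r: "\<And>x. r \<le> norm x \<Longrightarrow> cmod (u x) \<le> V / 2"
    using fourier_vanishes_at_infinity[OF h, of "V / 2"] V0 unfolding u_def by auto
  have "compact (cball (0::'a) \<bar>r\<bar>)" "cball (0::'a) \<bar>r\<bar> \<noteq> {}" by auto
  moreover have "continuous_on (cball (0::'a) \<bar>r\<bar>) (\<lambda>x. cmod (u x))"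
    by (intro continuous_on_norm continuous_on_subset[OF uc(1)]) auto
  ultimately obtain z where z: "\<And>x. x \<in> cball 0 \<bar>r\<bar> \<Longrightarrow> cmod (u x) \<le> cmod (u z)"
    using continuous_attains_sup[of "cball (0::'a) \<bar>r\<bar>" "\<lambda>x. cmod (u x)"] by blast
  define M where "M = max (V / 2) (cmod (u z))"
  have M: "0 < M" "M < V" using V0 lt[of z] by (auto simp: M_def)
  have uM: "cmod (u x) \<le> M" for x
    using r[of x] z[of x] by (cases "r \<le> norm x") (auto simp: M_def le_max_iff_disj)
  define M' where "M' = (M + V) / 2"
  have M': "M < M'" "M' < V" "0 < M'" using M by (auto simp: M'_def)
  have "v 0 = complex_of_real V" by (simp add: v_def fourier_def H_def V_def)
  then have v0: "cmod (v 0) = V" using V0 by simp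
  have "open {x. M' < cmod (v x)}"
    by (intro open_Collect_less continuous_on_norm continuous_on_const uc)
  moreover have "0 \<in> {x. M' < cmod (v x)}" using v0 M' by simp
  ultimately obtain \<delta> where \<delta>: "0 < \<delta>" "ball 0 \<delta> \<subseteq> {x. M' < cmod (v x)}" by (meson openE)
  define B where "B = measure lborel (ball (0::'a) \<delta>)"
  have B: "0 < B" unfolding B_def using content_ball_pos[OF \<delta>(1)] by simp
  have eB: "emeasure lborel (ball (0::'a) \<delta>) = ennreal B"
    unfolding B_def using emeasure_bounded_finite[OF bounded_ball, of "0::'a" \<delta>] by (intro emeasure_eq_ennreal_measure) auto
  define Nu where "Nu = (LINT x|lborel. (cmod (u x))\<^sup>2)"
  have u: "sqint u" unfolding u_def by (rule plancherel_L1[OF h])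
  have key: "(M'\<^sup>2) ^ Suc k * B \<le> (M\<^sup>2) ^ k * Nu" for k
  proof -
    have "ennreal ((M'\<^sup>2) ^ Suc k * B) = (\<integral>\<^sup>+x. ennreal ((M'\<^sup>2) ^ Suc k) * indicator (ball 0 \<delta>) x \<partial>(lborel :: 'a measure))"
      by (subst nn_integral_cmult_indicator) (auto simp: eB ennreal_mult B[THEN less_imp_le] simp del: power_Suc)
    also have "\<dots> \<le> (\<integral>\<^sup>+x. ennreal (((cmod (v x))\<^sup>2) ^ Suc k) \<partial>lborel)"
    proof (intro nn_integral_mono)
      fix x
      show "ennreal ((M'\<^sup>2) ^ Suc k) * indicator (ball 0 \<delta>) x \<le> ennreal (((cmod (v x))\<^sup>2) ^ Suc k)"
      proof (cases "x \<in> ball 0 \<delta>")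
        case True
        then have "M' \<le> cmod (v x)" using \<delta>(2) by auto
        then have "(M'\<^sup>2) ^ Suc k \<le> ((cmod (v x))\<^sup>2) ^ Suc k" using M' by (intro power_mono) auto
        then show ?thesis using True by (simp add: ennreal_leI del: power_Suc)
      qed simp
    qed
    also have "\<dots> = (\<integral>\<^sup>+x. ennreal (((cmod (u x))\<^sup>2) ^ Suc k) \<partial>lborel)"
      unfolding u_def v_def by (rule eq[symmetric])
    also have "\<dots> \<le> (\<integral>\<^sup>+x. ennreal ((M\<^sup>2) ^ k) * ennreal ((cmod (u x))\<^sup>2) \<partial>lborel)"
    proof (intro nn_integral_mono)
      fix x
      have "((cmod (u x))\<^sup>2) ^ k * (cmod (u x))\<^sup>2 \<le> (M\<^sup>2) ^ k * (cmod (u x))\<^sup>2"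
        using uM[of x] by (intro mult_right_mono power_mono) auto
      then show "ennreal (((cmod (u x))\<^sup>2) ^ Suc k) \<le> ennreal ((M\<^sup>2) ^ k) * ennreal ((cmod (u x))\<^sup>2)"
        by (subst ennreal_mult[symmetric]) (auto intro!: ennreal_leI simp: mult.commute)
    qed
    also have "\<dots> = ennreal ((M\<^sup>2) ^ k) * ennreal Nu"
      unfolding Nu_def nn_integral_sqint[OF u, symmetric] by (rule nn_integral_cmult) measurable
    also have "\<dots> = ennreal ((M\<^sup>2) ^ k * Nu)" by (rule ennreal_mult[symmetric]) (auto simp: Nu_def)
    finally show ?thesis by (subst (asm) ennreal_le_iff) (auto simp: Nu_def)
  qed
  (* the ratio of the two growth rates *)
  define \<rho> where "\<rho> = (M' / M)\<^sup>2"
  have \<rho>: "1 < \<rho>" unfolding \<rho>_def using M M' by (intro one_less_power) auto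
  have "\<rho> ^ k * (M'\<^sup>2 * B) \<le> Nu" for k
  proof -
    have "\<rho> ^ k * (M\<^sup>2) ^ k = (M'\<^sup>2) ^ k"
      unfolding \<rho>_def power_mult_distrib[symmetric] using M by (simp add: power_divide)
    then have "(M\<^sup>2) ^ k * (\<rho> ^ k * (M'\<^sup>2 * B)) = (M'\<^sup>2) ^ Suc k * B" by (simp add: mult_ac)
    also have "\<dots> \<le> (M\<^sup>2) ^ k * Nu" by (rule key)
    finally show ?thesis using M by (simp add: mult_le_cancel_left)
  qed
  moreover obtain k where "Nu / (M'\<^sup>2 * B) < \<rho> ^ k" using real_arch_pow[OF \<rho>] by blast
  then have "Nu < \<rho> ^ k * (M'\<^sup>2 * B)" using M' B by (simp add: pos_divide_less_eq)
  ultimately show False by (meson not_le)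
qed

text \<open>Equality in the triangle inequality for integrals: after multiplication by the constant phase and the plane wave, the real part has the
same integral as the modulus, so the integrand is real and nonnegative almost everywhere.\<close>
lemma phase_of_maximum:
  fixes h :: "'a::euclidean_space \<Rightarrow> complex"
  assumes h: "integrable lborel h" and le: "(LINT \<xi>|lborel. cmod (h \<xi>)) \<le> cmod (fourier h x\<^sub>0)"
  shows "\<exists>\<theta>. AE \<xi> in lborel. h \<xi> = cis \<theta> * cis (- (2 * pi * (x\<^sub>0 \<bullet> \<xi>))) * complex_of_real (cmod (h \<xi>))"
proof -
  have [measurable]: "h \<in> borel_measurable borel" using borel_measurable_integrable[OF h] by simp
  define \<theta> where "\<theta> = Arg (fourier h x\<^sub>0)"
  have \<theta>: "fourier h x\<^sub>0 = cmod (fourier h x\<^sub>0) * cis \<theta>"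
    unfolding \<theta>_def using rcis_cmod_Arg[of "fourier h x\<^sub>0"] by (simp add: rcis_def)
  define k where "k \<xi> = cis (- \<theta>) * (cis (2 * pi * (x\<^sub>0 \<bullet> \<xi>)) * h \<xi>)" for \<xi>
  have k: "integrable lborel k" unfolding k_def by (intro integrable_mult_right integrable_cis_mult h) measurable
  have "(LINT \<xi>|lborel. k \<xi>) = cis (- \<theta>) * fourier h x\<^sub>0" by (simp add: k_def fourier_def)
  also have "\<dots> = complex_of_real (cmod (fourier h x\<^sub>0))"
    by (subst \<theta>) (simp add: mult.left_commute cis_mult)
  finally have ik: "(LINT \<xi>|lborel. k \<xi>) = complex_of_real (cmod (fourier h x\<^sub>0))" .
  have Rk: "integrable lborel (\<lambda>\<xi>. Re (k \<xi>))" "(LINT \<xi>|lborel. Re (k \<xi>)) = cmod (fourier h x\<^sub>0)"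
    using integrable_bounded_linear[OF bounded_linear_Re k] integral_bounded_linear[OF bounded_linear_Re k] ik by auto
  have nk: "cmod (k \<xi>) = cmod (h \<xi>)" for \<xi> by (simp add: k_def norm_mult)
  have nn: "0 \<le> cmod (h \<xi>) - Re (k \<xi>)" for \<xi> using complex_Re_le_cmod[of "k \<xi>"] by (simp add: nk)
  have i: "integrable lborel (\<lambda>\<xi>. cmod (h \<xi>) - Re (k \<xi>))" using h Rk by auto
  have "(LINT \<xi>|lborel. cmod (h \<xi>) - Re (k \<xi>)) \<le> 0" using h Rk le by simp
  moreover have "0 \<le> (LINT \<xi>|lborel. cmod (h \<xi>) - Re (k \<xi>))" using nn by simp
  ultimately have "(LINT \<xi>|lborel. cmod (h \<xi>) - Re (k \<xi>)) = 0" by simp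
  then have "AE \<xi> in lborel. cmod (h \<xi>) - Re (k \<xi>) = 0"
    using integral_nonneg_eq_0_iff_AE[OF i] nn by auto
  then have "AE \<xi> in lborel. h \<xi> = cis \<theta> * cis (- (2 * pi * (x\<^sub>0 \<bullet> \<xi>))) * complex_of_real (cmod (h \<xi>))"
  proof eventually_elim
    case (elim \<xi>)
    then have "Re (k \<xi>) = cmod (k \<xi>)" by (simp add: nk)
    then have "k \<xi> = complex_of_real (cmod (h \<xi>))"
      using cmod_power2[of "k \<xi>"] nk[of \<xi>] by (simp add: complex_eq_iff)
    then have "cis \<theta> * cis (- (2 * pi * (x\<^sub>0 \<bullet> \<xi>))) * complex_of_real (cmod (h \<xi>))
       = (cis \<theta> * cis (- \<theta>)) * (cis (- (2 * pi * (x\<^sub>0 \<bullet> \<xi>))) * cis (2 * pi * (x\<^sub>0 \<bullet> \<xi>))) * h \<xi>"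
      by (simp add: k_def mult_ac)
    then show ?case by (simp add: cis_mult)
  qed
  then show ?thesis ..
qed

theorem corollary1p3:
  fixes \<alpha> :: real and u :: "real^4 \<Rightarrow> complex"
  assumes "\<alpha> < 32 * pi^2"
    and "ennreal (32 * pi^2 - \<alpha>) < ennreal ((32 * pi^2)^2) * B\<^sub>2 / 2"
    and "extremal \<alpha> u"
  shows "\<exists>(\<theta>::real) (x\<^sub>0::real^4) (w::real^4 \<Rightarrow> real). radially_symmetric w \<and>
           (AE x in lebesgue. u x = exp (\<i> * of_real \<theta>) * of_real (w (x - x\<^sub>0)))"
proof -
  note \<alpha> = assms(1)
  obtain h u' where u': "AE x in lborel. u x = u' x" and m: "maximiser \<alpha> h u'"
    using extremal_maximiser[OF \<alpha> assms(3)] by blast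
  note mf = maximiser_fourier[OF \<alpha> m]
  have "fourier_pair h u'" using m by (simp add: maximiser_def)
  then have h: "integrable lborel h" "sqint h" using maximiser_integrable[OF \<alpha> m] fourier_pairD by auto
  note [measurable] = sqint_measurable[OF h(2)]
  define H where "H \<xi> = complex_of_real (cmod (h \<xi>))" for \<xi>
  define v where "v = fourier H"
  have mH: "maximiser \<alpha> H v"
    and pow: "\<And>k. (\<integral>\<^sup>+x. ennreal (((cmod (fourier h x))\<^sup>2) ^ Suc k) \<partial>lborel) = (\<integral>\<^sup>+x. ennreal (((cmod (fourier H x))\<^sup>2) ^ Suc k) \<partial>lborel)"
    using maximiser_modulus[OF \<alpha> mf(2)] by (simp_all add: H_def[abs_def] v_def)
  (* points of equal norm are exchanged by a reflection, under which |h| is invariant *)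
  have radial: "v x = v y" if nxy: "norm x = norm y" for x y
  proof (cases "x = y")
    case False
    obtain e where e: "norm e = 1" "direction.reflect e x = y" using exists_reflection[OF nxy False] by blast
    have "AE \<xi> in lborel. cmod (h (direction.reflect e \<xi>)) = cmod (h \<xi>)"
      using maximiser_reflection[OF \<alpha> _ _ e(1), of "\<lambda>\<xi>. cmod (h \<xi>)"] mH by (simp add: H_def[abs_def] v_def)
    then have "AE \<xi> in lborel. H (direction.reflect e \<xi>) = H \<xi>" by eventually_elim (simp add: H_def)
    then have "fourier H (direction.reflect e x) = fourier H x"
      by (intro fourier_reflection e(1)) (auto simp: H_def[abs_def])
    then show ?thesis using e(2) by (simp add: v_def)
  qed simp
  have real: "v x = complex_of_real (Re (v x))" for x
  proof -
    (* conjugation reflects the argument, which a radial function does not notice *)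
    have "cnj (v x) = v (- x)" unfolding v_def cnj_fourier by (simp add: H_def[abs_def])
    also have "\<dots> = v x" by (rule radial) simp
    finally have "Im (v x) = 0" by (simp add: complex_eq_iff)
    then show ?thesis by (simp add: complex_eq_iff)
  qed
  have V: "0 < (LINT \<xi>|lborel. cmod (h \<xi>))"
  proof (rule ccontr)
    assume "\<not> ?thesis"
    moreover have "0 \<le> (LINT \<xi>|lborel. cmod (h \<xi>))" by simp
    ultimately have "(LINT \<xi>|lborel. cmod (h \<xi>)) = 0" by linarith
    then have "AE \<xi> in lborel. cmod (h \<xi>) = 0"
      using integral_nonneg_eq_0_iff_AE[OF integrable_norm[OF h(1)]] by simp
    then have "(LINT \<xi>|lborel. (cmod (h \<xi>))\<^sup>2) = 0"
      by (intro integral_eq_zero_AE) (auto elim: eventually_mono)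
    then show False using maximiser_nontrivial[OF m] by simp
  qed
  obtain x\<^sub>0 where "(LINT \<xi>|lborel. cmod (h \<xi>)) \<le> cmod (fourier h x\<^sub>0)"
    using modulus_maximum[OF h V] pow by (auto simp: H_def[abs_def])
  then obtain \<theta> where \<theta>: "AE \<xi> in lborel. h \<xi> = cis \<theta> * cis (- (2 * pi * (x\<^sub>0 \<bullet> \<xi>))) * complex_of_real (cmod (h \<xi>))"
    using phase_of_maximum[OF h(1)] by blast
  have shift: "fourier h x = cis \<theta> * v (x - x\<^sub>0)" for x
  proof -
    have "fourier h x = (LINT \<xi>|lborel. cis (2 * pi * (x \<bullet> \<xi>)) * (cis \<theta> * cis (- (2 * pi * (x\<^sub>0 \<bullet> \<xi>))) * H \<xi>))"
      unfolding fourier_def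
    proof (rule integral_cong_AE)
      show "AE \<xi> in lborel. cis (2 * pi * (x \<bullet> \<xi>)) * h \<xi> = cis (2 * pi * (x \<bullet> \<xi>)) * (cis \<theta> * cis (- (2 * pi * (x\<^sub>0 \<bullet> \<xi>))) * H \<xi>)"
        using \<theta> by eventually_elim (simp add: H_def)
    qed (unfold H_def, measurable)
    also have "\<dots> = (LINT \<xi>|lborel. cis \<theta> * (cis (2 * pi * ((x - x\<^sub>0) \<bullet> \<xi>)) * H \<xi>))"
    proof (rule Bochner_Integration.integral_cong[OF refl])
      fix \<xi>
      have "cis (2 * pi * ((x - x\<^sub>0) \<bullet> \<xi>)) = cis (2 * pi * (x \<bullet> \<xi>)) * cis (- (2 * pi * (x\<^sub>0 \<bullet> \<xi>)))"
        by (simp add: cis_mult inner_diff_left right_diff_distrib)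
      then show "cis (2 * pi * (x \<bullet> \<xi>)) * (cis \<theta> * cis (- (2 * pi * (x\<^sub>0 \<bullet> \<xi>))) * H \<xi>) = cis \<theta> * (cis (2 * pi * ((x - x\<^sub>0) \<bullet> \<xi>)) * H \<xi>)"
        by (simp only: mult_ac)
    qed
    finally show ?thesis by (simp add: v_def fourier_def)
  qed
  show ?thesis
  proof (intro exI conjI)
    show "radially_symmetric (\<lambda>x. Re (v x))"
      unfolding radially_symmetric_def by (intro allI impI arg_cong[where f=Re] radial) assumption
    show "AE x in lebesgue. u x = exp (\<i> * of_real \<theta>) * of_real (Re (v (x - x\<^sub>0)))"
    proof (rule AE_completion)
      show "AE x in lborel. u x = exp (\<i> * of_real \<theta>) * of_real (Re (v (x - x\<^sub>0)))"
        using u' mf(1) by eventually_elim (simp only: shift real[symmetric] cis_conv_exp)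
    qed
  qed
qed

end
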